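(* Let $A=\mathbb R[x_1,\dots,x_n]$ be a quadratic Poisson algebra and let $A^!$ be its Koszul dual Poisson algebra. If the modular vector field $\nu$ of $A$ is diagonalizable, then so is the modular vector field $\nu^!$ of $A^!$. In this case $$\mathrm{HP}^\bullet(A)\cong\mathrm{HP}^\bullet(A^!)$$ as Batalin-Vilkovisky algebras.
   Context: $\pi=\sum c_{i_1i_2}^{j_1j_2}x_{i_1}x_{i_2}\frac{\partial}{\partial x_{j_1}}\wedge\frac{\partial}{\partial x_{j_2}}$ ($c_{i_1i_2}^{j_1j_2}\in\mathbb R$) is a Poisson structure on $A$; $A^!=\Lambda(\xi_1,\dots,\xi_n)$, $|\xi_i|=-1$, carries the graded Poisson structure $\pi^!=\sum c_{i_1i_2}^{j_1j_2}\xi_{j_1}\xi_{j_2}\frac{\partial}{\partial\xi_{i_1}}\frac{\partial}{\partial\xi_{i_2}}$. $\mathrm{HP}^\bullet$ is the cohomology of polyvectors with $\delta(P)(f_0,\dots,f_p)=\sum_i(-1)^i\{f_i,P(\dots\widehat{f_i}\dots)\}+\sum_{i<j}(-1)^{i+j}P(\{f_i,f_j\},\dots\widehat{f_i}\dots\widehat{f_j}\dots)$; for $A^!$ with Koszul signs on $\mathfrak X^\bullet(A^!)=\Lambda(\xi_i)\otimes\mathbb R[\partial/\partial\xi_i]$, grading $|\xi_i|=-1$, $|\partial/\partial\xi_i|=0$, cohomological degree being its negative. A derivation is diagonalizable if the algebra is the direct sum of its eigenspaces with eigenvalues in $\mathbb R$. Modular data for $A$: $\eta=dx_1\wedge\cdots\wedge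 dx_n$, $\iota_{P\wedge Q}=\iota_P\iota_Q$, $\iota_{\mathrm{Div}(P)}\eta=d(\iota_P\eta)$, $\nu:=-\mathrm{Div}(\pi)$. $\mathrm{HP}_\bullet(A,A_\nu)$ is the homology of $\Omega^\bullet(A)$ with $\partial_\nu(f_0df_1\wedge\cdots\wedge df_p)=\sum_i(-1)^{i-1}(\{f_0,f_i\}+f_0\nu(f_i))df_1\wedge\cdots\widehat{df_i}\cdots\wedge df_p+\sum_{i<j}(-1)^{j-i}f_0d\{f_i,f_j\}\wedge df_1\wedge\cdots\widehat{df_i}\cdots\widehat{df_j}\cdots\wedge df_p$, and $\iota_{(-)}\eta$ induces $\mathrm{HP}^\bullet(A)\cong\mathrm{HP}_{n-\bullet}(A,A_\nu)$. Modular data for $A^!$: polyderivations with values in the linear dual $(A^!)^*$ are identified with the graded dual of $\Omega^\bullet(A^!)$, with Poisson coboundary $\partial$ and dual de Rham differential $d^*$; $\xi_1^*\cdots\xi_n^*$ gives an $A^!$-module isomorphism $\eta^!:A^!\to(A^!)^*$, $\iota_\varphi\eta^!:=\eta^!\circ\varphi$, $\iota_{\mathrm{Div}(\varphi)}\eta^!=d^*(\iota_\varphi\eta^!)$, $\nu^!:=-\mathrm{Div}(\pi^!)$. With differential $\partial_{\nu^!}$ equal to $\partial$ plus multiplication by $\nu^!$, $\iota_{(-)}\eta^!$ induces $\mathrm{HP}^\bullet(A^!)\cong\mathrm{HP}^{\bullet-n}(A^!,(A^!)^*_{\nu^!})$. A Batalin-Vilkovisky algebra is a graded commutative algebra with a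 square-zero operator $\Delta$ of degree $-1$ satisfying $\Delta(abc)=\Delta(ab)c+(-1)^{|a|}a\Delta(bc)+(-1)^{(|a|-1)|b|}b\Delta(ac)-(\Delta a)bc-(-1)^{|a|}a(\Delta b)c-(-1)^{|a|+|b|}ab(\Delta c)$. On $\mathrm{HP}^\bullet(A)$ (resp. $\mathrm{HP}^\bullet(A^!)$) the product is the wedge product of polyvectors and $\Delta$ is the transport, through the twisted duality, of $d$ (resp. $d^*$) acting on the weight-zero subcomplex (total eigenvalue $0$ under the modular vector field), which computes the twisted Poisson (co)homology and on which $d$ (resp. $d^*$) anticommutes with $\partial_\nu$ (resp. $\partial_{\nu^!}$). *)

theory Defs
  imports Complex_Main "HOL-Library.Poly_Mapping" "HOL-Library.Function_Algebras" "HOL-Library.Cardinality"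
begin

section \<open>Vector space structures on function and polynomial types\<close>

instantiation "fun" :: (type, real_vector) real_vector
begin
definition scaleR_fun :: "real \<Rightarrow> ('a \<Rightarrow> 'b) \<Rightarrow> 'a \<Rightarrow> 'b"
  where "scaleR_fun r f = (\<lambda>x. r *\<^sub>R f x)"
instance
  by standard (simp_all add: scaleR_fun_def fun_eq_iff scaleR_add_left scaleR_add_right)
end

instantiation poly_mapping :: (type, real_vector) real_vector
begin
definition scaleR_poly_mapping :: "real \<Rightarrow> ('a \<Rightarrow>\<^sub>0 'b) \<Rightarrow> 'a \<Rightarrow>\<^sub>0 'b"
  where "scaleR_poly_mapping r p = Poly_Mapping.map (scaleR r) p"
instance
  by standard
    (auto intro!: poly_mapping_eqI
      simp: scaleR_poly_mapping_def Poly_Mapping.map.rep_eq lookup_add when_def scaleR_add_left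
        scaleR_add_right[symmetric])
end


section \<open>Graded vector spaces\<close>

text \<open>\<open>gr d\<close> is the homogeneous component of degree \<open>d\<close>.  Koszul signs only make sense for
  homogeneous arguments, so graded (multi)linear maps are represented throughout by their values on
  homogeneous arguments, with the value 0 on all other arguments.\<close>

class graded = real_vector +
  fixes gr :: "int \<Rightarrow> 'a set"

definition homogeneous :: "'a::graded \<Rightarrow> bool"
  where "homogeneous f \<longleftrightarrow> (\<exists>d. f \<in> gr d)"

definition hdeg :: "'a::graded \<Rightarrow> int"
  where "hdeg f = (if f = 0 then 0 else (THE d. f \<in> gr d))"

abbreviation homs :: "'a::graded list \<Rightarrow> bool"
  where "homs fs \<equiv> (\<forall>f\<in>set fs. homogeneous f)"

abbreviation degs :: "'a::graded list \<Rightarrow> int"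
  where "degs fs \<equiv> sum_list (map hdeg fs)"

definition ksgn :: "int \<Rightarrow> real"
  where "ksgn e = (if even e then 1 else -1)"

instantiation real :: graded
begin
definition gr_real :: "int \<Rightarrow> real set"
  where "gr_real d = (if d = 0 then UNIV else {0})"
instance ..
end

text \<open>Graded linear maps of degree \<open>e\<close>; in particular \<open>'b \<Rightarrow> real\<close> is the graded dual of \<open>'b\<close>.\<close>

instantiation "fun" :: (graded, graded) graded
begin
definition gr_fun :: "int \<Rightarrow> ('a \<Rightarrow> 'b) set"
  where "gr_fun e = {\<psi>. (\<forall>f. \<not> homogeneous f \<longrightarrow> \<psi> f = 0) \<and>
     (\<forall>d. \<forall>f\<in>gr d. \<psi> f \<in> gr (d + e) \<and> (\<forall>r. \<psi> (r *\<^sub>R f) = r *\<^sub>R \<psi> f) \<and>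
        (\<forall>g\<in>gr d. \<psi> (f + g) = \<psi> f + \<psi> g))}"
instance ..
end


section \<open>Polyderivations of a graded commutative algebra\<close>

text \<open>Let \<open>'b\<close> be a graded commutative algebra and \<open>'m\<close> a module over it with left action \<open>act\<close>.
  A skew-symmetric polyderivation of arity \<open>p\<close> and internal degree \<open>m\<close>, i.e. raising degrees by
  \<open>m\<close>, has cohomological degree \<open>p - m\<close>.  An element \<open>P\<close> of \<open>polyder act k\<close> is a finite sum of
  polyderivations of cohomological degree \<open>k\<close>; its component of arity \<open>p\<close> is the restriction of
  \<open>P\<close> to lists of length \<open>p\<close> and has internal degree \<open>p - k\<close>.  When all of \<open>'b\<close> has degree 0,
  the case of polynomials, only the arity \<open>p = k\<close> occurs.  For the exterior algebra on generators
  of degree \<open>-1\<close>, each generator has cohomological degree 1 and each derivation dual to a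
  generator has cohomological degree 0.\<close>

definition polyder ::
    "('b::{graded,ring_1} \<Rightarrow> 'm \<Rightarrow> 'm) \<Rightarrow> int \<Rightarrow> ('b list \<Rightarrow> 'm::graded) set"
  where "polyder act k = {P.
    (\<forall>fs. \<not> homs fs \<longrightarrow> P fs = 0) \<and>
    (\<forall>fs. homs fs \<longrightarrow> P fs \<in> gr (int (length fs) - k + degs fs)) \<and>
    (\<forall>fs gs d f g. f \<in> gr d \<longrightarrow> g \<in> gr d \<longrightarrow>
       P (fs @ (f + g) # gs) = P (fs @ f # gs) + P (fs @ g # gs)) \<and>
    (\<forall>fs gs r f. homogeneous f \<longrightarrow> P (fs @ (r *\<^sub>R f) # gs) = r *\<^sub>R P (fs @ f # gs)) \<and>
    (\<forall>fs gs f g. P (fs @ g # f # gs) = - (ksgn (hdeg f * hdeg g) *\<^sub>R P (fs @ f # g # gs))) \<and>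
    (\<forall>fs gs f g. homogeneous f \<longrightarrow> homogeneous g \<longrightarrow>
       (let m = int (length fs + 1 + length gs) - k in
        P (fs @ (f * g) # gs) =
          ksgn (hdeg f * (m + degs fs)) *\<^sub>R act f (P (fs @ g # gs)) +
          ksgn (hdeg g * (m + degs fs + hdeg f)) *\<^sub>R act g (P (fs @ f # gs)))) \<and>
    (\<exists>N. \<forall>fs. N < length fs \<longrightarrow> P fs = 0)}"

abbreviation polyvectors :: "int \<Rightarrow> ('b::{graded,ring_1} list \<Rightarrow> 'b) set"
  where "polyvectors \<equiv> polyder (*)"

definition scalar_pv :: "'b \<Rightarrow> 'b::{graded,ring_1} list \<Rightarrow> 'b"
  where "scalar_pv a = (\<lambda>fs. if fs = [] then a else 0)"

definition vector_pv :: "('b \<Rightarrow> 'b) \<Rightarrow> 'b::{graded,ring_1} list \<Rightarrow> 'b"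
  where "vector_pv D = (\<lambda>fs. case fs of [f] \<Rightarrow> (if homogeneous f then D f else 0) | _ \<Rightarrow> 0)"

text \<open>Wedge product of \<open>P\<close> of cohomological degree \<open>k\<close> and \<open>Q\<close> of cohomological degree \<open>l\<close>:
  the sum over all shuffles \<open>(I, - I)\<close> of the arguments.  In the exponent, the first sum is the
  sign of the shuffle together with the Koszul sign for reordering the arguments, the second sum
  moves \<open>Q\<close> (of internal degree \<open>q - l\<close>, \<open>q\<close> being its arity) past the arguments of \<open>P\<close>, and
  the last term moves the \<open>q\<close> shifts of \<open>Q\<close> past \<open>P\<close> (of internal degree \<open>card I - k\<close>); with it the
  product is graded commutative for the cohomological degree.\<close>

definition wedge ::
    "('b::{graded,ring_1} \<Rightarrow> 'm \<Rightarrow> 'm) \<Rightarrow> int \<Rightarrow> int \<Rightarrow> ('b list \<Rightarrow> 'b) \<Rightarrow> ('b list \<Rightarrow> 'm) \<Rightarrow> 'b list \<Rightarrow> 'm::graded"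
  where "wedge act k l P Q fs = (if \<not> homs fs then 0 else
    (\<Sum>I\<in>Pow {..<length fs}.
       let q = int (length fs) - int (card I) in
       ksgn ((\<Sum>b\<in>I. \<Sum>a\<in>{..<b} - I. 1 + hdeg (fs ! a) * hdeg (fs ! b))
             + (\<Sum>a\<in>I. (q - l) * hdeg (fs ! a))
             + q * (int (card I) - k))
       *\<^sub>R act (P (nths fs I)) (Q (nths fs (- I)))))"

text \<open>The Poisson coboundary on polyderivations of cohomological degree \<open>k\<close>, where \<open>br\<close> is the
  Poisson bracket (of internal degree 0) and \<open>mbr f x\<close> is the bracket of \<open>f\<close> with a module element
  \<open>x\<close>.  The summands beyond \<open>i\<close>, resp. \<open>i + j\<close>, in the exponents are the Koszul signs.\<close>

definition coboundary ::
    "('b \<Rightarrow> 'b \<Rightarrow> 'b) \<Rightarrow> ('b \<Rightarrow> 'm \<Rightarrow> 'm) \<Rightarrow> int \<Rightarrow> ('b::{graded,ring_1} list \<Rightarrow> 'm) \<Rightarrow> 'b list \<Rightarrow> 'm::graded"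
  where "coboundary br mbr k P fs = (if \<not> homs fs then 0 else
    (\<Sum>i<length fs.
       ksgn (int i + hdeg (fs ! i) * (int (length fs) - 1 - k + degs (take i fs)))
       *\<^sub>R mbr (fs ! i) (P (nths fs (- {i})))) +
    (\<Sum>j<length fs. \<Sum>i<j.
       ksgn (int (i + j) + hdeg (fs ! i) * degs (take i fs)
             + hdeg (fs ! j) * (degs (take j fs) + hdeg (fs ! i)))
       *\<^sub>R P (br (fs ! i) (fs ! j) # nths fs (- {i, j}))))"

definition bracket_of :: "('b list \<Rightarrow> 'b) \<Rightarrow> 'b \<Rightarrow> 'b \<Rightarrow> 'b"
  where "bracket_of \<pi> f g = \<pi> [f, g]"

definition derivation_of :: "('b list \<Rightarrow> 'b) \<Rightarrow> 'b::{graded,ring_1} \<Rightarrow> 'b"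
  where "derivation_of P = (THE D. linear D \<and> (\<forall>f. homogeneous f \<longrightarrow> D f = P [f]))"

text \<open>The algebra is the direct sum of the eigenspaces with real eigenvalues.\<close>

definition diagonalizable :: "('b::real_vector \<Rightarrow> 'b) \<Rightarrow> bool"
  where "diagonalizable D \<longleftrightarrow>
    (\<forall>f. \<exists>!g :: real \<Rightarrow> 'b. finite {l. g l \<noteq> 0} \<and> (\<forall>l. D (g l) = l *\<^sub>R g l) \<and>
       f = (\<Sum>l | g l \<noteq> 0. g l))"

definition poisson_bracket :: "('b::comm_ring_1 \<Rightarrow> 'b \<Rightarrow> 'b) \<Rightarrow> bool"
  where "poisson_bracket br \<longleftrightarrow>
    (\<forall>f g. br f g = - br g f) \<and>
    (\<forall>f g h. br f (g + h) = br f g + br f h) \<and>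
    (\<forall>f g h. br f (g * h) = br f g * h + g * br f h) \<and>
    (\<forall>f g h. br f (br g h) + br g (br h f) + br h (br f g) = 0)"


section \<open>Batalin-Vilkovisky algebras\<close>

text \<open>A graded algebra is given by its homogeneous components, so every operation carries the
  degrees of its arguments.\<close>

record 'h bv_structure =
  comp :: "int \<Rightarrow> 'h set"
  gzero :: "int \<Rightarrow> 'h"
  gadd :: "int \<Rightarrow> 'h \<Rightarrow> 'h \<Rightarrow> 'h"
  gscale :: "int \<Rightarrow> real \<Rightarrow> 'h \<Rightarrow> 'h"
  gmult :: "int \<Rightarrow> int \<Rightarrow> 'h \<Rightarrow> 'h \<Rightarrow> 'h"
  gone :: 'h
  bv_delta :: "int \<Rightarrow> 'h \<Rightarrow> 'h"

definition graded_comm_algebra :: "'h bv_structure \<Rightarrow> bool"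
  where "graded_comm_algebra H \<longleftrightarrow>
    (\<forall>k. gzero H k \<in> comp H k) \<and>
    (\<forall>k. \<forall>a\<in>comp H k. \<forall>b\<in>comp H k. gadd H k a b \<in> comp H k) \<and>
    (\<forall>k r. \<forall>a\<in>comp H k. gscale H k r a \<in> comp H k) \<and>
    (\<forall>k. \<forall>a\<in>comp H k. \<forall>b\<in>comp H k. \<forall>c\<in>comp H k.
       gadd H k (gadd H k a b) c = gadd H k a (gadd H k b c)) \<and>
    (\<forall>k. \<forall>a\<in>comp H k. \<forall>b\<in>comp H k. gadd H k a b = gadd H k b a) \<and>
    (\<forall>k. \<forall>a\<in>comp H k. gadd H k (gzero H k) a = a) \<and>
    (\<forall>k. \<forall>a\<in>comp H k. gadd H k a (gscale H k (-1) a) = gzero H k) \<and>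
    (\<forall>k. \<forall>a\<in>comp H k. gscale H k 1 a = a) \<and>
    (\<forall>k r s. \<forall>a\<in>comp H k. gscale H k r (gscale H k s a) = gscale H k (r * s) a) \<and>
    (\<forall>k r s. \<forall>a\<in>comp H k. gscale H k (r + s) a = gadd H k (gscale H k r a) (gscale H k s a)) \<and>
    (\<forall>k r. \<forall>a\<in>comp H k. \<forall>b\<in>comp H k.
       gscale H k r (gadd H k a b) = gadd H k (gscale H k r a) (gscale H k r b)) \<and>
    gone H \<in> comp H 0 \<and>
    (\<forall>k l. \<forall>a\<in>comp H k. \<forall>b\<in>comp H l. gmult H k l a b \<in> comp H (k + l)) \<and>
    (\<forall>k. \<forall>a\<in>comp H k. gmult H 0 k (gone H) a = a) \<and>
    (\<forall>k l. \<forall>a\<in>comp H k. \<forall>b\<in>comp H k. \<forall>c\<in>comp H l.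
       gmult H k l (gadd H k a b) c = gadd H (k + l) (gmult H k l a c) (gmult H k l b c)) \<and>
    (\<forall>k l r. \<forall>a\<in>comp H k. \<forall>b\<in>comp H l.
       gmult H k l (gscale H k r a) b = gscale H (k + l) r (gmult H k l a b)) \<and>
    (\<forall>k l m. \<forall>a\<in>comp H k. \<forall>b\<in>comp H l. \<forall>c\<in>comp H m.
       gmult H (k + l) m (gmult H k l a b) c = gmult H k (l + m) a (gmult H l m b c)) \<and>
    (\<forall>k l. \<forall>a\<in>comp H k. \<forall>b\<in>comp H l.
       gmult H k l a b = gscale H (k + l) (ksgn (k * l)) (gmult H l k b a))"

definition bv_algebra :: "'h bv_structure \<Rightarrow> bool"
  where "bv_algebra H \<longleftrightarrow> graded_comm_algebra H \<and>
    (\<forall>k. \<forall>a\<in>comp H k. bv_delta H k a \<in> comp H (k - 1)) \<and>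
    (\<forall>k. \<forall>a\<in>comp H k. \<forall>b\<in>comp H k.
       bv_delta H k (gadd H k a b) = gadd H (k - 1) (bv_delta H k a) (bv_delta H k b)) \<and>
    (\<forall>k r. \<forall>a\<in>comp H k. bv_delta H k (gscale H k r a) = gscale H (k - 1) r (bv_delta H k a)) \<and>
    (\<forall>k. \<forall>a\<in>comp H k. bv_delta H (k - 1) (bv_delta H k a) = gzero H (k - 2)) \<and>
    (\<forall>k l m. \<forall>a\<in>comp H k. \<forall>b\<in>comp H l. \<forall>c\<in>comp H m.
       (let N = k + l + m - 1; plus = gadd H N; sc = gscale H N; \<Delta> = bv_delta H; mul = gmult H in
        \<Delta> (k + l + m) (mul (k + l) m (mul k l a b) c) =
          plus (mul (k + l - 1) m (\<Delta> (k + l) (mul k l a b)) c)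
         (plus (sc (ksgn k) (mul k (l + m - 1) a (\<Delta> (l + m) (mul l m b c))))
         (plus (sc (ksgn ((k - 1) * l)) (mul l (k + m - 1) b (\<Delta> (k + m) (mul k m a c))))
         (plus (sc (-1) (mul (k - 1 + l) m (mul (k - 1) l (\<Delta> k a) b) c))
         (plus (sc (- ksgn k) (mul (k + (l - 1)) m (mul k (l - 1) a (\<Delta> l b)) c))
               (sc (- ksgn (k + l)) (mul (k + l) (m - 1) (mul k l a b) (\<Delta> m c)))))))))"

text \<open>Isomorphisms of BV algebras are isomorphisms of graded algebras commuting with \<open>\<Delta>\<close>.\<close>

definition bv_isomorphic :: "'h bv_structure \<Rightarrow> 'g bv_structure \<Rightarrow> bool"
  where "bv_isomorphic H G \<longleftrightarrow> bv_algebra H \<and> bv_algebra G \<and>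
    (\<exists>\<phi> :: int \<Rightarrow> 'h \<Rightarrow> 'g.
      (\<forall>k. bij_betw (\<phi> k) (comp H k) (comp G k)) \<and>
      (\<forall>k. \<forall>a\<in>comp H k. \<forall>b\<in>comp H k. \<phi> k (gadd H k a b) = gadd G k (\<phi> k a) (\<phi> k b)) \<and>
      (\<forall>k r. \<forall>a\<in>comp H k. \<phi> k (gscale H k r a) = gscale G k r (\<phi> k a)) \<and>
      (\<forall>k l. \<forall>a\<in>comp H k. \<forall>b\<in>comp H l.
         \<phi> (k + l) (gmult H k l a b) = gmult G k l (\<phi> k a) (\<phi> l b)) \<and>
      \<phi> 0 (gone H) = gone G \<and>
      (\<forall>k. \<forall>a\<in>comp H k. \<phi> (k - 1) (bv_delta H k a) = bv_delta G k (\<phi> k a)))"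


section \<open>Poisson cohomology\<close>

definition cocycles :: "('b \<Rightarrow> 'b \<Rightarrow> 'b) \<Rightarrow> int \<Rightarrow> ('b::{graded,ring_1} list \<Rightarrow> 'b) set"
  where "cocycles br k = {P \<in> polyvectors k. coboundary br br k P = 0}"

definition coboundaries :: "('b \<Rightarrow> 'b \<Rightarrow> 'b) \<Rightarrow> int \<Rightarrow> ('b::{graded,ring_1} list \<Rightarrow> 'b) set"
  where "coboundaries br k = coboundary br br (k - 1) ` polyvectors (k - 1)"

definition HP_class :: "('b \<Rightarrow> 'b \<Rightarrow> 'b) \<Rightarrow> int \<Rightarrow> ('b list \<Rightarrow> 'b) \<Rightarrow> ('b::{graded,ring_1} list \<Rightarrow> 'b) set"
  where "HP_class br k P = {Q \<in> cocycles br k. Q - P \<in> coboundaries br k}"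

definition HP ::
    "('b \<Rightarrow> 'b \<Rightarrow> 'b) \<Rightarrow> (int \<Rightarrow> ('b list \<Rightarrow> 'b) set \<Rightarrow> ('b list \<Rightarrow> 'b) set) \<Rightarrow>
     ('b::{graded,ring_1} list \<Rightarrow> 'b) set bv_structure"
  where "HP br \<Delta> = \<lparr>
    comp = (\<lambda>k. HP_class br k ` cocycles br k),
    gzero = (\<lambda>k. HP_class br k 0),
    gadd = (\<lambda>k X Y. \<Union>P\<in>X. \<Union>Q\<in>Y. HP_class br k (P + Q)),
    gscale = (\<lambda>k r X. \<Union>P\<in>X. HP_class br k (r *\<^sub>R P)),
    gmult = (\<lambda>k l X Y. \<Union>P\<in>X. \<Union>Q\<in>Y. HP_class br (k + l) (wedge (*) k l P Q)),
    gone = HP_class br 0 (scalar_pv 1),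
    bv_delta = \<Delta>\<rparr>"

text \<open>Transport of an operator \<open>D\<close> to Poisson cohomology.  Here \<open>\<iota>\<close> identifies polyvectors with a
  twisted complex; \<open>W k\<close> are the weight-zero cycles and \<open>B k\<close> all boundaries of the twisted complex
  in the degree corresponding to cohomological degree \<open>k\<close>.  A class is sent through \<open>\<iota>\<close> to twisted
  (co)homology, represented there by a weight-zero cycle \<open>\<omega>\<close>, and the twisted class of \<open>D \<omega>\<close> is
  sent back.  The union is over all choices, all of which yield the same class.\<close>

definition transport ::
    "('b \<Rightarrow> 'b \<Rightarrow> 'b) \<Rightarrow> (('b::{graded,ring_1} list \<Rightarrow> 'b) \<Rightarrow> 't::real_vector) \<Rightarrow>
     (int \<Rightarrow> 't set) \<Rightarrow> (int \<Rightarrow> 't set) \<Rightarrow> ('t \<Rightarrow> 't) \<Rightarrow>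
     int \<Rightarrow> ('b list \<Rightarrow> 'b) set \<Rightarrow> ('b list \<Rightarrow> 'b) set"
  where "transport br \<iota> W B D k X =
    \<Union> {HP_class br (k - 1) Q | Q P \<omega>. Q \<in> cocycles br (k - 1) \<and> P \<in> X \<and> \<omega> \<in> W k \<and>
        \<omega> - \<iota> P \<in> B k \<and> \<iota> Q - D \<omega> \<in> B (k - 1)}"


section \<open>Exterior algebras\<close>

text \<open>The exterior algebra on generators indexed by \<open>'i\<close> with coefficients in \<open>'r\<close>: an element is
  given by its coefficients with respect to the basis of increasing products of generators.\<close>

typedef ('i, 'r) ext = "UNIV :: ('i set \<Rightarrow> 'r) set"
  morphisms ecoeff Ext by simp

lemma ecoeff_Ext [simp]: "ecoeff (Ext f) = f"
  by (simp add: Ext_inverse)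

lemma ext_eqI: "(\<And>S. ecoeff a S = ecoeff b S) \<Longrightarrow> a = b"
  by (metis ecoeff_inject ext)

instantiation ext :: (type, ab_group_add) ab_group_add
begin
definition zero_ext :: "('a, 'b) ext" where "0 = Ext (\<lambda>S. 0)"
definition plus_ext :: "('a, 'b) ext \<Rightarrow> ('a, 'b) ext \<Rightarrow> ('a, 'b) ext"
  where "a + b = Ext (\<lambda>S. ecoeff a S + ecoeff b S)"
definition minus_ext :: "('a, 'b) ext \<Rightarrow> ('a, 'b) ext \<Rightarrow> ('a, 'b) ext"
  where "a - b = Ext (\<lambda>S. ecoeff a S - ecoeff b S)"
definition uminus_ext :: "('a, 'b) ext \<Rightarrow> ('a, 'b) ext"
  where "- a = Ext (\<lambda>S. - ecoeff a S)"
instance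
  by standard
    (auto intro!: ext_eqI simp: zero_ext_def plus_ext_def minus_ext_def uminus_ext_def algebra_simps)
end

instantiation ext :: (type, real_vector) real_vector
begin
definition scaleR_ext :: "real \<Rightarrow> ('a, 'b) ext \<Rightarrow> ('a, 'b) ext"
  where "r *\<^sub>R a = Ext (\<lambda>S. r *\<^sub>R ecoeff a S)"
instance
  by standard
    (auto intro!: ext_eqI simp: scaleR_ext_def plus_ext_def scaleR_add_left scaleR_add_right)
end

definition inversions :: "'i::linorder set \<Rightarrow> 'i set \<Rightarrow> nat"
  where "inversions T U = card {(t, u). t \<in> T \<and> u \<in> U \<and> u < t}"

lemma inversions_Un_left:
  fixes T U V :: "'i::{finite,linorder} set"
  assumes "T \<inter> U = {}"
  shows "inversions (T \<union> U) V = inversions T V + inversions U V"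
proof -
  have "{(t, u). t \<in> T \<union> U \<and> u \<in> V \<and> u < t} =
      {(t, u). t \<in> T \<and> u \<in> V \<and> u < t} \<union> {(t, u). t \<in> U \<and> u \<in> V \<and> u < t}" by auto
  then show ?thesis
    unfolding inversions_def using assms by (simp only:) (rule card_Un_disjoint, auto)
qed

lemma inversions_Un_right:
  fixes T U V :: "'i::{finite,linorder} set"
  assumes "U \<inter> V = {}"
  shows "inversions T (U \<union> V) = inversions T U + inversions T V"
proof -
  have "{(t, u). t \<in> T \<and> u \<in> U \<union> V \<and> u < t} =
      {(t, u). t \<in> T \<and> u \<in> U \<and> u < t} \<union> {(t, u). t \<in> T \<and> u \<in> V \<and> u < t}" by auto
  then show ?thesis
    unfolding inversions_def using assms by (simp only:) (rule card_Un_disjoint, auto)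
qed

instantiation ext :: ("{finite,linorder}", comm_ring_1) ring_1
begin
definition one_ext :: "('a, 'b) ext"
  where "1 = Ext (\<lambda>S. if S = {} then 1 else 0)"
definition times_ext :: "('a, 'b) ext \<Rightarrow> ('a, 'b) ext \<Rightarrow> ('a, 'b) ext"
  where "a * b = Ext (\<lambda>S. \<Sum>T\<in>Pow S. (-1) ^ inversions T (S - T) * ecoeff a T * ecoeff b (S - T))"

instance
proof
  fix a b c :: "('a, 'b) ext"
  show "a * b * c = a * (b * c)"
  proof (rule ext_eqI)
    fix S :: "'a set"
    let ?A = "ecoeff a" and ?B = "ecoeff b" and ?C = "ecoeff c"
    let ?l = "\<lambda>U T. (-1) ^ inversions U (S - U) * ((-1) ^ inversions T (U - T) * ?A T * ?B (U - T)) * ?C (S - U)"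
    let ?r = "\<lambda>T V. (-1) ^ inversions T (S - T) * ?A T *
        ((-1) ^ inversions V (S - T - V) * ?B V * ?C (S - T - V))"
    have eq: "?l (T \<union> V) T = ?r T V" if "T \<subseteq> S" "V \<subseteq> S - T" for T V
    proof -
      have d: "T \<union> V - T = V" "S - (T \<union> V) = S - T - V" "V \<union> (S - T - V) = S - T"
        "T \<inter> V = {}" "V \<inter> (S - T - V) = {}" using that by auto
      have "inversions (T \<union> V) (S - T - V) + inversions T V
          = inversions T (V \<union> (S - T - V)) + inversions V (S - T - V)"
        by (simp only: inversions_Un_left[OF d(4)] inversions_Un_right[OF d(5)])
      then have "inversions (T \<union> V) (S - T - V) + inversions T V
          = inversions T (S - T) + inversions V (S - T - V)" by (simp only: d)
      then have "(-1) ^ inversions (T \<union> V) (S - T - V) * (-1) ^ inversions T V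
          = (-1) ^ inversions T (S - T) * ((-1) ^ inversions V (S - T - V) :: 'b)"
        by (simp only: power_add[symmetric])
      then show ?thesis by (simp only: d) (simp add: ac_simps flip: power_add)
    qed
    have eq': "?r T (U - T) = ?l U T" if "U \<subseteq> S" "T \<subseteq> U" for U T
    proof -
      have "T \<union> (U - T) = U" "T \<subseteq> S" "U - T \<subseteq> S - T" using that by auto
      then show ?thesis using eq[of T "U - T"] by (simp only:)
    qed
    have "ecoeff (a * b * c) S = (\<Sum>U\<in>Pow S. \<Sum>T\<in>Pow U. ?l U T)"
      by (simp add: times_ext_def sum_distrib_left sum_distrib_right)
    also have "\<dots> = (\<Sum>(U, T)\<in>Sigma (Pow S) Pow. ?l U T)"
      by (rule sum.Sigma) auto
    also have "\<dots> = (\<Sum>(T, V)\<in>Sigma (Pow S) (\<lambda>T. Pow (S - T)). ?r T V)"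
      by (rule sum.reindex_bij_witness[of _ "\<lambda>(T, V). (T \<union> V, T)" "\<lambda>(U, T). (T, U - T)"])
        (use eq' in auto)
    also have "\<dots> = (\<Sum>T\<in>Pow S. \<Sum>V\<in>Pow (S - T). ?r T V)"
      by (rule sum.Sigma[symmetric]) auto
    also have "\<dots> = ecoeff (a * (b * c)) S"
      by (simp add: times_ext_def sum_distrib_left)
    finally show "ecoeff (a * b * c) S = ecoeff (a * (b * c)) S" .
  qed
  show "(a + b) * c = a * c + b * c" "a * (b + c) = a * b + a * c"
    by (auto intro!: ext_eqI simp: times_ext_def plus_ext_def algebra_simps sum.distrib)
  have i: "inversions {} X = 0" "inversions X {} = 0" for X :: "'a set"
    by (simp_all add: inversions_def)
  show "1 * a = a"
  proof (rule ext_eqI)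
    fix S :: "'a set"
    have "ecoeff (1 * a) S = (\<Sum>T\<in>Pow S. if T = {} then ecoeff a S else 0)"
      unfolding times_ext_def one_ext_def ecoeff_Ext by (rule sum.cong) (auto simp: i)
    then show "ecoeff (1 * a) S = ecoeff a S" by simp
  qed
  show "a * 1 = a"
  proof (rule ext_eqI)
    fix S :: "'a set"
    have "ecoeff (a * 1) S = (\<Sum>T\<in>Pow S. if T = S then ecoeff a S else 0)"
      unfolding times_ext_def one_ext_def ecoeff_Ext by (rule sum.cong) (auto simp: i)
    then show "ecoeff (a * 1) S = ecoeff a S" by simp
  qed
  show "(0 :: ('a, 'b) ext) \<noteq> 1"
    by (metis (mono_tags, lifting) ecoeff_Ext one_ext_def zero_ext_def zero_neq_one)
qed
end

definition econst :: "'r \<Rightarrow> ('i, 'r::zero) ext"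
  where "econst f = Ext (\<lambda>S. if S = {} then f else 0)"

definition egen :: "'i \<Rightarrow> ('i, 'r::zero_neq_one) ext"
  where "egen i = Ext (\<lambda>S. if S = {i} then 1 else 0)"

text \<open>The odd derivation over the coefficients which is dual to the \<open>i\<close>-th generator, acting from
  the left.\<close>

definition contract :: "'i::linorder \<Rightarrow> ('i, 'r) ext \<Rightarrow> ('i, 'r::ring_1) ext"
  where "contract i a =
    Ext (\<lambda>S. if i \<in> S then 0 else (-1) ^ card {s \<in> S. s < i} * ecoeff a (insert i S))"

text \<open>The generators have degree \<open>-1\<close>.\<close>

instantiation ext :: (type, real_vector) graded
begin
definition gr_ext :: "int \<Rightarrow> ('a, 'b) ext set"
  where "gr_ext d = {a. \<forall>S. ecoeff a S \<noteq> 0 \<longrightarrow> - int (card S) = d}"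
instance ..
end


section \<open>The quadratic Poisson algebra $A$ and its twisted Poisson homology\<close>

text \<open>The variables are indexed by a finite linearly ordered type; its order is the order of the
  variables in the volume form.\<close>

type_synonym 'n poly = "('n \<Rightarrow>\<^sub>0 nat) \<Rightarrow>\<^sub>0 real"
type_synonym 'n forms = "('n, 'n poly) ext"

instantiation poly_mapping :: (type, real_vector) graded
begin
definition gr_poly_mapping :: "int \<Rightarrow> ('a \<Rightarrow>\<^sub>0 'b) set"
  where "gr_poly_mapping d = (if d = 0 then UNIV else {0})"
instance ..
end

definition var :: "'n \<Rightarrow> 'n poly"
  where "var i = Poly_Mapping.single (Poly_Mapping.single i 1) 1"

definition pd :: "'n \<Rightarrow> 'n poly \<Rightarrow> 'n poly"
  where "pd i p = (\<Sum>m\<in>Poly_Mapping.keys p.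
    Poly_Mapping.single (m - Poly_Mapping.single i 1)
      (real (Poly_Mapping.lookup m i) * Poly_Mapping.lookup p m))"

text \<open>The coefficients are \<open>c i1 i2 j1 j2\<close>, with lower indices first.\<close>

type_synonym 'n quad = "'n \<Rightarrow> 'n \<Rightarrow> 'n \<Rightarrow> 'n \<Rightarrow> real"

definition pi_A :: "'n::{finite,linorder} quad \<Rightarrow> 'n poly list \<Rightarrow> 'n poly"
  where "pi_A c = (\<Sum>i1\<in>UNIV. \<Sum>i2\<in>UNIV. \<Sum>j1\<in>UNIV. \<Sum>j2\<in>UNIV. c i1 i2 j1 j2 *\<^sub>R
    wedge (*) 0 2 (scalar_pv (var i1 * var i2))
      (wedge (*) 1 1 (vector_pv (pd j1)) (vector_pv (pd j2))))"

abbreviation br_A :: "'n::{finite,linorder} quad \<Rightarrow> 'n poly \<Rightarrow> 'n poly \<Rightarrow> 'n poly"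
  where "br_A c \<equiv> bracket_of (pi_A c)"

definition forms_of_degree :: "int \<Rightarrow> 'n forms set"
  where "forms_of_degree q = {\<omega>. \<forall>S. ecoeff \<omega> S \<noteq> 0 \<longrightarrow> int (card S) = q}"

definition dR :: "'n::{finite,linorder} forms \<Rightarrow> 'n forms"
  where "dR \<omega> = (\<Sum>i\<in>UNIV. egen i * Ext (\<lambda>S. pd i (ecoeff \<omega> S)))"

definition dwedge :: "'n poly list \<Rightarrow> 'n::{finite,linorder} forms"
  where "dwedge fs = prod_list (map (\<lambda>f. dR (econst f)) fs)"

definition volume :: "'n::{finite,linorder} forms"
  where "volume = Ext (\<lambda>S. if S = UNIV then 1 else 0)"

text \<open>The contraction of the volume form with a polyvector \<open>P\<close>, which is the sum over
  \<open>s1 < \<dots> < sp\<close> of the coordinates \<open>P(x_s1, \<dots>, x_sp)\<close> times the wedge of the coordinate vector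
  fields for \<open>s1, \<dots>, sp\<close>.  As the contraction with a wedge product is the composition of the
  contractions, the last vector field is contracted first.\<close>

definition iota_A :: "('n poly list \<Rightarrow> 'n poly) \<Rightarrow> 'n::{finite,linorder} forms"
  where "iota_A P = (\<Sum>S\<in>UNIV. let s = sorted_list_of_set S in
    econst (P (map var s)) * foldr contract s volume)"

definition Div_A :: "int \<Rightarrow> ('n::{finite,linorder} poly list \<Rightarrow> 'n poly) \<Rightarrow> 'n poly list \<Rightarrow> 'n poly"
  where "Div_A k P = (THE Q. Q \<in> polyvectors (k - 1) \<and> iota_A Q = dR (iota_A P))"

definition nu_A :: "'n::{finite,linorder} quad \<Rightarrow> 'n poly \<Rightarrow> 'n poly"
  where "nu_A c = derivation_of (- Div_A 2 (pi_A c))"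

definition twisted_boundary ::
    "('n poly \<Rightarrow> 'n poly \<Rightarrow> 'n poly) \<Rightarrow> ('n poly \<Rightarrow> 'n poly) \<Rightarrow> 'n::{finite,linorder} forms \<Rightarrow> 'n forms"
  where "twisted_boundary br \<nu> = (THE L. linear L \<and> (\<forall>f0 fs.
    L (econst f0 * dwedge fs) =
      (\<Sum>i<length fs. ((-1) ^ i :: real) *\<^sub>R
         (econst (br f0 (fs ! i) + f0 * \<nu> (fs ! i)) * dwedge (nths fs (- {i})))) +
      (\<Sum>j<length fs. \<Sum>i<j. ((-1) ^ (j - i) :: real) *\<^sub>R
         (econst f0 * dR (econst (br (fs ! i) (fs ! j))) * dwedge (nths fs (- {i, j}))))))"

definition weight_zero_forms :: "('n poly \<Rightarrow> 'n poly) \<Rightarrow> 'n::{finite,linorder} forms set"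
  where "weight_zero_forms \<nu> = span {econst f0 * dwedge fs | f0 fs ls.
    list_all2 (\<lambda>f l. \<nu> f = l *\<^sub>R f) (f0 # fs) ls \<and> sum_list ls = 0}"

definition Delta_A ::
    "'n::{finite,linorder} quad \<Rightarrow> int \<Rightarrow> ('n poly list \<Rightarrow> 'n poly) set \<Rightarrow> ('n poly list \<Rightarrow> 'n poly) set"
  where "Delta_A c =
    (let bd = twisted_boundary (br_A c) (nu_A c); n = int CARD('n) in
     transport (br_A c) iota_A
       (\<lambda>k. {\<omega> \<in> forms_of_degree (n - k) \<inter> weight_zero_forms (nu_A c). bd \<omega> = 0})
       (\<lambda>k. bd ` forms_of_degree (n - k + 1)) dR)"

definition HP_A ::
    "'n::{finite,linorder} quad \<Rightarrow> ('n poly list \<Rightarrow> 'n poly) set bv_structure"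
  where "HP_A c = HP (br_A c) (Delta_A c)"


section \<open>The Koszul dual $A^!$ and its twisted Poisson cohomology\<close>

type_synonym 'n koszul = "('n, real) ext"

definition pi_K :: "'n::{finite,linorder} quad \<Rightarrow> 'n koszul list \<Rightarrow> 'n koszul"
  where "pi_K c = (\<Sum>i1\<in>UNIV. \<Sum>i2\<in>UNIV. \<Sum>j1\<in>UNIV. \<Sum>j2\<in>UNIV. c i1 i2 j1 j2 *\<^sub>R
    wedge (*) 2 0 (scalar_pv (egen j1 * egen j2))
      (wedge (*) 0 0 (vector_pv (contract i1)) (vector_pv (contract i2))))"

abbreviation br_K :: "'n::{finite,linorder} quad \<Rightarrow> 'n koszul \<Rightarrow> 'n koszul \<Rightarrow> 'n koszul"
  where "br_K c \<equiv> bracket_of (pi_K c)"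

text \<open>The linear dual as a left module and as a Poisson module.\<close>

definition dual_act :: "'b \<Rightarrow> ('b \<Rightarrow> real) \<Rightarrow> 'b::{graded,ring_1} \<Rightarrow> real"
  where "dual_act a \<psi> = (\<lambda>b. if homogeneous b then ksgn (hdeg a * hdeg \<psi>) * \<psi> (a * b) else 0)"

definition dual_br :: "('b \<Rightarrow> 'b \<Rightarrow> 'b) \<Rightarrow> 'b \<Rightarrow> ('b \<Rightarrow> real) \<Rightarrow> 'b::{graded,ring_1} \<Rightarrow> real"
  where "dual_br br f \<psi> =
    (\<lambda>g. if homogeneous g then - ksgn (hdeg f * hdeg \<psi>) * \<psi> (br f g) else 0)"

text \<open>\<open>eta_K a\<close> is the functional dual to the product of all generators, multiplied by \<open>a\<close>; it has
  degree \<open>n\<close> as a map from the algebra to its dual.\<close>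

definition eta_K :: "'n::{finite,linorder} koszul \<Rightarrow> 'n koszul \<Rightarrow> real"
  where "eta_K a = (\<lambda>b. if homogeneous b then ecoeff (a * b) UNIV else 0)"

definition iota_K ::
    "('n koszul list \<Rightarrow> 'n koszul) \<Rightarrow> 'n::{finite,linorder} koszul list \<Rightarrow> 'n koszul \<Rightarrow> real"
  where "iota_K P = eta_K \<circ> P"

text \<open>A polyderivation \<open>\<phi>\<close> with values in the dual is identified with the functional sending
  \<open>f0 df1 \<dots> dfp\<close> to \<open>\<phi>(f1, \<dots>, fp)(f0)\<close>, up to the Koszul sign for moving \<open>f0\<close> past \<open>f1, \<dots>, fp\<close>.
  Precomposition with the de Rham differential, which sends \<open>f0 df1 \<dots> dfp\<close> to
  \<open>1 df0 df1 \<dots> dfp\<close>, becomes the following operator.\<close>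

definition dR_dual ::
    "('b list \<Rightarrow> 'b \<Rightarrow> real) \<Rightarrow> 'b list \<Rightarrow> 'b::{graded,ring_1} \<Rightarrow> real"
  where "dR_dual \<phi> = (\<lambda>fs f0.
    if homogeneous f0 then ksgn (hdeg f0 * degs fs) * \<phi> (f0 # fs) 1 else 0)"

definition Div_K :: "int \<Rightarrow> ('n::{finite,linorder} koszul list \<Rightarrow> 'n koszul) \<Rightarrow> 'n koszul list \<Rightarrow> 'n koszul"
  where "Div_K k P = (THE Q. Q \<in> polyvectors (k - 1) \<and> iota_K Q = dR_dual (iota_K P))"

definition nu_pv_K :: "'n::{finite,linorder} quad \<Rightarrow> 'n koszul list \<Rightarrow> 'n koszul"
  where "nu_pv_K c = - Div_K 2 (pi_K c)"

definition nu_K :: "'n::{finite,linorder} quad \<Rightarrow> 'n koszul \<Rightarrow> 'n koszul"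
  where "nu_K c = derivation_of (nu_pv_K c)"

definition twisted_coboundary ::
    "'n::{finite,linorder} quad \<Rightarrow> int \<Rightarrow> ('n koszul list \<Rightarrow> 'n koszul \<Rightarrow> real) \<Rightarrow> 'n koszul list \<Rightarrow> 'n koszul \<Rightarrow> real"
  where "twisted_coboundary c k \<phi> =
    coboundary (br_K c) (dual_br (br_K c)) k \<phi> + wedge dual_act 1 k (nu_pv_K c) \<phi>"

text \<open>The functionals on differential forms which vanish on all forms of nonzero weight.\<close>

definition weight_zero_dual ::
    "('b \<Rightarrow> 'b) \<Rightarrow> ('b list \<Rightarrow> 'b::{graded,ring_1} \<Rightarrow> real) set"
  where "weight_zero_dual \<nu> = {\<phi>. \<forall>f0 fs ls.
    list_all2 (\<lambda>f l. homogeneous f \<and> \<nu> f = l *\<^sub>R f) (f0 # fs) ls \<and> sum_list ls \<noteq> 0 \<longrightarrow> \<phi> fs f0 = 0}"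

definition Delta_K ::
    "'n::{finite,linorder} quad \<Rightarrow> int \<Rightarrow> ('n koszul list \<Rightarrow> 'n koszul) set \<Rightarrow> ('n koszul list \<Rightarrow> 'n koszul) set"
  where "Delta_K c =
    (let n = int CARD('n) in
     transport (br_K c) iota_K
       (\<lambda>k. {\<phi> \<in> polyder dual_act (k - n) \<inter> weight_zero_dual (nu_K c).
              twisted_coboundary c (k - n) \<phi> = 0})
       (\<lambda>k. twisted_coboundary c (k - n - 1) ` polyder dual_act (k - n - 1)) dR_dual)"

definition HP_K ::
    "'n::{finite,linorder} quad \<Rightarrow> ('n koszul list \<Rightarrow> 'n koszul) set bv_structure"
  where "HP_K c = HP (br_K c) (Delta_K c)"

end

theory Submission
  imports Defs "HOL-Library.Multiset"
begin

text \<open>Let \<open>V\<close> be the algebra of polynomials in even variables \<open>x\<^sub>1, \<dots>,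
  x\<^sub>n\<close> and odd variables \<open>\<theta>\<^sub>1, \<dots>, \<theta>\<^sub>n\<close>, with its
  Schouten bracket \<open>[-, -]\<close>. Reading \<open>\<theta>\<^sub>j\<close> as the vector field dual to
  \<open>x\<^sub>j\<close>, \<open>V\<close> is the algebra of polyvectors on \<open>A\<close>. Reading
  \<open>\<theta>\<^sub>j\<close> as the generator \<open>\<xi>\<^sub>j\<close> and \<open>x\<^sub>i\<close>, up
  to sign, as the derivation dual to \<open>\<xi>\<^sub>i\<close>, the same \<open>V\<close> is the algebra of
  polyvectors on \<open>A\<^sup>!\<close>. The polyderivation belonging to an element of \<open>V\<close> is in
  both cases given by iterated brackets with functions, and the bivectors of \<open>A\<close> and of
  \<open>A\<^sup>!\<close> come from one and the same element \<open>\<pi>\<close>. Hence both Poisson complexes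
  are \<open>V\<close> with the differential \<open>[\<pi>, -]\<close>, up to a sign that affects neither
  cocycles nor coboundaries, and the products agree (\<open>wedge_ev\<close>, \<open>coboundary_ev\<close>,
  \<open>polyvectors_eq\<close>).

  The operator \<open>\<Delta>\<close>, the sum of the second derivatives by \<open>x\<^sub>j\<close> and
  \<open>\<theta>\<^sub>j\<close>, is the divergence on both sides. For \<open>A\<close>, contraction with the
  volume form turns it into the de Rham differential (\<open>dR_star\<close>). For \<open>A\<^sup>!\<close>, the
  dual de Rham differential evaluates a polyvector at one more argument and integrates over the odd variables,
  and integration by parts turns this into \<open>\<Delta>\<close> (\<open>dR_dual_T_K\<close>). So both modular
  vector fields are given by \<open>m = - \<Delta> \<pi>\<close>. This element is bilinear in \<open>x\<close>
  and \<open>\<theta>\<close>, with a matrix \<open>M\<close> say; one modular vector field acts on the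
  generators \<open>x\<^sub>i\<close> and the other one on the generators \<open>\<xi>\<^sub>i\<close>, by
  matrices that are transposes of each other. Both are derivations, therefore each is diagonalizable if and only
  if \<open>M\<close> is. This is the first claim.

  Because \<open>\<Delta>\<close> is a derivation of the bracket up to sign, \<open>[m, -]\<close> is minus the
  anticommutator of \<open>\<Delta>\<close> and \<open>[\<pi>, -]\<close> (\<open>wt_eq\<close>). If \<open>[m,
  -]\<close> is diagonalizable, \<open>\<Delta>\<close> is thus a contracting homotopy, up to the factor given
  by the eigenvalue, on every nonzero weight space. Cohomology classes have representatives of weight zero,
  unique up to coboundaries of elements of weight zero, and there \<open>\<Delta>\<close> anticommutes with
  \<open>[\<pi>, -]\<close>. The seven-term relation is an identity for \<open>\<Delta>\<close> on
  \<open>V\<close>. The predicate \<open>presents\<close> says that a graded algebra with an operator arises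
  from \<open>V\<close> in this way; such structures are Batalin-Vilkovisky algebras and any two of them are
  isomorphic (\<open>presents_bv_algebra\<close>, \<open>presents_bv_isomorphic\<close>).

  It remains to see that the two cohomologies with their transported operators are of this kind
  (\<open>HP_A_presents\<close>, \<open>HP_K_presents\<close>): the identifications with the twisted complexes
  map \<open>[\<pi>, -]\<close> to minus the twisted differential and the kernel of \<open>[m, -]\<close> onto
  the weight-zero subcomplex.\<close>

section \<open>Exterior algebras over a commutative ring\<close>

lemma ksgn_add: "ksgn (a + b) = ksgn a * ksgn b"
  by (auto simp: ksgn_def)

lemma ksgn_minus [simp]: "ksgn (- a) = ksgn a"
  by (simp add: ksgn_def)

lemma ksgn_0 [simp]: "ksgn 0 = 1" and ksgn_1 [simp]: "ksgn 1 = -1"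
  by (simp_all add: ksgn_def)

lemma ksgn_square [simp]: "ksgn a * ksgn a = 1"
  by (simp add: ksgn_def)

lemma ksgn_of_nat: "ksgn (int k) = (-1) ^ k"
  by (simp add: ksgn_def uminus_power_if)

lemma ecoeff_simps [simp]:
  "ecoeff 0 S = 0"
  "ecoeff (a + b) S = ecoeff a S + ecoeff b S"
  "ecoeff (a - b) S = ecoeff a S - ecoeff b S"
  "ecoeff (- a) S = - ecoeff a S"
  for a b :: "('i, 'r::ab_group_add) ext"
  by (simp_all add: zero_ext_def plus_ext_def minus_ext_def uminus_ext_def)

lemma ecoeff_scaleR [simp]: "ecoeff (r *\<^sub>R a) S = r *\<^sub>R ecoeff a S"
  by (simp add: scaleR_ext_def)

lemma ecoeff_sum: "ecoeff (sum f A) S = (\<Sum>x\<in>A. ecoeff (f x) S)"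
  by (induction A rule: infinite_finite_induct) auto

lemma ext_eq_iff: "a = b \<longleftrightarrow> (\<forall>S. ecoeff a S = ecoeff b S)"
  using ext_eqI by blast

lemma lookup_scaleR [simp]:
  "Poly_Mapping.lookup (r *\<^sub>R p) m = r *\<^sub>R Poly_Mapping.lookup p m"
  by (auto simp: scaleR_poly_mapping_def Poly_Mapping.map.rep_eq when_def)

lemma scaleR_poly_eq: "r *\<^sub>R p = Poly_Mapping.single 0 r * (p :: 'n poly)"
  by (simp add: scaleR_poly_mapping_def real_scaleR_def[abs_def] flip: mult_map_scale_conv_mult)

text \<open>These instances give polynomials and exterior algebras a scalar multiplication that is
  compatible with the product, so that one calculus covers both algebras.\<close>

instance poly_mapping :: (comm_monoid_add, real_algebra_1) real_algebra_1
proof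
  fix r :: real and p q :: "'a \<Rightarrow>\<^sub>0 'b"
  have l: "s *\<^sub>R t = Poly_Mapping.single 0 (of_real s) * t" for s and t :: "'a \<Rightarrow>\<^sub>0 'b"
    by (simp add: scaleR_poly_mapping_def scaleR_conv_of_real[abs_def] flip: mult_map_scale_conv_mult)
  have c: "t * Poly_Mapping.single 0 (of_real s) = Poly_Mapping.single 0 (of_real s) * t"
    for s and t :: "'a \<Rightarrow>\<^sub>0 'b"
  proof (induction t rule: update_induct)
    case const
    then show ?case by simp
  next
    case (update t k v)
    have u: "Poly_Mapping.update k v t = t + Poly_Mapping.single k v"
      using update(1) by (intro poly_mapping_eqI)
        (auto simp: lookup_update lookup_add lookup_single when_def in_keys_iff)
    have "Poly_Mapping.single k v * Poly_Mapping.single 0 (of_real s)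
      = Poly_Mapping.single 0 (of_real s) * Poly_Mapping.single k v"
      by (simp add: mult_single Real_Vector_Spaces.of_real_def)
    then show ?case
      by (simp add: u update.IH distrib_left distrib_right)
  qed
  show "r *\<^sub>R p * q = r *\<^sub>R (p * q)"
    by (simp add: l mult.assoc)
  show "p * r *\<^sub>R q = r *\<^sub>R (p * q)"
    by (simp add: l) (metis c mult.assoc)
qed

instance ext :: ("{finite,linorder}", "{comm_ring_1,real_algebra_1}") real_algebra_1
  by standard (auto intro!: ext_eqI simp: times_ext_def scaleR_sum_right)

lemma ecoeff_econst_mult [simp]: "ecoeff (econst p * a) S = p * ecoeff a S"
  for a :: "('i::{finite,linorder}, 'r::comm_ring_1) ext"
proof -
  have "ecoeff (econst p * a) S = (\<Sum>T\<in>Pow S. if T = {} then p * ecoeff a S else 0)"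
    unfolding times_ext_def econst_def ecoeff_Ext
    by (rule sum.cong) (auto simp: inversions_def)
  then show ?thesis by simp
qed

lemma ecoeff_mult_econst [simp]: "ecoeff (a * econst p) S = ecoeff a S * p"
  for a :: "('i::{finite,linorder}, 'r::comm_ring_1) ext"
proof -
  have "ecoeff (a * econst p) S = (\<Sum>T\<in>Pow S. if T = S then ecoeff a S * p else 0)"
    unfolding times_ext_def econst_def ecoeff_Ext
  proof (rule sum.cong)
    fix T assume "T \<in> Pow S"
    moreover have "inversions S (S - S) = 0" by (simp add: inversions_def)
    ultimately show "(-1) ^ inversions T (S - T) * ecoeff a T * (if S - T = {} then p else 0)
        = (if T = S then ecoeff a S * p else 0)"
      by auto
  qed simp
  then show ?thesis by simp
qed

lemma econst_commute: "a * econst p = econst p * a"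
  for a :: "('i::{finite,linorder}, 'r::comm_ring_1) ext"
  by (rule ext_eqI) (simp add: mult.commute)

lemma econst_0 [simp]: "econst 0 = (0 :: ('i, 'r::ab_group_add) ext)"
  by (rule ext_eqI) (simp add: econst_def)

lemma econst_1 [simp]: "econst 1 = (1 :: ('i::{finite,linorder}, 'r::comm_ring_1) ext)"
  by (rule ext_eqI) (simp add: econst_def one_ext_def)

lemma econst_add: "econst (p + q) = econst p + (econst q :: ('i, 'r::ab_group_add) ext)"
  by (rule ext_eqI) (simp add: econst_def)

lemma econst_minus: "econst (- p) = - (econst p :: ('i, 'r::ab_group_add) ext)"
  by (rule ext_eqI) (simp add: econst_def)

lemma econst_sum: "econst (sum f A) = (\<Sum>x\<in>A. econst (f x) :: ('i, 'r::ab_group_add) ext)"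
  by (induction A rule: infinite_finite_induct) (auto simp: econst_add)

lemma econst_scaleR: "econst (r *\<^sub>R p) = r *\<^sub>R econst p"
  by (rule ext_eqI) (simp add: econst_def)

lemma econst_mult: "econst (p * q) = (econst p * econst q :: ('i::{finite,linorder}, 'r::comm_ring_1) ext)"
  by (rule ext_eqI) (simp, simp add: econst_def)

text \<open>The exponent of the sign for moving a generator to its place in an increasing product.\<close>

definition below :: "'i::linorder \<Rightarrow> 'i set \<Rightarrow> nat"
  where "below i S = card {s\<in>S. s < i}"

lemma below_insert: "below j (insert i S) = (if i < j \<and> i \<notin> S then Suc (below j S) else below j S)"
  for S :: "'i::{finite,linorder} set"
proof -
  have "{s \<in> insert i S. s < j} = (if i < j then insert i {s\<in>S. s < j} else {s\<in>S. s < j})" by auto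
  then show ?thesis by (auto simp: insert_absorb below_def)
qed

lemma below_remove: "below j S = (if i < j \<and> i \<in> S then Suc (below j (S - {i})) else below j (S - {i}))"
  for S :: "'i::{finite,linorder} set"
  by (cases "i \<in> S") (use below_insert[of j i "S - {i}"] in \<open>auto simp: insert_absorb\<close>)

lemma ecoeff_egen_mult:
  "ecoeff (egen i * a) S = (if i \<in> S then (-1) ^ below i S * ecoeff a (S - {i}) else 0)"
  for a :: "('i::{finite,linorder}, 'r::comm_ring_1) ext"
proof -
  have inv: "inversions {i} (S - {i}) = below i S"
    unfolding inversions_def below_def
    by (rule bij_betw_same_card[of snd]) (auto simp: bij_betw_def inj_on_def image_iff)
  have "ecoeff (egen i * a) S = (\<Sum>T\<in>Pow S. if T = {i} then (-1) ^ below i S * ecoeff a (S - {i}) else 0)"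
    unfolding times_ext_def egen_def ecoeff_Ext
    by (rule sum.cong) (auto simp: inv)
  then show ?thesis by (simp add: sum.delta)
qed

lemma ecoeff_contract:
  "ecoeff (contract i a) S = (if i \<in> S then 0 else (-1) ^ below i S * ecoeff a (insert i S))"
  by (simp add: contract_def below_def)

lemma egen_egen_mult [simp]: "egen i * (egen i * a) = 0"
  for a :: "('i::{finite,linorder}, 'r::comm_ring_1) ext"
  by (rule ext_eqI) (simp add: ecoeff_egen_mult)

lemma egen_anticommute: "egen i * (egen j * a) = - (egen j * (egen i * a))"
  for a :: "('i::{finite,linorder}, 'r::comm_ring_1) ext"
proof -
  have less: "egen i * (egen j * a) = - (egen j * (egen i * a))" if "i < j" for i j
  proof (rule ext_eqI)
    fix S
    have c: "S - {i} - {j} = S - {j} - {i}" by auto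
    show "ecoeff (egen i * (egen j * a)) S = ecoeff (- (egen j * (egen i * a))) S"
    proof (cases "i \<in> S \<and> j \<in> S")
      case True
      then have m: "i \<in> S" "j \<in> S" "i \<in> S - {j}" "j \<in> S - {i}"
        using that by auto
      have b1: "(-1) ^ below j S = - ((-1) ^ below j (S - {i}) :: 'r)"
        using that True by (subst below_remove[of j S i]) auto
      have b2: "below i (S - {j}) = below i S"
        using that True by (subst below_remove[of i S j]) auto
      show ?thesis
        unfolding ecoeff_egen_mult[of i] ecoeff_egen_mult[of j] ecoeff_simps
        by (simp only: m if_True b1 b2 c mult_minus_left minus_minus) (rule mult.left_commute)
    qed (auto simp: ecoeff_egen_mult)
  qed
  show ?thesis
    using less[of i j] less[of j i] by (cases i j rule: linorder_cases) auto
qed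

lemma contract_egen_mult: "contract i (egen j * a) = (if i = j then a else 0) - egen j * contract i a"
  for a :: "('i::{finite,linorder}, 'r::comm_ring_1) ext"
proof (rule ext_eqI)
  fix S
  have b: "below i (S - {i}) = below i S" "below i (insert i S) = below i S"
    unfolding below_def by (rule arg_cong[of _ _ card], force)+
  consider "i = j" "i \<in> S" | "i = j" "i \<notin> S" | "i \<noteq> j" "i \<in> S \<or> j \<notin> S" | "i \<noteq> j" "i \<notin> S" "j \<in> S" by blast
  then show "ecoeff (contract i (egen j * a)) S = ecoeff ((if i = j then a else 0) - egen j * contract i a) S"
  proof cases
    case 1
    have "insert i (S - {i}) = S" using 1 by auto
    then show ?thesis
      unfolding 1(1)[symmetric] using 1(2) by (simp add: ecoeff_contract ecoeff_egen_mult b(1))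
  next
    case 2
    then show ?thesis
      unfolding 2(1)[symmetric] by (simp add: ecoeff_contract ecoeff_egen_mult b(2))
  next
    case 3
    then show ?thesis by (simp add: ecoeff_contract ecoeff_egen_mult) blast
  next
    case 4
    then have d: "insert i S - {j} = insert i (S - {j})" by auto
    have "(-1) ^ below i S * (-1) ^ below j (insert i S) = - ((-1) ^ below j S * (-1) ^ below i (S - {j}) :: 'r)"
    proof (cases "i < j")
      case True
      have "below i S = below i (S - {j})"
        using less_not_sym[OF True] by (subst below_remove[of i S j]) simp
      moreover have "below j (insert i S) = Suc (below j S)"
        using 4 True by (simp add: below_insert)
      ultimately show ?thesis by (simp add: mult.commute)
    next
      case False
      have "below i S = Suc (below i (S - {j}))"
        using 4 False by (subst below_remove[of i S j]) simp
      moreover have "below j (insert i S) = below j S"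
        using 4 False by (simp add: below_insert)
      ultimately show ?thesis by (simp add: mult.commute)
    qed
    then have s: "(-1) ^ below i S * ((-1) ^ below j (insert i S) * e)
        = - ((-1) ^ below j S * ((-1) ^ below i (S - {j}) * e))" for e :: 'r
      by (simp only: mult.assoc[symmetric] mult_minus_left)
    show ?thesis
      using 4 by (simp add: ecoeff_contract ecoeff_egen_mult d s)
  qed
qed

lemma contract_simps [simp]:
  "contract i 0 = 0" "contract i (a + b) = contract i a + contract i b"
  "contract i (a - b) = contract i a - contract i b" "contract i (- a) = - contract i a"
  "contract i (econst p) = 0" "contract i (econst p * a) = econst p * contract i a"
  for a b :: "('i::{finite,linorder}, 'r::comm_ring_1) ext"
proof -
  show "contract i (econst p) = (0 :: ('i, 'r) ext)" for p :: 'r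
    by (rule ext_eqI) (simp add: ecoeff_contract, simp add: econst_def)
qed (rule ext_eqI; simp add: ecoeff_contract distrib_left right_diff_distrib mult.left_commute[of _ p])+

lemma contract_1 [simp]: "contract i (1 :: ('i::{finite,linorder}, 'r::comm_ring_1) ext) = 0"
  using contract_simps(5)[of i 1] by simp

lemma contract_scaleR [simp]: "contract i (r *\<^sub>R a) = r *\<^sub>R contract i a"
  for a :: "('i::{finite,linorder}, 'r::{comm_ring_1,real_algebra_1}) ext"
  by (rule ext_eqI) (simp add: ecoeff_contract)

lemma contract_sum: "contract i (sum f A) = (\<Sum>x\<in>A. contract i (f x))"
  for f :: "'x \<Rightarrow> ('i::{finite,linorder}, 'r::comm_ring_1) ext"
  by (induction A rule: infinite_finite_induct) auto

lemma contract_egen: "contract i (egen j) = (if i = j then 1 else (0 :: ('i::{finite,linorder}, 'r::comm_ring_1) ext))"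
  using contract_egen_mult[of i j 1] by simp

text \<open>As an algebra over its coefficients the exterior algebra is generated by the generators.
  Identities between derivations are proved along this rule.\<close>

lemma ext_induct [case_names econst add egen]:
  fixes a :: "('i::{finite,linorder}, 'r::comm_ring_1) ext"
  assumes const: "\<And>p. P (econst p)" and add: "\<And>a b. P a \<Longrightarrow> P b \<Longrightarrow> P (a + b)"
    and egen: "\<And>i a. P a \<Longrightarrow> P (egen i * a)"
  shows "P a"
proof -
  define mono where "mono S p = (Ext (\<lambda>T. if T = S then p else 0) :: ('i, 'r) ext)" for S p
  have m: "P (mono S p)" if "card S = k" for S p k
    using that
  proof (induction k arbitrary: S)
    case 0
    then have "mono S p = econst p" by (simp add: mono_def econst_def)
    then show ?case using const by simp
  next
    case (Suc k)
    define i where "i = Min S"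
    have ne: "S \<noteq> {}" using Suc.prems by auto
    have i: "i \<in> S" using ne by (simp add: i_def)
    have less: "below i S = 0" by (auto simp: i_def below_def dest: Min_le[OF finite])
    have "mono S p = egen i * mono (S - {i}) p"
      using i less by (intro ext_eqI) (auto simp: ecoeff_egen_mult mono_def)
    moreover have "P (mono (S - {i}) p)" using i Suc by (intro Suc.IH) simp
    ultimately show ?case using egen by simp
  qed
  have s: "P (\<Sum>S\<in>\<A>. mono S (ecoeff a S))" for \<A>
    by (induction \<A> rule: infinite_finite_induct) (use const[of 0] add m in auto)
  have "(\<Sum>S\<in>UNIV. mono S (ecoeff a S)) = a"
    by (rule ext_eqI) (simp add: ecoeff_sum mono_def)
  then show ?thesis using s[of UNIV] by simp
qed

text \<open>The grading automorphism, by which every odd operator fails to commute with left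
  multiplication.\<close>

definition par :: "('i, 'r) ext \<Rightarrow> ('i, 'r::ring_1) ext"
  where "par a = Ext (\<lambda>S. (-1) ^ card S * ecoeff a S)"

lemma par_simps [simp]:
  "par 0 = 0" "par (a + b) = par a + par b" "par (a - b) = par a - par b"
  "par (- a) = - par a" "par (par a) = a" "par (econst p) = (econst p :: ('i, 'r) ext)" "par 1 = (1 :: ('i, 'r) ext)"
  "par (econst p * a) = econst p * par a" "par (egen i) = - (egen i :: ('i, 'r) ext)" "par (egen i * a) = - (egen i * par a)"
  for a b :: "('i::{finite,linorder}, 'r::comm_ring_1) ext"
proof -
  show *: "par (egen i * a) = - (egen i * par a)" for a :: "('i, 'r) ext"
  proof (rule ext_eqI)
    fix S
    have "(-1) ^ card S = - ((-1) ^ card (S - {i}) :: 'r)" if "i \<in> S"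
      using that by (subst card.remove[of S i]) auto
    then show "ecoeff (par (egen i * a)) S = ecoeff (- (egen i * par a)) S"
      by (auto simp: par_def ecoeff_egen_mult mult.left_commute)
  qed
  show **: "par (econst p) = (econst p :: ('i, 'r) ext)" for p :: 'r
    by (rule ext_eqI) (auto simp: par_def econst_def)
  show p1: "par 1 = (1 :: ('i, 'r) ext)" using **[of 1] by (simp only: econst_1)
  show "par (egen i) = - (egen i :: ('i, 'r) ext)" using *[of 1] by (simp add: p1)
qed (rule ext_eqI; simp add: par_def distrib_left right_diff_distrib mult.left_commute[of _ p])+

lemma par_scaleR [simp]: "par (r *\<^sub>R a) = r *\<^sub>R par a"
  for a :: "('i::{finite,linorder}, 'r::{comm_ring_1,real_algebra_1}) ext"
  by (rule ext_eqI) (simp add: par_def)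

lemma par_sum: "par (sum f A) = (\<Sum>x\<in>A. par (f x))"
  for f :: "'x \<Rightarrow> ('i::{finite,linorder}, 'r::comm_ring_1) ext"
  by (induction A rule: infinite_finite_induct) auto

lemma par_mult [simp]: "par (a * b) = par a * par b"
  for a b :: "('i::{finite,linorder}, 'r::comm_ring_1) ext"
  by (induction a rule: ext_induct) (simp_all add: distrib_right mult.assoc)

lemma contract_mult: "contract i (a * b) = contract i a * b + par a * contract i b"
  for a b :: "('i::{finite,linorder}, 'r::comm_ring_1) ext"
  by (induction a rule: ext_induct)
    (simp_all add: distrib_right distrib_left left_diff_distrib right_diff_distrib contract_egen_mult mult.assoc)

lemma par_contract: "par (contract i a) = - contract i (par a)"
  for a :: "('i::{finite,linorder}, 'r::comm_ring_1) ext"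
  by (induction a rule: ext_induct) (simp_all add: contract_egen_mult)

lemma contract_anticommute: "contract i (contract j a) = - contract j (contract i a)"
  for a :: "('i::{finite,linorder}, 'r::comm_ring_1) ext"
  by (induction a rule: ext_induct) (simp_all add: contract_egen_mult)

lemma mult_egen: "b * egen i = egen i * par b"
  for b :: "('i::{finite,linorder}, 'r::comm_ring_1) ext"
proof (induction b rule: ext_induct)
  case (egen j a)
  then show ?case by (simp add: mult.assoc egen_anticommute[of i j])
qed (simp_all add: econst_commute[of "egen i"] distrib_left distrib_right)

subsection \<open>The grading\<close>

text \<open>The grading is indexed by integers, with zero components outside the range of the number of
  generators, because brackets, contractions and coboundaries shift degrees in both directions.\<close>

definition hpart :: "int \<Rightarrow> ('i, 'r::zero) ext set"
  where "hpart k = {a. \<forall>S. ecoeff a S \<noteq> 0 \<longrightarrow> int (card S) = k}"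

lemma gr_ext_eq: "gr d = hpart (- d)"
  by (auto simp: gr_ext_def hpart_def)

lemma forms_of_degree_eq: "forms_of_degree = hpart"
  by (simp add: forms_of_degree_def hpart_def fun_eq_iff)

lemma hpart_0 [simp]: "0 \<in> hpart k" for k :: int
  by (simp add: hpart_def)

lemma
  fixes a b :: "('i, 'r::ab_group_add) ext"
  shows hpart_add: "a \<in> hpart k \<Longrightarrow> b \<in> hpart k \<Longrightarrow> a + b \<in> hpart k"
    and hpart_diff: "a \<in> hpart k \<Longrightarrow> b \<in> hpart k \<Longrightarrow> a - b \<in> hpart k"
    and hpart_minus: "a \<in> hpart k \<Longrightarrow> - a \<in> hpart k"
  by (auto simp: hpart_def) (metis add_0 diff_0_right)+

lemma hpart_sum: "(\<And>x. x \<in> A \<Longrightarrow> f x \<in> hpart k) \<Longrightarrow> sum f A \<in> hpart k"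
  for f :: "'x \<Rightarrow> ('i, 'r::ab_group_add) ext"
  by (induction A rule: infinite_finite_induct) (auto intro: hpart_add)

lemma hpart_scaleR: "a \<in> hpart k \<Longrightarrow> r *\<^sub>R a \<in> hpart k"
  by (auto simp: hpart_def)

lemma hpart_unique: "a \<in> hpart k \<Longrightarrow> a \<in> hpart l \<Longrightarrow> a \<noteq> 0 \<Longrightarrow> k = l"
  for a :: "('i, 'r::ab_group_add) ext"
  by (auto simp: hpart_def ext_eq_iff)

lemma hpart_negative: "a \<in> hpart k \<Longrightarrow> k < 0 \<Longrightarrow> a = 0"
  for a :: "('i, 'r::ab_group_add) ext"
  by (force simp: hpart_def ext_eq_iff)

lemma hpart_large: "a \<in> hpart k \<Longrightarrow> int CARD('i) < k \<Longrightarrow> a = 0"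
  for a :: "('i::finite, 'r::ab_group_add) ext"
proof (rule ext_eqI)
  fix S :: "'i set" assume *: "a \<in> hpart k" "int CARD('i) < k"
  moreover have "card S \<le> CARD('i)" by (rule card_mono) auto
  ultimately show "ecoeff a S = ecoeff 0 S" by (force simp: hpart_def)
qed

lemma hpart_mult: "a \<in> hpart k \<Longrightarrow> b \<in> hpart l \<Longrightarrow> a * b \<in> hpart (k + l)"
  for a b :: "('i::{finite,linorder}, 'r::comm_ring_1) ext"
proof -
  assume a: "a \<in> hpart k" and b: "b \<in> hpart l"
  have "int (card S) = k + l" if nz: "ecoeff (a * b) S \<noteq> 0" for S
  proof -
    obtain T where T: "T \<subseteq> S" "(-1) ^ inversions T (S - T) * ecoeff a T * ecoeff b (S - T) \<noteq> 0"
      using nz unfolding times_ext_def ecoeff_Ext by (metis (no_types, lifting) PowD sum.neutral)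
    then have "ecoeff a T \<noteq> 0" "ecoeff b (S - T) \<noteq> 0" by auto
    then have "int (card T) = k" "int (card (S - T)) = l" using a b by (auto simp: hpart_def)
    then show ?thesis using T(1) by (simp add: card_Diff_subset card_mono finite_subset of_nat_diff)
  qed
  then show ?thesis by (simp add: hpart_def)
qed

lemma hpart_econst [simp]: "econst p \<in> hpart 0"
  by (simp add: hpart_def econst_def)

lemma hpart_1 [simp]: "1 \<in> (hpart 0 :: ('i::{finite,linorder}, 'r::comm_ring_1) ext set)"
  unfolding econst_1[symmetric] by (rule hpart_econst)

lemma hpart_egen [simp]: "egen i \<in> hpart 1"
  by (simp add: hpart_def egen_def)

lemma hpart_contract: "a \<in> hpart k \<Longrightarrow> contract i a \<in> hpart (k - 1)"
  for a :: "('i::{finite,linorder}, 'r::comm_ring_1) ext"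
  unfolding hpart_def
  by (auto simp: ecoeff_contract split: if_splits) (metis add_diff_cancel_left' card_insert_disjoint finite mult_zero_right of_nat_Suc)

lemma hpart_0_econst: "a \<in> hpart 0 \<Longrightarrow> a = econst (ecoeff a {})"
  for a :: "('i::finite, 'r::zero) ext"
  by (rule ext_eqI) (auto simp: hpart_def econst_def)

lemma par_hpart: "a \<in> hpart k \<Longrightarrow> par a = ksgn k *\<^sub>R a"
  for a :: "('i::{finite,linorder}, 'r::{comm_ring_1,real_algebra_1}) ext"
proof (rule ext_eqI)
  fix S assume "a \<in> hpart k"
  then have "ecoeff a S = 0 \<or> k = int (card S)" by (auto simp: hpart_def)
  then show "ecoeff (par a) S = ecoeff (ksgn k *\<^sub>R a) S"
    by (auto simp: par_def ksgn_of_nat uminus_power_if)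
qed

lemma par_hpart_mem: "a \<in> hpart k \<Longrightarrow> par a \<in> hpart k"
  for a :: "('i::{finite,linorder}, 'r::comm_ring_1) ext"
  unfolding hpart_def par_def ecoeff_Ext mem_Collect_eq
  by (intro allI impI) (drule spec, erule mp, erule contrapos_nn, simp)

text \<open>The statement is linear in the left factor, so that it can be proved by induction on it
  without assuming it homogeneous.\<close>

lemma mult_hpart_commute: "b \<in> hpart l \<Longrightarrow> a * b = b * (if even l then a else par a)"
  for a b :: "('i::{finite,linorder}, 'r::{comm_ring_1,real_algebra_1}) ext"
proof (induction a rule: ext_induct)
  case (egen i a)
  have "b * egen i = ksgn l *\<^sub>R (egen i * b)"
    using egen.prems by (simp add: mult_egen par_hpart)
  then have e: "egen i * b = ksgn l *\<^sub>R (b * egen i)" by simp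
  have "egen i * a * b = egen i * b * (if even l then a else par a)"
    using egen by (simp add: mult.assoc)
  also have "\<dots> = b * (if even l then egen i * a else par (egen i * a))"
    by (simp add: e mult.assoc ksgn_def)
  finally show ?case .
next
  case (econst p)
  then show ?case by (simp add: econst_commute)
next
  case (add a b)
  then show ?case by (simp add: distrib_left distrib_right)
qed

lemma graded_commute:
  fixes a b :: "('i::{finite,linorder}, 'r::{comm_ring_1,real_algebra_1}) ext"
  assumes "a \<in> hpart k" "b \<in> hpart l"
  shows "a * b = ksgn (k * l) *\<^sub>R (b * a)"
  using mult_hpart_commute[OF assms(2), of a] assms(1) by (auto simp: par_hpart ksgn_def)

section \<open>Polynomials\<close>

lemma lookup_pd:
  "Poly_Mapping.lookup (pd i p) m
    = real (Poly_Mapping.lookup m i + 1) * Poly_Mapping.lookup p (m + Poly_Mapping.single i 1)"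
proof -
  let ?s = "Poly_Mapping.single i (1 :: nat)"
  have t: "(if m' - ?s = m then real (Poly_Mapping.lookup m' i) * Poly_Mapping.lookup p m' else 0)
      = (if m' = m + ?s then real (Poly_Mapping.lookup m i + 1) * Poly_Mapping.lookup p (m + ?s) else 0)"
    (is "?l = ?r") for m'
  proof (cases "m' - ?s = m \<and> Poly_Mapping.lookup m' i \<noteq> 0")
    case True
    have "m' = m + ?s"
    proof (rule poly_mapping_eqI)
      fix j show "Poly_Mapping.lookup m' j = Poly_Mapping.lookup (m + ?s) j"
        using True by (auto simp: lookup_add lookup_minus lookup_single when_def)
    qed
    then show ?thesis by (simp add: lookup_add)
  next
    case False
    have "m' \<noteq> m + ?s \<or> False" using False by (auto simp: lookup_add)
    then show ?thesis using False by auto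
  qed
  have "Poly_Mapping.lookup (pd i p) m
      = (\<Sum>m'\<in>Poly_Mapping.keys p. if m' - ?s = m then real (Poly_Mapping.lookup m' i) * Poly_Mapping.lookup p m' else 0)"
    by (simp add: pd_def lookup_sum lookup_single when_def)
  also have "\<dots> = real (Poly_Mapping.lookup m i + 1) * Poly_Mapping.lookup p (m + ?s)"
    unfolding t by (simp add: sum.delta in_keys_iff)
  finally show ?thesis .
qed

lemma pd_simps [simp]:
  "pd i 0 = 0" "pd i (p + q) = pd i p + pd i q" "pd i (p - q) = pd i p - pd i q" "pd i (- p) = - pd i p"
  "pd i (r *\<^sub>R p) = r *\<^sub>R pd i p" "pd i (Poly_Mapping.single 0 r) = 0" "pd i 1 = 0"
  for i :: 'a
proof -
  show s: "pd i (Poly_Mapping.single 0 r) = 0" for r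
  proof (rule poly_mapping_eqI)
    fix m :: "'a \<Rightarrow>\<^sub>0 nat"
    have "m + Poly_Mapping.single i 1 \<noteq> 0"
    proof
      assume "m + Poly_Mapping.single i 1 = 0"
      then have "Poly_Mapping.lookup (m + Poly_Mapping.single i 1) i = 0" by simp
      then show False by (simp add: lookup_add)
    qed
    then show "Poly_Mapping.lookup (pd i (Poly_Mapping.single 0 r)) m = Poly_Mapping.lookup 0 m"
      by (simp add: lookup_pd lookup_single when_def)
  qed
  show "pd i 1 = 0" using s[of 1] by simp
qed (auto intro!: poly_mapping_eqI simp: lookup_pd lookup_add lookup_minus ring_distribs)

lemma pd_sum: "pd i (sum f A) = (\<Sum>x\<in>A. pd i (f x))"
  by (induction A rule: infinite_finite_induct) auto

lemma pd_commute: "pd i (pd j p) = pd j (pd i p)"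
  by (rule poly_mapping_eqI) (auto simp: lookup_pd lookup_add lookup_single when_def ac_simps)

lemma poly_single_induct [case_names zero single add]:
  assumes "P 0" "\<And>m r. P (Poly_Mapping.single m r)" "\<And>p q. P p \<Longrightarrow> P q \<Longrightarrow> P (p + q)"
  shows "P (p :: 'a \<Rightarrow>\<^sub>0 'b::comm_monoid_add)"
proof -
  have *: "P (\<Sum>m\<in>M. Poly_Mapping.single m (Poly_Mapping.lookup p m))" for M
    by (induction M rule: infinite_finite_induct) (use assms in auto)
  have "(\<Sum>m\<in>Poly_Mapping.keys p. Poly_Mapping.single m (Poly_Mapping.lookup p m)) = p"
    by (rule poly_mapping_eqI) (simp add: lookup_sum lookup_single when_def in_keys_iff)
  then show ?thesis using *[of "Poly_Mapping.keys p"] by (simp only:)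
qed

definition mdeg :: "('n::finite \<Rightarrow>\<^sub>0 nat) \<Rightarrow> nat"
  where "mdeg m = (\<Sum>i\<in>UNIV. Poly_Mapping.lookup m i)"

lemma mdeg_simps [simp]: "mdeg 0 = 0" "mdeg (m + m') = mdeg m + mdeg m'" "mdeg (Poly_Mapping.single i k) = k"
proof -
  have "mdeg (Poly_Mapping.single i k) = (\<Sum>j\<in>UNIV. if j = i then k else 0)"
    unfolding mdeg_def by (rule sum.cong) (auto simp: lookup_single)
  then show "mdeg (Poly_Mapping.single i k) = k" by simp
  show "mdeg 0 = 0" unfolding mdeg_def by simp
  show "mdeg (m + m') = mdeg m + mdeg m'" unfolding mdeg_def lookup_add by (rule sum.distrib)
qed

lemma mdeg_eq_0_iff: "mdeg m = 0 \<longleftrightarrow> m = 0"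
  unfolding mdeg_def poly_mapping_eq_iff by (auto simp: fun_eq_iff)

lemma monomial_induct [case_names zero add]:
  fixes m :: "'n::finite \<Rightarrow>\<^sub>0 nat"
  assumes "P 0" "\<And>i m. P m \<Longrightarrow> P (Poly_Mapping.single i 1 + m)"
  shows "P m"
proof (induction "mdeg m" arbitrary: m)
  case 0
  then show ?case using assms(1) by (simp add: mdeg_eq_0_iff)
next
  case (Suc k)
  then have "m \<noteq> 0" by auto
  then obtain i where i: "Poly_Mapping.lookup m i \<noteq> 0" by (metis poly_mapping_eqI lookup_zero)
  define m' where "m' = m - Poly_Mapping.single i 1"
  have m: "m = Poly_Mapping.single i 1 + m'"
    using i by (intro poly_mapping_eqI) (auto simp: m'_def lookup_add lookup_minus lookup_single when_def)
  have "mdeg m = Suc (mdeg m')" by (subst m) simp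
  then have "k = mdeg m'" using Suc(2) by simp
  then have "P m'" by (rule Suc(1))
  then show ?case by (subst m) (rule assms(2))
qed

lemma var_mult_single: "var i * Poly_Mapping.single m r = Poly_Mapping.single (Poly_Mapping.single i 1 + m) r"
  by (simp add: var_def mult_single)

text \<open>The constants and multiplication by variables generate all polynomials; the partial derivatives
  are determined by their values along this rule.\<close>

lemma poly_induct [case_names const add var]:
  fixes p :: "'n::finite poly"
  assumes "\<And>r. P (Poly_Mapping.single 0 r)" "\<And>p q. P p \<Longrightarrow> P q \<Longrightarrow> P (p + q)" "\<And>i p. P p \<Longrightarrow> P (var i * p)"
  shows "P p"
proof (induction p rule: poly_single_induct)
  case zero
  then show ?case using assms(1)[of 0] by simp
next
  case (single m r)
  then show ?case
    by (induction m rule: monomial_induct) (use assms(1) assms(3)[unfolded var_def] in \<open>auto simp: mult_single\<close>, metis assms(3) var_mult_single One_nat_def)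
qed (use assms in auto)

lemma lookup_var_mult:
  "Poly_Mapping.lookup (var i * p) m
    = (if Poly_Mapping.lookup m i = 0 then 0 else Poly_Mapping.lookup p (m - Poly_Mapping.single i 1))"
proof (induction p rule: poly_single_induct)
  case (single m' r)
  have "(Poly_Mapping.single i 1 + m' = m) = (Poly_Mapping.lookup m i \<noteq> 0 \<and> m' = m - Poly_Mapping.single i 1)"
    (is "?l = ?r")
  proof
    assume ?l
    then show ?r by (auto simp: lookup_add)
  next
    assume ?r
    then show ?l
      by (intro poly_mapping_eqI) (auto simp: lookup_add lookup_minus lookup_single when_def)
  qed
  then show ?case by (auto simp: var_mult_single lookup_single when_def)
qed (simp_all add: distrib_left lookup_add)

lemma pd_var_mult: "pd i (var j * p) = (if i = j then p else 0) + var j * pd i p"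
  for i j :: 'a
proof (rule poly_mapping_eqI)
  fix m :: "'a \<Rightarrow>\<^sub>0 nat"
  have s: "m - Poly_Mapping.single j 1 + Poly_Mapping.single j 1 = m" if "Poly_Mapping.lookup m j \<noteq> 0"
    using that by (intro poly_mapping_eqI) (auto simp: lookup_add lookup_minus lookup_single when_def)
  have c: "m + Poly_Mapping.single i 1 - Poly_Mapping.single j 1 = m - Poly_Mapping.single j 1 + Poly_Mapping.single i 1"
    if "Poly_Mapping.lookup m j \<noteq> 0"
    using that by (intro poly_mapping_eqI) (auto simp: lookup_add lookup_minus lookup_single when_def)
  show "Poly_Mapping.lookup (pd i (var j * p)) m = Poly_Mapping.lookup ((if i = j then p else 0) + var j * pd i p) m"
    by (cases "Poly_Mapping.lookup m j = 0")
      (auto simp: lookup_pd lookup_var_mult lookup_add lookup_minus lookup_single when_def c[simplified] s[simplified] distrib_right left_diff_distrib)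
qed

lemma pd_var: "pd i (var j) = (if i = j then 1 else 0)"
  using pd_var_mult[of i j 1] by simp

lemma pd_mult: "pd i (p * q) = pd i p * q + p * pd i q" for p q :: "'n::finite poly"
proof (induction p rule: poly_induct)
  case (const r)
  then show ?case by (simp flip: scaleR_poly_eq)
next
  case (var j p)
  then show ?case by (simp add: pd_var_mult mult.assoc ring_distribs)
qed (simp_all add: ring_distribs)

section \<open>Polynomial polyvectors and the Schouten bracket\<close>

lemma forms_induct [case_names const add var egen]:
  fixes \<omega> :: "'n::{finite,linorder} forms"
  assumes "\<And>r. P (econst (Poly_Mapping.single 0 r))" "\<And>a b. P a \<Longrightarrow> P b \<Longrightarrow> P (a + b)"
    and "\<And>i a. P a \<Longrightarrow> P (econst (var i) * a)" "\<And>i a. P a \<Longrightarrow> P (egen i * a)"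
  shows "P \<omega>"
proof (induction \<omega> rule: ext_induct)
  case (econst p)
  then show ?case
    by (induction p rule: poly_induct) (use assms in \<open>auto simp: econst_add econst_mult\<close>)
qed (use assms in auto)

definition pdx :: "'n \<Rightarrow> 'n forms \<Rightarrow> 'n forms"
  where "pdx i \<omega> = Ext (\<lambda>S. pd i (ecoeff \<omega> S))"

lemma ecoeff_pdx [simp]: "ecoeff (pdx i \<omega>) S = pd i (ecoeff \<omega> S)"
  by (simp add: pdx_def)

lemma pdx_simps [simp]:
  "pdx i 0 = 0" "pdx i (a + b) = pdx i a + pdx i b" "pdx i (a - b) = pdx i a - pdx i b"
  "pdx i (- a) = - pdx i a" "pdx i (r *\<^sub>R a) = r *\<^sub>R pdx i a" "pdx i (econst p) = econst (pd i p)"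
  by (rule ext_eqI; simp add: econst_def)+

lemma pdx_1 [simp]: "pdx i (1 :: 'n::{finite,linorder} forms) = 0"
  using pdx_simps(6)[of i "1 :: 'n poly"] by simp

lemma pdx_sum: "pdx i (sum f A) = (\<Sum>x\<in>A. pdx i (f x))"
  by (induction A rule: infinite_finite_induct) auto

lemma pd_neg_one_power_mult [simp]: "pd i ((-1) ^ k * p) = (-1) ^ k * pd i p"
  by (cases "even k") auto

lemma pdx_egen_mult [simp]: "pdx i (egen j * a) = egen j * pdx i a" for a :: "'n::{finite,linorder} forms"
  by (rule ext_eqI) (simp add: ecoeff_egen_mult)

lemma pdx_egen [simp]: "pdx i (egen j) = (0 :: 'n::{finite,linorder} forms)"
  using pdx_egen_mult[of i j 1] by simp

lemma pdx_econst_mult: "pdx i (econst p * a) = econst (pd i p) * a + econst p * pdx i a"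
  for a :: "'n::{finite,linorder} forms"
  by (rule ext_eqI) (simp add: pd_mult)

lemma pdx_mult: "pdx i (a * b) = pdx i a * b + a * pdx i b" for a b :: "'n::{finite,linorder} forms"
  by (induction a rule: ext_induct) (simp_all add: distrib_right distrib_left pdx_econst_mult mult.assoc)

lemma pdx_commute: "pdx i (pdx j a) = pdx j (pdx i a)"
  by (rule ext_eqI) (simp add: pd_commute)

lemma pdx_contract: "pdx i (contract j a) = contract j (pdx i a)" for a :: "'n::{finite,linorder} forms"
  by (rule ext_eqI) (simp add: ecoeff_contract)

lemma pdx_par: "pdx i (par a) = par (pdx i a)" for a :: "'n::{finite,linorder} forms"
  by (rule ext_eqI) (simp add: par_def)

lemma hpart_pdx: "a \<in> hpart k \<Longrightarrow> pdx i a \<in> hpart k" for a :: "'n forms"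
  unfolding hpart_def mem_Collect_eq ecoeff_pdx
  by (intro allI impI) (drule spec, erule mp, erule contrapos_nn, simp)

text \<open>For homogeneous arguments this is the bracket of degree \<open>-1\<close> with
  \<open>[\<theta>\<^sub>j, x\<^sub>j] = 1\<close> in which the derivatives by
  \<open>\<theta>\<^sub>j\<close> act from the left. The factor \<open>par\<close> is the sign for
  moving the odd derivative past its own argument. This makes the bracket with a fixed homogeneous
  left argument a derivation in the right argument.\<close>

definition schouten :: "'n::{finite,linorder} forms \<Rightarrow> 'n forms \<Rightarrow> 'n forms"
  where "schouten a b = (\<Sum>j\<in>UNIV. par (contract j a) * pdx j b - pdx j a * contract j b)"

lemma schouten_simps [simp]:
  "schouten 0 b = 0" "schouten a 0 = 0" "schouten (a + a') b = schouten a b + schouten a' b"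
  "schouten a (b + b') = schouten a b + schouten a b'"
  "schouten (a - a') b = schouten a b - schouten a' b"
  "schouten a (b - b') = schouten a b - schouten a b'"
  "schouten (- a) b = - schouten a b" "schouten a (- b) = - schouten a b"
  "schouten (r *\<^sub>R a) b = r *\<^sub>R schouten a b" "schouten a (r *\<^sub>R b) = r *\<^sub>R schouten a b"
  by (simp_all add: schouten_def ring_distribs sum.distrib sum_subtractf sum_negf scaleR_sum_right
      scaleR_diff_right)

lemma schouten_sum_left: "schouten (sum f A) b = (\<Sum>x\<in>A. schouten (f x) b)"
  and schouten_sum_right: "schouten a (sum f A) = (\<Sum>x\<in>A. schouten a (f x))"
  by (induction A rule: infinite_finite_induct) auto

lemma schouten_const [simp]: "schouten a (econst (Poly_Mapping.single 0 r)) = 0" "schouten a 1 = 0"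
  by (simp_all add: schouten_def)

lemma schouten_var: "schouten a (econst (var i)) = par (contract i a)"
proof -
  have "schouten a (econst (var i)) = (\<Sum>j\<in>UNIV. if j = i then par (contract i a) else 0)"
    unfolding schouten_def by (rule sum.cong) (auto simp: pd_var)
  then show ?thesis by simp
qed

lemma schouten_egen: "schouten a (egen i) = - pdx i a"
proof -
  have "schouten a (egen i) = (\<Sum>j\<in>UNIV. if j = i then - pdx i a else 0)"
    unfolding schouten_def by (rule sum.cong) (auto simp: contract_egen)
  then show ?thesis by simp
qed

lemma hpart_schouten: "a \<in> hpart k \<Longrightarrow> b \<in> hpart l \<Longrightarrow> schouten a b \<in> hpart (k + l - 1)"
proof -
  assume ab: "a \<in> hpart k" "b \<in> hpart l"
  have "par (contract j a) * pdx j b \<in> hpart (k - 1 + l)" "pdx j a * contract j b \<in> hpart (k + (l - 1))" for j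
    by (intro hpart_mult par_hpart_mem hpart_contract hpart_pdx ab)+
  moreover have "k - 1 + l = k + l - 1" "k + (l - 1) = k + l - 1" by auto
  ultimately show ?thesis
    unfolding schouten_def by (intro hpart_sum hpart_diff) metis+
qed

lemma schouten_antisym:
  assumes "a \<in> hpart k" "b \<in> hpart l"
  shows "schouten a b = - (ksgn ((k - 1) * (l - 1)) *\<^sub>R schouten b a)"
proof -
  have 1: "par (contract j a) * pdx j b = ksgn ((k - 1) * (l - 1)) *\<^sub>R (pdx j b * contract j a)" for j
  proof -
    have "par (contract j a) * pdx j b = ksgn (k - 1) *\<^sub>R (contract j a * pdx j b)"
      by (simp add: par_hpart[OF hpart_contract[OF assms(1)]])
    also have "\<dots> = (ksgn (k - 1) * ksgn ((k - 1) * l)) *\<^sub>R (pdx j b * contract j a)"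
      by (subst graded_commute[OF hpart_contract[OF assms(1)] hpart_pdx[OF assms(2)]]) simp
    finally show ?thesis by (simp add: ksgn_def split: if_splits)
  qed
  have 2: "pdx j a * contract j b = ksgn ((k - 1) * (l - 1)) *\<^sub>R (par (contract j b) * pdx j a)" for j
  proof -
    have "pdx j a * contract j b = ksgn (k * (l - 1)) *\<^sub>R (contract j b * pdx j a)"
      by (rule graded_commute[OF hpart_pdx[OF assms(1)] hpart_contract[OF assms(2)]])
    also have "\<dots> = (ksgn (k * (l - 1)) * ksgn (l - 1)) *\<^sub>R (par (contract j b) * pdx j a)"
      by (simp add: par_hpart[OF hpart_contract[OF assms(2)]])
    finally show ?thesis by (simp add: ksgn_def split: if_splits)
  qed
  show ?thesis
    unfolding schouten_def
    by (simp add: 1 2 sum_subtractf scaleR_sum_right scaleR_diff_right)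
qed

lemma schouten_mult_right:
  assumes "a \<in> hpart k" "b \<in> hpart l"
  shows "schouten a (b * c) = schouten a b * c + ksgn ((k - 1) * l) *\<^sub>R (b * schouten a c)"
proof -
  have 1: "par (contract j a) * b = ksgn ((k - 1) * l) *\<^sub>R (b * par (contract j a))" for j
    by (rule graded_commute[OF par_hpart_mem[OF hpart_contract[OF assms(1)]] assms(2)])
  have 2: "pdx j a * par b = ksgn ((k - 1) * l) *\<^sub>R (b * pdx j a)" for j
  proof -
    have "pdx j a * par b = (ksgn l * ksgn (k * l)) *\<^sub>R (b * pdx j a)"
      by (simp add: par_hpart[OF assms(2)] graded_commute[OF hpart_pdx[OF assms(1)] assms(2)])
    then show ?thesis by (simp add: ksgn_def split: if_splits)
  qed
  define s where "s = ksgn ((k - 1) * l)"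
  have "par (contract j a) * pdx j (b * c) - pdx j a * contract j (b * c)
      = (par (contract j a) * pdx j b - pdx j a * contract j b) * c
        + s *\<^sub>R (b * (par (contract j a) * pdx j c - pdx j a * contract j c))" for j
    by (simp add: pdx_mult contract_mult ring_distribs scaleR_diff_right
        flip: mult.assoc) (simp add: 1 2 flip: s_def)
  then show ?thesis
    unfolding schouten_def s_def[symmetric] by (simp add: sum.distrib sum_distrib_left sum_distrib_right scaleR_sum_right)
qed

lemma schouten_mult_left:
  assumes "a \<in> hpart k" "b \<in> hpart l" "c \<in> hpart m"
  shows "schouten (a * b) c = a * schouten b c + ksgn (l * (m - 1)) *\<^sub>R (schouten a c * b)"
proof -
  have "schouten (a * b) c = - (ksgn ((k + l - 1) * (m - 1)) *\<^sub>R schouten c (a * b))"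
    by (rule schouten_antisym[OF hpart_mult[OF assms(1,2)] assms(3)])
  then show ?thesis
    unfolding schouten_mult_right[OF assms(3,1)] schouten_antisym[OF assms(3,1)] schouten_antisym[OF assms(3,2)]
    by (cases "even k"; cases "even l"; cases "even m") (simp_all add: ksgn_def)
qed

text \<open>Taking the derivative by \<open>\<theta>\<^sub>i\<close> is, up to a sign, bracketing with
  \<open>x\<^sub>i\<close>. This lemma and the next one say that the derivatives are derivations
  of the bracket, that is, the Jacobi identity with a generator as the last argument.\<close>

lemma par_contract_schouten:
  "par (contract i (schouten a b)) = schouten a (par (contract i b)) - schouten (par (contract i a)) (par b)"
proof -
  have "par (contract i (par (contract j a) * pdx j b - pdx j a * contract j b))
      = (par (contract j a) * pdx j (par (contract i b)) - pdx j a * contract j (par (contract i b)))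
        - (par (contract j (par (contract i a))) * pdx j (par b) - pdx j (par (contract i a)) * contract j (par b))" for j
    by (simp add: contract_mult par_contract pdx_contract pdx_par contract_anticommute[of j i])
  then show ?thesis
    unfolding schouten_def contract_sum par_sum sum_subtractf[symmetric] by (intro sum.cong refl)
qed

lemma pdx_schouten: "pdx i (schouten a b) = schouten (pdx i a) b + schouten a (pdx i b)"
  unfolding schouten_def
  by (simp add: pdx_sum pdx_mult pdx_contract pdx_par pdx_commute[of _ i] sum.distrib sum_subtractf)

text \<open>For fixed \<open>a\<close> and \<open>b\<close> the Jacobiator is a derivation in \<open>c\<close>, so it suffices to evaluate it on the
  generators, where it expresses that the partial derivatives are derivations of the bracket.\<close>

lemma schouten_jacobi:
  assumes "a \<in> hpart k" "b \<in> hpart l"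
  shows "schouten (schouten a b) c
    = schouten a (schouten b c) - ksgn ((k - 1) * (l - 1)) *\<^sub>R schouten b (schouten a c)"
proof -
  have ab: "schouten a b \<in> hpart (k + l - 1)" using hpart_schouten[OF assms] .
  have step: "schouten (schouten a b) (g * c)
      = schouten a (schouten b (g * c)) - ksgn ((k - 1) * (l - 1)) *\<^sub>R schouten b (schouten a (g * c))"
    if g: "g \<in> hpart m" and
      G: "schouten (schouten a b) g = schouten a (schouten b g) - ksgn ((k - 1) * (l - 1)) *\<^sub>R schouten b (schouten a g)"
     and C: "schouten (schouten a b) c = schouten a (schouten b c) - ksgn ((k - 1) * (l - 1)) *\<^sub>R schouten b (schouten a c)"
    for g c m
  proof -
    note ag = hpart_schouten[OF assms(1) g] and bg = hpart_schouten[OF assms(2) g]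
    show ?thesis
      unfolding schouten_mult_right[OF ab g] schouten_mult_right[OF assms(1) g] schouten_mult_right[OF assms(2) g]
        schouten_simps schouten_mult_right[OF assms(1) bg] schouten_mult_right[OF assms(2) ag]
        schouten_mult_right[OF assms(1) g] schouten_mult_right[OF assms(2) g] G C
      by (cases "even k"; cases "even l"; cases "even m")
        (simp_all add: ksgn_def ring_distribs)
  qed
  show ?thesis
  proof (induction c rule: forms_induct)
    case (var i c)
    have a': "par (contract i a) \<in> hpart (k - 1)" and b': "par b = ksgn l *\<^sub>R b"
      using assms by (auto intro: par_hpart_mem hpart_contract par_hpart)
    show ?case
    proof (rule step[OF hpart_econst _ var])
      show "schouten (schouten a b) (econst (var i)) = schouten a (schouten b (econst (var i)))
          - ksgn ((k - 1) * (l - 1)) *\<^sub>R schouten b (schouten a (econst (var i)))"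
        unfolding schouten_var par_contract_schouten schouten_antisym[OF a' assms(2)] b'
          schouten_simps
        by (cases "even k"; cases "even l") (simp_all add: ksgn_def)
    qed
  next
    case (egen i c)
    show ?case
    proof (rule step[OF hpart_egen _ egen])
      show "schouten (schouten a b) (egen i) = schouten a (schouten b (egen i))
          - ksgn ((k - 1) * (l - 1)) *\<^sub>R schouten b (schouten a (egen i))"
        unfolding schouten_egen pdx_schouten schouten_antisym[OF hpart_pdx[OF assms(1)] assms(2)]
        by simp
    qed
  qed (simp_all add: scaleR_add_right)
qed

section \<open>The Batalin-Vilkovisky operator on polyvectors\<close>

text \<open>The divergence of polyvectors on \<open>A\<close> with respect to the constant volume form. For
  \<open>A\<^sup>!\<close> the same operator is the divergence with respect to integration over
  the odd variables.\<close>

definition bvop :: "'n::{finite,linorder} forms \<Rightarrow> 'n forms"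
  where "bvop a = (\<Sum>j\<in>UNIV. pdx j (contract j a))"

lemma bvop_simps [simp]:
  "bvop 0 = 0" "bvop (a + b) = bvop a + bvop b" "bvop (a - b) = bvop a - bvop b" "bvop (- a) = - bvop a"
  "bvop (r *\<^sub>R a) = r *\<^sub>R bvop a"
  by (simp_all add: bvop_def sum.distrib sum_subtractf sum_negf scaleR_sum_right)

lemma bvop_sum: "bvop (sum f A) = (\<Sum>x\<in>A. bvop (f x))"
  by (induction A rule: infinite_finite_induct) auto

lemma hpart_bvop: "a \<in> hpart k \<Longrightarrow> bvop a \<in> hpart (k - 1)"
  unfolding bvop_def by (intro hpart_sum hpart_pdx hpart_contract)

lemma par_bvop: "par (bvop a) = - bvop (par a)"
  by (simp add: bvop_def par_sum par_contract sum_negf flip: pdx_par)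

lemma bvop_bvop [simp]: "bvop (bvop a) = 0"
proof -
  have "bvop (bvop a) = (\<Sum>i\<in>UNIV. \<Sum>j\<in>UNIV. pdx i (pdx j (contract i (contract j a))))"
    by (simp add: bvop_def pdx_sum contract_sum pdx_contract)
  also have "\<dots> = (\<Sum>j\<in>UNIV. \<Sum>i\<in>UNIV. pdx i (pdx j (contract i (contract j a))))"
    by (rule sum.swap)
  also have "\<dots> = - (\<Sum>j\<in>UNIV. \<Sum>i\<in>UNIV. pdx j (pdx i (contract j (contract i a))))"
    unfolding sum_negf[symmetric]
  proof (intro sum.cong refl)
    fix i j :: 'a
    show "pdx i (pdx j (contract i (contract j a))) = - pdx j (pdx i (contract j (contract i a)))"
      unfolding contract_anticommute[of i j] pdx_commute[of i j] by simp
  qed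
  also have "\<dots> = - bvop (bvop a)"
    by (simp add: bvop_def pdx_sum contract_sum pdx_contract)
  finally have "bvop (bvop a) = - bvop (bvop a)" .
  then have "(2 :: real) *\<^sub>R bvop (bvop a) = 0" by (simp add: scaleR_2 add_eq_0_iff)
  then show ?thesis by simp
qed

text \<open>The bracket measures the failure of the operator to be a derivation.\<close>

lemma bvop_mult: "bvop (a * b) = bvop a * b + par a * bvop b - schouten (par a) b"
  unfolding bvop_def schouten_def
  by (simp add: contract_mult pdx_mult pdx_par par_contract[of _ "par a", simplified] sum.distrib sum_subtractf sum_negf
      sum_distrib_left sum_distrib_right)

text \<open>This is \<open>bvop_bvop\<close> applied to a product and expanded by \<open>bvop_mult\<close>.\<close>

lemma bvop_schouten: "bvop (schouten a b) = schouten (bvop a) b - schouten (par a) (bvop b)"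
proof -
  have "0 = bvop (bvop (par a * b))" by simp
  then show ?thesis by (simp add: bvop_mult par_bvop algebra_simps)
qed

text \<open>The seven-term relation. It says that the bracket, as the defect of \<open>bvop\<close> from
  being a derivation, is itself a derivation.\<close>

lemma bvop_triple:
  assumes "a \<in> hpart k" "b \<in> hpart l"
  shows "bvop (a * b * c) = bvop (a * b) * c + ksgn k *\<^sub>R (a * bvop (b * c))
    + ksgn ((k - 1) * l) *\<^sub>R (b * bvop (a * c)) - bvop a * b * c
    - ksgn k *\<^sub>R (a * bvop b * c) - ksgn (k + l) *\<^sub>R (a * b * bvop c)"
proof -
  have p: "par a = ksgn k *\<^sub>R a" using assms(1) by (rule par_hpart)
  have s: "schouten a d = ksgn k *\<^sub>R (bvop a * d) + a * bvop d - ksgn k *\<^sub>R bvop (a * d)" for d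
    using bvop_mult[of a d] by (simp add: p ksgn_def split: if_splits)
  have ba: "b * a = ksgn (k * l) *\<^sub>R (a * b)"
    using graded_commute[OF assms(2,1)] by (simp add: mult.commute)
  have bda: "b * bvop a = ksgn ((k - 1) * l) *\<^sub>R (bvop a * b)"
    using graded_commute[OF assms(2) hpart_bvop[OF assms(1)]] by (simp add: mult.commute)
  have "bvop (a * (b * c)) = bvop a * (b * c) + ksgn k *\<^sub>R (a * bvop (b * c))
      - ksgn k *\<^sub>R (schouten a b * c + ksgn ((k - 1) * l) *\<^sub>R (b * schouten a c))"
    by (simp add: bvop_mult[of a] p schouten_mult_right[OF assms])
  then show ?thesis
    unfolding s
    by (simp add: ring_distribs ba bda scaleR_add_right scaleR_diff_right flip: mult.assoc)
      (simp add: ksgn_def split: if_splits)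
qed

section \<open>Recursion for the product and the coboundary of polyderivations\<close>

lemma nths_Cons_compl_0: "nths (f # fs) (- {0}) = fs"
  by (simp add: nths_Cons nths_all)

lemma nths_Cons_compl_Suc: "nths (f # fs) (- {Suc i}) = f # nths fs (- {i})"
  by (simp add: nths_Cons) (rule arg_cong[where f = "nths fs"], auto)

lemma nths_Cons_compl_0_Suc: "nths (f # fs) (- {0, Suc j}) = nths fs (- {j})"
  by (simp add: nths_Cons) (rule arg_cong[where f = "nths fs"], auto)

lemma nths_Cons_compl_Suc_Suc: "nths (f # fs) (- {Suc i, Suc j}) = f # nths fs (- {i, j})"
  by (simp add: nths_Cons) (rule arg_cong[where f = "nths fs"], auto)

lemma nths_singleton: "i < length fs \<Longrightarrow> nths fs {i} = [fs ! i]"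
proof (induction fs arbitrary: i)
  case (Cons f fs)
  have s: "{j. Suc j = Suc m} = {m}" for m by auto
  show ?case using Cons by (cases i) (auto simp: nths_Cons s)
qed simp

lemma ksgn_cong: "even (x - y) \<Longrightarrow> ksgn x = ksgn y"
  by (auto simp: ksgn_def)

lemma Pow_lessThan_Suc:
  "Pow {..<Suc n} = (\<lambda>I. insert 0 (Suc ` I)) ` Pow {..<n} \<union> (\<lambda>I. Suc ` I) ` Pow {..<n}"
proof
  show "Pow {..<Suc n} \<subseteq> (\<lambda>I. insert 0 (Suc ` I)) ` Pow {..<n} \<union> (\<lambda>I. Suc ` I) ` Pow {..<n}"
  proof
    fix J assume "J \<in> Pow {..<Suc n}"
    then have J: "J \<subseteq> {..<Suc n}" by simp
    define I where "I = {j. Suc j \<in> J}"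
    have "I \<in> Pow {..<n}" using J by (auto simp: I_def)
    moreover have "J = (if 0 \<in> J then insert 0 (Suc ` I) else Suc ` I)"
    proof (rule set_eqI)
      fix x show "x \<in> J \<longleftrightarrow> x \<in> (if 0 \<in> J then insert 0 (Suc ` I) else Suc ` I)"
        by (cases x) (auto simp: I_def)
    qed
    ultimately show "J \<in> (\<lambda>I. insert 0 (Suc ` I)) ` Pow {..<n} \<union> (\<lambda>I. Suc ` I) ` Pow {..<n}"
      by (cases "0 \<in> J") auto
  qed
qed auto

lemma wedge_Nil: "wedge act k l P Q [] = act (P []) (Q [])"
  by (simp add: wedge_def)

text \<open>Inserting an argument is a derivation of the wedge product: the first argument goes to either
  the left or the right factor. The degrees of the polyderivations change accordingly, and all
  signs of the shuffle formula are accounted for by the two signs in front.\<close>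

lemma wedge_Cons:
  assumes "homs (f # fs)"
  shows "wedge act k l P Q (f # fs)
    = ksgn (l * hdeg f) *\<^sub>R wedge act (k - hdeg f - 1) l (\<lambda>xs. P (f # xs)) Q fs
      + ksgn k *\<^sub>R wedge act k (l - hdeg f - 1) P (\<lambda>xs. Q (f # xs)) fs"
proof -
  define n where "n = length fs"
  define h where "h a = hdeg (fs ! a)" for a
  define S1 where "S1 I = (\<Sum>b\<in>I. \<Sum>a\<in>{..<b} - I. 1 + h a * h b)" for I
  define H where "H I = (\<Sum>a\<in>I. h a)" for I
  define F where "F J = (let q = int (length (f # fs)) - int (card J) in
       ksgn ((\<Sum>b\<in>J. \<Sum>a\<in>{..<b} - J. 1 + hdeg ((f # fs) ! a) * hdeg ((f # fs) ! b))
             + (\<Sum>a\<in>J. (q - l) * hdeg ((f # fs) ! a))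
             + q * (int (card J) - k))
       *\<^sub>R act (P (nths (f # fs) J)) (Q (nths (f # fs) (- J))))" for J
  \<comment> \<open>The shuffles are divided according to the side to which the first argument goes.\<close>
  have inj: "inj_on (\<lambda>I. insert 0 (Suc ` I)) (Pow {..<n})" "inj_on (\<lambda>I. Suc ` I) (Pow {..<n})"
    by (auto simp: inj_on_def dest!: arg_cong[of "insert 0 _" _ "\<lambda>J. {j. Suc j \<in> J}"])
  have "wedge act k l P Q (f # fs) = (\<Sum>J\<in>Pow {..<Suc n}. F J)"
    using assms by (simp add: wedge_def F_def n_def)
  also have "\<dots> = (\<Sum>J\<in>(\<lambda>I. insert 0 (Suc ` I)) ` Pow {..<n}. F J) + (\<Sum>J\<in>(\<lambda>I. Suc ` I) ` Pow {..<n}. F J)"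
    unfolding Pow_lessThan_Suc by (rule sum.union_disjoint) auto
  also have "\<dots> = (\<Sum>I\<in>Pow {..<n}. F (insert 0 (Suc ` I))) + (\<Sum>I\<in>Pow {..<n}. F (Suc ` I))"
    by (simp add: sum.reindex[OF inj(1)] sum.reindex[OF inj(2)])
  also have "(\<Sum>I\<in>Pow {..<n}. F (insert 0 (Suc ` I)))
      = ksgn (l * hdeg f) *\<^sub>R wedge act (k - hdeg f - 1) l (\<lambda>xs. P (f # xs)) Q fs"
  proof -
    have "F (insert 0 (Suc ` I)) = ksgn (l * hdeg f) *\<^sub>R
       (let q = int (length fs) - int (card I) in
       ksgn ((\<Sum>b\<in>I. \<Sum>a\<in>{..<b} - I. 1 + hdeg (fs ! a) * hdeg (fs ! b))
             + (\<Sum>a\<in>I. (q - l) * hdeg (fs ! a))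
             + q * (int (card I) - (k - hdeg f - 1)))
       *\<^sub>R act (P (f # nths fs I)) (Q (nths fs (- I))))" if "I \<in> Pow {..<n}" for I
    proof -
      have fin: "finite I" using that by (auto intro: finite_subset)
      have c: "card (insert 0 (Suc ` I)) = Suc (card I)" using fin by (simp add: card_image)
      have d: "{..<Suc b} - insert 0 (Suc ` I) = Suc ` ({..<b} - I)" for b
      proof (rule set_eqI)
        fix x show "x \<in> {..<Suc b} - insert 0 (Suc ` I) \<longleftrightarrow> x \<in> Suc ` ({..<b} - I)"
          by (cases x) auto
      qed
      have s: "(\<Sum>b\<in>insert 0 (Suc ` I). \<Sum>a\<in>{..<b} - insert 0 (Suc ` I). 1 + hdeg ((f # fs) ! a) * hdeg ((f # fs) ! b)) = S1 I"
        using fin by (simp add: sum.reindex d S1_def h_def)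
      have t: "(\<Sum>a\<in>insert 0 (Suc ` I). (q - l) * hdeg ((f # fs) ! a)) = (q - l) * hdeg f + (q - l) * H I" for q
        using fin by (simp add: sum.reindex H_def h_def sum_distrib_left)
      have n1: "nths (f # fs) (insert 0 (Suc ` I)) = f # nths fs I"
        by (simp add: nths_Cons) (rule arg_cong[where f = "nths fs"], auto)
      have n2: "nths (f # fs) (- insert 0 (Suc ` I)) = nths fs (- I)"
        by (simp add: nths_Cons) (rule arg_cong[where f = "nths fs"], auto)
      define q where "q = int (length fs) - int (card I)"
      have "ksgn (S1 I + ((q - l) * hdeg f + (q - l) * H I) + q * (int (Suc (card I)) - k))
          = ksgn (l * hdeg f) * ksgn (S1 I + (q - l) * H I + q * (int (card I) - (k - hdeg f - 1)))"
        unfolding ksgn_add[symmetric] by (rule ksgn_cong) (simp add: algebra_simps)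
      then show ?thesis
        unfolding F_def c s t n1 n2 Let_def
        by (simp add: q_def S1_def h_def H_def sum_distrib_left)
    qed
    then show ?thesis
      using assms by (simp add: wedge_def n_def scaleR_sum_right)
  qed
  also have "(\<Sum>I\<in>Pow {..<n}. F (Suc ` I)) = ksgn k *\<^sub>R wedge act k (l - hdeg f - 1) P (\<lambda>xs. Q (f # xs)) fs"
  proof -
    have "F (Suc ` I) = ksgn k *\<^sub>R
       (let q = int (length fs) - int (card I) in
       ksgn ((\<Sum>b\<in>I. \<Sum>a\<in>{..<b} - I. 1 + hdeg (fs ! a) * hdeg (fs ! b))
             + (\<Sum>a\<in>I. (q - (l - hdeg f - 1)) * hdeg (fs ! a))
             + q * (int (card I) - k))
       *\<^sub>R act (P (nths fs I)) (Q (f # nths fs (- I))))" if "I \<in> Pow {..<n}" for I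
    proof -
      have fin: "finite I" using that by (auto intro: finite_subset)
      have c: "card (Suc ` I) = card I" by (simp add: card_image)
      have d: "{..<Suc b} - Suc ` I = insert 0 (Suc ` ({..<b} - I))" for b
      proof (rule set_eqI)
        fix x show "x \<in> {..<Suc b} - Suc ` I \<longleftrightarrow> x \<in> insert 0 (Suc ` ({..<b} - I))"
          by (cases x) auto
      qed
      have s: "(\<Sum>b\<in>Suc ` I. \<Sum>a\<in>{..<b} - Suc ` I. 1 + hdeg ((f # fs) ! a) * hdeg ((f # fs) ! b))
          = int (card I) + hdeg f * H I + S1 I"
        using fin by (simp add: sum.reindex d S1_def h_def H_def sum.distrib sum_distrib_left card_image)
      have t: "(\<Sum>a\<in>Suc ` I. (q - l) * hdeg ((f # fs) ! a)) = (q - l) * H I" for q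
        by (simp add: sum.reindex H_def h_def sum_distrib_left)
      have n1: "nths (f # fs) (Suc ` I) = nths fs I"
        by (simp add: nths_Cons) (rule arg_cong[where f = "nths fs"], auto)
      have n2: "nths (f # fs) (- (Suc ` I)) = f # nths fs (- I)"
        by (simp add: nths_Cons) (rule arg_cong[where f = "nths fs"], auto)
      define q where "q = int (length fs) - int (card I)"
      have "ksgn (int (card I) + hdeg f * H I + S1 I + (q + 1 - l) * H I + (q + 1) * (int (card I) - k))
          = ksgn k * ksgn (S1 I + (q - (l - hdeg f - 1)) * H I + q * (int (card I) - k))"
        unfolding ksgn_add[symmetric] by (rule ksgn_cong) (simp add: algebra_simps)
      moreover have L: "int (length (f # fs)) - int (card I) = q + 1" by (simp add: q_def)
      ultimately show ?thesis
        unfolding F_def Let_def c s t n1 n2 L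
        by (simp only: scaleR_scaleR q_def S1_def h_def H_def sum_distrib_left)
    qed
    then show ?thesis
      using assms by (simp add: wedge_def n_def scaleR_sum_right)
  qed
  finally show ?thesis .
qed

lemma coboundary_Nil [simp]: "coboundary br mbr k P [] = 0"
  by (simp add: coboundary_def)

lemma coboundary_nonhom: "\<not> homs fs \<Longrightarrow> coboundary br mbr k P fs = 0"
  by (simp add: coboundary_def)

text \<open>The part of the coboundary in which the first argument takes part is a Lie derivative; the
  remaining part is, up to sign, the coboundary of the polyderivation into which the first
  argument has been inserted. This is the Cartan formula, with the Lie derivative written out.\<close>

lemma coboundary_Cons:
  assumes homs: "homs (f # fs)"
    and skew: "\<And>x xs. P (x # f # xs) = - (ksgn (hdeg f * hdeg x) *\<^sub>R P (f # x # xs))"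
    and zero: "\<And>xs. P (f # 0 # xs) = 0"
    and br: "\<And>x y. homogeneous x \<Longrightarrow> homogeneous y \<Longrightarrow> br x y = 0 \<or> hdeg (br x y) = hdeg x + hdeg y"
  shows "coboundary br mbr k P (f # fs)
    = ksgn (hdeg f * (int (length fs) - k)) *\<^sub>R mbr f (P fs)
      - (\<Sum>j<length fs. ksgn (int j + hdeg (fs ! j) * degs (take j fs)) *\<^sub>R P (br f (fs ! j) # nths fs (- {j})))
      - coboundary br mbr (k - hdeg f - 1) (\<lambda>xs. P (f # xs)) fs"
proof -
  let ?n = "length fs"
  have 1: "(\<Sum>i<length (f # fs).
       ksgn (int i + hdeg ((f # fs) ! i) * (int (length (f # fs)) - 1 - k + degs (take i (f # fs))))
       *\<^sub>R mbr ((f # fs) ! i) (P (nths (f # fs) (- {i}))))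
    = ksgn (hdeg f * (int ?n - k)) *\<^sub>R mbr f (P fs)
     - (\<Sum>i<?n. ksgn (int i + hdeg (fs ! i) * (int ?n - 1 - (k - hdeg f - 1) + degs (take i fs)))
       *\<^sub>R mbr (fs ! i) (P (f # nths fs (- {i}))))" (is "?l = _ - ?r")
  proof -
    have "ksgn (int (Suc i) + hdeg (fs ! i) * (int ?n - k + (hdeg f + degs (take i fs))))
       = - ksgn (int i + hdeg (fs ! i) * (int ?n - 1 - (k - hdeg f - 1) + degs (take i fs)))" for i
      by (auto simp: ksgn_def)
    then show ?thesis
      unfolding list.size(4) add_Suc_right add_0_right One_nat_def sum.lessThan_Suc_shift nths_Cons_compl_0 nths_Cons_compl_Suc
      by (simp add: sum_negf)
  qed
  have 2: "(\<Sum>j<length (f # fs). \<Sum>i<j.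
       ksgn (int (i + j) + hdeg ((f # fs) ! i) * degs (take i (f # fs))
             + hdeg ((f # fs) ! j) * (degs (take j (f # fs)) + hdeg ((f # fs) ! i)))
       *\<^sub>R P (br ((f # fs) ! i) ((f # fs) ! j) # nths (f # fs) (- {i, j})))
    = - (\<Sum>j<?n. ksgn (int j + hdeg (fs ! j) * degs (take j fs)) *\<^sub>R P (br f (fs ! j) # nths fs (- {j})))
      - (\<Sum>j<?n. \<Sum>i<j.
       ksgn (int (i + j) + hdeg (fs ! i) * degs (take i fs)
             + hdeg (fs ! j) * (degs (take j fs) + hdeg (fs ! i)))
       *\<^sub>R P (f # br (fs ! i) (fs ! j) # nths fs (- {i, j})))"
  proof -
    let ?G = "\<lambda>i j. ksgn (int (i + j) + hdeg ((f # fs) ! i) * degs (take i (f # fs))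
             + hdeg ((f # fs) ! j) * (degs (take j (f # fs)) + hdeg ((f # fs) ! i)))
       *\<^sub>R P (br ((f # fs) ! i) ((f # fs) ! j) # nths (f # fs) (- {i, j}))"
    have a: "?G 0 (Suc j) = - (ksgn (int j + hdeg (fs ! j) * degs (take j fs)) *\<^sub>R P (br f (fs ! j) # nths fs (- {j})))" for j
    proof -
      have "ksgn (int (0 + Suc j) + hdeg ((f # fs) ! 0) * degs (take 0 (f # fs))
             + hdeg ((f # fs) ! Suc j) * (degs (take (Suc j) (f # fs)) + hdeg ((f # fs) ! 0)))
          = - ksgn (int j + hdeg (fs ! j) * degs (take j fs))"
        by (auto simp: ksgn_def)
      then show ?thesis
        by (simp only: nth_Cons_0 nth_Cons_Suc nths_Cons_compl_0_Suc) simp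
    qed
    have b: "?G (Suc i) (Suc j)
      = - (ksgn (int (i + j) + hdeg (fs ! i) * degs (take i fs)
             + hdeg (fs ! j) * (degs (take j fs) + hdeg (fs ! i)))
       *\<^sub>R P (f # br (fs ! i) (fs ! j) # nths fs (- {i, j})))" if "i < j" "j < ?n" for i j
    proof (cases "br (fs ! i) (fs ! j) = 0")
      case True
      then show ?thesis by (simp add: skew[of 0] zero nths_Cons_compl_Suc_Suc)
    next
      case False
      have "homogeneous (fs ! i)" "homogeneous (fs ! j)" using homs that by auto
      with False br have h: "hdeg (br (fs ! i) (fs ! j)) = hdeg (fs ! i) + hdeg (fs ! j)" by blast
      have "ksgn (int (Suc i + Suc j) + hdeg ((f # fs) ! Suc i) * degs (take (Suc i) (f # fs))
             + hdeg ((f # fs) ! Suc j) * (degs (take (Suc j) (f # fs)) + hdeg ((f # fs) ! Suc i)))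
             * ksgn (hdeg f * (hdeg (fs ! i) + hdeg (fs ! j)))
           = ksgn (int (i + j) + hdeg (fs ! i) * degs (take i fs)
             + hdeg (fs ! j) * (degs (take j fs) + hdeg (fs ! i)))"
        unfolding ksgn_add[symmetric] by (rule ksgn_cong) (simp add: algebra_simps)
      then show ?thesis
        by (simp only: nth_Cons_Suc nths_Cons_compl_Suc_Suc skew h scaleR_minus_right scaleR_scaleR)
    qed
    have "(\<Sum>j<Suc ?n. \<Sum>i<j. ?G i j) = (\<Sum>j<?n. ?G 0 (Suc j) + (\<Sum>i<j. ?G (Suc i) (Suc j)))"
      by (simp only: sum.lessThan_Suc_shift) (simp only: lessThan_0 sum.empty add_0_left)
    also have "\<dots> = (\<Sum>j<?n. - (ksgn (int j + hdeg (fs ! j) * degs (take j fs)) *\<^sub>R P (br f (fs ! j) # nths fs (- {j})))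
        + (\<Sum>i<j. - (ksgn (int (i + j) + hdeg (fs ! i) * degs (take i fs)
             + hdeg (fs ! j) * (degs (take j fs) + hdeg (fs ! i)))
       *\<^sub>R P (f # br (fs ! i) (fs ! j) # nths fs (- {i, j})))))"
      by (intro sum.cong refl arg_cong2[where f = "(+)"] a b) auto
    also have "\<dots> = - (\<Sum>j<?n. ksgn (int j + hdeg (fs ! j) * degs (take j fs)) *\<^sub>R P (br f (fs ! j) # nths fs (- {j})))
      - (\<Sum>j<?n. \<Sum>i<j.
       ksgn (int (i + j) + hdeg (fs ! i) * degs (take i fs)
             + hdeg (fs ! j) * (degs (take j fs) + hdeg (fs ! i)))
       *\<^sub>R P (f # br (fs ! i) (fs ! j) # nths fs (- {i, j})))"
      by (simp add: sum_subtractf sum_negf)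
    finally show ?thesis
      by (simp only: list.size(4) add_Suc_right add_0_right One_nat_def)
  qed
  show ?thesis
    unfolding coboundary_def using homs by (simp only: 1 2) simp
qed

section \<open>Polyderivations as derived brackets\<close>

lemma polyder_skew:
  "P \<in> polyder act k \<Longrightarrow> P (fs @ g # f # gs) = - (ksgn (hdeg f * hdeg g) *\<^sub>R P (fs @ f # g # gs))"
  unfolding polyder_def mem_Collect_eq by (elim conjE) blast

text \<open>The data for reading elements of \<open>V\<close> as polyderivations of an algebra
  \<open>'b\<close>. The algebra is embedded in \<open>V\<close> as a subalgebra on which the
  Schouten bracket vanishes, and \<open>pr\<close> sets the complementary variables to zero: for
  \<open>A\<close> these are the \<open>\<theta>\<^sub>j\<close>, for \<open>A\<^sup>!\<close> the
  \<open>x\<^sub>j\<close>. The sign \<open>eps\<close> is \<open>-1\<close> for \<open>A\<close>,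
  where it makes the insertion of \<open>x\<^sub>j\<close> equal to the derivative by
  \<open>\<theta>\<^sub>j\<close>, and \<open>1\<close> for \<open>A\<^sup>!\<close>, where it
  makes the divergence correspond to \<open>bvop\<close> without a sign.

  The assumption \<open>nilpotent\<close> is the bound on the number of arguments in the
  definition of polyderivations, and \<open>gen_induct\<close> is what is needed to determine a
  polyderivation by its values on generators.\<close>

locale polyvector_side =
  fixes eps :: real and emb :: "'b::{graded,ring_1} \<Rightarrow> 'n::{finite,linorder} forms"
    and pr :: "'n forms \<Rightarrow> 'b" and gen :: "'n \<Rightarrow> 'b"
  assumes eps: "eps * eps = 1"
    and linear_emb: "linear emb" and linear_pr: "linear pr"
    and emb_mult: "emb (f * g) = emb f * emb g" and emb_1: "emb 1 = 1"
    and pr_mult: "pr (a * b) = pr a * pr b"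
    and pr_emb: "pr (emb f) = f"
    and gr_iff: "f \<in> gr d \<longleftrightarrow> emb f \<in> hpart (- d)"
    and pr_hpart: "a \<in> hpart k \<Longrightarrow> emb (pr a) \<in> hpart k"
    and emb_schouten: "schouten (emb f) (emb g) = 0"
    and nilpotent: "a \<in> hpart k \<Longrightarrow>
      \<exists>N. \<forall>fs. N < length fs \<longrightarrow> pr (fold (\<lambda>f a. eps *\<^sub>R schouten (par a) (emb f)) fs a) = 0"
    and gen_hom: "homogeneous (gen j)"
    and gen_induct: "(\<And>r. Q (r *\<^sub>R 1)) \<Longrightarrow> (\<And>j a. homogeneous a \<Longrightarrow> Q a \<Longrightarrow> Q (gen j * a)) \<Longrightarrow>
      (\<And>d a b. a \<in> gr d \<Longrightarrow> b \<in> gr d \<Longrightarrow> Q a \<Longrightarrow> Q b \<Longrightarrow> Q (a + b)) \<Longrightarrow> homogeneous f \<Longrightarrow> Q f"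
begin

lemma eps_simps [simp]: "eps * eps = 1" "eps *\<^sub>R eps *\<^sub>R (x :: 'x::real_vector) = x" "eps * (eps * y) = y"
  using eps by (simp_all flip: mult.assoc)

lemmas emb_simps [simp] = linear_0[OF linear_emb] linear_add[OF linear_emb] linear_diff[OF linear_emb]
  linear_neg[OF linear_emb] linear_scale[OF linear_emb] emb_mult emb_1
lemmas pr_simps [simp] = linear_0[OF linear_pr] linear_add[OF linear_pr] linear_diff[OF linear_pr]
  linear_neg[OF linear_pr] linear_scale[OF linear_pr] pr_mult pr_emb

lemma emb_eq_iff [simp]: "emb f = emb g \<longleftrightarrow> f = g"
  by (metis pr_emb)

lemma gr_0 [simp]: "(0 :: 'b) \<in> gr d"
  by (simp add: gr_iff)

lemma gr_add: "f \<in> gr d \<Longrightarrow> g \<in> gr d \<Longrightarrow> (f :: 'b) + g \<in> gr d"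
  by (simp add: gr_iff hpart_add)

lemma gr_scaleR: "f \<in> gr d \<Longrightarrow> r *\<^sub>R (f :: 'b) \<in> gr d"
  by (simp add: gr_iff hpart_scaleR)

lemma gr_mult: "f \<in> gr d \<Longrightarrow> g \<in> gr e \<Longrightarrow> (f :: 'b) * g \<in> gr (d + e)"
  unfolding gr_iff using hpart_mult[of "emb f" "- d" "emb g" "- e"] by (simp add: algebra_simps)

lemma gr_1 [simp]: "(1 :: 'b) \<in> gr 0"
  by (simp add: gr_iff)

lemma gr_unique: "f \<in> gr d \<Longrightarrow> f \<in> gr e \<Longrightarrow> (f :: 'b) \<noteq> 0 \<Longrightarrow> d = e"
  unfolding gr_iff by (metis emb_eq_iff emb_simps(1) hpart_unique neg_equal_iff_equal)

lemma hdeg_eq: "f \<in> gr d \<Longrightarrow> (f :: 'b) \<noteq> 0 \<Longrightarrow> hdeg f = d"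
  unfolding hdeg_def using gr_unique by (auto intro!: the_equality)

lemma hdeg_0 [simp]: "hdeg (0 :: 'b) = 0"
  by (simp add: hdeg_def)

lemma gr_hdeg: "homogeneous (f :: 'b) \<Longrightarrow> f \<in> gr (hdeg f)"
  by (cases "f = 0") (auto simp: homogeneous_def hdeg_eq)

lemma homogeneousI: "(f :: 'b) \<in> gr d \<Longrightarrow> homogeneous f"
  by (auto simp: homogeneous_def)

lemma homogeneous_0 [simp]: "homogeneous (0 :: 'b)"
  by (rule homogeneousI[of _ 0]) simp

lemma homogeneous_mult: "homogeneous f \<Longrightarrow> homogeneous g \<Longrightarrow> homogeneous (f * g :: 'b)"
  using gr_mult gr_hdeg homogeneousI by blast

lemma homogeneous_scaleR: "homogeneous f \<Longrightarrow> homogeneous (r *\<^sub>R f :: 'b)"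
  using gr_scaleR gr_hdeg homogeneousI by blast

lemma pr_gr: "a \<in> hpart k \<Longrightarrow> pr a \<in> gr (- k)"
  by (simp add: gr_iff pr_hpart)

lemma emb_hpart: "f \<in> gr d \<Longrightarrow> emb f \<in> hpart (- d)"
  by (simp add: gr_iff)

lemma gr_commute: "f \<in> gr d \<Longrightarrow> g \<in> gr e \<Longrightarrow> f * g = ksgn (d * e) *\<^sub>R (g * f :: 'b)"
  using graded_commute[OF emb_hpart emb_hpart, of f d g e]
  by (metis emb_eq_iff emb_mult emb_simps(5) minus_mult_minus)

subsection \<open>Insertion of functions into a polyvector\<close>

text \<open>Inserting \<open>f\<close> as the first argument of a polyvector is a derived bracket. The
  automorphism \<open>par\<close> supplies the sign that turns the symmetry of iterated brackets
  into the Koszul rule for skew-symmetric maps (\<open>ins_swap\<close>).\<close>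

definition ins :: "'b \<Rightarrow> 'n forms \<Rightarrow> 'n forms"
  where "ins f a = eps *\<^sub>R schouten (par a) (emb f)"

lemma ins_simps [simp]:
  "ins f 0 = 0" "ins f (a + b) = ins f a + ins f b" "ins f (a - b) = ins f a - ins f b"
  "ins f (- a) = - ins f a" "ins f (r *\<^sub>R a) = r *\<^sub>R ins f a"
  "ins 0 a = 0" "ins (f + g) a = ins f a + ins g a" "ins (r *\<^sub>R f) a = r *\<^sub>R ins f a"
  by (simp_all add: ins_def scaleR_add_right scaleR_diff_right)

lemma ins_eq: "a \<in> hpart k \<Longrightarrow> ins f a = (eps * ksgn k) *\<^sub>R schouten a (emb f)"
  by (simp add: ins_def par_hpart)

lemma ins_hpart: "a \<in> hpart k \<Longrightarrow> f \<in> gr d \<Longrightarrow> ins f a \<in> hpart (k - d - 1)"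
  using hpart_schouten[OF par_hpart_mem emb_hpart, of a k f d] by (simp add: ins_def hpart_scaleR)

lemma ins_swap:
  assumes "a \<in> hpart k" "f \<in> gr d" "g \<in> gr e"
  shows "ins g (ins f a) = - (ksgn (d * e) *\<^sub>R ins f (ins g a))"
proof -
  let ?f = "emb f" and ?g = "emb g"
  have f: "?f \<in> hpart (- d)" and g: "?g \<in> hpart (- e)" using assms emb_hpart by auto
  have j: "schouten (schouten a ?f) ?g = - (ksgn ((k - 1) * (- d - 1)) *\<^sub>R schouten ?f (schouten a ?g))"
    unfolding schouten_jacobi[OF assms(1) f] by (simp add: emb_schouten)
  have s: "schouten ?f (schouten a ?g) = - (ksgn ((- d - 1) * (k + - e - 1 - 1)) *\<^sub>R schouten (schouten a ?g) ?f)"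
    by (rule schouten_antisym[OF f hpart_schouten[OF assms(1) g]])
  show ?thesis
    unfolding ins_eq[OF assms(1)] ins_eq[OF hpart_scaleR[OF hpart_schouten[OF assms(1) f]]]
      ins_eq[OF hpart_scaleR[OF hpart_schouten[OF assms(1) g]]] schouten_simps j s
    by (cases "even k"; cases "even d"; cases "even e") (simp_all add: ksgn_def)
qed

lemma ins_emb: "homogeneous f \<Longrightarrow> ins g (emb f) = 0"
  by (simp add: ins_eq[OF emb_hpart[OF gr_hdeg]] emb_schouten)

lemma ins_mult:
  assumes "a \<in> hpart k" "b \<in> hpart l" "f \<in> gr d"
  shows "ins f (a * b) = ksgn (l * d) *\<^sub>R (ins f a * b) + ksgn k *\<^sub>R (a * ins f b)"
  unfolding ins_eq[OF assms(1)] ins_eq[OF assms(2)] ins_eq[OF hpart_mult[OF assms(1,2)]]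
    schouten_mult_left[OF assms(1,2) emb_hpart[OF assms(3)]]
  by (cases "even k"; cases "even l"; cases "even d") (simp_all add: ksgn_def scaleR_add_right scaleR_diff_right)

lemma ins_mult_emb:
  assumes "a \<in> hpart k" "f \<in> gr d" "h \<in> gr e"
  shows "ins h (a * emb f) = ksgn (d * e) *\<^sub>R (ins h a * emb f)"
  using ins_mult[OF assms(1) emb_hpart[OF assms(2)] assms(3)] ins_emb[OF homogeneousI[OF assms(2)]] by simp

lemma ins_prod:
  assumes "a \<in> hpart k" "f \<in> gr d" "g \<in> gr e"
  shows "ins (f * g) a = ksgn (d * e) *\<^sub>R (ins g a * emb f) + ins f a * emb g"
proof -
  have c: "emb f * schouten a (emb g) = ksgn (d * (k - e - 1)) *\<^sub>R (schouten a (emb g) * emb f)"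
    using graded_commute[OF emb_hpart[OF assms(2)] hpart_schouten[OF assms(1) emb_hpart[OF assms(3)]]]
    by (simp add: ksgn_def)
  show ?thesis
    unfolding ins_eq[OF assms(1)] emb_mult schouten_mult_right[OF assms(1) emb_hpart[OF assms(2)]] c
    by (cases "even k"; cases "even d"; cases "even e") (simp_all add: ksgn_def scaleR_add_right scaleR_diff_right)
qed

lemma fold_ins_simps [simp]:
  "fold ins fs 0 = 0" "fold ins fs (a + b) = fold ins fs a + fold ins fs b"
  "fold ins fs (a - b) = fold ins fs a - fold ins fs b"
  "fold ins fs (- a) = - fold ins fs a" "fold ins fs (r *\<^sub>R a) = r *\<^sub>R fold ins fs a"
  by (induction fs arbitrary: a b) simp_all

lemma fold_ins_hpart: "a \<in> hpart k \<Longrightarrow> homs fs \<Longrightarrow> fold ins fs a \<in> hpart (k - degs fs - int (length fs))"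
proof (induction fs arbitrary: a k)
  case (Cons f fs)
  have "fold ins fs (ins f a) \<in> hpart (k - hdeg f - 1 - degs fs - int (length fs))"
    using Cons by (intro Cons.IH ins_hpart gr_hdeg) auto
  then show ?case by (simp add: algebra_simps)
qed simp

lemma fold_ins_mult_emb:
  assumes "a \<in> hpart k" "f \<in> gr d" "homs hs"
  shows "fold ins hs (a * emb f) = ksgn (d * degs hs) *\<^sub>R (fold ins hs a * emb f)"
  using assms(1,3)
proof (induction hs arbitrary: a k)
  case (Cons h hs)
  then have h: "h \<in> gr (hdeg h)" by (simp add: gr_hdeg)
  have "fold ins hs (ins h a * emb f) = ksgn (d * degs hs) *\<^sub>R (fold ins hs (ins h a) * emb f)"
    by (rule Cons.IH[OF ins_hpart[OF Cons.prems(1) h]]) (use Cons.prems(2) in auto)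
  then show ?case
    using Cons.prems by (simp add: ins_mult_emb[OF _ assms(2) h] ksgn_add distrib_left)
qed simp

definition ev :: "'n forms \<Rightarrow> 'b list \<Rightarrow> 'b"
  where "ev a fs = (if homs fs then pr (fold ins fs a) else 0)"

lemma ev_simps [simp]: "ev 0 = 0" "ev (a + b) = ev a + ev b" "ev (a - b) = ev a - ev b" "ev (- a) = - ev a"
  "ev (r *\<^sub>R a) = r *\<^sub>R ev a"
  by (auto simp: fun_eq_iff ev_def scaleR_fun_def)

lemma ev_Cons: "homogeneous f \<Longrightarrow> ev a (f # fs) = ev (ins f a) fs"
  by (simp add: ev_def)

lemma ev_Nil: "ev a [] = pr a"
  by (simp add: ev_def)

lemma ev_append: "homs fs \<Longrightarrow> ev a (fs @ gs) = ev (fold ins fs a) gs"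
  by (auto simp: ev_def)

lemma ev_nonhom: "\<not> homs fs \<Longrightarrow> ev a fs = 0"
  by (simp only: ev_def if_False)

lemma ev_gr:
  assumes "a \<in> hpart k" "homs fs"
  shows "ev a fs \<in> gr (int (length fs) - k + degs fs)"
  using pr_gr[OF fold_ins_hpart[OF assms]] assms(2) by (simp add: ev_def algebra_simps)

text \<open>Only the first argument needs to be considered here: the general Leibniz rule follows by
  inserting the preceding arguments first.\<close>

lemma ev_leibniz:
  assumes a: "a \<in> hpart k" and f: "f \<in> gr d" and g: "g \<in> gr e" and gs: "homs gs"
  shows "ev a ((f * g) # gs) =
      ksgn (d * (int (length gs) + 1 - k)) *\<^sub>R (f * ev a (g # gs))
      + ksgn (e * (int (length gs) + 1 - k + d)) *\<^sub>R (g * ev a (f # gs))"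
proof -
  have h: "homogeneous f" "homogeneous g" "homogeneous (f * g)"
    using f g homogeneousI homogeneous_mult by blast+
  let ?F = "\<lambda>x. pr (fold ins gs (ins x a))"
  have F: "?F x \<in> gr (- (k - c - 1 - degs gs - int (length gs)))" if "x \<in> gr c" for x c
    by (intro pr_gr fold_ins_hpart ins_hpart a that gs)
  have "fold ins gs (ins (f * g) a)
    = ksgn (d * e) *\<^sub>R ksgn (d * degs gs) *\<^sub>R (fold ins gs (ins g a) * emb f)
      + ksgn (e * degs gs) *\<^sub>R (fold ins gs (ins f a) * emb g)"
    unfolding ins_prod[OF a f g]
    by (simp only: fold_ins_simps fold_ins_mult_emb[OF ins_hpart[OF a g] f gs]
        fold_ins_mult_emb[OF ins_hpart[OF a f] g gs])
  then have "?F (f * g) = ksgn (d * e) *\<^sub>R ksgn (d * degs gs) *\<^sub>R (?F g * f) + ksgn (e * degs gs) *\<^sub>R (?F f * g)"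
    by simp
  also have "?F g * f = ksgn (- (k - e - 1 - degs gs - int (length gs)) * d) *\<^sub>R (f * ?F g)"
    by (rule gr_commute[OF F[OF g] f])
  also have "?F f * g = ksgn (- (k - d - 1 - degs gs - int (length gs)) * e) *\<^sub>R (g * ?F f)"
    by (rule gr_commute[OF F[OF f] g])
  also have "ksgn (d * e) *\<^sub>R ksgn (d * degs gs) *\<^sub>R ksgn (- (k - e - 1 - degs gs - int (length gs)) * d) *\<^sub>R (f * ?F g)
      = ksgn (d * (int (length gs) + 1 - k)) *\<^sub>R (f * ?F g)"
    unfolding scaleR_scaleR ksgn_add[symmetric] mult.assoc
    by (rule arg_cong2[where f = scaleR, OF ksgn_cong]) (auto simp: algebra_simps)
  also have "ksgn (e * degs gs) *\<^sub>R ksgn (- (k - d - 1 - degs gs - int (length gs)) * e) *\<^sub>R (g * ?F f)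
      = ksgn (e * (int (length gs) + 1 - k + d)) *\<^sub>R (g * ?F f)"
    unfolding scaleR_scaleR ksgn_add[symmetric] mult.assoc
    by (rule arg_cong2[where f = scaleR, OF ksgn_cong]) (auto simp: algebra_simps)
  finally show ?thesis
    using h gs by (simp add: ev_def)
qed

lemma ev_polyder:
  assumes a: "a \<in> hpart k"
  shows "ev a \<in> polyvectors k"
proof -
  have add: "ev a (fs @ (f + g) # gs) = ev a (fs @ f # gs) + ev a (fs @ g # gs)"
    if "f \<in> gr d" "g \<in> gr d" for fs gs d f g
    using homogeneousI[OF that(1)] homogeneousI[OF that(2)] homogeneousI[OF gr_add[OF that]]
    by (auto simp: ev_def)
  have scale: "ev a (fs @ (r *\<^sub>R f) # gs) = r *\<^sub>R ev a (fs @ f # gs)" if "homogeneous f" for fs gs r f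
    using that homogeneous_scaleR[OF that] by (auto simp: ev_def)
  have swap: "ev a (fs @ g # f # gs) = - (ksgn (hdeg f * hdeg g) *\<^sub>R ev a (fs @ f # g # gs))" for fs gs f g
  proof (cases "homs (fs @ f # g # gs)")
    case True
    then have h: "homs fs" "homogeneous f" "homogeneous g" "homs gs" by auto
    show ?thesis
      using h ins_swap[OF fold_ins_hpart[OF a h(1)] gr_hdeg[OF h(2)] gr_hdeg[OF h(3)]]
      by (simp add: ev_def)
  next
    case False
    then have "\<not> homs (fs @ g # f # gs)" by auto
    then have "ev a (fs @ g # f # gs) = 0" "ev a (fs @ f # g # gs) = 0"
      using False ev_nonhom by blast+
    then show ?thesis by simp
  qed
  have leib: "(let m = int (length fs + 1 + length gs) - k in
        ev a (fs @ (f * g) # gs) =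
          ksgn (hdeg f * (m + degs fs)) *\<^sub>R (f * ev a (fs @ g # gs)) +
          ksgn (hdeg g * (m + degs fs + hdeg f)) *\<^sub>R (g * ev a (fs @ f # gs)))"
    if "homogeneous f" "homogeneous g" for fs gs f g
  proof (cases "homs fs \<and> homs gs")
    case True
    then have b: "fold ins fs a \<in> hpart (k - degs fs - int (length fs))" using a by (simp add: fold_ins_hpart)
    have m: "int (length gs) + 1 - (k - degs fs - int (length fs)) = int (length fs + 1 + length gs) - k + degs fs"
      by simp
    show ?thesis
      using True ev_leibniz[OF b gr_hdeg[OF that(1)] gr_hdeg[OF that(2)], of gs]
      unfolding m by (simp add: ev_append Let_def)
  next
    case False
    then have "ev a (fs @ x # gs) = 0" for x by (intro ev_nonhom) auto
    then show ?thesis by (simp add: Let_def)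
  qed
  obtain N where "\<forall>fs. N < length fs \<longrightarrow> pr (fold ins fs a) = 0"
    using nilpotent[OF a] unfolding ins_def[abs_def] by blast
  then have bound: "\<exists>N. \<forall>fs. N < length fs \<longrightarrow> ev a fs = 0"
    by (intro exI[of _ N]) (simp add: ev_def)
  show ?thesis
    unfolding polyder_def mem_Collect_eq
    by (intro conjI allI impI; (rule bound | rule add | rule scale | rule swap | rule leib | rule ev_gr[OF a] | rule ev_nonhom))
qed

text \<open>Both sides satisfy the same recursion in the number of arguments, since insertion is a
  derivation of the product of \<open>V\<close>.\<close>

lemma wedge_ev:
  assumes "a \<in> hpart k" "b \<in> hpart l"
  shows "wedge (*) k l (ev a) (ev b) = ev (a * b)"
proof
  fix fs
  show "wedge (*) k l (ev a) (ev b) fs = ev (a * b) fs"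
  proof (cases "homs fs")
    case True
    then show ?thesis
      using assms
    proof (induction fs arbitrary: a b k l)
      case Nil
      then show ?case by (simp add: wedge_Nil ev_Nil)
    next
      case (Cons f fs)
      then have f: "homogeneous f" "f \<in> gr (hdeg f)" "homs fs" by (auto simp: gr_hdeg)
      have e: "(\<lambda>xs. ev c (f # xs)) = ev (ins f c)" for c
        using f(1) by (simp add: ev_Cons fun_eq_iff)
      show ?case
        unfolding wedge_Cons[OF Cons.prems(1)] e ev_Cons[OF f(1)]
          ins_mult[OF Cons.prems(2,3) f(2)]
          Cons.IH[OF f(3) ins_hpart[OF Cons.prems(2) f(2)] Cons.prems(3)]
          Cons.IH[OF f(3) Cons.prems(2) ins_hpart[OF Cons.prems(3) f(2)]]
        by (simp add: scaleR_fun_def)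
    qed
  qed (simp add: wedge_def ev_nonhom)
qed

lemma ev_scalar: "homogeneous f \<Longrightarrow> scalar_pv f = ev (emb f)"
proof
  fix fs :: "'b list" assume "homogeneous f"
  then show "scalar_pv f fs = ev (emb f) fs"
    by (cases fs) (auto simp: scalar_pv_def ev_def ins_emb)
qed

text \<open>A polyvector is determined by its values on generators: the algebra is generated by them, and
  the Leibniz rule reduces products to their factors.\<close>

lemma polyvector_eqI:
  assumes P: "P \<in> polyvectors k" and Q: "Q \<in> polyvectors k"
    and eq: "\<And>js. P (map gen js) = Q (map gen js)"
  shows "P = Q"
proof
  fix fs
  have leib: "R (fs @ (f * g) # gs) =
          ksgn (hdeg f * (int (length fs + 1 + length gs) - k + degs fs)) *\<^sub>R (f * R (fs @ g # gs)) +
          ksgn (hdeg g * (int (length fs + 1 + length gs) - k + degs fs + hdeg f)) *\<^sub>R (g * R (fs @ f # gs))"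
    if "homogeneous f" "homogeneous g" "R \<in> polyvectors k" for fs gs f g and R :: "'b list \<Rightarrow> 'b"
    using that unfolding polyder_def by (auto simp: Let_def)
  have add: "R (fs @ (f + g) # gs) = R (fs @ f # gs) + R (fs @ g # gs)"
    if "f \<in> gr d" "g \<in> gr d" "R \<in> polyvectors k" for fs gs d f g and R :: "'b list \<Rightarrow> 'b"
    using that unfolding polyder_def by auto
  have scale: "R (fs @ (r *\<^sub>R f) # gs) = r *\<^sub>R R (fs @ f # gs)" if "homogeneous f" "R \<in> polyvectors k" for fs gs r f and R :: "'b list \<Rightarrow> 'b"
    using that unfolding polyder_def by auto
  have hdeg1: "hdeg (1 :: 'b) = 0" by (rule hdeg_eq[OF gr_1]) simp
  have hom1: "homogeneous (1 :: 'b)" by (rule homogeneousI[OF gr_1])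
  have one: "R (fs @ 1 # gs) = 0" if "R \<in> polyvectors k" for fs gs and R :: "'b list \<Rightarrow> 'b"
    using leib[OF hom1 hom1 that, of fs gs] by (simp add: hdeg1)
  have "P (fs @ map gen js) = Q (fs @ map gen js)" if "homs fs" for js
    using that
  proof (induction fs arbitrary: js rule: rev_induct)
    case Nil
    then show ?case by (simp add: eq)
  next
    case (snoc f fs)
    then have f: "homogeneous f" and fs: "homs fs" by auto
    have "P (fs @ f # map gen js) = Q (fs @ f # map gen js)"
    proof (rule gen_induct[where Q = "\<lambda>f. P (fs @ f # map gen js) = Q (fs @ f # map gen js)", OF _ _ _ f])
      show "P (fs @ r *\<^sub>R 1 # map gen js) = Q (fs @ r *\<^sub>R 1 # map gen js)" for r
        by (simp add: scale[OF hom1] P Q one)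
      show "P (fs @ (gen j * a) # map gen js) = Q (fs @ (gen j * a) # map gen js)"
        if "homogeneous a" "P (fs @ a # map gen js) = Q (fs @ a # map gen js)" for j a
        using that snoc.IH[OF fs, of "j # js"] by (simp add: leib[OF gen_hom that(1)] P Q)
      show "P (fs @ (a + b) # map gen js) = Q (fs @ (a + b) # map gen js)"
        if "a \<in> gr d" "b \<in> gr d" "P (fs @ a # map gen js) = Q (fs @ a # map gen js)"
          "P (fs @ b # map gen js) = Q (fs @ b # map gen js)" for d a b
        using that by (simp add: add[OF that(1,2)] P Q)
    qed
    then show ?case by simp
  qed
  from this[of "[]"] show "P fs = Q fs"
    by (cases "homs fs") (use P Q in \<open>auto simp: polyder_def\<close>)
qed

end

subsection \<open>The Poisson coboundary\<close>

locale poisson_side = polyvector_side eps emb pr gen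
  for eps and emb :: "'b::{graded,ring_1} \<Rightarrow> 'n::{finite,linorder} forms" and pr gen +
  fixes \<pi> :: "'n forms"
  assumes pi_hpart: "\<pi> \<in> hpart 2"
    and pr_pi: "pr (schouten \<pi> a) = 0"
    and emb_br: "homogeneous f \<Longrightarrow> homogeneous g \<Longrightarrow> emb (pr (ins g (ins f \<pi>))) = ins g (ins f \<pi>)"
    and pr_lie: "homogeneous f \<Longrightarrow> pr (schouten (ins f \<pi>) a) = pr (schouten (ins f \<pi>) (emb (pr a)))"
begin

abbreviation br where "br \<equiv> bracket_of (ev \<pi>)"

text \<open>The differential on \<open>V\<close> that becomes the Poisson coboundary under evaluation.\<close>

definition dl where "dl a = (- eps) *\<^sub>R schouten \<pi> a"

lemma dl_simps [simp]: "dl 0 = 0" "dl (a + b) = dl a + dl b" "dl (a - b) = dl a - dl b" "dl (- a) = - dl a"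
  "dl (r *\<^sub>R a) = r *\<^sub>R dl a"
  by (simp_all add: dl_def scaleR_add_right scaleR_diff_right scaleR_minus_right[symmetric] del: scaleR_minus_right)

lemma dl_hpart: "a \<in> hpart k \<Longrightarrow> dl a \<in> hpart (k + 1)"
  using hpart_schouten[OF pi_hpart, of a k] by (auto simp: dl_def add.commute intro: hpart_scaleR hpart_minus)

text \<open>The Lie derivative along the Hamiltonian vector field of \<open>f\<close>, defined by the Cartan
  formula; by the Jacobi identity it is the bracket with that vector field
  (\<open>lie_eq\<close>).\<close>

definition lie where "lie f a = ins f (dl a) + dl (ins f a)"

lemma br_eq: "homogeneous f \<Longrightarrow> homogeneous g \<Longrightarrow> br f g = pr (ins g (ins f \<pi>))"
  by (simp add: bracket_of_def ev_def)

lemma br_gr: "f \<in> gr d \<Longrightarrow> g \<in> gr e \<Longrightarrow> br f g \<in> gr (d + e)"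
  using pr_gr[OF ins_hpart[OF ins_hpart[OF pi_hpart, of f d], of g e]]
  by (simp add: br_eq homogeneousI algebra_simps)

lemma lie_eq:
  assumes a: "a \<in> hpart l" and f: "f \<in> gr d"
  shows "lie f a = (- eps * ksgn (d * (l + 1))) *\<^sub>R schouten (ins f \<pi>) a"
proof -
  note F = emb_hpart[OF f]
  have s: "schouten \<pi> (emb f) = - (ksgn (- d - 1) *\<^sub>R schouten (emb f) \<pi>)"
    using schouten_antisym[OF pi_hpart F] by simp
  have t: "schouten (dl a) (emb f) = - (ksgn ((l + 1 - 1) * (- d - 1)) *\<^sub>R schouten (emb f) (dl a))"
    by (rule schouten_antisym[OF dl_hpart[OF a] F])
  have u: "schouten a (emb f) = - (ksgn ((l - 1) * (- d - 1)) *\<^sub>R schouten (emb f) a)"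
    by (rule schouten_antisym[OF a F])
  have j: "schouten (schouten (emb f) \<pi>) a = schouten (emb f) (schouten \<pi> a)
      - ksgn ((- d - 1) * (2 - 1)) *\<^sub>R schouten \<pi> (schouten (emb f) a)"
    by (rule schouten_jacobi[OF F pi_hpart])
  show ?thesis
    unfolding lie_def ins_eq[OF pi_hpart] ins_eq[OF a] ins_eq[OF dl_hpart[OF a]] s t u
    unfolding dl_def schouten_simps j
    by (cases "even l"; cases "even d") (simp_all add: ksgn_def scaleR_diff_right algebra_simps)
qed

lemma emb_br_eq:
  assumes f: "f \<in> gr d" and g: "g \<in> gr e"
  shows "schouten (ins f \<pi>) (emb g) = (eps * ksgn (1 - d)) *\<^sub>R emb (br f g)"
proof -
  have Y: "ins f \<pi> \<in> hpart (1 - d)" using ins_hpart[OF pi_hpart f] by simp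
  have "schouten (ins f \<pi>) (emb g) = (eps * ksgn (1 - d)) *\<^sub>R ins g (ins f \<pi>)"
    unfolding ins_eq[OF Y] by (cases "even d") (simp_all add: ksgn_def)
  then show ?thesis
    using emb_br[OF homogeneousI[OF f] homogeneousI[OF g]] br_eq[OF homogeneousI[OF f] homogeneousI[OF g]]
    by simp
qed

text \<open>The Cartan commutation relation between insertions and Lie derivatives, from which the values of
  a Lie derivative are obtained argument by argument.\<close>

lemma ins_lie:
  assumes a: "a \<in> hpart l" and f: "f \<in> gr d" and g: "g \<in> gr e"
  shows "ins g (lie f a) = ksgn (d * e) *\<^sub>R lie f (ins g a) - ins (br f g) a"
proof -
  let ?Y = "ins f \<pi>"
  have Y: "?Y \<in> hpart (1 - d)" using ins_hpart[OF pi_hpart f] by simp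
  have Ya: "schouten ?Y a \<in> hpart (l - d)" using hpart_schouten[OF Y a] by simp
  have j: "schouten (schouten ?Y a) (emb g) = schouten ?Y (schouten a (emb g))
      - ksgn ((1 - d - 1) * (l - 1)) *\<^sub>R schouten a (schouten ?Y (emb g))"
    by (rule schouten_jacobi[OF Y a])
  show ?thesis
    unfolding lie_eq[OF a f] lie_eq[OF ins_hpart[OF a g] f]
    unfolding ins_simps ins_eq[OF Ya] ins_eq[OF a]
      schouten_simps j emb_br_eq[OF f g]
    by (cases "even l"; cases "even d"; cases "even e") (simp_all add: ksgn_def scaleR_diff_right algebra_simps)
qed

lemma pr_lie_eq:
  assumes a: "a \<in> hpart l" and f: "f \<in> gr d"
  shows "pr (lie f a) = ksgn (d * l) *\<^sub>R br f (pr a)"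
proof -
  have "pr (lie f a) = (- eps * ksgn (d * (l + 1))) *\<^sub>R pr (schouten (ins f \<pi>) (emb (pr a)))"
    unfolding lie_eq[OF a f] pr_simps pr_lie[OF homogeneousI[OF f], of a] ..
  then show ?thesis
    unfolding emb_br_eq[OF f pr_gr[OF a]]
    by (cases "even l"; cases "even d") (simp_all add: ksgn_def)
qed

lemma lie_ev:
  assumes f: "f \<in> gr d" and a: "a \<in> hpart l" and fs: "homs fs"
  shows "ev (lie f a) fs = ksgn (d * (int (length fs) - l)) *\<^sub>R br f (ev a fs)
    - (\<Sum>j<length fs. ksgn (int j + hdeg (fs ! j) * degs (take j fs)) *\<^sub>R ev a (br f (fs ! j) # nths fs (- {j})))"
  using a fs
proof (induction fs arbitrary: a l)
  case Nil
  then show ?case by (simp add: ev_Nil pr_lie_eq[OF _ f] ksgn_def)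
next
  case (Cons g gs)
  then have g: "homogeneous g" "g \<in> gr (hdeg g)" and gs: "homs gs" by (auto simp: gr_hdeg)
  let ?e = "hdeg g"
  let ?S = "\<Sum>j<length gs. ksgn (int j + hdeg (gs ! j) * degs (take j gs)) *\<^sub>R ev (ins g a) (br f (gs ! j) # nths gs (- {j}))"
  have brh: "homogeneous (br f x)" if "homogeneous x" for x
    using br_gr[OF f gr_hdeg[OF that]] homogeneousI by blast
  have "ev (lie f a) (g # gs) = ksgn (d * ?e) *\<^sub>R ev (lie f (ins g a)) gs - ev (ins (br f g) a) gs"
    by (simp add: ev_Cons[OF g(1)] ins_lie[OF Cons.prems(1) f g(2)] scaleR_fun_def)
  also have "ev (lie f (ins g a)) gs = ksgn (d * (int (length gs) - (l - ?e - 1))) *\<^sub>R br f (ev (ins g a) gs) - ?S"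
    by (rule Cons.IH[OF ins_hpart[OF Cons.prems(1) g(2)] gs])
  also have "ksgn (d * ?e) *\<^sub>R (ksgn (d * (int (length gs) - (l - ?e - 1))) *\<^sub>R br f (ev (ins g a) gs) - ?S)
      = ksgn (d * (int (length (g # gs)) - l)) *\<^sub>R br f (ev a (g # gs)) - ksgn (d * ?e) *\<^sub>R ?S"
    by (cases "even d"; cases "even l"; cases "even ?e"; cases "even (length gs)")
      (simp_all add: ksgn_def ev_Cons[OF g(1)])
  also have "ksgn (d * ?e) *\<^sub>R ?S + ev (ins (br f g) a) gs
    = (\<Sum>j<length (g # gs). ksgn (int j + hdeg ((g # gs) ! j) * degs (take j (g # gs)))
        *\<^sub>R ev a (br f ((g # gs) ! j) # nths (g # gs) (- {j})))"
  proof -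
    have "ksgn (d * ?e) *\<^sub>R ksgn (int j + hdeg (gs ! j) * degs (take j gs)) *\<^sub>R ev (ins g a) (br f (gs ! j) # nths gs (- {j}))
       = ksgn (int (Suc j) + hdeg (gs ! j) * (?e + degs (take j gs))) *\<^sub>R ev a (br f (gs ! j) # g # nths gs (- {j}))"
      if j: "j < length gs" for j
    proof -
      have x: "homogeneous (gs ! j)" using gs j by auto
      note b = br_gr[OF f gr_hdeg[OF x]]
      have "ev a (br f (gs ! j) # g # nths gs (- {j}))
        = - (ksgn (?e * (d + hdeg (gs ! j))) *\<^sub>R ev (ins g a) (br f (gs ! j) # nths gs (- {j})))"
        using ins_swap[OF Cons.prems(1) g(2) b] brh[OF x] g(1)
        by (simp add: ev_Cons scaleR_fun_def)
      then show ?thesis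
        by (cases "even d"; cases "even ?e"; cases "even (hdeg (gs ! j))"; cases "even (degs (take j gs))"; cases "even j")
          (simp_all add: ksgn_def)
    qed
    then show ?thesis
      using g(1) gs brh[OF g(1)]
      by (simp add: sum.lessThan_Suc_shift nths_Cons_compl_0 nths_Cons_compl_Suc ev_Cons scaleR_sum_right del: sum.lessThan_Suc)
  qed
  ultimately show ?case by (simp add: algebra_simps)
qed

text \<open>Inserting the first argument turns the coboundary formula into the Cartan formula, by induction
  on the number of arguments.\<close>

lemma coboundary_ev:
  assumes "a \<in> hpart k"
  shows "coboundary br br k (ev a) = ev (dl a)"
proof
  fix fs
  show "coboundary br br k (ev a) fs = ev (dl a) fs"
  proof (cases "homs fs")
    case True
    then show ?thesis
      using assms
    proof (induction fs arbitrary: a k)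
      case Nil
      then show ?case by (simp add: ev_Nil dl_def pr_pi scaleR_fun_def)
    next
      case (Cons f fs)
      then have f: "homogeneous f" "f \<in> gr (hdeg f)" and fs: "homs fs" by (auto simp: gr_hdeg)
      have e: "(\<lambda>xs. ev a (f # xs)) = ev (ins f a)"
        using f(1) by (simp add: ev_Cons fun_eq_iff)
      note P = ev_polyder[OF Cons.prems(2)]
      have "coboundary br br k (ev a) (f # fs)
        = ksgn (hdeg f * (int (length fs) - k)) *\<^sub>R br f (ev a fs)
          - (\<Sum>j<length fs. ksgn (int j + hdeg (fs ! j) * degs (take j fs)) *\<^sub>R ev a (br f (fs ! j) # nths fs (- {j})))
          - coboundary br br (k - hdeg f - 1) (ev (ins f a)) fs"
        unfolding e[symmetric]
      proof (rule coboundary_Cons[OF Cons.prems(1)])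
        show "ev a (x # f # xs) = - (ksgn (hdeg f * hdeg x) *\<^sub>R ev a (f # x # xs))" for x xs
          using polyder_skew[OF P, of "[]" x f xs] by simp
        show "ev a (f # 0 # xs) = 0" for xs
          by (simp add: ev_def)
        show "br x y = 0 \<or> hdeg (br x y) = hdeg x + hdeg y" if "homogeneous x" "homogeneous y" for x y
          using hdeg_eq[OF br_gr[OF gr_hdeg[OF that(1)] gr_hdeg[OF that(2)]]] by blast
      qed
      also have "\<dots> = ev (lie f a) fs - ev (dl (ins f a)) fs"
        by (simp only: lie_ev[OF f(2) Cons.prems(2) fs] Cons.IH[OF fs ins_hpart[OF Cons.prems(2) f(2)]])
      also have "\<dots> = ev (dl a) (f # fs)"
        by (simp add: lie_def ev_Cons[OF f(1)])
      finally show ?case .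
    qed
  qed (simp add: coboundary_nonhom ev_nonhom)
qed

end

section \<open>Sums of eigenvectors\<close>

text \<open>Applying \<open>T - m\<close> removes one of the summands, so that induction on their number
  applies.\<close>

lemma eigen_independent:
  assumes T: "linear T" and "finite F" and "\<And>l. l \<in> F \<Longrightarrow> T (v l) = l *\<^sub>R v l" and "(\<Sum>l\<in>F. v l) = 0"
    and "l \<in> F"
  shows "v l = 0"
  using assms(2-)
proof (induction F arbitrary: v l rule: finite_induct)
  case (insert m F)
  have s: "v m = - (\<Sum>l\<in>F. v l)"
    using insert.prems(2) insert.hyps by (simp add: eq_neg_iff_add_eq_0)
  have "(\<Sum>l\<in>F. (l - m) *\<^sub>R v l) = T (\<Sum>l\<in>F. v l) - m *\<^sub>R (\<Sum>l\<in>F. v l)"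
    using insert.prems(1) by (simp add: linear_sum[OF T] scaleR_left_diff_distrib sum_subtractf scaleR_sum_right)
  also have "T (\<Sum>l\<in>F. v l) = m *\<^sub>R (\<Sum>l\<in>F. v l)"
    using insert.prems(1)[of m] by (simp add: s linear_neg[OF T])
  finally have z: "(\<Sum>l\<in>F. (l - m) *\<^sub>R v l) = 0" by simp
  have F: "v l = 0" if "l \<in> F" for l
  proof -
    have "(l - m) *\<^sub>R v l = 0"
      by (rule insert.IH[OF _ z that]) (simp add: insert.prems(1) linear_scale[OF T] mult.commute)
    moreover have "l \<noteq> m" using that insert.hyps by auto
    ultimately show ?thesis by simp
  qed
  then show ?case using insert.prems(3) s by auto
qed simp

lemma eigen_decomposition:
  assumes T: "linear T" and "x \<in> span {v. \<exists>l. T v = l *\<^sub>R v}"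
  shows "\<exists>g. finite {l. g l \<noteq> 0} \<and> (\<forall>l. T (g l) = l *\<^sub>R g l) \<and> x = (\<Sum>l | g l \<noteq> 0. g l)"
  using assms(2)
proof (induction rule: span_induct_alt)
  case base
  show ?case by (rule exI[of _ "\<lambda>_. 0"]) (simp add: linear_0[OF T])
next
  case (step c y x)
  from step.hyps(1) obtain m where m: "T y = m *\<^sub>R y" by auto
  from step.IH obtain g where g: "finite {l. g l \<noteq> 0}" "\<And>l. T (g l) = l *\<^sub>R g l" "x = (\<Sum>l | g l \<noteq> 0. g l)"
    by auto
  define h where "h l = (if l = m then c *\<^sub>R y else 0) + g l" for l
  let ?F = "insert m {l. g l \<noteq> 0}"
  have fin: "finite ?F" using g(1) by simp
  have sub: "{l. h l \<noteq> 0} \<subseteq> ?F" by (auto simp: h_def)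
  have "(\<Sum>l | h l \<noteq> 0. h l) = (\<Sum>l\<in>?F. h l)"
    by (rule sum.mono_neutral_left[OF fin sub]) auto
  also have "\<dots> = c *\<^sub>R y + (\<Sum>l\<in>?F. g l)"
    using fin by (simp add: h_def sum.distrib)
  also have "(\<Sum>l\<in>?F. g l) = x"
    unfolding g(3) by (rule sum.mono_neutral_right[OF fin]) auto
  finally have "c *\<^sub>R y + x = (\<Sum>l | h l \<noteq> 0. h l)" by simp
  moreover have "finite {l. h l \<noteq> 0}" using finite_subset[OF sub fin] .
  moreover have "T (h l) = l *\<^sub>R h l" for l
    by (simp add: h_def linear_add[OF T] linear_scale[OF T] linear_0[OF T] g(2) m scaleR_add_right)
  ultimately show ?case by blast
qed

text \<open>Linear independence of eigenvectors makes the decomposition unique, so that only spanning has to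
  be checked.\<close>

lemma diagonalizableI:
  assumes T: "linear T" and span: "\<And>x. x \<in> span {v. \<exists>l. T v = l *\<^sub>R v}"
  shows "diagonalizable T"
  unfolding diagonalizable_def
proof
  fix x
  show "\<exists>!g. finite {l. g l \<noteq> 0} \<and> (\<forall>l. T (g l) = l *\<^sub>R g l) \<and> x = (\<Sum>l | g l \<noteq> 0. g l)"
  proof (rule ex_ex1I)
    show "\<exists>g. finite {l. g l \<noteq> 0} \<and> (\<forall>l. T (g l) = l *\<^sub>R g l) \<and> x = (\<Sum>l | g l \<noteq> 0. g l)"
      by (rule eigen_decomposition[OF T span])
  next
    fix g h
    assume g: "finite {l. g l \<noteq> 0} \<and> (\<forall>l. T (g l) = l *\<^sub>R g l) \<and> x = (\<Sum>l | g l \<noteq> 0. g l)"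
      and h: "finite {l. h l \<noteq> 0} \<and> (\<forall>l. T (h l) = l *\<^sub>R h l) \<and> x = (\<Sum>l | h l \<noteq> 0. h l)"
    let ?F = "{l. g l \<noteq> 0} \<union> {l. h l \<noteq> 0}"
    have fin: "finite ?F" using g h by simp
    have "(\<Sum>l\<in>?F. g l) = (\<Sum>l | g l \<noteq> 0. g l)" "(\<Sum>l\<in>?F. h l) = (\<Sum>l | h l \<noteq> 0. h l)"
      by (rule sum.mono_neutral_right[OF fin], auto)+
    then have z: "(\<Sum>l\<in>?F. g l - h l) = 0" using g h by (simp add: sum_subtractf)
    show "g = h"
    proof
      fix l
      show "g l = h l"
      proof (cases "l \<in> ?F")
        case True
        have "g l - h l = 0"
          by (rule eigen_independent[OF T fin _ z True])
            (use g h in \<open>simp add: linear_diff[OF T] scaleR_diff_right\<close>)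
        then show ?thesis by simp
      qed auto
    qed
  qed
qed

section \<open>The Batalin-Vilkovisky algebra of a polynomial Poisson structure\<close>

text \<open>Eigenvectors of the modular derivation may be inhomogeneous. The projections onto the
  homogeneous components commute with it, and so the components of an element can be decomposed
  separately.\<close>

definition degpart :: "int \<Rightarrow> 'n forms \<Rightarrow> 'n::{finite,linorder} forms"
  where "degpart k a = Ext (\<lambda>S. if int (card S) = k then ecoeff a S else 0)"

lemma degpart_simps [simp]:
  "degpart k (a + b) = degpart k a + degpart k b" "degpart k 0 = 0" "degpart k a \<in> hpart k"
  by (auto intro!: ext_eqI simp: degpart_def hpart_def)

lemma degpart_sum: "degpart k (sum f A) = (\<Sum>x\<in>A. degpart k (f x))"
  by (induction A rule: infinite_finite_induct) auto

lemma degpart_hpart: "a \<in> hpart j \<Longrightarrow> degpart k a = (if j = k then a else 0)"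
  by (rule ext_eqI) (auto simp: degpart_def hpart_def)

lemma degpart_total: "a = (\<Sum>k\<in>{0..int CARD('n)}. degpart k a)" for a :: "'n::{finite,linorder} forms"
proof (rule ext_eqI)
  fix S :: "'n set"
  have "card S \<le> CARD('n)" by (rule card_mono) auto
  then show "ecoeff a S = ecoeff (\<Sum>k\<in>{0..int CARD('n)}. degpart k a) S"
    by (simp add: ecoeff_sum degpart_def)
qed

lemma degpart_commute:
  fixes a :: "'n::{finite,linorder} forms"
  assumes T: "linear T" and deg: "\<And>j b. b \<in> hpart j \<Longrightarrow> T b \<in> hpart j"
  shows "T (degpart k a) = degpart k (T a)"
proof -
  have "degpart k (T a) = degpart k (T (\<Sum>j\<in>{0..int CARD('n)}. degpart j a))"
    using degpart_total[of a] by simp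
  also have "\<dots> = (\<Sum>j\<in>{0..int CARD('n)}. if j = k then T (degpart k a) else 0)"
    unfolding linear_sum[OF T] degpart_sum
    by (rule sum.cong) (auto simp: degpart_hpart[OF deg[OF degpart_simps(3)]])
  also have "\<dots> = T (degpart k a)"
  proof (cases "k \<in> {0..int CARD('n)}")
    case False
    then have "degpart k a = 0"
      using hpart_negative[OF degpart_simps(3)] hpart_large[OF degpart_simps(3)] by force
    then show ?thesis by (simp add: linear_0[OF T])
  qed simp
  finally show ?thesis ..
qed

subsection \<open>The complex, the modular element and the weights\<close>

locale bv_model =
  fixes \<pi> :: "'n::{finite,linorder} forms"
  assumes pi2: "\<pi> \<in> hpart 2" and master: "schouten \<pi> \<pi> = 0"
begin

definition cocyc :: "int \<Rightarrow> 'n forms set"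
  where "cocyc k = {a \<in> hpart k. schouten \<pi> a = 0}"

definition cobound :: "int \<Rightarrow> 'n forms set"
  where "cobound k = schouten \<pi> ` hpart (k - 1)"

text \<open>The modular vector field as an element of \<open>V\<close>.\<close>

definition modvec :: "'n forms"
  where "modvec = - bvop \<pi>"

definition wt :: "'n forms \<Rightarrow> 'n forms"
  where "wt a = schouten modvec a"

lemma modvec_hpart: "modvec \<in> hpart 1"
  using hpart_bvop[OF pi2] by (simp add: modvec_def hpart_minus)

lemma bvop_modvec [simp]: "bvop modvec = 0"
  by (simp add: modvec_def)

lemma linear_wt: "linear wt"
  by (rule linearI) (simp_all add: wt_def)

lemma wt_hpart: "a \<in> hpart k \<Longrightarrow> wt a \<in> hpart k"
  using hpart_schouten[OF modvec_hpart, of a k] by (simp add: wt_def)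

text \<open>The Jacobi identity for \<open>\<pi>\<close>, \<open>\<pi>\<close> and \<open>a\<close> counts
  the double bracket twice, so the master equation forces the square of the differential to
  vanish.\<close>

lemma dd [simp]: "schouten \<pi> (schouten \<pi> a) = 0"
proof -
  have "schouten (schouten \<pi> \<pi>) a = schouten \<pi> (schouten \<pi> a) - ksgn ((2 - 1) * (2 - 1)) *\<^sub>R schouten \<pi> (schouten \<pi> a)"
    by (rule schouten_jacobi[OF pi2 pi2])
  then have "(2 :: real) *\<^sub>R schouten \<pi> (schouten \<pi> a) = 0" by (simp add: master scaleR_2)
  then show ?thesis by simp
qed

text \<open>The Lie derivative along the modular vector field is the anticommutator of the differential and
  the Batalin-Vilkovisky operator, so both preserve weights, and the differential is exact in
  nonzero weight.\<close>

lemma wt_eq: "wt a = - (bvop (schouten \<pi> a) + schouten \<pi> (bvop a))"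
  by (simp add: wt_def modvec_def bvop_schouten par_hpart[OF pi2] ksgn_def)

lemma wt_d: "wt (schouten \<pi> a) = schouten \<pi> (wt a)"
  by (simp add: wt_eq)

lemma wt_bvop: "wt (bvop a) = bvop (wt a)"
  by (simp add: wt_eq)

lemma wt_mult: "wt (a * b) = wt a * b + a * wt b"
proof -
  have h: "wt (degpart k a * b) = wt (degpart k a) * b + degpart k a * wt b" for k
    using schouten_mult_right[OF modvec_hpart degpart_simps(3)[of k a], of b] by (simp add: wt_def)
  have "wt ((\<Sum>k\<in>{0..int CARD('n)}. degpart k a) * b)
      = wt (\<Sum>k\<in>{0..int CARD('n)}. degpart k a) * b + (\<Sum>k\<in>{0..int CARD('n)}. degpart k a) * wt b"
    by (simp add: linear_sum[OF linear_wt] sum_distrib_right h sum.distrib)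
  then show ?thesis by (simp flip: degpart_total)
qed

lemma cocyc_add: "a \<in> cocyc k \<Longrightarrow> b \<in> cocyc k \<Longrightarrow> a + b \<in> cocyc k"
  and cocyc_diff: "a \<in> cocyc k \<Longrightarrow> b \<in> cocyc k \<Longrightarrow> a - b \<in> cocyc k"
  and cocyc_scaleR: "a \<in> cocyc k \<Longrightarrow> r *\<^sub>R a \<in> cocyc k"
  and cocyc_0: "0 \<in> cocyc k"
  by (auto simp: cocyc_def hpart_add hpart_diff hpart_scaleR)

lemma cocyc_minus: "a \<in> cocyc k \<Longrightarrow> - a \<in> cocyc k"
  using cocyc_scaleR[of a k "-1"] by simp

lemma cocyc_mult: "a \<in> cocyc k \<Longrightarrow> b \<in> cocyc l \<Longrightarrow> a * b \<in> cocyc (k + l)"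
  by (auto simp: cocyc_def hpart_mult schouten_mult_right[OF pi2])

lemma cocyc_1: "1 \<in> cocyc 0"
  by (simp add: cocyc_def)

lemma cobound_0: "0 \<in> cobound k"
  unfolding cobound_def by (rule image_eqI[of _ _ 0]) auto

lemma cobound_cocyc: "a \<in> cobound k \<Longrightarrow> a \<in> cocyc k"
  using hpart_schouten[OF pi2, of _ "k - 1"] by (auto simp: cobound_def cocyc_def)

lemma cobound_diff: "a \<in> cobound k \<Longrightarrow> b \<in> cobound k \<Longrightarrow> a - b \<in> cobound k"
  unfolding cobound_def by (auto intro!: image_eqI[of _ _ "_ - _"] hpart_diff simp flip: schouten_simps)

lemma cobound_add: "a \<in> cobound k \<Longrightarrow> b \<in> cobound k \<Longrightarrow> a + b \<in> cobound k"
  unfolding cobound_def by (auto intro!: image_eqI[of _ _ "_ + _"] hpart_add simp flip: schouten_simps)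

lemma cobound_minus: "a \<in> cobound k \<Longrightarrow> - a \<in> cobound k"
  using cobound_diff[OF cobound_0] by fastforce

text \<open>The cocycles on which the operator of the Batalin-Vilkovisky structure can be computed by
  \<open>bvop\<close>.\<close>

definition cocyc0 :: "int \<Rightarrow> 'n forms set"
  where "cocyc0 k = {a \<in> cocyc k. wt a = 0}"

lemma cocyc0_bvop: "a \<in> cocyc0 k \<Longrightarrow> bvop a \<in> cocyc0 (k - 1)"
proof -
  assume a: "a \<in> cocyc0 k"
  have "schouten \<pi> (bvop a) = - wt a - bvop (schouten \<pi> a)" by (simp add: wt_eq)
  then have "schouten \<pi> (bvop a) = 0" using a by (simp add: cocyc0_def cocyc_def)
  moreover have "wt (bvop a) = 0" using a by (simp add: wt_bvop cocyc0_def)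
  ultimately show ?thesis using a by (simp add: cocyc0_def cocyc_def hpart_bvop)
qed

lemma cocyc0_ops: "a \<in> cocyc0 k \<Longrightarrow> b \<in> cocyc0 k \<Longrightarrow> a + b \<in> cocyc0 k" "a \<in> cocyc0 k \<Longrightarrow> r *\<^sub>R a \<in> cocyc0 k"
  "a \<in> cocyc0 k \<Longrightarrow> b \<in> cocyc0 l \<Longrightarrow> a * b \<in> cocyc0 (k + l)"
  by (auto simp: cocyc0_def cocyc_add cocyc_scaleR cocyc_mult wt_mult linear_add[OF linear_wt] linear_scale[OF linear_wt])

text \<open>A graded algebra whose classes are represented by the cocycles of the model. The operator is only
  prescribed on cocycles of weight zero: on other representatives \<open>bvop\<close> need not give a cocycle.\<close>

definition presents :: "(int \<Rightarrow> 'n forms \<Rightarrow> 'h) \<Rightarrow> 'h bv_structure \<Rightarrow> bool"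
  where "presents c H \<longleftrightarrow>
    (\<forall>k. comp H k = c k ` cocyc k) \<and>
    (\<forall>k. \<forall>a\<in>cocyc k. \<forall>b\<in>cocyc k. c k a = c k b \<longleftrightarrow> a - b \<in> cobound k) \<and>
    (\<forall>k. gzero H k = c k 0) \<and>
    (\<forall>k. \<forall>a\<in>cocyc k. \<forall>b\<in>cocyc k. gadd H k (c k a) (c k b) = c k (a + b)) \<and>
    (\<forall>k r. \<forall>a\<in>cocyc k. gscale H k r (c k a) = c k (r *\<^sub>R a)) \<and>
    (\<forall>k l. \<forall>a\<in>cocyc k. \<forall>b\<in>cocyc l. gmult H k l (c k a) (c l b) = c (k + l) (a * b)) \<and>
    gone H = c 0 1 \<and>
    (\<forall>k. \<forall>a\<in>cocyc0 k. bv_delta H k (c k a) = c (k - 1) (bvop a))"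

lemma presentsD:
  assumes "presents c H"
  shows presents_comp: "comp H k = c k ` cocyc k"
    and presents_eq: "a \<in> cocyc k \<Longrightarrow> b \<in> cocyc k \<Longrightarrow> c k a = c k b \<longleftrightarrow> a - b \<in> cobound k"
    and presents_zero: "gzero H k = c k 0" and presents_one: "gone H = c 0 1"
    and presents_add: "a \<in> cocyc k \<Longrightarrow> b \<in> cocyc k \<Longrightarrow> gadd H k (c k a) (c k b) = c k (a + b)"
    and presents_scale: "a \<in> cocyc k \<Longrightarrow> gscale H k r (c k a) = c k (r *\<^sub>R a)"
    and presents_mult: "a \<in> cocyc k \<Longrightarrow> b \<in> cocyc l \<Longrightarrow> gmult H k l (c k a) (c l b) = c (k + l) (a * b)"
    and presents_delta: "a \<in> cocyc0 k \<Longrightarrow> bv_delta H k (c k a) = c (k - 1) (bvop a)"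
  using assms unfolding presents_def by auto

end

locale diagonal_bv_model = bv_model \<pi> for \<pi> :: "'n::{finite,linorder} forms" +
  assumes wt_span: "\<And>a. a \<in> span {v. \<exists>l. wt v = l *\<^sub>R v}"
begin

lemma hpart_weights:
  assumes "a \<in> hpart k"
  shows "\<exists>F v. finite F \<and> (\<forall>l. wt (v l) = l *\<^sub>R v l \<and> v l \<in> hpart k) \<and> a = (\<Sum>l\<in>F. v l)"
proof -
  obtain g where g: "finite {l. g l \<noteq> 0}" "\<And>l. wt (g l) = l *\<^sub>R g l" "a = (\<Sum>l | g l \<noteq> 0. g l)"
    using eigen_decomposition[OF linear_wt wt_span] by blast
  have "degpart k (l *\<^sub>R b) = l *\<^sub>R degpart k b" for l b
    by (rule ext_eqI) (simp add: degpart_def)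
  then have "wt (degpart k (g l)) = l *\<^sub>R degpart k (g l)" for l
    by (simp add: degpart_commute[OF linear_wt wt_hpart] g(2))
  moreover have "a = (\<Sum>l | g l \<noteq> 0. degpart k (g l))"
    using degpart_hpart[OF assms, of k] g(3) by (simp flip: degpart_sum)
  ultimately show ?thesis using g(1) by (intro exI[of _ "{l. g l \<noteq> 0}"] exI[of _ "\<lambda>l. degpart k (g l)"]) auto
qed

text \<open>On the eigenspace for \<open>l \<noteq> 0\<close> a cocycle \<open>v\<close> satisfies \<open>l
  v = - [\<pi>, bvop v]\<close> by \<open>wt_eq\<close>. The components of nonzero weight of a
  cocycle are therefore coboundaries.\<close>

lemma weight_zero_representative:
  assumes "a \<in> cocyc k"
  shows "\<exists>b\<in>cocyc0 k. a - b \<in> cobound k"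
proof -
  obtain F v where F: "finite F" and v: "\<And>l. wt (v l) = l *\<^sub>R v l" "\<And>l. v l \<in> hpart k" and a: "a = (\<Sum>l\<in>F. v l)"
    using hpart_weights[of a k] assms unfolding cocyc_def by blast
  have "(\<Sum>l\<in>F. schouten \<pi> (v l)) = 0"
    using assms by (simp add: cocyc_def a schouten_sum_right)
  then have d: "schouten \<pi> (v l) = 0" if "l \<in> F" for l
    by (rule eigen_independent[OF linear_wt F _ _ that, of "\<lambda>l. schouten \<pi> (v l)", rotated])
      (simp add: wt_d v(1))
  \<comment> \<open>The component of weight zero; zero need not be among the eigenvalues that occur.\<close>
  define b where "b = (if 0 \<in> F then v 0 else 0)"
  have b: "b \<in> cocyc0 k"
    using v[of 0] d by (auto simp: b_def cocyc0_def cocyc_def linear_0[OF linear_wt])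
  have e: "v l \<in> cobound k" if "l \<in> F - {0}" for l
  proof -
    have "v l = schouten \<pi> (- (1 / l) *\<^sub>R bvop (v l))"
    proof -
      have "schouten \<pi> (bvop (v l)) = - wt (v l) - bvop (schouten \<pi> (v l))" by (simp add: wt_eq)
      then show ?thesis using that v(1)[of l] d[of l] by simp
    qed
    moreover have "- (1 / l) *\<^sub>R bvop (v l) \<in> hpart (k - 1)" by (intro hpart_scaleR hpart_bvop v)
    ultimately show ?thesis unfolding cobound_def by blast
  qed
  have "(\<Sum>l\<in>G. v l) \<in> cobound k" if "G \<subseteq> F - {0}" for G
    using that by (induction G rule: infinite_finite_induct) (use e in \<open>auto intro: cobound_add cobound_0\<close>)
  from this[of "F - {0}"] have "(\<Sum>l\<in>F - {0}. v l) \<in> cobound k" by simp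
  moreover have "a = b + (\<Sum>l\<in>F - {0}. v l)"
    unfolding a b_def using F by (simp add: sum.remove)
  ultimately show ?thesis using b by (intro bexI[of _ b]) auto
qed

text \<open>The differential preserves weights, so the component of weight zero of a primitive is again a
  primitive.\<close>

lemma weight_zero_cobound:
  assumes "a \<in> cobound k" "wt a = 0"
  shows "\<exists>b\<in>hpart (k - 1). wt b = 0 \<and> a = schouten \<pi> b"
proof -
  obtain r where r: "r \<in> hpart (k - 1)" and a: "a = schouten \<pi> r" using assms(1) by (auto simp: cobound_def)
  obtain F v where F: "finite F" and v: "\<And>l. wt (v l) = l *\<^sub>R v l" "\<And>l. v l \<in> hpart (k - 1)" and r: "r = (\<Sum>l\<in>F. v l)"
    using hpart_weights[OF r] by blast
  define b where "b = (if 0 \<in> F then v 0 else 0)"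
  define u where "u l = (if l \<in> F then schouten \<pi> (v l) else 0) - (if l = 0 then a else 0)" for l
  have "(\<Sum>l\<in>insert 0 F. u l) = (\<Sum>l\<in>insert 0 F. if l \<in> F then schouten \<pi> (v l) else 0) - a"
    using F by (simp add: u_def sum_subtractf sum.delta)
  also have "(\<Sum>l\<in>insert 0 F. if l \<in> F then schouten \<pi> (v l) else 0) = (\<Sum>l\<in>F. schouten \<pi> (v l))"
    by (rule sum.mono_neutral_cong_right) (use F in auto)
  also have "\<dots> - a = 0" by (simp add: a r schouten_sum_right)
  finally have "u 0 = 0"
    by (rule eigen_independent[OF linear_wt _ _ _ insertI1, rotated 2])
      (use F assms(2) in \<open>auto simp: u_def wt_d v(1) linear_diff[OF linear_wt] linear_0[OF linear_wt] linear_neg[OF linear_wt]\<close>)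
  then have "a = schouten \<pi> b" by (auto simp: u_def b_def split: if_splits)
  moreover have "b \<in> hpart (k - 1)" "wt b = 0" using v[of 0] by (auto simp: b_def linear_0[OF linear_wt])
  ultimately show ?thesis by blast
qed

lemma bvop_cobound:
  assumes "a \<in> cobound k" "wt a = 0"
  shows "bvop a \<in> cobound (k - 1)"
proof -
  obtain b where b: "b \<in> hpart (k - 1)" "wt b = 0" "a = schouten \<pi> b"
    using weight_zero_cobound[OF assms] by blast
  have "bvop (schouten \<pi> b) = - wt b - schouten \<pi> (bvop b)" by (simp add: wt_eq)
  then have "bvop a = schouten \<pi> (- bvop b)" using b by simp
  moreover have "- bvop b \<in> hpart (k - 1 - 1)" by (intro hpart_minus hpart_bvop b)
  ultimately show ?thesis unfolding cobound_def by blast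
qed

lemma presents_comp0:
  assumes "presents c H"
  shows "comp H k = c k ` cocyc0 k"
proof
  show "comp H k \<subseteq> c k ` cocyc0 k"
  proof
    fix x assume "x \<in> comp H k"
    then obtain a where a: "a \<in> cocyc k" "x = c k a" using presents_comp[OF assms] by auto
    obtain b where b: "b \<in> cocyc0 k" "a - b \<in> cobound k" using weight_zero_representative[OF a(1)] by blast
    then have "c k a = c k b" using presents_eq[OF assms a(1)] unfolding cocyc0_def by blast
    then show "x \<in> c k ` cocyc0 k" using a b by auto
  qed
  show "c k ` cocyc0 k \<subseteq> comp H k"
    unfolding presents_comp[OF assms] cocyc0_def by auto
qed

text \<open>Every class has a representative of weight zero, and sums, products and \<open>bvop\<close>
  preserve weight zero. On such representatives the axioms are identities of \<open>V\<close>.\<close>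

theorem presents_bv_algebra:
  assumes P: "presents c H"
  shows "bv_algebra H"
proof -
  note comp = presents_comp[OF P] and zero = presents_zero[OF P] and one = presents_one[OF P]
    and add = presents_add[OF P] and scale = presents_scale[OF P] and mult = presents_mult[OF P]
    and delta = presents_delta[OF P]
  have mem: "c k a \<in> c k ` cocyc k" if "a \<in> cocyc k" for k a using that by blast
  note clo = cocyc_add cocyc_minus cocyc_scaleR cocyc_0 cocyc_mult cocyc_1
  have g1: "gzero H k \<in> comp H k"
    "a \<in> comp H k \<Longrightarrow> b \<in> comp H k \<Longrightarrow> gadd H k a b \<in> comp H k"
    "a \<in> comp H k \<Longrightarrow> gscale H k r a \<in> comp H k"
    "a \<in> comp H k \<Longrightarrow> b \<in> comp H k \<Longrightarrow> c' \<in> comp H k \<Longrightarrow>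
       gadd H k (gadd H k a b) c' = gadd H k a (gadd H k b c')"
    "a \<in> comp H k \<Longrightarrow> b \<in> comp H k \<Longrightarrow> gadd H k a b = gadd H k b a"
    "a \<in> comp H k \<Longrightarrow> gadd H k (gzero H k) a = a"
    "a \<in> comp H k \<Longrightarrow> gadd H k a (gscale H k (-1) a) = gzero H k"
    "a \<in> comp H k \<Longrightarrow> gscale H k 1 a = a"
    "a \<in> comp H k \<Longrightarrow> gscale H k r (gscale H k s a) = gscale H k (r * s) a"
    "a \<in> comp H k \<Longrightarrow> gscale H k (r + s) a = gadd H k (gscale H k r a) (gscale H k s a)"
    "a \<in> comp H k \<Longrightarrow> b \<in> comp H k \<Longrightarrow>
       gscale H k r (gadd H k a b) = gadd H k (gscale H k r a) (gscale H k r b)"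
    "gone H \<in> comp H 0" for k r s a b c'
    unfolding comp zero one by (auto simp: add scale clo scaleR_add_left scaleR_add_right ac_simps intro!: mem)
  have g2: "a \<in> comp H k \<Longrightarrow> b \<in> comp H l \<Longrightarrow> gmult H k l a b \<in> comp H (k + l)"
    "a \<in> comp H k \<Longrightarrow> gmult H 0 k (gone H) a = a"
    "a \<in> comp H k \<Longrightarrow> b \<in> comp H k \<Longrightarrow> c' \<in> comp H l \<Longrightarrow>
       gmult H k l (gadd H k a b) c' = gadd H (k + l) (gmult H k l a c') (gmult H k l b c')"
    "a \<in> comp H k \<Longrightarrow> b \<in> comp H l \<Longrightarrow>
       gmult H k l (gscale H k r a) b = gscale H (k + l) r (gmult H k l a b)" for k l r a b c'
    unfolding comp one by (auto simp: add scale mult clo distrib_right intro!: mem)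
  have g3: "gmult H (k + l) m (gmult H k l a b) d = gmult H k (l + m) a (gmult H l m b d)"
    if "a \<in> comp H k" "b \<in> comp H l" "d \<in> comp H m" for k l m a b d
    using that unfolding comp by (auto simp: mult clo mult.assoc add.assoc)
  have g4: "gmult H k l a b = gscale H (k + l) (ksgn (k * l)) (gmult H l k b a)"
    if ab: "a \<in> comp H k" "b \<in> comp H l" for k l a b
  proof -
    obtain a' b' where a': "a' \<in> cocyc k" "a = c k a'" and b': "b' \<in> cocyc l" "b = c l b'"
      using ab unfolding comp by blast
    have "a' * b' = ksgn (k * l) *\<^sub>R (b' * a')"
      using a' b' by (intro graded_commute) (auto simp: cocyc_def)
    then show ?thesis
      using a' b' mult[OF b'(1) a'(1)] scale[OF cocyc_mult[OF b'(1) a'(1)]] by (simp add: mult add.commute)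
  qed
  have gca: "graded_comm_algebra H"
    unfolding graded_comm_algebra_def
    by (intro conjI allI ballI) (fact g1 g2 g3 g4)+
  note comp0 = presents_comp0[OF P]
  have sub: "a \<in> cocyc0 k \<Longrightarrow> a \<in> cocyc k" for a k by (simp add: cocyc0_def)
  note clo0 = cocyc0_ops cocyc0_bvop
  have d1: "a \<in> comp H k \<Longrightarrow> bv_delta H k a \<in> comp H (k - 1)"
    "a \<in> comp H k \<Longrightarrow> b \<in> comp H k \<Longrightarrow>
       bv_delta H k (gadd H k a b) = gadd H (k - 1) (bv_delta H k a) (bv_delta H k b)"
    "a \<in> comp H k \<Longrightarrow> bv_delta H k (gscale H k r a) = gscale H (k - 1) r (bv_delta H k a)" for k r a b
    unfolding comp0 by (auto simp: add scale delta clo0 sub)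
  have d2: "bv_delta H (k - 1) (bv_delta H k a) = gzero H (k - 2)" if "a \<in> comp H k" for k a
    using that delta[OF cocyc0_bvop] unfolding comp0 zero by (auto simp: delta)
  have d3: "(let N = k + l + m - 1; plus = gadd H N; sc = gscale H N; \<Delta> = bv_delta H; mul = gmult H in
        \<Delta> (k + l + m) (mul (k + l) m (mul k l a b) d) =
          plus (mul (k + l - 1) m (\<Delta> (k + l) (mul k l a b)) d)
         (plus (sc (ksgn k) (mul k (l + m - 1) a (\<Delta> (l + m) (mul l m b d))))
         (plus (sc (ksgn ((k - 1) * l)) (mul l (k + m - 1) b (\<Delta> (k + m) (mul k m a d))))
         (plus (sc (-1) (mul (k - 1 + l) m (mul (k - 1) l (\<Delta> k a) b) d))
         (plus (sc (- ksgn k) (mul (k + (l - 1)) m (mul k (l - 1) a (\<Delta> l b)) d))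
               (sc (- ksgn (k + l)) (mul (k + l) (m - 1) (mul k l a b) (\<Delta> m d))))))))"
    if abd: "a \<in> comp H k" "b \<in> comp H l" "d \<in> comp H m" for k l m a b d
  proof -
    obtain x y z where x: "x \<in> cocyc0 k" "a = c k x" and y: "y \<in> cocyc0 l" "b = c l y"
      and z: "z \<in> cocyc0 m" "d = c m z"
      using abd unfolding comp0 by blast
    define N where "N = k + l + m - 1"
    have ix: "k + l - 1 + m = N" "k + (l + m - 1) = N" "l + (k + m - 1) = N" "k - 1 + l + m = N"
      "k + (l - 1) + m = N" "k + l + (m - 1) = N" "k + l + m - 1 = N"
      by (auto simp: N_def)
    note xs = x(1) y(1) z(1)
    note xyz = xs clo0(3)[OF x(1) y(1)] clo0(3)[OF y(1) z(1)] clo0(3)[OF x(1) z(1)]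
    note dd = cocyc0_bvop[OF xyz(1)] cocyc0_bvop[OF xyz(2)] cocyc0_bvop[OF xyz(3)]
      cocyc0_bvop[OF xyz(4)] cocyc0_bvop[OF xyz(5)] cocyc0_bvop[OF xyz(6)]
    have m0: "gmult H k' l' (c k' u) (c l' v) = c (k' + l') (u * v)" if "u \<in> cocyc0 k'" "v \<in> cocyc0 l'" for k' l' u v
      using that by (simp add: mult sub)
    have s0: "gscale H N r (c N u) = c N (r *\<^sub>R u)" if "u \<in> cocyc0 N" for r u
      using that by (simp add: scale sub)
    have a0: "gadd H N (c N u) (c N v) = c N (u + v)" if "u \<in> cocyc0 N" "v \<in> cocyc0 N" for u v
      using that by (simp add: add sub)
    have T: "bvop (x * y) * z \<in> cocyc0 N" "x * bvop (y * z) \<in> cocyc0 N" "y * bvop (x * z) \<in> cocyc0 N"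
      "bvop x * y * z \<in> cocyc0 N" "x * bvop y * z \<in> cocyc0 N" "x * y * bvop z \<in> cocyc0 N"
      using clo0(3)[OF dd(4) xs(3)] clo0(3)[OF xs(1) dd(5)] clo0(3)[OF xs(2) dd(6)]
        clo0(3)[OF clo0(3)[OF dd(1) xs(2)] xs(3)] clo0(3)[OF clo0(3)[OF xs(1) dd(2)] xs(3)] clo0(3)[OF xyz(4) dd(3)]
      unfolding ix by auto
    have E: "bvop (x * y * z) = bvop (x * y) * z + (ksgn k *\<^sub>R (x * bvop (y * z)) +
       (ksgn ((k - 1) * l) *\<^sub>R (y * bvop (x * z)) + ((-1) *\<^sub>R (bvop x * y * z) +
        ((- ksgn k) *\<^sub>R (x * bvop y * z) + (- ksgn (k + l)) *\<^sub>R (x * y * bvop z)))))"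
      using bvop_triple[of x k y l z] xs by (simp add: cocyc0_def cocyc_def)
    have "bv_delta H (k + l + m) (gmult H (k + l) m (gmult H k l a b) d) = c N (bvop (x * y * z))"
      unfolding x(2) y(2) z(2) m0[OF xs(1,2)] m0[OF xyz(4) xs(3)] delta[OF clo0(3)[OF xyz(4) xs(3)]] ix ..
    moreover have "gmult H (k + l - 1) m (bv_delta H (k + l) (gmult H k l a b)) d = c N (bvop (x * y) * z)"
      unfolding x(2) y(2) z(2) m0[OF xs(1,2)] delta[OF xyz(4)] m0[OF dd(4) xs(3)] ix ..
    moreover have "gmult H k (l + m - 1) a (bv_delta H (l + m) (gmult H l m b d)) = c N (x * bvop (y * z))"
      unfolding x(2) y(2) z(2) m0[OF xs(2,3)] delta[OF xyz(5)] m0[OF xs(1) dd(5)] ix ..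
    moreover have "gmult H l (k + m - 1) b (bv_delta H (k + m) (gmult H k m a d)) = c N (y * bvop (x * z))"
      unfolding x(2) y(2) z(2) m0[OF xs(1,3)] delta[OF xyz(6)] m0[OF xs(2) dd(6)] ix ..
    moreover have "gmult H (k - 1 + l) m (gmult H (k - 1) l (bv_delta H k a) b) d = c N (bvop x * y * z)"
      unfolding x(2) y(2) z(2) delta[OF xs(1)] m0[OF dd(1) xs(2)] m0[OF clo0(3)[OF dd(1) xs(2)] xs(3)] ix ..
    moreover have "gmult H (k + (l - 1)) m (gmult H k (l - 1) a (bv_delta H l b)) d = c N (x * bvop y * z)"
      unfolding x(2) y(2) z(2) delta[OF xs(2)] m0[OF xs(1) dd(2)] m0[OF clo0(3)[OF xs(1) dd(2)] xs(3)] ix ..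
    moreover have "gmult H (k + l) (m - 1) (gmult H k l a b) (bv_delta H m d) = c N (x * y * bvop z)"
      unfolding x(2) y(2) z(2) delta[OF xs(3)] m0[OF xs(1,2)] m0[OF xyz(4) dd(3)] ix ..
    ultimately show ?thesis
      unfolding Let_def ix by (simp only: s0 a0 T cocyc0_ops E)
  qed
  show ?thesis
    unfolding bv_algebra_def
    by (intro conjI allI ballI gca) (fact d1 d2 d3)+
qed

text \<open>The isomorphism sends the class of a cocycle in one structure to the class of the same cocycle
  in the other one. It is well defined and injective because classes coincide in both structures
  for the same reason.\<close>

theorem presents_bv_isomorphic:
  assumes H: "presents c H" and G: "presents d G"
  shows "bv_isomorphic H G"
proof -
  define \<phi> where "\<phi> k x = d k (SOME a. a \<in> cocyc k \<and> c k a = x)" for k x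
  have \<phi>: "\<phi> k (c k a) = d k a" if a: "a \<in> cocyc k" for k a
  proof -
    define b where "b = (SOME b. b \<in> cocyc k \<and> c k b = c k a)"
    have b: "b \<in> cocyc k \<and> c k b = c k a"
      unfolding b_def by (rule someI[of _ a]) (use a in simp)
    then have "b - a \<in> cobound k" using presents_eq[OF H] a by blast
    then have "d k b = d k a" using presents_eq[OF G] a b by blast
    then show ?thesis by (simp add: \<phi>_def b_def)
  qed
  have bij: "bij_betw (\<phi> k) (comp H k) (comp G k)" for k
  proof -
    have inj: "c k a = c k b" if "a \<in> cocyc k" "b \<in> cocyc k" "d k a = d k b" for a b
    proof -
      have "a - b \<in> cobound k" using that presents_eq[OF G] by blast
      then show ?thesis using that presents_eq[OF H] by blast
    qed
    have "inj_on (\<phi> k) (c k ` cocyc k)"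
    proof (rule inj_onI, elim imageE)
      fix x y a b assume *: "\<phi> k x = \<phi> k y" "x = c k a" "a \<in> cocyc k" "y = c k b" "b \<in> cocyc k"
      then have "d k a = d k b" using \<phi>[of a k] \<phi>[of b k] by simp
      from inj[OF *(3,5) this] show "x = y" unfolding *(2,4) .
    qed
    moreover have "\<phi> k ` c k ` cocyc k = d k ` cocyc k"
      unfolding image_image by (rule image_cong[OF refl]) (rule \<phi>)
    ultimately show ?thesis
      unfolding bij_betw_def presents_comp[OF H] presents_comp[OF G] by blast
  qed
  note comp = presents_comp[OF H]
  have add: "\<phi> k (gadd H k a b) = gadd G k (\<phi> k a) (\<phi> k b)" if "a \<in> comp H k" "b \<in> comp H k" for k a b
    using that unfolding comp
  proof (elim imageE)
    fix x y assume "a = c k x" "x \<in> cocyc k" "b = c k y" "y \<in> cocyc k"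
    then show ?thesis by (simp add: presents_add[OF H] presents_add[OF G] \<phi> cocyc_add)
  qed
  have scale: "\<phi> k (gscale H k r a) = gscale G k r (\<phi> k a)" if "a \<in> comp H k" for k r a
    using that unfolding comp
  proof (elim imageE)
    fix x assume "a = c k x" "x \<in> cocyc k"
    then show ?thesis by (simp add: presents_scale[OF H] presents_scale[OF G] \<phi> cocyc_scaleR)
  qed
  have mult: "\<phi> (k + l) (gmult H k l a b) = gmult G k l (\<phi> k a) (\<phi> l b)" if "a \<in> comp H k" "b \<in> comp H l" for k l a b
    using that unfolding comp
  proof (elim imageE)
    fix x y assume "a = c k x" "x \<in> cocyc k" "b = c l y" "y \<in> cocyc l"
    then show ?thesis by (simp add: presents_mult[OF H] presents_mult[OF G] \<phi> cocyc_mult)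
  qed
  have delta: "\<phi> (k - 1) (bv_delta H k a) = bv_delta G k (\<phi> k a)" if "a \<in> comp H k" for k a
    using that unfolding presents_comp0[OF H]
  proof (elim imageE)
    fix x assume x: "a = c k x" "x \<in> cocyc0 k"
    then have "x \<in> cocyc k" "bvop x \<in> cocyc (k - 1)" using cocyc0_bvop by (auto simp: cocyc0_def)
    then show ?thesis using x by (simp add: presents_delta[OF H] presents_delta[OF G] \<phi>)
  qed
  have one: "\<phi> 0 (gone H) = gone G"
    using \<phi>[OF cocyc_1] by (simp add: presents_one[OF H] presents_one[OF G])
  show ?thesis
    unfolding bv_isomorphic_def
    using presents_bv_algebra[OF H] presents_bv_algebra[OF G] bij add scale mult one delta by blast
qed

end

section \<open>Poisson cohomology as cohomology of polynomial polyvectors\<close>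

text \<open>Sides on which evaluation is bijective, that is, every polyderivation is given by a unique
  element of \<open>V\<close>. It is enough to compare values on generators.\<close>

locale full_side = poisson_side eps emb pr gen \<pi>
  for eps and emb :: "'b::{graded,ring_1} \<Rightarrow> 'n::{finite,linorder} forms" and pr gen and \<pi> +
  assumes ev_gen_0: "a \<in> hpart k \<Longrightarrow> (\<And>js. ev a (map gen js) = 0) \<Longrightarrow> a = 0"
    and ev_gen_ex: "P \<in> polyvectors k \<Longrightarrow> \<exists>a\<in>hpart k. \<forall>js. ev a (map gen js) = P (map gen js)"
begin

lemma ev_inj: "a \<in> hpart k \<Longrightarrow> ev a = 0 \<Longrightarrow> a = 0"
  by (rule ev_gen_0) auto

lemma ev_eq_iff: "a \<in> hpart k \<Longrightarrow> b \<in> hpart k \<Longrightarrow> ev a = ev b \<longleftrightarrow> a = b"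
  using ev_inj[of "a - b" k] by (auto simp: hpart_diff)

lemma ev_surj: "P \<in> polyvectors k \<Longrightarrow> \<exists>a\<in>hpart k. P = ev a"
  using ev_gen_ex polyvector_eqI ev_polyder by metis

lemma polyvectors_eq: "polyvectors k = ev ` hpart k"
  using ev_surj ev_polyder by auto

end

locale model_side = full_side eps emb pr gen \<pi> + diagonal_bv_model \<pi>
  for eps and emb :: "'b::{graded,ring_1} \<Rightarrow> 'n::{finite,linorder} forms" and pr gen and \<pi>
begin

lemma dl_0_iff: "dl a = 0 \<longleftrightarrow> schouten \<pi> a = 0"
proof -
  have "eps \<noteq> 0" using eps by (metis mult_zero_left zero_neq_one)
  then show ?thesis by (simp add: dl_def)
qed

lemma cocycles_eq: "cocycles br k = ev ` cocyc k"
proof -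
  have "coboundary br br k (ev a) = 0 \<longleftrightarrow> schouten \<pi> a = 0" if "a \<in> hpart k" for a
    using ev_inj[OF dl_hpart[OF that]] by (auto simp: coboundary_ev[OF that] simp flip: dl_0_iff)
  then show ?thesis
    by (auto simp: cocycles_def polyvectors_eq cocyc_def)
qed

lemma coboundaries_eq: "coboundaries br k = ev ` cobound k"
proof -
  have d: "dl ` hpart j = schouten \<pi> ` hpart j" for j
  proof -
    have "dl a = schouten \<pi> ((- eps) *\<^sub>R a)" "schouten \<pi> a = dl ((- eps) *\<^sub>R a)" for a
      by (simp_all add: dl_def)
    then show ?thesis using hpart_scaleR by blast
  qed
  have "coboundaries br k = ev ` dl ` hpart (k - 1)"
    unfolding coboundaries_def polyvectors_eq image_image
    by (rule image_cong[OF refl]) (rule coboundary_ev)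
  then show ?thesis by (simp add: cobound_def d)
qed

definition cls where "cls k a = HP_class br k (ev a)"

lemma cls_mem:
  assumes "a \<in> cocyc k"
  shows "cls k a = ev ` {b \<in> cocyc k. b - a \<in> cobound k}"
proof -
  have "ev b - ev a \<in> ev ` cobound k \<longleftrightarrow> b - a \<in> cobound k" if b: "b \<in> cocyc k" for b
  proof
    assume "ev b - ev a \<in> ev ` cobound k"
    then obtain r where r: "r \<in> cobound k" "ev (b - a) = ev r" by auto
    then have "b - a = r"
      using ev_eq_iff[of "b - a" k r] b assms cobound_cocyc[OF r(1)] by (auto simp: cocyc_def hpart_diff)
    then show "b - a \<in> cobound k" using r by simp
  next
    assume "b - a \<in> cobound k"
    then show "ev b - ev a \<in> ev ` cobound k" by (metis ev_simps(3) image_eqI)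
  qed
  then show ?thesis
    unfolding cls_def HP_class_def cocycles_eq coboundaries_eq by auto
qed

lemma cls_eq_iff:
  assumes "a \<in> cocyc k" "b \<in> cocyc k"
  shows "cls k a = cls k b \<longleftrightarrow> a - b \<in> cobound k"
proof
  assume eq: "cls k a = cls k b"
  have "ev a \<in> cls k a" unfolding cls_mem[OF assms(1)] using assms cobound_0 by simp
  then obtain c where c: "c \<in> cocyc k" "c - b \<in> cobound k" "ev a = ev c"
    unfolding eq cls_mem[OF assms(2)] by auto
  then have "a = c" using ev_eq_iff[of a k c] assms by (simp add: cocyc_def)
  then show "a - b \<in> cobound k" using c by simp
next
  assume d: "a - b \<in> cobound k"
  have "c - a \<in> cobound k \<longleftrightarrow> c - b \<in> cobound k" for c
    using cobound_add[OF _ d, of "c - a"] cobound_diff[OF _ d, of "c - b"] by auto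
  then show "cls k a = cls k b" unfolding cls_mem[OF assms(1)] cls_mem[OF assms(2)] by simp
qed

text \<open>The operations on cohomology are unions over all representatives; here they are evaluated when
  the result does not depend on the representative.\<close>

lemma cls_Union:
  assumes "a \<in> cocyc k"
    and "\<And>b. b \<in> cocyc k \<Longrightarrow> b - a \<in> cobound k \<Longrightarrow> F (ev b) = X"
  shows "(\<Union>P\<in>cls k a. F P) = X"
proof -
  have "a \<in> {b \<in> cocyc k. b - a \<in> cobound k}" using assms(1) cobound_0 by simp
  then have "{b \<in> cocyc k. b - a \<in> cobound k} \<noteq> {}" by blast
  then show ?thesis unfolding cls_mem[OF assms(1)] using assms(2) by auto
qed

lemma cls_gadd:
  assumes "a \<in> cocyc k" "b \<in> cocyc k"
  shows "(\<Union>P\<in>cls k a. \<Union>Q\<in>cls k b. HP_class br k (P + Q)) = cls k (a + b)"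
proof (intro cls_Union assms)
  fix a' b' assume *: "a' \<in> cocyc k" "a' - a \<in> cobound k" "b' \<in> cocyc k" "b' - b \<in> cobound k"
  have "(a' - a) + (b' - b) \<in> cobound k" using * by (intro cobound_add)
  then have "a' + b' - (a + b) \<in> cobound k" by (simp add: algebra_simps)
  then have "cls k (a' + b') = cls k (a + b)" using * assms by (subst cls_eq_iff) (auto intro: cocyc_add)
  then show "HP_class br k (ev a' + ev b') = cls k (a + b)" by (simp add: cls_def)
qed

lemma cls_gscale:
  assumes "a \<in> cocyc k"
  shows "(\<Union>P\<in>cls k a. HP_class br k (r *\<^sub>R P)) = cls k (r *\<^sub>R a)"
proof (intro cls_Union assms)
  fix a' assume *: "a' \<in> cocyc k" "a' - a \<in> cobound k"
  then obtain s where "s \<in> hpart (k - 1)" "a' - a = schouten \<pi> s" by (auto simp: cobound_def)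
  then have "r *\<^sub>R a' - r *\<^sub>R a = schouten \<pi> (r *\<^sub>R s)" "r *\<^sub>R s \<in> hpart (k - 1)"
    by (auto simp flip: scaleR_diff_right intro: hpart_scaleR)
  then have "r *\<^sub>R a' - r *\<^sub>R a \<in> cobound k" unfolding cobound_def by blast
  then have "cls k (r *\<^sub>R a') = cls k (r *\<^sub>R a)" using * assms by (subst cls_eq_iff) (auto intro: cocyc_scaleR)
  then show "HP_class br k (r *\<^sub>R ev a') = cls k (r *\<^sub>R a)" by (simp add: cls_def)
qed

lemma cls_gmult:
  assumes "a \<in> cocyc k" "b \<in> cocyc l"
  shows "(\<Union>P\<in>cls k a. \<Union>Q\<in>cls l b. HP_class br (k + l) (wedge (*) k l P Q)) = cls (k + l) (a * b)"
proof (intro cls_Union assms)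
  fix a' b' assume *: "a' \<in> cocyc k" "a' - a \<in> cobound k" "b' \<in> cocyc l" "b' - b \<in> cobound l"
  obtain r where r: "r \<in> hpart (k - 1)" "a' - a = schouten \<pi> r" using * by (auto simp: cobound_def)
  obtain s where s: "s \<in> hpart (l - 1)" "b' - b = schouten \<pi> s" using * by (auto simp: cobound_def)
  have h: "a \<in> hpart k" "b' \<in> hpart l" "schouten \<pi> a = 0" "schouten \<pi> b' = 0"
    using assms * by (auto simp: cocyc_def)
  have "schouten \<pi> (r * b' + ksgn k *\<^sub>R (a * s)) = (a' - a) * b' + a * (b' - b)"
    using h r s by (simp add: schouten_mult_right[OF pi2 r(1)] schouten_mult_right[OF pi2 h(1)] ksgn_def)
  also have "\<dots> = a' * b' - a * b" by (simp add: algebra_simps)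
  finally have "a' * b' - a * b = schouten \<pi> (r * b' + ksgn k *\<^sub>R (a * s))" ..
  moreover have "r * b' + ksgn k *\<^sub>R (a * s) \<in> hpart (k + l - 1)"
    using hpart_mult[OF r(1) h(2)] hpart_mult[OF h(1) s(1)]
    by (intro hpart_add hpart_scaleR) (simp_all add: algebra_simps)
  ultimately have "a' * b' - a * b \<in> cobound (k + l)" unfolding cobound_def by blast
  then have "cls (k + l) (a' * b') = cls (k + l) (a * b)" using * assms by (subst cls_eq_iff) (auto intro: cocyc_mult)
  then show "HP_class br (k + l) (wedge (*) k l (ev a') (ev b')) = cls (k + l) (a * b)"
    using wedge_ev[of a' k b' l] * by (simp add: cls_def cocyc_def)
qed

text \<open>If \<open>T\<close> identifies \<open>V\<close> with a twisted complex in such a way that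
  weight-zero cycles, boundaries and the operator \<open>D\<close> correspond to those of
  \<open>V\<close>, then the transported operator is \<open>bvop\<close> on representatives of
  weight zero. It does not depend on the choices by \<open>bvop_cobound\<close>.\<close>

lemma cls_transport:
  fixes T :: "'n forms \<Rightarrow> 't::real_vector"
  assumes \<iota>: "\<And>k b. b \<in> hpart k \<Longrightarrow> \<iota> (ev b) = T b"
    and T_diff: "\<And>b c. T (b - c) = T b - T c"
    and T_inj: "\<And>k b c. b \<in> hpart k \<Longrightarrow> c \<in> hpart k \<Longrightarrow> T b = T c \<Longrightarrow> b = c"
    and W: "\<And>k. W k = T ` cocyc0 k" and B: "\<And>k. B k = T ` cobound k"
    and D: "\<And>k b. b \<in> hpart k \<Longrightarrow> D (T b) = T (bvop b)"
    and a: "a \<in> cocyc0 k"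
  shows "transport br \<iota> W B D k (cls k a) = cls (k - 1) (bvop a)"
proof -
  have ac: "a \<in> cocyc k" using a by (simp add: cocyc0_def)
  have da: "bvop a \<in> cocyc (k - 1)" using cocyc0_bvop[OF a] by (simp add: cocyc0_def)
  have TB: "T b - T c \<in> B j \<longleftrightarrow> b - c \<in> cobound j" if "b \<in> hpart j" "c \<in> hpart j" for b c j
  proof
    assume "T b - T c \<in> B j"
    then obtain r where r: "r \<in> cobound j" "T (b - c) = T r" unfolding B by (auto simp: T_diff)
    then have "b - c = r"
      using cobound_cocyc[OF r(1)] by (intro T_inj[of _ j]) (auto simp: cocyc_def hpart_diff that)
    then show "b - c \<in> cobound j" using r by simp
  qed (auto simp: B simp flip: T_diff)
  let ?S = "{HP_class br (k - 1) Q | Q P \<omega>. Q \<in> cocycles br (k - 1) \<and> P \<in> cls k a \<and> \<omega> \<in> W k \<and>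
        \<omega> - \<iota> P \<in> B k \<and> \<iota> Q - D \<omega> \<in> B (k - 1)}"
  have "?S = {cls (k - 1) (bvop a)}"
  proof (intro equalityI subsetI)
    fix X assume "X \<in> ?S"
    then obtain Q P \<omega> where X: "X = HP_class br (k - 1) Q" "Q \<in> cocycles br (k - 1)" "P \<in> cls k a" "\<omega> \<in> W k"
      "\<omega> - \<iota> P \<in> B k" "\<iota> Q - D \<omega> \<in> B (k - 1)" by blast
    obtain q where q: "q \<in> cocyc (k - 1)" "Q = ev q" using X(2) by (auto simp: cocycles_eq)
    obtain p where p: "p \<in> cocyc k" "p - a \<in> cobound k" "P = ev p" using X(3) by (auto simp: cls_mem[OF ac])
    obtain w where w: "w \<in> cocyc0 k" "\<omega> = T w" using X(4) by (auto simp: W)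
    have wh: "w \<in> hpart k" "p \<in> hpart k" "q \<in> hpart (k - 1)" "bvop w \<in> hpart (k - 1)"
      using w(1) p(1) q(1) by (auto simp: cocyc0_def cocyc_def intro: hpart_bvop)
    have "w - p \<in> cobound k" using X(5) unfolding w(2) p(3) \<iota>[OF wh(2)] TB[OF wh(1,2)] .
    from cobound_add[OF this p(2)] have wa: "w - a \<in> cobound k" by simp
    have "bvop (w - a) \<in> cobound (k - 1)"
      by (rule bvop_cobound[OF wa]) (use w(1) a in \<open>simp add: cocyc0_def linear_diff[OF linear_wt]\<close>)
    moreover have "q - bvop w \<in> cobound (k - 1)"
      using X(6) unfolding w(2) q(2) \<iota>[OF wh(3)] D[OF wh(1)] TB[OF wh(3,4)] .
    ultimately have "q - bvop a \<in> cobound (k - 1)" using cobound_add by fastforce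
    then have "cls (k - 1) q = cls (k - 1) (bvop a)" using cls_eq_iff[OF q(1) da] by simp
    then show "X \<in> {cls (k - 1) (bvop a)}" using X(1) q(2) by (simp add: cls_def)
  next
    fix X assume "X \<in> {cls (k - 1) (bvop a)}"
    then have X: "X = HP_class br (k - 1) (ev (bvop a))" by (simp add: cls_def)
    have h: "a \<in> hpart k" "bvop a \<in> hpart (k - 1)" using ac da by (auto simp: cocyc_def)
    have 1: "ev (bvop a) \<in> cocycles br (k - 1)" using da by (simp add: cocycles_eq)
    have 2: "ev a \<in> cls k a" unfolding cls_mem[OF ac] using ac cobound_0 by simp
    have 3: "T a \<in> W k" using a by (simp add: W)
    have 4: "T a - \<iota> (ev a) \<in> B k" using cobound_0 unfolding \<iota>[OF h(1)] TB[OF h(1) h(1)] by simp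
    have 5: "\<iota> (ev (bvop a)) - D (T a) \<in> B (k - 1)"
      using cobound_0 unfolding \<iota>[OF h(2)] D[OF h(1)] TB[OF h(2) h(2)] by simp
    show "X \<in> ?S" unfolding mem_Collect_eq using X 1 2 3 4 5 by blast
  qed
  then show ?thesis unfolding transport_def by simp
qed

theorem HP_presents:
  assumes "\<And>k a. a \<in> cocyc0 k \<Longrightarrow> \<Delta> k (cls k a) = cls (k - 1) (bvop a)"
  shows "presents cls (HP br \<Delta>)"
proof -
  have "HP_class br k ` cocycles br k = cls k ` cocyc k" for k
    by (simp add: cocycles_eq image_image cls_def)
  moreover have "HP_class br k 0 = cls k 0" for k by (simp add: cls_def)
  moreover have "HP_class br 0 (scalar_pv 1) = cls 0 1"
    using ev_scalar[OF homogeneousI[OF gr_1]] by (simp add: cls_def)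
  ultimately show ?thesis
    unfolding presents_def HP_def bv_structure.simps
    using cls_eq_iff cls_gadd cls_gscale cls_gmult assms by simp
qed

end

section \<open>The polynomial algebra\<close>

text \<open>The common source of the bivectors of \<open>A\<close> and \<open>A\<^sup>!\<close>
  (\<open>pi_A_eq\<close>, \<open>pi_K_eq\<close>).\<close>

definition piV :: "'n::{finite,linorder} quad \<Rightarrow> 'n forms"
  where "piV c = (\<Sum>i1\<in>UNIV. \<Sum>i2\<in>UNIV. \<Sum>j1\<in>UNIV. \<Sum>j2\<in>UNIV.
    c i1 i2 j1 j2 *\<^sub>R (econst (var i1 * var i2) * (egen j1 * egen j2)))"

lemma piV_hpart: "piV c \<in> hpart 2"
proof -
  have "econst (var i1 * var i2) * (egen j1 * egen j2) \<in> hpart (0 + (1 + 1))" for i1 i2 j1 j2 :: 'a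
    by (intro hpart_mult) auto
  then show ?thesis unfolding piV_def by (intro hpart_sum hpart_scaleR) simp
qed

lemma eq_minus_self:
  assumes "x = - x" shows "x = (0 :: 'v::real_vector)"
proof -
  have "(2 :: real) *\<^sub>R x = x + x" by (rule scaleR_2)
  also have "\<dots> = x + - x" by (rule arg_cong[OF assms])
  finally show ?thesis by simp
qed

text \<open>Whether a property of lists that is invariant under adjacent transpositions holds for a list
  depends only on the multiset of its entries.\<close>

lemma skew_sort:
  assumes "\<And>xs a b ys. R (xs @ b # a # ys) \<longleftrightarrow> R (xs @ a # b # ys)"
  shows "R (xs @ sort ys) \<longleftrightarrow> R (xs @ ys)"
proof -
  have ins: "R (xs @ insort a zs) \<longleftrightarrow> R (xs @ a # zs)" for xs a zs
  proof (induction zs arbitrary: xs)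
    case (Cons z zs)
    show ?case
      using Cons.IH[of "xs @ [z]"] assms[of xs z a zs] by simp
  qed simp
  show ?thesis
  proof (induction ys arbitrary: xs)
    case (Cons y ys)
    show ?case using Cons.IH[of "xs @ [y]"] ins[of xs y "sort ys"] by simp
  qed simp
qed

lemma ecoeff_0_mult [simp]: "ecoeff (a * b) {} = ecoeff a {} * ecoeff b {}"
  for a b :: "('i::{finite,linorder}, 'r::comm_ring_1) ext"
  by (simp add: times_ext_def inversions_def)

lemma gr_poly [simp]: "f \<in> gr 0" "homogeneous f" "hdeg f = 0" for f :: "'n poly"
proof -
  show 0: "f \<in> gr 0" by (simp add: gr_poly_mapping_def)
  then show "homogeneous f" by (auto simp: homogeneous_def)
  have "(THE d. f \<in> gr d) = 0" if "f \<noteq> 0"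
    by (rule the_equality) (use 0 that in \<open>auto simp: gr_poly_mapping_def split: if_splits\<close>)
  then show "hdeg f = 0" by (simp add: hdeg_def)
qed

lemma degs_poly [simp]: "degs fs = 0" for fs :: "'n poly list"
  by (induction fs) simp_all

lemma ecoeff_econst_empty [simp]: "ecoeff (econst p) {} = p"
  by (simp add: econst_def)

lemma fold_schouten_econst_hpart:
  "a \<in> hpart k \<Longrightarrow> fold (\<lambda>f a. (-1) *\<^sub>R schouten (par a) (econst f)) fs a \<in> hpart (k - int (length fs))"
proof (induction fs arbitrary: a k)
  case (Cons f fs)
  have "schouten (par a) (econst f) \<in> hpart (k + 0 - 1)"
    using Cons.prems by (intro hpart_schouten par_hpart_mem) auto
  then have "fold (\<lambda>f a. (-1) *\<^sub>R schouten (par a) (econst f)) fs ((-1) *\<^sub>R schouten (par a) (econst f))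
      \<in> hpart (k - 1 - int (length fs))"
    by (intro Cons.IH hpart_scaleR) simp
  then show ?case by (simp add: algebra_simps)
qed simp

definition scalar_part :: "('n, 'n poly) ext \<Rightarrow> 'n poly"
  where "scalar_part a = ecoeff a {}"

interpretation A: polyvector_side "-1" "econst :: _ \<Rightarrow> 'n::{finite,linorder} forms" scalar_part var
proof (rule polyvector_side.intro)
  show "linear (econst :: _ \<Rightarrow> 'n forms)"
    by (rule linearI) (simp_all add: econst_add econst_scaleR)
  show "linear (scalar_part :: 'n forms \<Rightarrow> _)"
    by (rule linearI) (simp_all add: scalar_part_def)
  show "f \<in> gr d \<longleftrightarrow> (econst f :: 'n forms) \<in> hpart (- d)" for f d
    by (auto simp: gr_poly_mapping_def hpart_def econst_def)
  show "econst (scalar_part a) \<in> (hpart k :: 'n forms set)" if "a \<in> hpart k" for a :: "'n forms" and k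
    using that by (auto simp: hpart_def econst_def scalar_part_def)
  show "schouten (econst f) (econst g :: 'n forms) = 0" for f g
    by (simp add: schouten_def)
  show "\<exists>N. \<forall>fs. N < length fs \<longrightarrow>
      scalar_part (fold (\<lambda>f a. (-1) *\<^sub>R schouten (par a) (econst f)) fs a) = 0"
    if "a \<in> hpart k" for a :: "'n forms" and k
  proof (intro exI[of _ "nat k"] allI impI)
    fix fs :: "'n poly list" assume "nat k < length fs"
    then have "fold (\<lambda>f a. (-1) *\<^sub>R schouten (par a) (econst f)) fs a = 0"
      by (intro hpart_negative[OF fold_schouten_econst_hpart[OF that]]) linarith
    then show "scalar_part (fold (\<lambda>f a. (-1) *\<^sub>R schouten (par a) (econst f)) fs a) = 0"
      by (simp only: scalar_part_def ecoeff_simps)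
  qed
  show "Q f" if "\<And>r. Q (r *\<^sub>R 1)" "\<And>j a. homogeneous a \<Longrightarrow> Q a \<Longrightarrow> Q (var j * a)"
    "\<And>d a b. a \<in> gr d \<Longrightarrow> b \<in> gr d \<Longrightarrow> Q a \<Longrightarrow> Q b \<Longrightarrow> Q (a + b)" for Q and f :: "'n poly"
    using that(1,2) that(3)[of _ 0, OF gr_poly(1) gr_poly(1)]
    by (induction f rule: poly_induct) (auto simp: scaleR_poly_eq)
qed (simp_all add: econst_mult scalar_part_def)

lemma A_ins: "A.ins f a = (\<Sum>j\<in>UNIV. econst (pd j f) * contract j a)"
  by (simp add: A.ins_def schouten_def par_contract[of _ "par a"] sum_negf econst_commute[of "contract j a" for j])

lemma A_ins_var: "A.ins (var j) a = contract j a"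
proof -
  have "A.ins (var j) a = (\<Sum>i\<in>UNIV. if i = j then contract j a else 0)"
    unfolding A_ins by (rule sum.cong) (auto simp: pd_var)
  then show ?thesis by simp
qed

lemma A_fold_ins_var: "fold A.ins (map var js) a = fold contract js a"
  by (induction js arbitrary: a) (simp_all add: A_ins_var)

lemma A_ev_var: "A.ev a (map var js) = ecoeff (fold contract js a) {}"
  by (simp add: A.ev_def A_fold_ins_var scalar_part_def)

lemma ecoeff_fold_contract:
  "sorted js \<Longrightarrow> distinct js \<Longrightarrow> ecoeff (fold contract js a) {} = ecoeff a (set js)"
  for a :: "('i::{finite,linorder}, 'r::comm_ring_1) ext"
proof (induction js arbitrary: a)
  case (Cons j js)
  have "{s \<in> set js. s < j} = {}" using Cons.prems by auto
  then have "below j (set js) = 0" unfolding below_def by simp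
  then show ?case using Cons by (simp add: ecoeff_contract)
qed simp

lemma A_ev_sorted: "A.ev a (map var (sorted_list_of_set S)) = ecoeff a S"
  for a :: "'n::{finite,linorder} forms"
  by (simp add: A_ev_var ecoeff_fold_contract)

text \<open>The coefficients of the polyvector are the values on increasing lists of variables. By skew
  symmetry these determine the values on all lists of variables, those with repetitions being
  zero.\<close>

lemma A_ev_ex:
  fixes P :: "'n::{finite,linorder} poly list \<Rightarrow> 'n poly"
  assumes P: "P \<in> polyvectors k"
  shows "\<exists>a\<in>hpart k. \<forall>js. A.ev a (map var js) = P (map var js)"
proof -
  define a :: "'n forms" where "a = Ext (\<lambda>S. P (map var (sorted_list_of_set S)))"
  have gr: "P fs \<in> gr (int (length fs) - k + degs fs)" for fs
    using P unfolding polyder_def by simp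
  have a: "a \<in> hpart k"
  proof -
    have "int (card S) = k" if "P (map var (sorted_list_of_set S)) \<noteq> 0" for S :: "'n set"
    proof -
      show ?thesis
        using gr[of "map var (sorted_list_of_set S)"] that by (auto simp: gr_poly_mapping_def o_def split: if_splits)
    qed
    then show ?thesis by (simp add: a_def hpart_def)
  qed
  have skew: "Q (fs @ g # f # gs) = - Q (fs @ f # g # gs)" if "Q \<in> polyvectors k"
    for fs gs f g and Q :: "'n poly list \<Rightarrow> 'n poly"
    by (rule trans[OF polyder_skew[OF that]]) simp
  have rep: "Q (fs @ f # f # gs) = 0" if "Q \<in> polyvectors k"
    for fs gs f and Q :: "'n poly list \<Rightarrow> 'n poly"
    by (rule eq_minus_self) (rule skew[OF that])
  note E = A.ev_polyder[OF a]
  define R where "R js \<longleftrightarrow> A.ev a (map var js) = P (map var js)" for js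
  have swap: "R (xs @ y # x # ys) \<longleftrightarrow> R (xs @ x # y # ys)" for xs x y ys
    using skew[OF E, of "map var xs" "var y" "var x" "map var ys"] skew[OF P, of "map var xs" "var y" "var x" "map var ys"]
    by (simp add: R_def)
  have "R js" for js
  proof -
    have s: "R (sort js)"
    proof (cases "distinct js")
      case True
      have "sort js = sorted_list_of_set (set js)"
        using True by (simp add: sorted_list_of_set_sort_remdups distinct_remdups_id)
      then show ?thesis by (simp add: R_def A_ev_sorted a_def)
    next
      case False
      then obtain xs x ys where d: "sort js = xs @ x # x # ys"
      proof -
        assume *: "\<And>xs x ys. sort js = xs @ x # x # ys \<Longrightarrow> thesis"
        have "\<not> distinct zs \<Longrightarrow> sorted zs \<Longrightarrow> \<exists>xs x ys. zs = xs @ x # x # ys" for zs :: "'n list"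
        proof (induction zs)
          case (Cons z zs)
          show ?case
          proof (cases "distinct zs")
            case True
            then have "z \<in> set zs" using Cons.prems by simp
            then obtain u us where u: "zs = u # us" by (cases zs) auto
            then have "z = u" using Cons.prems \<open>z \<in> set zs\<close> by (auto intro: order.antisym)
            then show ?thesis using u by (intro exI[of _ "[]"]) auto
          next
            case False
            then obtain xs x ys where "zs = xs @ x # x # ys" using Cons by auto
            then show ?thesis by (intro exI[of _ "z # xs"]) auto
          qed
        qed simp
        then show thesis using * False by (metis distinct_sort sorted_sort)
      qed
      show ?thesis unfolding d R_def using rep[OF E] rep[OF P] by simp
    qed
    show ?thesis using skew_sort[of R "[]" js] swap s by simp
  qed
  then show ?thesis using a unfolding R_def by blast
qed

lemma A_ev_egen: "A.ev (egen j) = vector_pv (pd j)"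
proof
  fix fs :: "'a poly list"
  have f: "A.ins f (egen j) = econst (pd j f)" for f :: "'a poly"
  proof -
    have "A.ins f (egen j) = (\<Sum>i\<in>UNIV. if i = j then econst (pd j f) else 0)"
      unfolding A_ins by (rule sum.cong) (auto simp: contract_egen)
    then show ?thesis by simp
  qed
  show "A.ev (egen j) fs = vector_pv (pd j) fs"
  proof (cases fs)
    case Nil
    then show ?thesis by (simp add: A.ev_def vector_pv_def egen_def scalar_part_def)
  next
    case (Cons f gs)
    then show ?thesis
      by (cases gs) (simp_all add: A.ev_Cons A.ev_Nil f vector_pv_def A.ins_emb)
  qed
qed

lemma pi_A_eq: "pi_A c = A.ev (piV c)"
proof -
  have "wedge (*) 0 2 (scalar_pv (var i1 * var i2)) (wedge (*) 1 1 (vector_pv (pd j1)) (vector_pv (pd j2)))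
      = A.ev (econst (var i1 * var i2) * (egen j1 * egen j2))" for i1 i2 j1 j2 :: 'a
  proof -
    have "wedge (*) 1 1 (vector_pv (pd j1)) (vector_pv (pd j2)) = A.ev (egen j1 * egen j2)"
      by (simp add: A.wedge_ev flip: A_ev_egen)
    moreover have "egen j1 * egen j2 \<in> (hpart 2 :: 'a forms set)"
      using hpart_mult[OF hpart_egen hpart_egen, of j1 j2] by simp
    ultimately show ?thesis
      using A.wedge_ev[OF hpart_econst, of "egen j1 * egen j2" 2 "var i1 * var i2"] by (simp add: A.ev_scalar)
  qed
  moreover have "A.ev (sum g X) = (\<Sum>x\<in>X. A.ev (g x))" for g :: "'a \<Rightarrow> 'a forms" and X
    by (induction X rule: infinite_finite_induct) auto
  ultimately show ?thesis by (simp add: pi_A_def piV_def)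
qed

interpretation A: poisson_side "-1" "econst :: _ \<Rightarrow> 'n::{finite,linorder} forms" scalar_part var "piV c" for c
proof
  have z: "ecoeff a {} = 0" if "a \<in> hpart k" "k \<noteq> 0" for a :: "'n forms" and k
    using that by (auto simp: hpart_def)
  have z1: "ecoeff (contract j (piV c)) {} = 0" for j :: 'n
    using hpart_contract[OF piV_hpart] by (rule z) simp
  have z2: "ecoeff (pdx j (piV c)) {} = 0" for j :: 'n
    using hpart_pdx[OF piV_hpart] by (rule z) simp
  show "scalar_part (schouten (piV c) a) = 0" for a
    using z1 z2 by (simp add: schouten_def ecoeff_sum par_def scalar_part_def)
  show "econst (scalar_part (A.ins g (A.ins f (piV c)))) = A.ins g (A.ins f (piV c))" for f g :: "'n poly"
  proof -
    have "A.ins g (A.ins f (piV c)) \<in> hpart (2 - 0 - 1 - 0 - 1)"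
      by (intro A.ins_hpart piV_hpart gr_poly)
    then have "A.ins g (A.ins f (piV c)) \<in> hpart 0" by simp
    from hpart_0_econst[OF this] show ?thesis by (simp add: scalar_part_def)
  qed
  show "scalar_part (schouten (A.ins f (piV c)) a) = scalar_part (schouten (A.ins f (piV c)) (econst (scalar_part a)))"
    for f :: "'n poly" and a
  proof -
    have "A.ins f (piV c) \<in> hpart (2 - 0 - 1)" by (intro A.ins_hpart piV_hpart gr_poly)
    then have "ecoeff (pdx j (A.ins f (piV c))) {} = 0" for j by (intro z[OF hpart_pdx]) auto
    then show ?thesis by (simp add: schouten_def ecoeff_sum scalar_part_def)
  qed
qed (rule piV_hpart)

interpretation A: full_side "-1" "econst :: _ \<Rightarrow> 'n::{finite,linorder} forms" scalar_part var "piV c" for c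
proof
  show "a = 0" if "a \<in> hpart k" "\<And>js. A.ev a (map var js) = 0" for a :: "'n forms" and k
    using that(2) by (intro ext_eqI) (simp flip: A_ev_sorted)
qed (rule A_ev_ex)

lemma br_A_eq: "br_A c = bracket_of (A.ev (piV c))"
  by (simp add: pi_A_eq)

lemma A_dl: "A.dl c a = schouten (piV c) a"
  by (simp add: A.dl_def)

text \<open>The element \<open>[\<pi>, \<pi>]\<close> is determined by its values on three variables, and
  there it is twice the Jacobiator.\<close>

lemma master_eq:
  assumes "poisson_bracket (br_A c)"
  shows "schouten (piV c) (piV c) = 0"
proof -
  let ?d = "schouten (piV c) (piV c)" and ?b = "br_A c"
  have d3: "?d \<in> hpart 3" using hpart_schouten[OF piV_hpart[of c] piV_hpart[of c]] by simp
  show ?thesis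
  proof (rule A.ev_gen_0[OF d3])
    fix js
    show "A.ev ?d (map var js) = 0"
    proof (cases "length js = 3")
      case False
      then show ?thesis
        using A.ev_gr[OF d3, of "map var js"] False by (simp add: gr_poly_mapping_def o_def)
    next
      case True
      then obtain i j k where js: "js = [i, j, k]"
        by (auto simp: numeral_3_eq_3 length_Suc_conv)
      let ?x = "var i" and ?y = "var j" and ?z = "var k"
      have anti: "?b f g = - ?b g f" and jac: "?b f (?b g h) + ?b g (?b h f) + ?b h (?b f g) = 0" for f g h
        using assms unfolding poisson_bracket_def by blast+
      have neg: "?b f (- g) = - ?b f g" for f g
      proof -
        have add: "?b f (u + v) = ?b f u + ?b f v" for u v using assms unfolding poisson_bracket_def by blast
        have "?b f 0 = 0" using add[of 0 0] by simp
        then have "?b f g + ?b f (- g) = 0" using add[of g "- g"] by simp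
        then show ?thesis by (simp add: add_eq_0_iff)
      qed
      have e: "A.ev (piV c) [f, g] = ?b f g" for f g by (simp add: bracket_of_def pi_A_eq)
      have "A.ev ?d [?x, ?y, ?z] = coboundary ?b ?b 2 (A.ev (piV c)) [?x, ?y, ?z]"
        using A.coboundary_ev[OF piV_hpart[of c], of c] by (simp add: A_dl pi_A_eq)
      also have "\<dots> = ?b ?x (?b ?y ?z) - ?b ?y (?b ?x ?z) + ?b ?z (?b ?x ?y)
          - ?b (?b ?x ?y) ?z + ?b (?b ?x ?z) ?y - ?b (?b ?y ?z) ?x"
        by (simp add: coboundary_def lessThan_Suc nths_Cons e ksgn_def numeral_3_eq_3 numeral_2_eq_2)
      also have "\<dots> = 2 * (?b ?x (?b ?y ?z) + ?b ?y (?b ?z ?x) + ?b ?z (?b ?x ?y))"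
        using anti[of "?b ?x ?y" ?z] anti[of "?b ?x ?z" ?y] anti[of "?b ?y ?z" ?x] anti[of ?x ?z] neg[of ?y "?b ?z ?x"]
        by simp
      also have "\<dots> = 0" by (simp add: jac)
      finally show ?thesis by (simp add: js)
    qed
  qed
qed

section \<open>Differential forms on affine space\<close>

definition star_basis :: "'n::{finite,linorder} set \<Rightarrow> 'n forms"
  where "star_basis S = foldr contract (sorted_list_of_set S) volume"

text \<open>Contracting the volume form with the coordinate vector fields in \<open>S\<close> leaves the
  product of the remaining coordinate differentials, up to this sign.\<close>

definition star_sign :: "'n::{finite,linorder} set \<Rightarrow> 'n poly"
  where "star_sign S = ecoeff (star_basis S) (- S)"

text \<open>Contraction of a polyvector with the volume form, as an operator on \<open>V\<close>: the type
  of differential forms is the type of polyvectors, and \<open>\<theta>\<^sub>j\<close> on the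
  side of forms is the differential of \<open>x\<^sub>j\<close>.\<close>

definition star :: "'n::{finite,linorder} forms \<Rightarrow> 'n forms"
  where "star a = (\<Sum>S\<in>UNIV. econst (ecoeff a S) * star_basis S)"

lemma iota_A_ev: "iota_A (A.ev a) = star a"
  by (simp add: iota_A_def star_def Let_def A_ev_sorted star_basis_def)

lemma foldr_contract_volume:
  "distinct js \<Longrightarrow> \<exists>s :: 'n poly. (s = 1 \<or> s = - 1) \<and>
    foldr contract js volume = Ext (\<lambda>T. if T = - set js then s else 0)"
  for js :: "'n::{finite,linorder} list"
proof (induction js)
  case Nil
  then show ?case by (auto simp: volume_def intro!: exI[of _ 1])
next
  case (Cons j js)
  then obtain s :: "'n poly" where s: "s = 1 \<or> s = - 1"
    "foldr contract js volume = Ext (\<lambda>T. if T = - set js then s else 0)" by auto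
  have i: "insert j T = - set js \<longleftrightarrow> T = - set (j # js)" if "j \<notin> T" for T
    using that Cons.prems by auto
  have "foldr contract (j # js) volume = Ext (\<lambda>T. if T = - set (j # js) then (-1) ^ below j (- set (j # js)) * s else 0)"
    by (rule ext_eqI) (auto simp: s(2) ecoeff_contract i)
  moreover have "(-1) ^ below j (- set (j # js)) * s = 1 \<or> (-1) ^ below j (- set (j # js)) * s = - 1"
    using s(1) by (cases "even (below j (- set (j # js)))") auto
  ultimately show ?case by blast
qed

lemma star_sign: "star_sign S = 1 \<or> star_sign S = - 1"
  and ecoeff_star_basis: "ecoeff (star_basis S) T = (if T = - S then star_sign S else 0)"
proof -
  obtain s :: "'a poly" where s: "s = 1 \<or> s = - 1"
    "star_basis S = Ext (\<lambda>T. if T = - S then s else 0)"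
    using foldr_contract_volume[of "sorted_list_of_set S"] by (auto simp: star_basis_def)
  then have "star_sign S = s" by (simp add: star_sign_def)
  then show "star_sign S = 1 \<or> star_sign S = - 1" "ecoeff (star_basis S) T = (if T = - S then star_sign S else 0)"
    using s by auto
qed

lemma star_sign_simps [simp]: "star_sign S * star_sign S = 1" "star_sign S * (star_sign S * p) = p"
  "p * star_sign S * star_sign S = p" "pd i (p * star_sign S) = pd i p * star_sign S"
  using star_sign[of S] by auto

lemma ecoeff_star: "ecoeff (star a) T = ecoeff a (- T) * star_sign (- T)"
proof -
  have "ecoeff (star a) T = (\<Sum>S\<in>UNIV. if S = - T then ecoeff a (- T) * star_sign (- T) else 0)"
    unfolding star_def ecoeff_sum by (rule sum.cong) (auto simp: ecoeff_star_basis)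
  then show ?thesis by simp
qed

lemma star_simps [simp]: "star 0 = 0" "star (a + b) = star a + star b" "star (a - b) = star a - star b"
  "star (- a) = - star a" "star (r *\<^sub>R a) = r *\<^sub>R star a" "star (econst p * a) = econst p * star a"
  by (auto intro!: ext_eqI simp: ecoeff_star algebra_simps)

lemma linear_star: "linear star"
  by (rule linearI) simp_all

lemma star_sum: "star (sum f A) = (\<Sum>x\<in>A. star (f x))"
  by (rule linear_sum[OF linear_star])

lemma star_inj: "star a = star b \<Longrightarrow> a = b"
proof (rule ext_eqI)
  fix S assume "star a = star b"
  then have "ecoeff (star a) (- S) * star_sign S = ecoeff (star b) (- S) * star_sign S" by simp
  then show "ecoeff a S = ecoeff b S" by (simp add: ecoeff_star)
qed

lemma star_surj: "\<exists>a. w = star a"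
  by (rule exI[of _ "Ext (\<lambda>S. ecoeff w (- S) * star_sign S)"]) (rule ext_eqI, simp add: ecoeff_star)

lemma star_hpart: "star a \<in> hpart (int CARD('n) - k) \<longleftrightarrow> a \<in> hpart k"
  for a :: "'n::{finite,linorder} forms"
proof -
  have c: "int (card (- T)) = int CARD('n) - int (card T)" for T :: "'n set"
    by (simp add: Compl_eq_Diff_UNIV card_Diff_subset of_nat_diff card_mono)
  have z: "ecoeff (star a) T = 0 \<longleftrightarrow> ecoeff a (- T) = 0" for T
    using star_sign[of "- T"] by (auto simp: ecoeff_star)
  have "star a \<in> hpart (int CARD('n) - k) \<longleftrightarrow> (\<forall>T. ecoeff a (- T) \<noteq> 0 \<longrightarrow> int (card (- T)) = k)"
    unfolding hpart_def mem_Collect_eq z c by auto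
  also have "\<dots> \<longleftrightarrow> a \<in> hpart k"
    unfolding hpart_def mem_Collect_eq by (metis double_compl)
  finally show ?thesis .
qed

lemma star_image_hpart: "star ` hpart k = (hpart (int CARD('n) - k) :: 'n::{finite,linorder} forms set)"
proof -
  have "w \<in> star ` hpart k" if "w \<in> hpart (int CARD('n) - k)" for w :: "'n forms"
    using star_surj[of w] that by (auto simp: star_hpart)
  then show ?thesis by (auto simp: star_hpart)
qed

lemma contract_foldr_contract:
  "sorted js \<Longrightarrow> distinct js \<Longrightarrow> j \<notin> set js \<Longrightarrow>
    contract j (foldr contract js v) = (-1) ^ below j (set js) *\<^sub>R foldr contract (insort j js) v"
  for v :: "'n::{finite,linorder} forms"
proof (induction js)
  case Nil
  then show ?case by (simp add: below_def)
next
  case (Cons a js)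
  show ?case
  proof (cases "j \<le> a")
    case True
    then have "{s \<in> set (a # js). s < j} = {}" using Cons.prems by auto
    then have "below j (set (a # js)) = 0" unfolding below_def by simp
    then show ?thesis using True by simp
  next
    case False
    then have "below j (set (a # js)) = Suc (below j (set js))"
      using Cons.prems by (simp add: below_insert)
    then show ?thesis
      using False Cons by (simp add: contract_anticommute[of j a])
  qed
qed

lemma contract_star_basis:
  assumes "j \<notin> S"
  shows "contract j (star_basis S) = (-1) ^ below j S *\<^sub>R star_basis (insert j S)"
proof -
  have "sorted_list_of_set (insert j S) = insort j (sorted_list_of_set S)"
    using assms by (simp add: sorted_list_of_set_insert)
  then show ?thesis
    using contract_foldr_contract[of "sorted_list_of_set S" j volume] assms
    by (simp add: star_basis_def)
qed

text \<open>With \<open>egen_star\<close> this is the exchange of products and contractions by the volume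
  form.\<close>

lemma star_egen: "star (egen j * a) = contract j (star a)"
proof (rule ext_eqI)
  fix T
  show "ecoeff (star (egen j * a)) T = ecoeff (contract j (star a)) T"
  proof (cases "j \<in> T")
    case False
    define S where "S = - insert j T"
    have S: "- T = insert j S" "insert j T = - S" "j \<notin> S" "insert j S - {j} = S" "- insert j S = T"
      using False by (auto simp: S_def)
    have b: "below j (insert j S) = below j S" by (simp add: below_insert)
    have "ecoeff (contract j (star_basis S)) T = (-1) ^ below j T * star_sign S"
      using False by (simp add: ecoeff_contract ecoeff_star_basis S)
    moreover have "ecoeff (contract j (star_basis S)) T = (-1) ^ below j S *\<^sub>R star_sign (insert j S)"
      by (simp add: contract_star_basis[OF S(3)] ecoeff_star_basis S(5))
    ultimately have e: "(-1) ^ below j S *\<^sub>R star_sign (insert j S) = (-1) ^ below j T * star_sign S" by simp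
    have e': "(-1) ^ below j S * star_sign (insert j S) = (-1) ^ below j T * star_sign S"
      using e by (cases "even (below j S)") auto
    have "ecoeff (star (egen j * a)) T = ecoeff a S * ((-1) ^ below j S * star_sign (insert j S))"
      by (simp add: ecoeff_star S(1) ecoeff_egen_mult S(4) b mult_ac)
    also have "\<dots> = ecoeff (contract j (star a)) T"
      unfolding e' using False by (simp add: ecoeff_contract ecoeff_star S(2) mult_ac)
    finally show ?thesis .
  qed (simp add: ecoeff_star ecoeff_egen_mult ecoeff_contract)
qed

lemma star_econst: "star (econst p) = econst p * volume"
proof -
  have "star_basis {} = (volume :: 'a forms)" by (simp add: star_basis_def)
  then have "star (1 :: 'a forms) = volume"
    unfolding star_def one_ext_def by (simp add: if_distrib[of econst] if_distrib[of "\<lambda>x. x * _"] sum.delta cong: if_cong)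
  then show ?thesis using star_simps(6)[of p "1 :: 'a forms"] by simp
qed

lemma egen_star: "egen i * star a = star (contract i a)"
proof (induction a rule: ext_induct)
  case (econst p)
  have "egen i * (econst p * volume) = 0"
    by (rule ext_eqI) (auto simp: ecoeff_egen_mult volume_def)
  then show ?case by (simp add: star_econst)
next
  case (egen j a)
  have "egen i * contract j (star a) = (if j = i then star a else 0) - contract j (egen i * star a)"
    by (simp add: contract_egen_mult)
  then show ?case by (simp add: star_egen contract_egen_mult egen)
qed (simp add: distrib_left)

lemma pdx_star: "pdx i (star a) = star (pdx i a)"
  by (rule ext_eqI) (simp add: ecoeff_star)

subsection \<open>The de Rham differential\<close>

lemma dR_eq: "dR w = (\<Sum>i\<in>UNIV. egen i * pdx i w)"
  by (simp add: dR_def pdx_def)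

lemma dR_simps [simp]: "dR 0 = 0" "dR (a + b) = dR a + dR b" "dR (r *\<^sub>R a) = r *\<^sub>R dR a"
  by (simp_all add: dR_eq distrib_left sum.distrib scaleR_sum_right)

text \<open>Products with \<open>\<theta>\<^sub>j\<close> and contractions by
  \<open>\<theta>\<^sub>j\<close> are exchanged by \<open>star\<close>, and the partial
  derivatives are preserved.\<close>

lemma dR_star: "dR (star a) = star (bvop a)"
  by (simp add: dR_eq bvop_def star_sum pdx_star egen_star pdx_contract)

lemma dR_econst: "dR (econst f) = (\<Sum>i\<in>UNIV. econst (pd i f) * egen i)"
  by (simp add: dR_eq econst_commute)

lemma dR_var: "dR (econst (var j)) = egen j"
proof -
  have "dR (econst (var j)) = (\<Sum>i\<in>UNIV. if i = j then egen j else (0 :: 'a forms))"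
    unfolding dR_econst by (rule sum.cong) (auto simp: pd_var)
  then show ?thesis by simp
qed

lemma hpart_dR_econst: "dR (econst f) \<in> hpart 1"
  using hpart_mult[OF hpart_econst hpart_egen] unfolding dR_econst by (intro hpart_sum) simp

lemma dR_econst_star: "dR (econst f) * star a = star (A.ins f a)"
  by (simp add: dR_econst A_ins sum_distrib_right star_sum egen_star mult.assoc)

lemma dwedge_simps [simp]: "dwedge [] = 1" "dwedge (f # fs) = dR (econst f) * dwedge fs"
  by (simp_all add: dwedge_def)

lemma dwedge_hpart: "dwedge fs \<in> hpart (int (length fs))"
proof (induction fs)
  case (Cons f fs)
  then show ?case using hpart_mult[OF hpart_dR_econst Cons, of f] by simp
qed simp

lemma econst_dwedge_hpart: "econst f * dwedge fs \<in> hpart (int (length fs))"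
  using hpart_mult[OF hpart_econst dwedge_hpart] by fastforce

text \<open>The forms are spanned by products of functions and differentials, also when these are restricted
  to a class of functions that spans all functions.\<close>

lemma forms_span:
  assumes "\<And>p. p \<in> span E"
  shows "w \<in> span {econst f0 * dwedge fs | f0 fs. f0 \<in> E \<and> set fs \<subseteq> E}" (is "_ \<in> span ?G")
proof (induction w rule: ext_induct)
  case (econst p)
  show ?case
    using assms[of p]
  proof (induction rule: span_induct_alt)
    case (step c x y)
    have "econst x * dwedge [] \<in> ?G" using step.hyps by fastforce
    then have "econst x \<in> ?G" by simp
    then show ?case
      using step.IH by (simp add: econst_add econst_scaleR span_add span_scale span_base)
  qed (simp add: span_zero)
next
  case (egen i a)
  have g: "dR (econst g) * a \<in> span ?G" if "g \<in> E" for g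
    using egen
  proof (induction rule: span_induct_alt)
    case (step c x y)
    then obtain f0 fs where x: "x = econst f0 * dwedge fs" "f0 \<in> E" "set fs \<subseteq> E" by auto
    have "dR (econst g) * x = econst f0 * dwedge (g # fs)"
      by (simp add: x(1)) (metis econst_commute mult.assoc)
    also have "\<dots> \<in> ?G" using x that by (intro CollectI exI[of _ f0] exI[of _ "g # fs"]) auto
    finally have "dR (econst g) * x \<in> span ?G" by (rule span_base)
    then show ?case using step.IH by (simp add: distrib_left span_add span_scale)
  qed (simp add: span_zero)
  have "dR (econst p) * a \<in> span ?G" for p
    using assms[of p]
    by (induction rule: span_induct_alt)
      (use g in \<open>simp_all add: econst_add econst_scaleR distrib_right span_add span_scale span_zero\<close>)
  from this[of "var i"] show ?case by (simp add: dR_var)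
qed (simp add: span_add)

subsection \<open>Lie derivatives\<close>

text \<open>The Lie derivative of differential forms along the vector field with the components
  \<open>v\<close>.\<close>

definition lie_form :: "('n \<Rightarrow> 'n poly) \<Rightarrow> 'n::{finite,linorder} forms \<Rightarrow> 'n forms"
  where "lie_form v w = (\<Sum>j\<in>UNIV. econst (v j) * pdx j w)
    + (\<Sum>i\<in>UNIV. \<Sum>j\<in>UNIV. econst (pd i (v j)) * (egen i * contract j w))"

definition vec_apply :: "('n \<Rightarrow> 'n poly) \<Rightarrow> 'n poly \<Rightarrow> 'n::finite poly"
  where "vec_apply v f = (\<Sum>j\<in>UNIV. v j * pd j f)"

lemma linear_lie_form: "linear (lie_form v)"
  by (rule linearI) (simp_all add: lie_form_def distrib_left sum.distrib scaleR_add_right scaleR_sum_right)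

lemma lie_form_mult: "lie_form v (a * b) = lie_form v a * b + a * lie_form v b"
proof -
  have 1: "econst (v j) * pdx j (a * b) = econst (v j) * pdx j a * b + a * (econst (v j) * pdx j b)" for j
    by (simp add: pdx_mult distrib_left mult.assoc) (metis econst_commute mult.assoc)
  have 2: "econst (pd i (v j)) * (egen i * contract j (a * b))
      = econst (pd i (v j)) * (egen i * contract j a) * b + a * (econst (pd i (v j)) * (egen i * contract j b))" for i j
  proof -
    have "egen i * (par a * contract j b) = a * (egen i * contract j b)"
      by (simp add: mult_egen flip: mult.assoc)
    then show ?thesis
      by (simp add: contract_mult distrib_left mult.assoc) (metis econst_commute mult.assoc)
  qed
  show ?thesis
    unfolding lie_form_def 1 2 by (simp add: sum.distrib sum_distrib_left sum_distrib_right distrib_left distrib_right)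
qed

lemma lie_form_econst: "lie_form v (econst f) = econst (vec_apply v f)"
  by (simp add: lie_form_def vec_apply_def econst_sum econst_mult)

lemma lie_form_egen: "lie_form v (egen k) = dR (econst (v k))"
proof -
  have "(\<Sum>j\<in>UNIV. econst (pd i (v j)) * (egen i * contract j (egen k)))
      = (\<Sum>j\<in>UNIV. if j = k then econst (pd i (v k)) * egen i else 0)" for i
    by (rule sum.cong) (auto simp: contract_egen)
  then show ?thesis by (simp add: lie_form_def dR_econst)
qed

lemma lie_form_dR: "lie_form v (dR (econst g)) = dR (econst (vec_apply v g))"
proof -
  have "lie_form v (dR (econst g))
      = (\<Sum>i\<in>UNIV. econst (vec_apply v (pd i g)) * egen i + econst (pd i g) * dR (econst (v i)))"
    unfolding dR_econst[of g] by (simp add: linear_sum[OF linear_lie_form] lie_form_mult lie_form_econst lie_form_egen)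
  also have "\<dots> = (\<Sum>i\<in>UNIV. \<Sum>j\<in>UNIV. econst (v j * pd j (pd i g)) * egen i)
      + (\<Sum>j\<in>UNIV. \<Sum>i\<in>UNIV. econst (pd j g * pd i (v j)) * egen i)"
    by (simp add: sum.distrib vec_apply_def econst_sum sum_distrib_right dR_econst sum_distrib_left econst_mult mult.assoc)
  also have "\<dots> = (\<Sum>i\<in>UNIV. \<Sum>j\<in>UNIV. econst (v j * pd j (pd i g)) * egen i + econst (pd j g * pd i (v j)) * egen i)"
    by (subst (2) sum.swap) (simp add: sum.distrib)
  also have "\<dots> = dR (econst (vec_apply v g))"
    unfolding dR_econst unfolding vec_apply_def pd_sum econst_sum sum_distrib_right
    by (intro sum.cong refl) (simp add: pd_mult econst_add distrib_right pd_commute mult.commute)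
  finally show ?thesis .
qed

lemma lie_form_dwedge:
  "lie_form v (dwedge fs) = (\<Sum>j<length fs. (-1) ^ j *\<^sub>R (dR (econst (vec_apply v (fs ! j))) * dwedge (nths fs (- {j}))))"
proof (induction fs)
  case Nil
  show ?case using lie_form_econst[of v 1] by (simp add: vec_apply_def)
next
  case (Cons f fs)
  have c: "dR (econst f) * dR (econst g) = - (dR (econst g) * dR (econst f))" for f g :: "'a poly"
    using graded_commute[OF hpart_dR_econst hpart_dR_econst, of f g] by (simp add: ksgn_def)
  have "dR (econst f) * ((-1) ^ j *\<^sub>R (dR (econst g) * w)) = (-1) ^ Suc j *\<^sub>R (dR (econst g) * (dR (econst f) * w))"
    for j g and w :: "'a forms"
    by (simp add: c[of f] flip: mult.assoc)
  then show ?case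
    unfolding dwedge_simps lie_form_mult lie_form_dR Cons.IH
    by (simp add: sum.lessThan_Suc_shift nths_Cons_compl_0 nths_Cons_compl_Suc sum_distrib_left del: sum.lessThan_Suc)
qed

text \<open>The bracket with a vector field is the Lie derivative of polyvectors. It differs from the Lie
  derivative of the contracted form by the Lie derivative of the volume form, that is, by the
  divergence.\<close>

lemma star_schouten:
  assumes "Y = (\<Sum>j\<in>UNIV. econst (v j) * egen j)"
  shows "star (schouten Y a) = lie_form v (star a) - star (bvop Y * a)"
proof -
  have cY: "contract j Y = econst (v j)" for j
  proof -
    have "contract j Y = (\<Sum>i\<in>UNIV. if i = j then econst (v j) else 0)"
      unfolding assms contract_sum by (rule sum.cong) (auto simp: contract_egen)
    then show ?thesis by simp
  qed
  have pY: "pdx j Y = (\<Sum>i\<in>UNIV. econst (pd j (v i)) * egen i)" for j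
    by (simp add: assms pdx_sum pdx_econst_mult)
  have bY: "bvop Y = (\<Sum>j\<in>UNIV. econst (pd j (v j)))"
    by (simp add: bvop_def cY)
  have e: "contract i (egen j * w) = (if i = j then w else 0) - egen j * contract i w" for i j and w :: "'a forms"
    by (rule contract_egen_mult)
  have "star (schouten Y a) = (\<Sum>j\<in>UNIV. econst (v j) * pdx j (star a))
      - (\<Sum>j\<in>UNIV. \<Sum>i\<in>UNIV. econst (pd j (v i)) * contract i (egen j * star a))"
    by (simp add: schouten_def cY pY star_sum sum_subtractf pdx_star sum_distrib_right mult.assoc star_egen egen_star)
  also have "(\<Sum>j\<in>UNIV. \<Sum>i\<in>UNIV. econst (pd j (v i)) * contract i (egen j * star a))
      = (\<Sum>j\<in>UNIV. econst (pd j (v j)) * star a) - (\<Sum>j\<in>UNIV. \<Sum>i\<in>UNIV. econst (pd j (v i)) * (egen j * contract i (star a)))"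
    unfolding e right_diff_distrib sum_subtractf
    by (simp add: if_distrib[of "\<lambda>x. _ * x"] sum.delta cong: if_cong)
  finally show ?thesis
    by (simp add: lie_form_def bY star_sum sum_distrib_right)
qed

lemma hpart_1_expand: "Y \<in> hpart 1 \<Longrightarrow> Y = (\<Sum>j\<in>UNIV. econst (ecoeff (contract j Y) {}) * egen j)"
  for Y :: "('i::{finite,linorder}, 'r::comm_ring_1) ext"
proof (rule ext_eqI)
  fix S assume Y: "Y \<in> hpart 1"
  have "ecoeff (\<Sum>j\<in>UNIV. econst (ecoeff (contract j Y) {}) * egen j) S
      = (\<Sum>j\<in>UNIV. if S = {j} then ecoeff Y S else 0)"
    unfolding ecoeff_sum
    by (rule sum.cong) (auto simp: ecoeff_contract egen_def below_def)
  also have "\<dots> = ecoeff Y S"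
  proof (cases "\<exists>j. S = {j}")
    case False
    then have "card S \<noteq> 1" by (simp add: card_1_singleton_iff)
    then have "ecoeff Y S = 0" using Y by (auto simp: hpart_def)
    then show ?thesis using False by simp
  qed (auto simp: sum.delta)
  finally show "ecoeff Y S = ecoeff (\<Sum>j\<in>UNIV. econst (ecoeff (contract j Y) {}) * egen j) S" ..
qed

section \<open>Eigenvectors of the transposed matrix\<close>

text \<open>For a spanning set of eigenvectors, the kernel is spanned by those with eigenvalue zero: the
  remaining ones contribute to the other eigenspaces.\<close>

lemma eigen_kernel:
  assumes T: "linear T" and G: "\<And>x. x \<in> G \<Longrightarrow> \<exists>l. T x = l *\<^sub>R x" and w: "w \<in> span G" "T w = 0"
  shows "w \<in> span {x \<in> G. T x = 0}"
proof -
  have "\<exists>u\<in>span {x \<in> G. T x = 0}. \<exists>g. finite {l. g l \<noteq> 0} \<and> g 0 = 0 \<and> (\<forall>l. T (g l) = l *\<^sub>R g l) \<and>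
      w = u + (\<Sum>l | g l \<noteq> 0. g l)"
    using w(1)
  proof (induction rule: span_induct_alt)
    case base
    show ?case by (intro bexI[of _ 0] exI[of _ "\<lambda>_. 0"]) (auto simp: linear_0[OF T] span_zero)
  next
    case (step c x y)
    obtain m where m: "T x = m *\<^sub>R x" using G[OF step.hyps] by blast
    obtain u g where u: "u \<in> span {x \<in> G. T x = 0}"
      and g: "finite {l. g l \<noteq> 0}" "g 0 = 0" "\<And>l. T (g l) = l *\<^sub>R g l" and y: "y = u + (\<Sum>l | g l \<noteq> 0. g l)"
      using step.IH by auto
    show ?case
    proof (cases "m = 0")
      case True
      then have "c *\<^sub>R x + u \<in> span {x \<in> G. T x = 0}"
        using m step.hyps u by (intro span_add span_scale) (auto intro: span_base)
      then show ?thesis using g y by (intro bexI[of _ "c *\<^sub>R x + u"] exI[of _ g]) auto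
    next
      case False
      define h where "h l = (if l = m then c *\<^sub>R x else 0) + g l" for l
      let ?F = "insert m {l. g l \<noteq> 0}"
      have fin: "finite ?F" using g(1) by simp
      have sub: "{l. h l \<noteq> 0} \<subseteq> ?F" by (auto simp: h_def)
      have "(\<Sum>l | h l \<noteq> 0. h l) = (\<Sum>l\<in>?F. h l)"
        by (rule sum.mono_neutral_left[OF fin sub]) auto
      also have "\<dots> = c *\<^sub>R x + (\<Sum>l\<in>?F. g l)"
        using fin by (simp add: h_def sum.distrib)
      also have "(\<Sum>l\<in>?F. g l) = (\<Sum>l | g l \<noteq> 0. g l)"
        by (rule sum.mono_neutral_right[OF fin]) auto
      finally have "c *\<^sub>R x + y = u + (\<Sum>l | h l \<noteq> 0. h l)" by (simp add: y)
      moreover have "finite {l. h l \<noteq> 0}" using finite_subset[OF sub fin] .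
      moreover have "T (h l) = l *\<^sub>R h l" for l
        by (simp add: h_def linear_add[OF T] linear_scale[OF T] linear_0[OF T] g(3) m scaleR_add_right)
      moreover have "h 0 = 0" using False g(2) by (simp add: h_def)
      ultimately show ?thesis using u by blast
    qed
  qed
  then obtain u g where u: "u \<in> span {x \<in> G. T x = 0}"
    and g: "finite {l. g l \<noteq> 0}" "g 0 = 0" "\<And>l. T (g l) = l *\<^sub>R g l" and wu: "w = u + (\<Sum>l | g l \<noteq> 0. g l)"
    by auto
  have "T u = 0"
    using u by (induction rule: span_induct_alt) (auto simp: linear_0[OF T] linear_add[OF T] linear_scale[OF T])
  then have z: "(\<Sum>l | g l \<noteq> 0. l *\<^sub>R g l) = 0"
    using w(2) by (simp add: wu linear_add[OF T] linear_sum[OF T] g(3))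
  have "g l = 0" for l
  proof (rule ccontr)
    assume l: "g l \<noteq> 0"
    have "l *\<^sub>R g l = 0"
      by (rule eigen_independent[OF T g(1) _ z]) (use l in \<open>auto simp: linear_scale[OF T] g(3)\<close>)
    then show False using l g(2) by auto
  qed
  then show ?thesis using u wu by simp
qed

text \<open>The components of the basis vectors under a decomposition into eigenvectors form the spectral
  projections of the matrix, whose transposes are the spectral projections of the transposed matrix.\<close>

lemma transposed_spectral_projections:
  fixes M :: "'n::finite \<Rightarrow> 'n \<Rightarrow> real" and E :: "real \<Rightarrow> 'n \<Rightarrow> 'n \<Rightarrow> real"
  assumes F: "finite F" and one: "\<And>i j. (\<Sum>l\<in>F. E l i j) = (if i = j then 1 else 0)"
    and eig: "\<And>l i j. l \<in> F \<Longrightarrow> (\<Sum>k\<in>UNIV. M i k * E l k j) = l * E l i j"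
    and l: "l \<in> F"
  shows "(\<Sum>k\<in>UNIV. E l i k * M k j) = l * E l i j"
proof -
  define T where "T v = (\<lambda>i. \<Sum>k\<in>UNIV. M i k * v k)" for v :: "'n \<Rightarrow> real"
  have T: "linear T"
    by (rule linearI) (simp_all add: T_def fun_eq_iff scaleR_fun_def sum.distrib distrib_left sum_distrib_left mult.left_commute)
  have proj: "(\<Sum>k\<in>UNIV. E l i k * E m k j) = (if l = m then E m i j else 0)" if lm: "l \<in> F" "m \<in> F" for l m i j
  proof -
    define w where "w l = (\<lambda>i. (\<Sum>k\<in>UNIV. E l i k * E m k j) - (if l = m then E m i j else 0))" for l
    have sum0: "(\<Sum>l\<in>F. w l) = 0"
    proof
      fix i
      have "(\<Sum>l\<in>F. w l) i = (\<Sum>l\<in>F. w l i)" by (induction F rule: infinite_finite_induct) auto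
      also have "\<dots> = (\<Sum>k\<in>UNIV. (\<Sum>l\<in>F. E l i k) * E m k j) - E m i j"
        unfolding w_def sum_subtractf using F lm
        by (subst sum.swap) (simp add: sum_distrib_right sum.delta)
      also have "\<dots> = 0" by (simp add: one if_distrib[of "\<lambda>x. x * _"] sum.delta cong: if_cong)
      finally show "(\<Sum>l\<in>F. w l) i = 0 i" by simp
    qed
    have Tw: "T (w l) = l *\<^sub>R w l" if "l \<in> F" for l
    proof
      fix i
      have "T (w l) i = (\<Sum>a\<in>UNIV. M i a * (\<Sum>k\<in>UNIV. E l a k * E m k j)) - (if l = m then \<Sum>a\<in>UNIV. M i a * E m a j else 0)"
        by (auto simp: T_def w_def right_diff_distrib sum_subtractf)
      also have "(\<Sum>a\<in>UNIV. M i a * (\<Sum>k\<in>UNIV. E l a k * E m k j)) = (\<Sum>k\<in>UNIV. (\<Sum>a\<in>UNIV. M i a * E l a k) * E m k j)"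
        by (simp add: sum_distrib_left sum_distrib_right mult.assoc) (rule sum.swap)
      also have "\<dots> = l * (\<Sum>k\<in>UNIV. E l i k * E m k j)"
        by (simp add: eig[OF that] sum_distrib_left mult.assoc)
      finally show "T (w l) i = (l *\<^sub>R w l) i"
        using eig[OF lm(2)] by (auto simp: w_def scaleR_fun_def right_diff_distrib)
    qed
    have "w l = 0" by (rule eigen_independent[OF T F Tw sum0 lm(1)])
    then have "w l i = 0" by simp
    then show ?thesis unfolding w_def by (simp only: right_minus_eq)
  qed
  have M: "M k j = (\<Sum>m\<in>F. m * E m k j)" for k j
  proof -
    have "M k j = (\<Sum>a\<in>UNIV. M k a * (\<Sum>m\<in>F. E m a j))"
      by (simp add: one if_distrib[of "\<lambda>x. _ * x"] sum.delta cong: if_cong)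
    also have "\<dots> = (\<Sum>m\<in>F. \<Sum>a\<in>UNIV. M k a * E m a j)"
      by (simp add: sum_distrib_left) (rule sum.swap)
    finally show ?thesis by (simp add: eig)
  qed
  have "(\<Sum>k\<in>UNIV. E l i k * M k j) = (\<Sum>m\<in>F. m * (\<Sum>k\<in>UNIV. E l i k * E m k j))"
    unfolding M sum_distrib_left by (subst sum.swap) (simp add: mult.left_commute)
  also have "\<dots> = (\<Sum>m\<in>F. if m = l then l * E l i j else 0)"
    by (rule sum.cong) (use l in \<open>auto simp: proj\<close>)
  finally show ?thesis using F l by simp
qed

lemma span_mult_closed:
  fixes S :: "'a::real_algebra set"
  assumes S: "\<And>x y. x \<in> S \<Longrightarrow> y \<in> S \<Longrightarrow> x * y \<in> span S" and "x \<in> span S" "y \<in> span S"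
  shows "x * y \<in> span S"
  using assms(2)
proof (induction rule: span_induct_alt)
  case (step c x z)
  have "x * y \<in> span S"
    using assms(3)
    by (induction rule: span_induct_alt) (use S step.hyps in \<open>auto simp: distrib_left intro: span_add span_scale span_zero\<close>)
  then show ?case using step.IH by (simp add: distrib_right span_add span_scale)
qed (simp add: span_zero)

section \<open>Modular data of a quadratic Poisson structure\<close>

text \<open>The description defining the divergence is satisfied by a unique polyvector because contraction
  with the volume form is injective.\<close>

lemma Div_A_ev:
  assumes "a \<in> hpart k"
  shows "Div_A k (A.ev a) = A.ev (bvop a)"
  unfolding Div_A_def
proof (rule the_equality)
  show "A.ev (bvop a) \<in> polyvectors (k - 1) \<and> iota_A (A.ev (bvop a)) = dR (iota_A (A.ev a))"
    using A.ev_polyder[OF hpart_bvop[OF assms]] by (simp add: iota_A_ev dR_star)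
next
  fix Q assume Q: "Q \<in> polyvectors (k - 1) \<and> iota_A Q = dR (iota_A (A.ev a))"
  then obtain b where b: "Q = A.ev b" using A.ev_surj by blast
  then have "star b = star (bvop a)" using Q by (simp add: iota_A_ev dR_star)
  then show "Q = A.ev (bvop a)" using b star_inj by blast
qed

lemma derivation_of_A_ev: "derivation_of (A.ev a) = (\<lambda>f. scalar_part (A.ins f a))"
  unfolding derivation_of_def
proof (rule the_equality)
  show "linear (\<lambda>f. scalar_part (A.ins f a)) \<and> (\<forall>f. homogeneous f \<longrightarrow> scalar_part (A.ins f a) = A.ev a [f])"
    by (auto intro!: linearI simp: A.ev_def)
qed (auto simp: A.ev_def fun_eq_iff)

locale quadratic_poisson =
  fixes c :: "'n::{finite,linorder} quad"
  assumes jac: "poisson_bracket (br_A c)"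
begin

sublocale bv_model "piV c"
  by unfold_locales (rule piV_hpart, rule master_eq[OF jac])

abbreviation \<pi> where "\<pi> \<equiv> piV c"

text \<open>The components of the modular vector field.\<close>

definition nuv where "nuv j = ecoeff (contract j modvec) {}"

lemma nu_A_ins: "nu_A c f = scalar_part (A.ins f modvec)"
proof -
  have "- Div_A 2 (pi_A c) = A.ev modvec"
    by (simp add: pi_A_eq Div_A_ev[OF piV_hpart] modvec_def)
  then show ?thesis by (simp add: nu_A_def derivation_of_A_ev)
qed

lemma nu_A_eq: "nu_A c = vec_apply nuv"
  by (rule ext) (simp add: nu_A_ins A_ins scalar_part_def ecoeff_sum vec_apply_def nuv_def mult.commute)

lemma modvec_expand: "modvec = (\<Sum>j\<in>UNIV. econst (nuv j) * egen j)"
  unfolding nuv_def by (rule hpart_1_expand[OF modvec_hpart])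

lemma wt_econst: "wt (econst f) = econst (nu_A c f)"
proof -
  have i: "A.ins f modvec = wt (econst f)"
    by (simp add: A.ins_def wt_def par_hpart[OF modvec_hpart])
  have "A.ins f modvec \<in> hpart (1 - 0 - 1)"
    by (intro A.ins_hpart modvec_hpart gr_poly)
  then have "A.ins f modvec \<in> hpart 0" by simp
  from hpart_0_econst[OF this] show ?thesis by (simp add: nu_A_ins scalar_part_def i)
qed

lemma wt_egen: "wt (egen i) = - pdx i modvec"
  by (simp add: wt_def schouten_egen)

lemma star_wt: "star (wt a) = lie_form nuv (star a)"
  using star_schouten[OF modvec_expand, of a] by (simp add: wt_def)

text \<open>The components of the Hamiltonian vector field of \<open>f\<close>.\<close>

definition hamv where "hamv f j = ecoeff (contract j (A.ins f \<pi>)) {}"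

lemma hamv_apply: "vec_apply (hamv f) g = br_A c f g"
  by (simp add: br_A_eq bracket_of_def A.ev_def A_ins[of g] scalar_part_def ecoeff_sum vec_apply_def hamv_def mult.commute)

text \<open>The divergence of a Hamiltonian vector field is the derivative of the function along the modular
  vector field. This is the classical definition of the modular vector field.\<close>

lemma bvop_ham: "bvop (A.ins f \<pi>) = econst (nu_A c f)"
proof -
  have "bvop (econst f) = 0" by (simp add: bvop_def)
  then have "bvop (A.ins f \<pi>) = schouten modvec (econst f)"
    by (simp add: A.ins_def par_hpart[OF piV_hpart] ksgn_def bvop_schouten modvec_def)
  then show ?thesis using wt_econst[of f] by (simp add: wt_def)
qed

lemma star_ham:
  "star (schouten (A.ins f \<pi>) a) = lie_form (hamv f) (star a) - econst (nu_A c f) * star a"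
proof -
  have "A.ins f \<pi> \<in> hpart (2 - 0 - 1)" by (intro A.ins_hpart piV_hpart gr_poly)
  then have "A.ins f \<pi> = (\<Sum>j\<in>UNIV. econst (hamv f j) * egen j)"
    unfolding hamv_def by (intro hpart_1_expand) simp
  from star_schouten[OF this] show ?thesis by (simp add: bvop_ham)
qed

subsection \<open>The twisted boundary\<close>

text \<open>The twisted boundary is the transport of the Poisson coboundary by \<open>star\<close>, so it is
  defined in this way; that it satisfies the explicit formula is \<open>bdry_formula\<close>.\<close>

definition bdry where "bdry w = - star (schouten \<pi> (SOME a. w = star a))"

lemma bdry_star: "bdry (star a) = - star (schouten \<pi> a)"
proof -
  have "star a = star (SOME b. star a = star b)" by (rule someI[of _ a]) simp
  then have "(SOME b. star a = star b) = a" using star_inj by metis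
  then show ?thesis by (simp add: bdry_def)
qed

lemma linear_bdry: "linear bdry"
proof (rule linearI)
  fix v w :: "'n forms" and r :: real
  obtain a b where "v = star a" "w = star b" using star_surj by metis
  then show "bdry (v + w) = bdry v + bdry w" "bdry (r *\<^sub>R v) = r *\<^sub>R bdry v"
    by (simp_all flip: star_simps add: bdry_star)
qed

text \<open>Multiplying a form by an exact differential corresponds to inserting a function into a
  polyvector. The Cartan formula on the side of polyvectors, translated to forms, gives a
  recursion for the boundary of a product of differentials; the correction by the divergence in
  \<open>star_schouten\<close> is the term with the modular vector field.\<close>

lemma bdry_dR:
  assumes "w \<in> hpart p"
  shows "bdry (dR (econst f) * w) = econst (nu_A c f) * w - lie_form (hamv f) w - dR (econst f) * bdry w"
proof -
  obtain a where a: "w = star a" using star_surj by blast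
  have ah: "a \<in> hpart (int CARD('n) - p)"
    using star_hpart[of a "int CARD('n) - p"] assms a by simp
  have "A.lie c f a = schouten (A.ins f \<pi>) a"
    using A.lie_eq[OF ah gr_poly(1), of c f] by simp
  then have "schouten \<pi> (A.ins f a) = schouten (A.ins f \<pi>) a - A.ins f (schouten \<pi> a)"
    by (simp add: A.lie_def A_dl algebra_simps)
  then show ?thesis
    by (simp add: a dR_econst_star bdry_star star_ham)
qed

lemma bdry_econst: "bdry (econst f) = 0"
proof -
  obtain a where a: "econst f = star a" using star_surj by blast
  have "star a \<in> hpart (int CARD('n) - int CARD('n))" using a[symmetric] by simp
  then have "a \<in> hpart (int CARD('n))" unfolding star_hpart .
  then have "schouten \<pi> a \<in> hpart (2 + int CARD('n) - 1)" by (rule hpart_schouten[OF piV_hpart])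
  then have "schouten \<pi> a = 0" by (rule hpart_large) simp
  then show ?thesis by (simp add: a bdry_star)
qed

text \<open>By induction on the number of differentials, using \<open>bdry_dR\<close>. The recursion moves
  the first differential to the outside, and the Lie derivative along its Hamiltonian vector field
  produces the brackets.\<close>

lemma bdry_formula:
  "bdry (econst f0 * dwedge fs) =
      (\<Sum>i<length fs. ((-1) ^ i :: real) *\<^sub>R
         (econst (br_A c f0 (fs ! i) + f0 * nu_A c (fs ! i)) * dwedge (nths fs (- {i})))) +
      (\<Sum>j<length fs. \<Sum>i<j. ((-1) ^ (j - i) :: real) *\<^sub>R
         (econst f0 * dR (econst (br_A c (fs ! i) (fs ! j))) * dwedge (nths fs (- {i, j}))))"
proof (induction fs)
  case Nil
  then show ?case by (simp add: bdry_econst)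
next
  case (Cons f fs)
  let ?d = "dR (econst f)" and ?n = "length fs"
  let ?s1 = "\<lambda>fs i. ((-1) ^ i :: real) *\<^sub>R
         (econst (br_A c f0 (fs ! i) + f0 * nu_A c (fs ! i)) * dwedge (nths fs (- {i})))"
  let ?s2 = "\<lambda>fs i j. ((-1) ^ (j - i) :: real) *\<^sub>R
         (econst f0 * dR (econst (br_A c (fs ! i) (fs ! j))) * dwedge (nths fs (- {i, j})))"
  have anti: "br_A c g h = - br_A c h g" for g h using jac unfolding poisson_bracket_def by blast
  have ec: "?d * (econst g * w) = econst g * (?d * w)" for g w
    by (metis econst_commute mult.assoc)
  have dd: "?d * (dR (econst g) * w) = - (dR (econst g) * (?d * w))" for g w
  proof -
    have "?d * dR (econst g) = - (dR (econst g) * ?d)"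
      using graded_commute[OF hpart_dR_econst hpart_dR_econst, of f g] by (simp add: ksgn_def)
    then show ?thesis by (simp flip: mult.assoc)
  qed
  have 1: "(\<Sum>i<length (f # fs). ?s1 (f # fs) i)
      = econst (br_A c f0 f + f0 * nu_A c f) * dwedge fs - ?d * (\<Sum>i<?n. ?s1 fs i)"
  proof -
    have "?s1 (f # fs) (Suc i) = - (?d * ?s1 fs i)" for i
      unfolding nth_Cons_Suc nths_Cons_compl_Suc dwedge_simps mult_scaleR_right ec by simp
    moreover have "?s1 (f # fs) 0 = econst (br_A c f0 f + f0 * nu_A c f) * dwedge fs"
      by (simp add: nths_Cons_compl_0)
    ultimately have "(\<Sum>i<Suc ?n. ?s1 (f # fs) i)
        = econst (br_A c f0 f + f0 * nu_A c f) * dwedge fs + (\<Sum>i<?n. - (?d * ?s1 fs i))"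
      by (simp only: sum.lessThan_Suc_shift)
    then show ?thesis by (simp only: length_Cons sum_negf sum_distrib_left diff_conv_add_uminus)
  qed
  have 2: "(\<Sum>j<length (f # fs). \<Sum>i<j. ?s2 (f # fs) i j)
      = - (econst f0 * lie_form (hamv f) (dwedge fs)) - ?d * (\<Sum>j<?n. \<Sum>i<j. ?s2 fs i j)"
  proof -
    have a: "?s2 (f # fs) (Suc i) (Suc j) = - (?d * ?s2 fs i j)" for i j
      by (simp add: nths_Cons_compl_Suc_Suc ec dd mult.assoc)
    have b: "?s2 (f # fs) 0 (Suc j)
        = - (econst f0 * ((-1) ^ j *\<^sub>R (dR (econst (vec_apply (hamv f) (fs ! j))) * dwedge (nths fs (- {j})))))" for j
      by (simp add: nths_Cons_compl_0_Suc hamv_apply mult.assoc)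
    have "(\<Sum>j<Suc ?n. \<Sum>i<j. ?s2 (f # fs) i j) = (\<Sum>j<?n. ?s2 (f # fs) 0 (Suc j) + (\<Sum>i<j. ?s2 (f # fs) (Suc i) (Suc j)))"
      by (simp only: sum.lessThan_Suc_shift) (simp only: lessThan_0 sum.empty add_0_left)
    also have "\<dots> = (\<Sum>j<?n. - (econst f0 * ((-1) ^ j *\<^sub>R (dR (econst (vec_apply (hamv f) (fs ! j))) * dwedge (nths fs (- {j})))))
        + (\<Sum>i<j. - (?d * ?s2 fs i j)))"
      by (simp only: a b)
    also have "\<dots> = - (econst f0 * lie_form (hamv f) (dwedge fs)) - ?d * (\<Sum>j<?n. \<Sum>i<j. ?s2 fs i j)"
      unfolding lie_form_dwedge sum_distrib_left by (simp only: sum.distrib sum_negf diff_conv_add_uminus)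
    finally show ?thesis by (simp only: length_Cons)
  qed
  have "econst f0 * dwedge (f # fs) = ?d * (econst f0 * dwedge fs)" by (simp add: ec)
  then have "bdry (econst f0 * dwedge (f # fs))
      = econst (nu_A c f) * (econst f0 * dwedge fs) - lie_form (hamv f) (econst f0 * dwedge fs)
        - ?d * bdry (econst f0 * dwedge fs)"
    using bdry_dR[OF econst_dwedge_hpart] by simp
  also have "lie_form (hamv f) (econst f0 * dwedge fs)
      = - (econst (br_A c f0 f) * dwedge fs) + econst f0 * lie_form (hamv f) (dwedge fs)"
    by (simp add: lie_form_mult lie_form_econst hamv_apply anti[of f f0] econst_minus)
  finally have b: "bdry (econst f0 * dwedge (f # fs)) = econst (nu_A c f) * (econst f0 * dwedge fs)
      - (- (econst (br_A c f0 f) * dwedge fs) + econst f0 * lie_form (hamv f) (dwedge fs))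
      - ?d * bdry (econst f0 * dwedge fs)" .
  have e: "econst (br_A c f0 f + f0 * nu_A c f) * dwedge fs
      = econst (br_A c f0 f) * dwedge fs + econst (nu_A c f) * (econst f0 * dwedge fs)"
    by (simp add: econst_add econst_mult distrib_right econst_commute[of "econst f0" "nu_A c f"] flip: mult.assoc)
  show ?case
    unfolding 1 2 e b Cons.IH distrib_left[of ?d]
    by (simp only: diff_conv_add_uminus minus_add_distrib minus_minus add_ac)
qed

lemma twisted_boundary_eq: "twisted_boundary (br_A c) (nu_A c) = bdry"
  unfolding twisted_boundary_def
proof (rule the_equality)
  fix L assume L: "linear L \<and> (\<forall>f0 fs. L (econst f0 * dwedge fs) =
      (\<Sum>i<length fs. ((-1) ^ i :: real) *\<^sub>R
         (econst (br_A c f0 (fs ! i) + f0 * nu_A c (fs ! i)) * dwedge (nths fs (- {i})))) +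
      (\<Sum>j<length fs. \<Sum>i<j. ((-1) ^ (j - i) :: real) *\<^sub>R
         (econst f0 * dR (econst (br_A c (fs ! i) (fs ! j))) * dwedge (nths fs (- {i, j})))))"
  show "L = bdry"
  proof
    fix w :: "'n forms"
    let ?G = "{econst f0 * dwedge fs | f0 fs. f0 \<in> UNIV \<and> set fs \<subseteq> UNIV} :: 'n forms set"
    have w: "w \<in> span ?G"
      by (rule forms_span) (simp add: span_base)
    have "L x = bdry x" if "x \<in> ?G" for x
    proof -
      from that obtain f0 fs where x: "x = econst f0 * dwedge fs" by auto
      show ?thesis unfolding x bdry_formula using L by blast
    qed
    then show "L w = bdry w"
      using linear_eq_on_span[of L bdry ?G w] L linear_bdry w by blast
  qed
qed (use linear_bdry bdry_formula in blast)

subsection \<open>The matrix of the modular vector field\<close>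

text \<open>The bivector is quadratic in \<open>x\<close> and in \<open>\<theta>\<close>, and
  \<open>bvop\<close> lowers both degrees by one.\<close>

lemma modvec_in_span: "modvec \<in> span (range (\<lambda>(i, j). econst (var i) * egen j))"
proof -
  define U :: "'n forms set" where "U = range (\<lambda>(i, j). econst (var i) * egen j)"
  have U: "econst (var i) * egen j \<in> span U" for i j by (rule span_base) (auto simp: U_def)
  have V: "econst ((if b1 then var i1 else 0) + (if b2 then var i2 else 0)) * egen j \<in> span U" for b1 b2 i1 i2 j
    by (cases b1; cases b2) (auto simp: econst_add distrib_right intro!: span_add span_zero U)
  have "econst (pd k (var i1 * var i2)) * contract k (egen j1 * egen j2) \<in> span U" for k i1 i2 j1 j2
  proof -
    have p: "pd k (var i1 * var i2) = (if k = i1 then var i2 else 0) + (if k = i2 then var i1 else 0)"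
      by (simp add: pd_mult pd_var)
    have "contract k (egen j1 * egen j2) = (if k = j1 then egen j2 else 0) - (if k = j2 then egen j1 else (0 :: 'n forms))"
      by (simp add: contract_egen_mult contract_egen)
    moreover define P :: "'n forms" where "P = econst (pd k (var i1 * var i2))"
    have W: "P * egen j \<in> span U" for j
      unfolding P_def p by (rule V)
    have "P * ((if k = j1 then egen j2 else 0) - (if k = j2 then egen j1 else 0)) \<in> span U"
      by (cases "k = j1"; cases "k = j2") (simp_all add: right_diff_distrib W span_diff span_neg span_zero)
    ultimately show ?thesis by (simp only: P_def)
  qed
  moreover have "pdx k (contract k (econst (var i1 * var i2) * (egen j1 * egen j2)))
      = econst (pd k (var i1 * var i2)) * contract k (egen j1 * egen j2)" for k i1 i2 j1 j2 :: 'n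
  proof -
    have "contract k (econst (var i1 * var i2) * (egen j1 * egen j2)) = econst (var i1 * var i2) * contract k (egen j1 * egen j2)"
      by (rule contract_simps(6))
    moreover have "pdx k (contract k (egen j1 * egen j2)) = 0"
      by (simp add: contract_egen_mult contract_egen)
    ultimately show ?thesis by (simp only: pdx_econst_mult mult_zero_right add_0_right)
  qed
  ultimately have "bvop (econst (var i1 * var i2) * (egen j1 * egen j2)) \<in> span U" for i1 i2 j1 j2
    unfolding bvop_def by (intro span_sum) (simp only:)
  then have "bvop \<pi> \<in> span U"
    unfolding piV_def bvop_sum bvop_simps by (intro span_sum span_scale)
  then show ?thesis unfolding modvec_def U_def by (rule span_neg)
qed

lemma ex_modular_matrix: "\<exists>M. modvec = (\<Sum>i\<in>UNIV. \<Sum>j\<in>UNIV. M i j *\<^sub>R (econst (var i) * egen j))"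
  using modvec_in_span
proof (induction rule: span_induct_alt)
  case base
  show ?case by (rule exI[of _ "\<lambda>_ _. 0"]) simp
next
  case (step r x y)
  obtain a b where x: "x = econst (var a) * egen b" using step.hyps by auto
  obtain M where y: "y = (\<Sum>i\<in>UNIV. \<Sum>j\<in>UNIV. M i j *\<^sub>R (econst (var i) * egen j))"
    using step.IH by (elim exE)
  have "(\<Sum>i\<in>UNIV. \<Sum>j\<in>UNIV. (if i = a then if j = b then r else 0 else 0) *\<^sub>R (econst (var i) * egen j))
      = (\<Sum>i\<in>UNIV. if i = a then r *\<^sub>R x else 0)"
    by (rule sum.cong) (auto simp: x if_distrib[of "\<lambda>r. r *\<^sub>R _"] sum.delta cong: if_cong)
  then have "r *\<^sub>R x = (\<Sum>i\<in>UNIV. \<Sum>j\<in>UNIV. (if i = a then if j = b then r else 0 else 0) *\<^sub>R (econst (var i) * egen j))"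
    by simp
  then have *: "r *\<^sub>R x + y = (\<Sum>i\<in>UNIV. \<Sum>j\<in>UNIV.
      ((if i = a then if j = b then r else 0 else 0) + M i j) *\<^sub>R (econst (var i) * egen j))"
    by (simp add: y scaleR_add_left sum.distrib)
  show ?case
    by (rule exI[of _ "\<lambda>i j. (if i = a then if j = b then r else 0 else 0) + M i j"]) (rule *)
qed

definition modmat where
  "modmat = (SOME M. modvec = (\<Sum>i\<in>UNIV. \<Sum>j\<in>UNIV. M i j *\<^sub>R (econst (var i) * egen j)))"

lemma modvec_eq: "modvec = (\<Sum>i\<in>UNIV. \<Sum>j\<in>UNIV. modmat i j *\<^sub>R (econst (var i) * egen j))"
  unfolding modmat_def by (rule someI_ex[OF ex_modular_matrix])

lemma nuv_eq: "nuv j = (\<Sum>i\<in>UNIV. modmat i j *\<^sub>R var i)"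
proof -
  have "contract j modvec = (\<Sum>i\<in>UNIV. \<Sum>k\<in>UNIV. if k = j then modmat i j *\<^sub>R econst (var i) else 0)"
    unfolding modvec_eq contract_sum
    by (intro sum.cong refl) (auto simp: contract_egen)
  then show ?thesis by (simp add: nuv_def ecoeff_sum)
qed

lemma pdx_modvec: "pdx i modvec = (\<Sum>j\<in>UNIV. modmat i j *\<^sub>R egen j)"
proof -
  have "pdx i modvec = (\<Sum>k\<in>UNIV. \<Sum>j\<in>UNIV. if k = i then modmat i j *\<^sub>R egen j else 0)"
    unfolding modvec_eq pdx_sum
    by (intro sum.cong refl) (auto simp: pdx_econst_mult pd_var)
  also have "\<dots> = (\<Sum>k\<in>UNIV. if k = i then \<Sum>j\<in>UNIV. modmat i j *\<^sub>R egen j else 0)"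
    by (rule sum.cong) auto
  finally show ?thesis by simp
qed

text \<open>The linear part of a polynomial is acted on by the matrix alone. Taking the linear parts of the
  eigenvectors of the derivation yields eigenvectors of the matrix.\<close>

lemma nu_A_linear_part:
  "Poly_Mapping.lookup (nu_A c p) (Poly_Mapping.single i 1)
    = (\<Sum>j\<in>UNIV. modmat i j * Poly_Mapping.lookup p (Poly_Mapping.single j 1))"
proof -
  have l: "Poly_Mapping.lookup (var a * q) (Poly_Mapping.single i 1) = (if a = i then Poly_Mapping.lookup q 0 else 0)" for a q
    by (simp add: lookup_var_mult lookup_single when_def)
  have "Poly_Mapping.lookup (nu_A c p) (Poly_Mapping.single i 1)
    = (\<Sum>j\<in>UNIV. \<Sum>a\<in>UNIV. modmat a j * (if a = i then Poly_Mapping.lookup (pd j p) 0 else 0))"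
    by (simp add: nu_A_eq vec_apply_def nuv_eq sum_distrib_right lookup_sum l del: One_nat_def)
  also have "\<dots> = (\<Sum>j\<in>UNIV. modmat i j * Poly_Mapping.lookup (pd j p) 0)"
    by (simp add: if_distrib[of "\<lambda>x. _ * x"] sum.delta cong: if_cong)
  finally show ?thesis by (simp add: lookup_pd)
qed

end

locale diagonal_quadratic = quadratic_poisson c for c :: "'n::{finite,linorder} quad" +
  assumes diag: "diagonalizable (nu_A c)"
begin

lemma poly_eigen_span: "p \<in> span {f. \<exists>l. nu_A c f = l *\<^sub>R f}"
proof -
  obtain g where g: "\<And>l. nu_A c (g l) = l *\<^sub>R g l" "p = (\<Sum>l | g l \<noteq> 0. g l)"
    using diag unfolding diagonalizable_def by metis
  show ?thesis unfolding g(2) by (intro span_sum span_base) (use g(1) in blast)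
qed

text \<open>Decompose each variable into eigenvectors. The coefficient of \<open>x\<^sub>i\<close> in the
  component of \<open>x\<^sub>j\<close> for the eigenvalue \<open>l\<close> is an entry of the
  spectral projection \<open>E l\<close>, first as a projection for \<open>modmat\<close> acting
  from the left and then, by \<open>transposed_spectral_projections\<close>, from the right. The
  latter is the way in which the matrix acts on the odd generators.\<close>

lemma spectral_projections:
  obtains F E where "finite F" "\<And>i j. (\<Sum>l\<in>F. E l i j) = (if i = j then 1 else 0 :: real)"
    "\<And>l i j. l \<in> F \<Longrightarrow> (\<Sum>k\<in>UNIV. E l i k * modmat k j) = l * E l i j"
proof -
  have "\<exists>g. finite {l. g l \<noteq> 0} \<and> (\<forall>l. nu_A c (g l) = l *\<^sub>R g l) \<and> var j = (\<Sum>l | g l \<noteq> 0. g l)" for j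
    using diag unfolding diagonalizable_def by metis
  then obtain g where g: "\<And>j. finite {l. g j l \<noteq> 0}" "\<And>j l. nu_A c (g j l) = l *\<^sub>R g j l"
    "\<And>j. var j = (\<Sum>l | g j l \<noteq> 0. g j l)" by metis
  define F where "F = (\<Union>j. {l. g j l \<noteq> 0})"
  define E where "E l i j = Poly_Mapping.lookup (g j l) (Poly_Mapping.single i 1)" for l i j
  have F: "finite F" using g(1) by (simp add: F_def)
  have one: "(\<Sum>l\<in>F. E l i j) = (if i = j then 1 else 0)" for i j
  proof -
    have "var j = (\<Sum>l\<in>F. g j l)"
      using g(3)[of j] by (subst sum.mono_neutral_right[OF F, of "{l. g j l \<noteq> 0}"]) (auto simp: F_def)
    then have "Poly_Mapping.lookup (var j) (Poly_Mapping.single i 1) = (\<Sum>l\<in>F. E l i j)"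
      by (simp add: E_def lookup_sum)
    moreover have "Poly_Mapping.single j (1 :: nat) = Poly_Mapping.single i 1 \<longleftrightarrow> i = j"
      by (metis lookup_single_eq lookup_single_not_eq zero_neq_one)
    ultimately show ?thesis by (simp add: var_def lookup_single when_def)
  qed
  have eig: "(\<Sum>k\<in>UNIV. modmat i k * E l k j) = l * E l i j" for l i j
    using nu_A_linear_part[of "g j l" i] by (simp add: g(2) E_def)
  show thesis
    by (rule that[OF F one]) (rule transposed_spectral_projections[OF F one eig])
qed

lemma egen_eigen_span: "egen i \<in> span {v. \<exists>l. wt v = l *\<^sub>R v}"
proof -
  obtain F E where F: "finite F" and one: "\<And>i j. (\<Sum>l\<in>F. E l i j) = (if i = j then 1 else 0 :: real)"
    and eig: "\<And>l i j. l \<in> F \<Longrightarrow> (\<Sum>k\<in>UNIV. E l i k * modmat k j) = l * E l i j"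
    by (rule spectral_projections) (rule that)
  define u where "u l = (\<Sum>k\<in>UNIV. E l i k *\<^sub>R egen k :: 'n forms)" for l
  have "wt (u l) = - l *\<^sub>R u l" if "l \<in> F" for l
  proof -
    have "wt (u l) = - (\<Sum>k\<in>UNIV. \<Sum>j\<in>UNIV. (E l i k * modmat k j) *\<^sub>R egen j)"
      by (simp add: u_def linear_sum[OF linear_wt] linear_scale[OF linear_wt] wt_egen pdx_modvec scaleR_sum_right sum_negf)
    also have "\<dots> = - (\<Sum>j\<in>UNIV. (\<Sum>k\<in>UNIV. E l i k * modmat k j) *\<^sub>R egen j)"
      by (subst sum.swap) (simp add: scaleR_sum_left)
    finally show ?thesis by (simp add: eig[OF that] u_def scaleR_sum_right sum_negf)
  qed
  then have "u l \<in> span {v. \<exists>l. wt v = l *\<^sub>R v}" if "l \<in> F" for l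
    using that by (intro span_base) blast
  then have "(\<Sum>l\<in>F. u l) \<in> span {v. \<exists>l. wt v = l *\<^sub>R v}" by (rule span_sum)
  also have "(\<Sum>l\<in>F. u l) = (\<Sum>k\<in>UNIV. if i = k then egen k else 0)"
    unfolding u_def by (subst sum.swap) (simp add: one if_distrib[of "\<lambda>r. r *\<^sub>R _"] flip: scaleR_sum_left cong: if_cong)
  finally show ?thesis by simp
qed

text \<open>The derivation acts on \<open>x\<^sub>j\<close> as the modular vector field of \<open>A\<close>,
  and on \<open>\<theta>\<^sub>i\<close> by minus the transposed matrix. Since products of
  eigenvectors are eigenvectors, it is enough that the generators are spanned by eigenvectors.\<close>

lemma wt_span_all: "a \<in> span {v. \<exists>l. wt v = l *\<^sub>R v}"
proof -
  let ?S = "{v. \<exists>l. wt v = l *\<^sub>R v}"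
  have S: "x * y \<in> span ?S" if xy: "x \<in> ?S" "y \<in> ?S" for x y
  proof -
    obtain l m where "wt x = l *\<^sub>R x" "wt y = m *\<^sub>R y" using xy by blast
    then have "wt (x * y) = (l + m) *\<^sub>R (x * y)" by (simp add: wt_mult scaleR_add_left)
    then show ?thesis by (intro span_base) blast
  qed
  have E: "econst p \<in> span ?S" for p
    using poly_eigen_span[of p]
  proof (induction rule: span_induct_alt)
    case (step r x y)
    then obtain l where "nu_A c x = l *\<^sub>R x" by auto
    then have "wt (econst x) = l *\<^sub>R econst x" by (simp add: wt_econst econst_scaleR)
    then have "econst x \<in> span ?S" by (intro span_base) blast
    then show ?case using step.IH by (simp add: econst_add econst_scaleR span_add span_scale)
  qed (simp add: span_zero)
  show ?thesis
    by (induction a rule: ext_induct) (auto intro: E span_add span_mult_closed[OF S] egen_eigen_span)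
qed

sublocale diagonal_bv_model "piV c"
  by unfold_locales (rule wt_span_all)

sublocale SA: model_side "-1" "econst :: _ \<Rightarrow> 'n forms" scalar_part var "piV c"
  by unfold_locales

subsection \<open>Forms of weight zero\<close>

lemma lie_form_eigen:
  assumes "list_all2 (\<lambda>f l. nu_A c f = l *\<^sub>R f) (f0 # fs) ls"
  shows "lie_form nuv (econst f0 * dwedge fs) = sum_list ls *\<^sub>R (econst f0 * dwedge fs)"
proof -
  obtain m ms where ls: "ls = m # ms" and m: "nu_A c f0 = m *\<^sub>R f0"
    and ms: "list_all2 (\<lambda>f l. nu_A c f = l *\<^sub>R f) fs ms"
    using assms by (auto simp: list_all2_Cons1)
  have "lie_form nuv (dwedge fs) = sum_list ms *\<^sub>R dwedge fs"
    using ms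
  proof (induction fs ms)
    case Nil
    then show ?case using lie_form_econst[of nuv 1] by (simp add: vec_apply_def)
  next
    case (Cons f fs l ms)
    then show ?case
      by (simp add: lie_form_mult lie_form_dR econst_scaleR scaleR_add_left flip: nu_A_eq)
  qed
  moreover have "lie_form nuv (econst f0) = m *\<^sub>R econst f0"
    using m by (simp add: lie_form_econst econst_scaleR flip: nu_A_eq)
  ultimately show ?thesis by (simp add: ls lie_form_mult scaleR_add_left)
qed

text \<open>Products of eigenfunctions and their differentials span all forms and are eigenvectors of the
  Lie derivative, the eigenvalue being the sum of the eigenvalues of the factors.\<close>

lemma weight_zero_forms_eq: "weight_zero_forms (nu_A c) = {w. lie_form nuv w = 0}"
proof
  show "weight_zero_forms (nu_A c) \<subseteq> {w. lie_form nuv w = 0}"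
  proof
    fix w assume "w \<in> weight_zero_forms (nu_A c)"
    then have "lie_form nuv w = 0"
      unfolding weight_zero_forms_def
    proof (induction rule: span_induct_alt)
      case (step r x y)
      then obtain f0 fs ls where x: "x = econst f0 * dwedge fs"
        "list_all2 (\<lambda>f l. nu_A c f = l *\<^sub>R f) (f0 # fs) ls" "sum_list ls = 0" by blast
      then have "lie_form nuv x = 0" using lie_form_eigen[OF x(2)] by simp
      then show ?case using step.IH by (simp add: linear_add[OF linear_lie_form] linear_scale[OF linear_lie_form])
    qed (rule linear_0[OF linear_lie_form])
    then show "w \<in> {w. lie_form nuv w = 0}" by simp
  qed
  show "{w. lie_form nuv w = 0} \<subseteq> weight_zero_forms (nu_A c)"
  proof
    fix w :: "'n forms" assume w: "w \<in> {w. lie_form nuv w = 0}"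
    let ?E = "{f. \<exists>l. nu_A c f = l *\<^sub>R f}"
    let ?G = "{econst f0 * dwedge fs | f0 fs. f0 \<in> ?E \<and> set fs \<subseteq> ?E}"
    have ls: "\<exists>ls. list_all2 (\<lambda>f l. nu_A c f = l *\<^sub>R f) fs ls" if "set fs \<subseteq> ?E" for fs
      using that by (induction fs) (auto simp: list_all2_Cons1)
    have G: "\<exists>f0 fs ls. x = econst f0 * dwedge fs \<and> list_all2 (\<lambda>f l. nu_A c f = l *\<^sub>R f) (f0 # fs) ls" if xG: "x \<in> ?G" for x
    proof -
      obtain f0 fs where x: "x = econst f0 * dwedge fs" "f0 \<in> ?E" "set fs \<subseteq> ?E" using xG by blast
      have "set (f0 # fs) \<subseteq> ?E" using x by simp
      from ls[OF this] show ?thesis using x(1) by blast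
    qed
    have "w \<in> span {x \<in> ?G. lie_form nuv x = 0}"
    proof (rule eigen_kernel[OF linear_lie_form])
      show "\<exists>l. lie_form nuv x = l *\<^sub>R x" if "x \<in> ?G" for x
        using G[OF that] lie_form_eigen by blast
      show "w \<in> span ?G" by (rule forms_span[OF poly_eigen_span])
    qed (use w in simp)
    moreover have "x \<in> weight_zero_forms (nu_A c)" if x: "x \<in> {x \<in> ?G. lie_form nuv x = 0}" for x
    proof (cases "x = 0")
      case True
      then show ?thesis by (simp add: weight_zero_forms_def span_zero)
    next
      case False
      obtain f0 fs ls where g: "x = econst f0 * dwedge fs" "list_all2 (\<lambda>f l. nu_A c f = l *\<^sub>R f) (f0 # fs) ls"
        using G x by blast
      then have "sum_list ls *\<^sub>R x = 0" using lie_form_eigen[OF g(2)] x by simp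
      then have "sum_list ls = 0" using False by simp
      then show ?thesis unfolding weight_zero_forms_def using g by (intro span_base) blast
    qed
    ultimately show "w \<in> weight_zero_forms (nu_A c)"
      unfolding weight_zero_forms_def by (metis (no_types, lifting) span_mono span_span subsetI subset_iff)
  qed
qed

text \<open>Contraction with the volume form satisfies the hypotheses of \<open>cls_transport\<close>.\<close>

theorem HP_A_presents: "presents SA.cls (HP_A c)"
proof -
  let ?n = "int CARD('n)"
  have W: "{w \<in> forms_of_degree (?n - k) \<inter> weight_zero_forms (nu_A c). bdry w = 0} = star ` cocyc0 k" for k
  proof -
    have "star a \<in> {w \<in> forms_of_degree (?n - k) \<inter> weight_zero_forms (nu_A c). bdry w = 0} \<longleftrightarrow> a \<in> cocyc0 k" for a
    proof -
      have z: "star b = 0 \<longleftrightarrow> b = 0" for b :: "'n forms" using star_inj[of b 0] by auto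
      show ?thesis
        by (auto simp: forms_of_degree_eq star_hpart weight_zero_forms_eq bdry_star z cocyc0_def cocyc_def simp flip: star_wt)
    qed
    note mem = this
    show ?thesis
    proof (rule set_eqI)
      fix w :: "'n forms"
      obtain a where a: "w = star a" using star_surj by blast
      have "star a \<in> star ` cocyc0 k \<longleftrightarrow> a \<in> cocyc0 k" using star_inj by blast
      then show "w \<in> {w \<in> forms_of_degree (?n - k) \<inter> weight_zero_forms (nu_A c). bdry w = 0} \<longleftrightarrow> w \<in> star ` cocyc0 k"
        unfolding a mem ..
    qed
  qed
  have B: "bdry ` forms_of_degree (?n - k + 1) = star ` cobound k" for k
  proof -
    have "forms_of_degree (?n - k + 1) = star ` (hpart (k - 1) :: 'n forms set)"
      by (simp add: forms_of_degree_eq star_image_hpart algebra_simps)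
    then have "bdry ` forms_of_degree (?n - k + 1) = (\<lambda>a. star (- schouten \<pi> a)) ` hpart (k - 1)"
      by (simp add: image_image bdry_star)
    also have "\<dots> = star ` (\<lambda>a. - a) ` cobound k" by (simp add: cobound_def image_image)
    also have "(\<lambda>a. - a) ` cobound k = cobound k"
    proof
      show "cobound k \<subseteq> (\<lambda>a. - a) ` cobound k"
      proof
        fix a assume "a \<in> cobound k"
        then show "a \<in> (\<lambda>a. - a) ` cobound k" using cobound_minus by (intro image_eqI[of _ _ "- a"]) auto
      qed
    qed (use cobound_minus in blast)
    finally show ?thesis .
  qed
  have br: "bracket_of (A.ev \<pi>) = br_A c" by (simp add: br_A_eq)
  have "Delta_A c k (SA.cls k a) = SA.cls (k - 1) (bvop a)" if "a \<in> cocyc0 k" for k a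
    unfolding Delta_A_def Let_def twisted_boundary_eq W B unfolding br[symmetric]
    by (rule SA.cls_transport[where T = star, OF iota_A_ev star_simps(3) star_inj refl refl dR_star that])
  then have "presents SA.cls (HP (bracket_of (A.ev \<pi>)) (Delta_A c))" by (rule SA.HP_presents)
  then show ?thesis by (simp only: HP_A_def br)
qed

end

section \<open>The Koszul dual exterior algebra\<close>

text \<open>The odd generators of \<open>V\<close> generate a copy of \<open>A\<^sup>!\<close> in
  \<open>V\<close>, consisting of the elements with constant coefficients.\<close>

definition embK :: "'n::{finite,linorder} koszul \<Rightarrow> 'n forms"
  where "embK a = Ext (\<lambda>S. Poly_Mapping.single 0 (ecoeff a S))"

definition const_part :: "'n::{finite,linorder} forms \<Rightarrow> 'n koszul"
  where "const_part a = Ext (\<lambda>S. Poly_Mapping.lookup (ecoeff a S) 0)"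

lemma single_scaleR: "Poly_Mapping.single 0 (r * x) = r *\<^sub>R Poly_Mapping.single 0 (x :: real)"
  by (rule poly_mapping_eqI) (simp add: lookup_single when_def)

lemma single_eq_0_iff: "Poly_Mapping.single 0 x = 0 \<longleftrightarrow> x = (0 :: real)"
  by (metis lookup_single_eq lookup_zero single_zero)

lemma single_neg_one_power: "Poly_Mapping.single 0 ((-1) ^ k * x) = (-1) ^ k * Poly_Mapping.single 0 (x :: real)"
  by (cases "even k") (simp_all add: single_uminus)

lemma embK_simps [simp]: "embK 0 = 0" "embK (a + b) = embK a + embK b" "embK (a - b) = embK a - embK b"
  "embK (- a) = - embK a" "embK (r *\<^sub>R a) = r *\<^sub>R embK a"
  "embK (econst x) = econst (Poly_Mapping.single 0 x)"
  "embK (econst x * a) = econst (Poly_Mapping.single 0 x) * embK a" "embK (egen i * a) = egen i * embK a"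
proof -
  show "embK 0 = 0" "embK (a + b) = embK a + embK b" "embK (a - b) = embK a - embK b"
    "embK (- a) = - embK a" "embK (r *\<^sub>R a) = r *\<^sub>R embK a"
    by (rule ext_eqI; simp add: embK_def single_add single_diff single_uminus single_scaleR)+
  show "embK (econst x) = econst (Poly_Mapping.single 0 x)"
    by (rule ext_eqI) (simp add: embK_def econst_def del: A.emb_simps)
  show "embK (econst x * a) = econst (Poly_Mapping.single 0 x) * embK a"
    by (rule ext_eqI) (simp add: embK_def mult_single del: A.emb_simps)
  show "embK (egen i * a) = egen i * embK a"
    by (rule ext_eqI) (auto simp: embK_def ecoeff_egen_mult single_neg_one_power)
qed

lemma embK_1 [simp]: "embK 1 = 1"
  using embK_simps(6)[of 1] by simp

lemma embK_egen [simp]: "embK (egen i) = egen i"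
  using embK_simps(8)[of i 1] by simp

lemma embK_mult: "embK (a * b) = embK a * embK b"
  by (induction a rule: ext_induct) (simp_all add: distrib_right mult.assoc)

lemma lookup_mult_0: "Poly_Mapping.lookup (p * q) 0 = Poly_Mapping.lookup p 0 * Poly_Mapping.lookup q 0"
  for p q :: "'n::finite poly"
proof (induction p rule: poly_induct)
  case (const r)
  then show ?case by (simp flip: scaleR_poly_eq)
next
  case (var i p)
  then show ?case by (simp add: mult.assoc lookup_var_mult)
qed (simp add: distrib_right lookup_add)

lemma lookup_neg_one_power: "Poly_Mapping.lookup ((-1) ^ k * p) m = (-1) ^ k * Poly_Mapping.lookup p m"
  for p :: "'n poly"
  by (cases "even k") simp_all

lemma const_part_simps [simp]: "const_part 0 = 0" "const_part (a + b) = const_part a + const_part b"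
  "const_part (a - b) = const_part a - const_part b" "const_part (- a) = - const_part a"
  "const_part (r *\<^sub>R a) = r *\<^sub>R const_part a"
  "const_part (econst p * a) = econst (Poly_Mapping.lookup p 0) * const_part a"
  "const_part (egen i * a) = egen i * const_part a"
proof -
  show "const_part 0 = 0" "const_part (a + b) = const_part a + const_part b"
    "const_part (a - b) = const_part a - const_part b" "const_part (- a) = - const_part a"
    "const_part (r *\<^sub>R a) = r *\<^sub>R const_part a"
    "const_part (econst p * a) = econst (Poly_Mapping.lookup p 0) * const_part a"
    by (rule ext_eqI; simp add: const_part_def lookup_add lookup_minus lookup_mult_0)+
  show "const_part (egen i * a) = egen i * const_part a"
    by (rule ext_eqI) (auto simp: const_part_def ecoeff_egen_mult lookup_neg_one_power)
qed

lemma const_part_econst [simp]: "const_part (econst p) = econst (Poly_Mapping.lookup p 0)"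
  by (rule ext_eqI) (simp add: const_part_def econst_def)

lemma const_part_sum: "const_part (sum f A) = (\<Sum>x\<in>A. const_part (f x))"
  by (induction A rule: infinite_finite_induct) auto

lemma const_part_mult: "const_part (a * b) = const_part a * const_part b"
  by (induction a rule: ext_induct) (simp_all add: distrib_right mult.assoc)

lemma const_part_contract: "const_part (contract j a) = contract j (const_part a)"
  by (rule ext_eqI) (simp add: const_part_def ecoeff_contract lookup_neg_one_power)

lemma const_part_par: "const_part (par a) = par (const_part a)"
  by (rule ext_eqI) (simp add: const_part_def par_def lookup_neg_one_power)

lemma contract_embK: "contract j (embK a) = embK (contract j a)"
  by (rule ext_eqI) (simp add: embK_def ecoeff_contract single_neg_one_power)

lemma const_part_embK [simp]: "const_part (embK a) = a"
  by (rule ext_eqI) (simp add: const_part_def embK_def)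

lemma pdx_embK [simp]: "pdx j (embK a) = 0"
  by (rule ext_eqI) (simp add: embK_def)

text \<open>A polynomial all of whose partial derivatives vanish is constant. This is how iterated
  insertions into the bivector are recognised as elements of \<open>A\<^sup>!\<close>.\<close>

lemma embK_const_part:
  assumes "\<And>j. pdx j a = 0"
  shows "embK (const_part a) = a"
proof (rule ext_eqI)
  fix S
  have z: "pd j (ecoeff a S) = 0" for j
    using assms[of j] by (metis ecoeff_pdx ecoeff_simps(1))
  show "ecoeff (embK (const_part a)) S = ecoeff a S"
  proof (rule poly_mapping_eqI)
    fix m
    show "Poly_Mapping.lookup (ecoeff (embK (const_part a)) S) m = Poly_Mapping.lookup (ecoeff a S) m"
    proof (cases "m = 0")
      case True
      then show ?thesis by (simp add: embK_def const_part_def)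
    next
      case False
      then obtain i where i: "Poly_Mapping.lookup m i \<noteq> 0" by (metis poly_mapping_eqI lookup_zero)
      define m' where "m' = m - Poly_Mapping.single i 1"
      have m: "m = m' + Poly_Mapping.single i 1"
        using i by (intro poly_mapping_eqI) (auto simp: m'_def lookup_add lookup_minus lookup_single when_def)
      have "real (Poly_Mapping.lookup m' i + 1) * Poly_Mapping.lookup (ecoeff a S) m = Poly_Mapping.lookup (pd i (ecoeff a S)) m'"
        unfolding lookup_pd m ..
      then have "Poly_Mapping.lookup (ecoeff a S) m = 0" by (simp add: z)
      then show ?thesis using False by (simp add: embK_def lookup_single when_def)
    qed
  qed
qed

subsection \<open>Bounds on the polynomial degree\<close>

text \<open>The total degree in \<open>x\<close> is at most \<open>N\<close>. Each insertion of an element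
  of \<open>A\<^sup>!\<close> lowers this degree by one, which bounds the number of arguments on
  which a polyvector can be nonzero.\<close>

definition xle :: "nat \<Rightarrow> 'n::{finite,linorder} forms \<Rightarrow> bool"
  where "xle N a \<longleftrightarrow> (\<forall>S m. Poly_Mapping.lookup (ecoeff a S) m \<noteq> 0 \<longrightarrow> mdeg m \<le> N)"

lemma ex_xle: "\<exists>N. xle N a" for a :: "'n::{finite,linorder} forms"
proof -
  have "finite (\<Union>S\<in>UNIV. mdeg ` Poly_Mapping.keys (ecoeff a S))" by simp
  then obtain N where "\<forall>x\<in>(\<Union>S\<in>UNIV. mdeg ` Poly_Mapping.keys (ecoeff a S)). x \<le> N"
    using finite_nat_set_iff_bounded_le by blast
  then have "xle N a" unfolding xle_def by (force simp: in_keys_iff)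
  then show ?thesis ..
qed

lemma xle_sum: "(\<And>x. x \<in> A \<Longrightarrow> xle N (f x)) \<Longrightarrow> xle N (sum f A)"
proof (induction A rule: infinite_finite_induct)
  case (insert x A)
  then have "xle N (f x)" "xle N (sum f A)" by auto
  then have "xle N (f x + sum f A)"
    unfolding xle_def ecoeff_simps lookup_add by (metis add.right_neutral)
  then show ?case using insert.hyps by simp
qed (simp_all add: xle_def)

lemma xle_minus: "xle N a \<Longrightarrow> xle N (- a)"
  by (simp add: xle_def)

lemma xle_par: "xle N a \<Longrightarrow> xle N (par a)"
  by (simp add: xle_def par_def lookup_neg_one_power)

lemma xle_pdx: "xle (Suc N) a \<Longrightarrow> xle N (pdx j a)"
  unfolding xle_def
proof (intro allI impI)
  fix S m assume *: "\<forall>S m. Poly_Mapping.lookup (ecoeff a S) m \<noteq> 0 \<longrightarrow> mdeg m \<le> Suc N"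
    and nz: "Poly_Mapping.lookup (ecoeff (pdx j a) S) m \<noteq> 0"
  from nz have "Poly_Mapping.lookup (ecoeff a S) (m + Poly_Mapping.single j 1) \<noteq> 0"
    by (simp add: lookup_pd)
  then have "mdeg (m + Poly_Mapping.single j 1) \<le> Suc N" using * by blast
  then show "mdeg m \<le> N" by simp
qed

lemma xle_0_pdx: "xle 0 a \<Longrightarrow> pdx j a = 0"
proof (rule ext_eqI, rule poly_mapping_eqI)
  fix S m assume "xle 0 a"
  then have "Poly_Mapping.lookup (ecoeff a S) (m + Poly_Mapping.single j 1) = 0"
    unfolding xle_def by (metis add_is_0 le_0_eq mdeg_simps(2,3) one_neq_zero)
  then show "Poly_Mapping.lookup (ecoeff (pdx j a) S) m = Poly_Mapping.lookup (ecoeff 0 S) m"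
    by (simp add: lookup_pd)
qed

lemma xle_mult_embK:
  assumes "xle N a"
  shows "xle N (a * embK g)"
  unfolding xle_def
proof (intro allI impI)
  fix S m assume nz: "Poly_Mapping.lookup (ecoeff (a * embK g) S) m \<noteq> 0"
  have eq: "ecoeff (a * embK g) S = (\<Sum>T\<in>Pow S. (-1) ^ inversions T (S - T) * (ecoeff g (S - T) *\<^sub>R ecoeff a T))"
    unfolding times_ext_def ecoeff_Ext embK_def by (simp add: scaleR_poly_eq mult_ac)
  have "(\<Sum>T\<in>Pow S. Poly_Mapping.lookup ((-1) ^ inversions T (S - T) * (ecoeff g (S - T) *\<^sub>R ecoeff a T)) m) \<noteq> 0"
    using nz unfolding eq lookup_sum .
  from sum.not_neutral_contains_not_neutral[OF this]
  obtain T where "Poly_Mapping.lookup ((-1) ^ inversions T (S - T) * (ecoeff g (S - T) *\<^sub>R ecoeff a T)) m \<noteq> 0"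
    by blast
  then have "Poly_Mapping.lookup (ecoeff a T) m \<noteq> 0" by (auto simp: lookup_neg_one_power)
  then show "mdeg m \<le> N" using assms by (auto simp: xle_def)
qed

lemma schouten_embK: "schouten a (embK f) = - (\<Sum>j\<in>UNIV. pdx j a * embK (contract j f))"
  by (simp add: schouten_def contract_embK sum_negf)

lemma fold_schouten_embK:
  "xle N a \<Longrightarrow> N < length fs \<Longrightarrow> fold (\<lambda>f a. 1 *\<^sub>R schouten (par a) (embK f)) fs a = 0"
proof (induction fs arbitrary: a N)
  case (Cons f fs)
  show ?case
  proof (cases N)
    case 0
    have z: "fold (\<lambda>f a. 1 *\<^sub>R schouten (par a) (embK f)) gs 0 = 0" for gs :: "'a koszul list"
      by (induction gs) simp_all
    have "schouten (par a) (embK f) = 0"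
      using Cons.prems 0 by (simp add: schouten_embK xle_0_pdx[OF xle_par])
    then show ?thesis using z by simp
  next
    case (Suc M)
    have "xle M (schouten (par a) (embK f))"
      unfolding schouten_embK using Cons.prems Suc
      by (intro xle_minus xle_sum xle_mult_embK xle_pdx xle_par) simp
    then show ?thesis using Cons.IH[of M] Cons.prems Suc by simp
  qed
qed simp

text \<open>The basis of increasing products, scaled by \<open>r\<close>.\<close>

definition kmono :: "'n::{finite,linorder} set \<Rightarrow> real \<Rightarrow> 'n koszul"
  where "kmono S r = Ext (\<lambda>T. if T = S then r else 0)"

lemma kmono_gr: "kmono S r \<in> gr (- int (card S))"
  by (simp add: kmono_def gr_ext_def)

lemma kmono_expansion: "(\<Sum>S\<in>UNIV. kmono S (ecoeff f S)) = f"
  by (rule ext_eqI) (simp add: ecoeff_sum kmono_def)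

lemma koszul_mono_induct:
  fixes f :: "'n::{finite,linorder} koszul"
  assumes f: "f \<in> gr d" and mono: "\<And>S r. Q (kmono S r)"
    and add: "\<And>a b. a \<in> gr d \<Longrightarrow> b \<in> gr d \<Longrightarrow> Q a \<Longrightarrow> Q b \<Longrightarrow> Q (a + b)"
  shows "Q f"
proof -
  have 0: "Q 0" using mono[of "{}" 0] by (simp add: kmono_def zero_ext_def)
  have "(\<Sum>S\<in>\<A>. kmono S (ecoeff f S)) \<in> gr d \<and> Q (\<Sum>S\<in>\<A>. kmono S (ecoeff f S))" for \<A>
  proof (induction \<A> rule: infinite_finite_induct)
    case (insert S \<A>)
    have "kmono S (ecoeff f S) \<in> gr d"
      using f kmono_gr[of S "ecoeff f S"] by (cases "ecoeff f S = 0") (auto simp: gr_ext_def kmono_def)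
    then show ?case using insert add mono by (auto simp: gr_ext_eq intro: hpart_add)
  qed (auto simp: 0 gr_ext_eq)
  then show ?thesis using kmono_expansion by metis
qed

text \<open>Sums are only formed within one degree, because graded maps are additive on homogeneous
  components only. The monomials are built up by splitting off the smallest generator, for which
  no sign occurs.\<close>

lemma koszul_gen_induct:
  fixes f :: "'n::{finite,linorder} koszul"
  assumes one: "\<And>r. Q (r *\<^sub>R 1)" and gen: "\<And>j a. homogeneous a \<Longrightarrow> Q a \<Longrightarrow> Q (egen j * a)"
    and add: "\<And>d a b. a \<in> gr d \<Longrightarrow> b \<in> gr d \<Longrightarrow> Q a \<Longrightarrow> Q b \<Longrightarrow> Q (a + b)" and f: "homogeneous f"
  shows "Q f"
proof -
  have m: "Q (kmono S r)" if "card S = k" for S r k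
    using that
  proof (induction k arbitrary: S)
    case 0
    then have "kmono S r = r *\<^sub>R 1" by (intro ext_eqI) (simp add: kmono_def one_ext_def)
    then show ?case using one by simp
  next
    case (Suc k)
    define i where "i = Min S"
    have ne: "S \<noteq> {}" using Suc.prems by auto
    have i: "i \<in> S" using ne by (simp add: i_def)
    have less: "below i S = 0" by (auto simp: i_def below_def dest: Min_le[OF finite])
    have "kmono S r = egen i * kmono (S - {i}) r"
      using i less by (intro ext_eqI) (auto simp: ecoeff_egen_mult kmono_def)
    moreover have "Q (kmono (S - {i}) r)" using i Suc by (intro Suc.IH) simp
    ultimately show ?case using gen kmono_gr by (metis homogeneous_def)
  qed
  obtain d where d: "f \<in> gr d" using f by (auto simp: homogeneous_def)
  show ?thesis by (rule koszul_mono_induct[OF d m[OF refl] add])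
qed

text \<open>On this side the complementary variables are the \<open>x\<^sub>j\<close>, and the bracket of
  two elements of \<open>A\<^sup>!\<close> vanishes as both are independent of \<open>x\<close>.\<close>

interpretation K: polyvector_side 1 "embK :: 'n::{finite,linorder} koszul \<Rightarrow> _" const_part egen
proof (rule polyvector_side.intro)
  show "linear (embK :: 'n koszul \<Rightarrow> _)" "linear (const_part :: _ \<Rightarrow> 'n koszul)"
    by (rule linearI; simp)+
  show "f \<in> gr d \<longleftrightarrow> embK f \<in> hpart (- d)" for f :: "'n koszul" and d
    by (simp add: gr_ext_eq hpart_def embK_def single_eq_0_iff)
  show "embK (const_part a) \<in> hpart k" if "a \<in> hpart k" for a :: "'n forms" and k
    using that unfolding hpart_def by (simp add: embK_def const_part_def single_eq_0_iff) (metis lookup_zero)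
  show "schouten (embK f) (embK g) = 0" for f g :: "'n koszul"
    by (simp add: schouten_def)
  show "\<exists>N. \<forall>fs. N < length fs \<longrightarrow> const_part (fold (\<lambda>f a. 1 *\<^sub>R schouten (par a) (embK f)) fs a) = 0"
    if "a \<in> hpart k" for a :: "'n forms" and k
  proof -
    obtain N where "xle N a" using ex_xle by blast
    then show ?thesis using fold_schouten_embK[of N a] by (metis const_part_simps(1))
  qed
  show "homogeneous (egen j :: 'n koszul)" for j
    unfolding homogeneous_def gr_ext_eq by (rule exI[of _ "-1"]) simp
  show "Q f" if "\<And>r. Q (r *\<^sub>R 1)" "\<And>j a. homogeneous a \<Longrightarrow> Q a \<Longrightarrow> Q (egen j * a)"
      "\<And>d a b. a \<in> gr d \<Longrightarrow> b \<in> gr d \<Longrightarrow> Q a \<Longrightarrow> Q b \<Longrightarrow> Q (a + b)" "homogeneous f" for Q and f :: "'n koszul"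
    using that by (rule koszul_gen_induct)
qed (simp_all add: embK_mult const_part_mult)

lemma egen_gr: "egen j \<in> (gr (- 1) :: 'n::{finite,linorder} koszul set)"
  by (simp add: gr_ext_eq)

lemma hdeg_egen [simp]: "hdeg (egen j :: 'n::{finite,linorder} koszul) = - 1"
proof (rule K.hdeg_eq[OF egen_gr])
  show "egen j \<noteq> (0 :: 'n koszul)"
    by (metis contract_egen contract_simps(1) zero_neq_one)
qed

lemma K_ins: "K.ins f a = - (\<Sum>j\<in>UNIV. pdx j (par a) * embK (contract j f))"
  by (simp add: K.ins_def schouten_embK)

lemma K_ins_egen: "K.ins (egen j) a = - pdx j (par a)"
  by (simp add: K.ins_def schouten_egen)

definition list_monomial :: "'n list \<Rightarrow> 'n \<Rightarrow>\<^sub>0 nat"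
  where "list_monomial js = sum_list (map (\<lambda>j. Poly_Mapping.single j 1) js)"

lemma lookup_list_monomial: "Poly_Mapping.lookup (list_monomial js) i = count (mset js) i"
  by (induction js) (simp_all add: list_monomial_def lookup_add lookup_single when_def)

text \<open>The number by which the coefficient of a monomial is multiplied when the derivatives listed in
  \<open>js\<close> are taken.\<close>

fun diff_coeff :: "'n list \<Rightarrow> ('n \<Rightarrow>\<^sub>0 nat) \<Rightarrow> real" where
  "diff_coeff [] m = 1"
| "diff_coeff (j # js) m = diff_coeff js m * (real (Poly_Mapping.lookup (m + list_monomial js) j) + 1)"

lemma diff_coeff_pos: "diff_coeff js m > 0"
  by (induction js) (auto intro!: mult_pos_pos)

text \<open>Inserting the generator \<open>\<xi>\<^sub>j\<close> is differentiation by
  \<open>x\<^sub>j\<close> up to sign. The values of a polyvector on lists of generators are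
  therefore its Taylor coefficients.\<close>

lemma lookup_fold_K_ins_egen:
  "Poly_Mapping.lookup (ecoeff (fold K.ins (map egen js) a) S) m
    = (- ((-1) ^ card S)) ^ length js * diff_coeff js m * Poly_Mapping.lookup (ecoeff a S) (m + list_monomial js)"
proof (induction js arbitrary: a)
  case Nil
  then show ?case by (simp add: list_monomial_def)
next
  case (Cons j js)
  have "Poly_Mapping.lookup (ecoeff (K.ins (egen j) a) S) m'
      = - ((-1) ^ card S) * ((real (Poly_Mapping.lookup m' j) + 1) * Poly_Mapping.lookup (ecoeff a S) (m' + Poly_Mapping.single j 1))" for m'
    by (simp add: K_ins_egen par_def lookup_neg_one_power lookup_pd)
  then show ?case
    using Cons[of "K.ins (egen j) a"] by (simp add: list_monomial_def add.assoc add.commute[of "Poly_Mapping.single j (Suc 0)"] mult_ac)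
qed

lemma ecoeff_K_ev_egen:
  "ecoeff (K.ev a (map egen js)) S
    = (- ((-1) ^ card S)) ^ length js * diff_coeff js 0 * Poly_Mapping.lookup (ecoeff a S) (list_monomial js)"
proof -
  have "homs (map egen js :: 'a koszul list)" using K.gen_hom by auto
  then have "K.ev a (map egen js) = const_part (fold K.ins (map egen js) a)"
    unfolding K.ev_def by (rule if_P)
  then show ?thesis using lookup_fold_K_ins_egen[of js a S 0] by (simp add: const_part_def)
qed

lemma ex_list_monomial: "\<exists>js. list_monomial js = m" for m :: "'n::finite \<Rightarrow>\<^sub>0 nat"
proof (induction m rule: monomial_induct)
  case zero
  show ?case by (rule exI[of _ "[]"]) (simp add: list_monomial_def)
next
  case (add i m)
  then obtain js where "list_monomial js = m" by blast
  then show ?case by (intro exI[of _ "i # js"]) (simp add: list_monomial_def)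
qed

lemma polyder_bound: "P \<in> polyder act k \<Longrightarrow> \<exists>N. \<forall>fs. N < length fs \<longrightarrow> P fs = 0"
  unfolding polyder_def mem_Collect_eq by (elim conjE)

lemma polyder_gr: "P \<in> polyder act k \<Longrightarrow> homs fs \<Longrightarrow> P fs \<in> gr (int (length fs) - k + degs fs)"
  unfolding polyder_def mem_Collect_eq by (elim conjE) blast

text \<open>The values on generators prescribe the Taylor coefficients. For each monomial one list of
  generators is chosen; the other lists of generators with the same monomial are permutations of
  it, and both sides change in the same way under transpositions. Finitely many coefficients are
  nonzero because of the bound on the number of arguments.\<close>

lemma K_ev_ex:
  fixes P :: "'n::{finite,linorder} koszul list \<Rightarrow> 'n koszul"
  assumes P: "P \<in> polyvectors k"
  shows "\<exists>a\<in>hpart k. \<forall>js. K.ev a (map egen js) = P (map egen js)"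
proof -
  obtain N where N: "\<And>fs. N < length fs \<Longrightarrow> P fs = 0" using polyder_bound[OF P] by blast
  define L where "L m = (SOME js. list_monomial js = m)" for m :: "'n \<Rightarrow>\<^sub>0 nat"
  have L: "list_monomial (L m) = m" for m unfolding L_def by (rule someI_ex[OF ex_list_monomial])
  define q where "q S m = (- ((-1) ^ card S)) ^ length (L m) / diff_coeff (L m) 0 * ecoeff (P (map egen (L m))) S"
    for S :: "'n set" and m
  have fin: "finite {m. q S m \<noteq> 0}" for S
  proof (rule finite_subset)
    show "{m. q S m \<noteq> 0} \<subseteq> list_monomial ` {js. length js \<le> N}"
    proof
      fix m assume "m \<in> {m. q S m \<noteq> 0}"
      then have "P (map egen (L m)) \<noteq> 0" by (auto simp: q_def)
      then have "length (L m) \<le> N" using N[of "map egen (L m)"] by (cases "length (L m) \<le> N") simp_all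
      then show "m \<in> list_monomial ` {js. length js \<le> N}" using L[of m] by (intro image_eqI[of _ _ "L m"]) auto
    qed
    show "finite (list_monomial ` {js :: 'n list. length js \<le> N})"
      using finite_lists_length_le[of "UNIV :: 'n set" N] by simp
  qed
  define a where "a = Ext (\<lambda>S. Abs_poly_mapping (q S))"
  have lk: "Poly_Mapping.lookup (ecoeff a S) m = q S m" for S m
    by (simp add: a_def fin)
  have sq: "(- ((-1) ^ card S)) ^ n * ((- ((-1) ^ card S)) ^ n * x) = (x :: real)" for S :: "'n set" and n x
    by (cases "even (card S)") (simp_all flip: mult.assoc power_mult_distrib)
  have aL: "K.ev a (map egen (L m)) = P (map egen (L m))" for m
  proof (rule ext_eqI)
    fix S
    have "diff_coeff (L m) 0 \<noteq> 0" using diff_coeff_pos[of "L m" 0] by simp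
    then show "ecoeff (K.ev a (map egen (L m))) S = ecoeff (P (map egen (L m))) S"
      by (simp add: ecoeff_K_ev_egen L lk q_def sq mult.assoc)
  qed
  have a: "a \<in> hpart k"
  proof -
    have "int (card S) = k" if "q S m \<noteq> 0" for S m
    proof -
      have "degs (map egen (L m) :: 'n koszul list) = - int (length (L m))"
        by (simp add: o_def sum_list_triv)
      moreover have "homs (map egen (L m) :: 'n koszul list)" using K.gen_hom by auto
      ultimately have "P (map egen (L m)) \<in> gr (int (length (map egen (L m) :: 'n koszul list)) - k + - int (length (L m)))"
        using polyder_gr[OF P, of "map egen (L m)"] by simp
      then have "P (map egen (L m)) \<in> hpart k" by (simp add: gr_ext_eq)
      moreover have "ecoeff (P (map egen (L m))) S \<noteq> 0" using that by (auto simp: q_def)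
      ultimately show ?thesis by (auto simp: hpart_def)
    qed
    then show ?thesis
      unfolding hpart_def by (auto simp: lk) (metis lk lookup_zero poly_mapping_eqI)
  qed
  note E = K.ev_polyder[OF a]
  have swap1: "Q (map egen xs @ egen y # egen x # map egen ys) = Q (map egen xs @ egen x # egen y # map egen ys)"
    if "Q \<in> polyvectors k" for xs x y ys and Q :: "'n koszul list \<Rightarrow> 'n koszul"
    by (rule trans[OF polyder_skew[OF that]]) simp
  define R where "R js \<longleftrightarrow> K.ev a (map egen js) = P (map egen js)" for js
  have swap: "R (xs @ y # x # ys) \<longleftrightarrow> R (xs @ x # y # ys)" for xs x y ys
    unfolding R_def by (simp add: swap1[OF E, of xs y x ys] swap1[OF P, of xs y x ys])
  have "R js" for js
  proof -
    have "mset (L (list_monomial js)) = mset js"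
      by (rule multiset_eqI) (metis L lookup_list_monomial)
    then have s: "sort (L (list_monomial js)) = sort js"
      by (metis mset_sort properties_for_sort sorted_sort)
    have "R (L (list_monomial js))" by (simp add: R_def aL)
    then have "R (sort js)" using skew_sort[of R "[]" "L (list_monomial js)"] swap by (simp add: s)
    then show ?thesis using skew_sort[of R "[]" js] swap by simp
  qed
  then show ?thesis using a unfolding R_def by blast
qed

text \<open>The derivation dual to \<open>\<xi>\<^sub>i\<close> is given by \<open>- x\<^sub>i\<close>. In
  the bivector two such factors occur, and the signs cancel.\<close>

lemma K_ev_var: "vector_pv (contract i) = K.ev (- econst (var i))"
proof
  fix fs :: "'a koszul list"
  have f: "K.ins f (- econst (var i)) = embK (contract i f)" for f :: "'a koszul"
  proof -
    have "K.ins f (- econst (var i)) = (\<Sum>j\<in>UNIV. if j = i then embK (contract i f) else 0)"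
      unfolding K_ins sum_negf[symmetric] by (rule sum.cong) (auto simp: pd_var)
    then show ?thesis by simp
  qed
  then have f': "K.ins f (econst (var i)) = - embK (contract i f)" for f :: "'a koszul"
    by (metis K.ins_simps(4) minus_minus)
  show "vector_pv (contract i) fs = K.ev (- econst (var i)) fs"
  proof (cases fs)
    case Nil
    then show ?thesis by (simp add: K.ev_Nil vector_pv_def lookup_var_mult[of _ 1, simplified])
  next
    case (Cons f gs)
    show ?thesis
    proof (cases "homogeneous f")
      case True
      then have "homogeneous (contract i f)"
        unfolding homogeneous_def gr_ext_eq by (metis hpart_contract minus_equation_iff)
      then show ?thesis
        using True Cons by (cases gs) (auto simp: K.ev_Cons K.ev_Nil f f' vector_pv_def K.ins_emb K.ev_def)
    next
      case False
      then have "\<not> homs fs" using Cons by simp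
      then show ?thesis using False Cons by (simp add: K.ev_nonhom vector_pv_def split: list.split)
    qed
  qed
qed

lemma pi_K_eq: "pi_K c = K.ev (piV c)"
proof -
  have "wedge (*) 2 0 (scalar_pv (egen j1 * egen j2)) (wedge (*) 0 0 (vector_pv (contract i1)) (vector_pv (contract i2)))
      = K.ev (econst (var i1 * var i2) * (egen j1 * egen j2))" for i1 i2 j1 j2 :: 'a
  proof -
    have "wedge (*) 0 0 (vector_pv (contract i1)) (vector_pv (contract i2)) = K.ev (econst (var i1 * var i2))"
      unfolding K_ev_var by (subst K.wedge_ev) (auto intro: hpart_minus simp: econst_mult)
    moreover have h: "egen j1 * egen j2 \<in> (hpart 2 :: 'a forms set)" "egen j1 * egen j2 \<in> (hpart 2 :: 'a koszul set)"
      using hpart_mult[OF hpart_egen hpart_egen] by fastforce+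
    moreover have "scalar_pv (egen j1 * egen j2) = K.ev (egen j1 * egen j2 :: 'a forms)"
      using K.ev_scalar[OF K.homogeneous_mult[OF K.gen_hom K.gen_hom], of j1 j2]
      by (simp only: embK_mult embK_egen)
    ultimately show ?thesis
      using K.wedge_ev[OF h(1) hpart_econst, of "var i1 * var i2"] econst_commute[of "egen j1 * egen j2 :: 'a forms" "var i1 * var i2"]
      by (simp only: add_0_right)
  qed
  moreover have "K.ev (sum g X) = (\<Sum>x\<in>X. K.ev (g x))" for g :: "'a \<Rightarrow> 'a forms" and X
    by (induction X rule: infinite_finite_induct) auto
  ultimately show ?thesis by (simp add: pi_K_def piV_def)
qed

text \<open>The bivector is homogeneous of degree two in \<open>x\<close>: its terms of degree zero and one
  vanish, and so do its third derivatives.\<close>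

lemma const_part_pdx_piV: "const_part (pdx j (piV c)) = 0"
  and const_part_piV: "const_part (piV c) = 0"
  and pdx_pdx_pdx_piV: "pdx i (pdx j (pdx k (piV c))) = 0"
proof -
  have v: "Poly_Mapping.lookup (var i :: 'a poly) 0 = 0" for i
    using lookup_var_mult[of i 1 0] by simp
  have "const_part (pdx j (econst (var i1 * var i2) * (egen j1 * egen j2))) = 0" for j i1 i2 j1 j2 :: 'a
    unfolding pdx_econst_mult
    by (simp add: pd_mult pd_var lookup_add lookup_mult_0 v del: K.emb_simps A.emb_simps)
  then show "const_part (pdx j (piV c)) = 0"
    unfolding piV_def by (simp only: pdx_sum const_part_sum pdx_simps const_part_simps scaleR_zero_right sum.neutral_const)
  show "const_part (piV c) = 0"
    unfolding piV_def const_part_sum const_part_simps lookup_mult_0 v by simp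
  have "pdx i (pdx j (pdx k (econst (var i1 * var i2) * (egen j1 * egen j2)))) = 0" for i j k i1 i2 j1 j2 :: 'a
  proof -
    have "pd i (pd j (pd k (var i1 * var i2))) = 0"
      by (auto simp: pd_mult pd_var)
    then show ?thesis by (simp only: pdx_econst_mult pdx_egen_mult pdx_egen mult_zero_right add_0_right econst_0 mult_zero_left)
  qed
  then show "pdx i (pdx j (pdx k (piV c))) = 0"
    unfolding piV_def by (simp only: pdx_sum pdx_simps scaleR_zero_right sum.neutral_const)
qed

text \<open>The bracket of two elements of \<open>A\<^sup>!\<close> is a second derivative of the bivector,
  hence independent of \<open>x\<close>.\<close>

interpretation K: poisson_side 1 "embK :: 'n::{finite,linorder} koszul \<Rightarrow> _" const_part egen "piV c" for c
proof (intro poisson_side.intro poisson_side_axioms.intro K.polyvector_side_axioms piV_hpart)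
  show "const_part (schouten (piV c) a) = 0" for a
    by (simp add: schouten_def const_part_sum const_part_mult const_part_contract const_part_par const_part_pdx_piV const_part_piV)
  have pdx_ins: "pdx i (K.ins f a) = K.ins f (pdx i a)" for i f and a :: "'n forms"
    by (simp add: K.ins_def pdx_schouten pdx_par)
  show "embK (const_part (K.ins g (K.ins f (piV c)))) = K.ins g (K.ins f (piV c))" for f g :: "'n koszul"
  proof (rule embK_const_part)
    fix j
    have "K.ins f (pdx i (pdx j (piV c))) = 0" for i
      by (simp add: K_ins pdx_par pdx_pdx_pdx_piV)
    then have "K.ins g (K.ins f (pdx j (piV c))) = 0"
      by (simp add: K_ins[of g] pdx_ins pdx_par)
    then show "pdx j (K.ins g (K.ins f (piV c))) = 0" by (simp add: pdx_ins)
  qed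
  show "const_part (schouten (K.ins f (piV c)) a) = const_part (schouten (K.ins f (piV c)) (embK (const_part a)))"
    for f :: "'n koszul" and a
  proof -
    have "const_part (K.ins f (piV c)) = 0"
      by (simp add: K_ins const_part_sum const_part_mult pdx_par const_part_par const_part_pdx_piV)
    then show ?thesis
      by (simp add: schouten_def const_part_sum const_part_mult const_part_contract const_part_par)
  qed
qed

lemma K_ev_gen_0:
  fixes a :: "'n::{finite,linorder} forms"
  assumes "\<And>js. K.ev a (map egen js) = 0"
  shows "a = 0"
proof (rule ext_eqI, rule poly_mapping_eqI)
  fix S :: "'n set" and m :: "'n \<Rightarrow>\<^sub>0 nat"
  obtain js where js: "list_monomial js = m" using ex_list_monomial by blast
  have "ecoeff (K.ev a (map egen js)) S = 0" unfolding assms by (rule ecoeff_simps)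
  moreover have "diff_coeff js 0 \<noteq> 0" using diff_coeff_pos[of js 0] by linarith
  ultimately have "Poly_Mapping.lookup (ecoeff a S) m = 0" unfolding ecoeff_K_ev_egen js by simp
  then show "Poly_Mapping.lookup (ecoeff a S) m = Poly_Mapping.lookup (ecoeff 0 S) m" by simp
qed

interpretation K: full_side 1 "embK :: 'n::{finite,linorder} koszul \<Rightarrow> _" const_part egen "piV c" for c
  by (intro full_side.intro full_side_axioms.intro K.poisson_side_axioms)
    (rule K_ev_gen_0, assumption, rule K_ev_ex, assumption)

lemma br_K_eq: "br_K c = bracket_of (K.ev (piV c))"
  unfolding pi_K_eq ..

section \<open>The twisted complex of the Koszul dual\<close>

subsection \<open>The duality between the exterior algebra and its linear dual\<close>

lemma eta_simps [simp]: "eta_K 0 = 0" "eta_K (a + b) = eta_K a + eta_K b" "eta_K (a - b) = eta_K a - eta_K b"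
  "eta_K (- a) = - eta_K a" "eta_K (r *\<^sub>R a) = r *\<^sub>R eta_K a"
  by (auto simp: eta_K_def fun_eq_iff distrib_right left_diff_distrib scaleR_fun_def)

lemma eta_sum: "eta_K (sum f A) = (\<Sum>x\<in>A. eta_K (f x))"
  by (induction A rule: infinite_finite_induct) auto

text \<open>The pairing of complementary monomials is \<open>1\<close> or \<open>-1\<close>. This makes the
  functional dual to the product of all generators a nondegenerate form on
  \<open>A\<^sup>!\<close>.\<close>

lemma ecoeff_mult_kmono:
  "ecoeff (a * kmono (- S) r) UNIV = (-1) ^ inversions S (- S) * (ecoeff a S * r)"
  for a :: "'n::{finite,linorder} koszul"
proof -
  have "ecoeff (a * kmono (- S) r) UNIV
      = (\<Sum>T\<in>UNIV. (-1) ^ inversions T (UNIV - T) * ecoeff a T * ecoeff (kmono (- S) r) (UNIV - T))"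
    by (simp add: times_ext_def)
  also have "\<dots> = (\<Sum>T\<in>UNIV. if S = T then (-1) ^ inversions S (- S) * (ecoeff a S * r) else 0)"
    by (rule sum.cong) (auto simp: kmono_def Compl_eq_Diff_UNIV[symmetric])
  finally show ?thesis by simp
qed

lemma eta_kmono: "eta_K a (kmono (- S) r) = (-1) ^ inversions S (- S) * (ecoeff a S * r)"
  using kmono_gr[of "- S" r] unfolding eta_K_def ecoeff_mult_kmono homogeneous_def by auto

lemma eta_eq_iff [simp]: "eta_K a = eta_K b \<longleftrightarrow> a = b" for a b :: "'n::{finite,linorder} koszul"
proof
  assume eq: "eta_K a = eta_K b"
  show "a = b"
  proof (rule ext_eqI)
    fix S
    have "eta_K a (kmono (- S) 1) = eta_K b (kmono (- S) 1)" by (simp only: eq)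
    then show "ecoeff a S = ecoeff b S" unfolding eta_kmono by simp
  qed
qed simp

lemma eta_0_iff [simp]: "eta_K a = 0 \<longleftrightarrow> a = 0" for a :: "'n::{finite,linorder} koszul"
  using eta_eq_iff[of a 0] by simp

lemma ecoeff_UNIV_gr: "a \<in> gr d \<Longrightarrow> ecoeff a UNIV \<in> gr (d + int CARD('n))" for a :: "'n::{finite,linorder} koszul"
  by (auto simp: gr_ext_def gr_real_def)

lemma eta_gr:
  fixes a :: "'n::{finite,linorder} koszul"
  assumes a: "a \<in> gr d" shows "eta_K a \<in> gr (d + int CARD('n))"
  unfolding gr_fun_def mem_Collect_eq
proof (intro conjI allI ballI impI)
  fix e and f g :: "'n koszul" and r assume fg: "f \<in> gr e"
  have h: "homogeneous f" using fg by (rule K.homogeneousI)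
  show "eta_K a f \<in> gr (e + (d + int CARD('n)))"
    using ecoeff_UNIV_gr[OF K.gr_mult[OF a fg]] h by (simp add: eta_K_def algebra_simps)
  show "eta_K a (r *\<^sub>R f) = r *\<^sub>R eta_K a f"
    using h by (simp add: eta_K_def K.homogeneous_scaleR)
  assume g: "g \<in> gr e"
  show "eta_K a (f + g) = eta_K a f + eta_K a g"
    using h K.homogeneousI[OF g] K.homogeneousI[OF K.gr_add[OF fg g]] by (simp add: eta_K_def distrib_left)
qed (simp add: eta_K_def)

lemma gr_fun_unique:
  fixes \<psi> :: "'n::{finite,linorder} koszul \<Rightarrow> real"
  assumes "\<psi> \<in> gr d" "\<psi> \<in> gr e" "\<psi> \<noteq> 0" shows "d = e"
proof -
  obtain f where f: "\<psi> f \<noteq> 0" using assms(3) by (auto simp: fun_eq_iff)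
  then obtain k where "f \<in> gr k" using assms(1) unfolding gr_fun_def homogeneous_def by blast
  then have "\<psi> f \<in> gr (k + d)" "\<psi> f \<in> gr (k + e)" using assms(1,2) unfolding gr_fun_def by blast+
  then show ?thesis using f by (auto simp: gr_real_def split: if_splits)
qed

lemma hdeg_eta:
  fixes a :: "'n::{finite,linorder} koszul"
  assumes a: "homogeneous a" "a \<noteq> 0" shows "hdeg (eta_K a) = hdeg a + int CARD('n)"
proof -
  have e: "eta_K a \<in> gr (hdeg a + int CARD('n))" by (rule eta_gr[OF K.gr_hdeg[OF a(1)]])
  have "(THE d. eta_K a \<in> gr d) = hdeg a + int CARD('n)"
    by (rule the_equality, rule e, rule gr_fun_unique[OF _ e]) (use a(2) in simp_all)
  then show ?thesis using a(2) by (simp add: hdeg_def[of "eta_K a"])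
qed

lemma eta_gr_iff:
  fixes a :: "'n::{finite,linorder} koszul"
  assumes a: "homogeneous a" shows "eta_K a \<in> gr (d + int CARD('n)) \<longleftrightarrow> a \<in> gr d"
proof
  assume e: "eta_K a \<in> gr (d + int CARD('n))"
  show "a \<in> gr d"
  proof (cases "a = 0")
    case False
    have "eta_K a \<in> gr (hdeg a + int CARD('n))" by (rule eta_gr[OF K.gr_hdeg[OF a]])
    then have "hdeg a + int CARD('n) = d + int CARD('n)" using gr_fun_unique[OF _ e] False by simp
    then show ?thesis using K.gr_hdeg[OF a] by simp
  qed simp
qed (rule eta_gr)

text \<open>The coefficients of the preimage are the values on the complementary monomials.\<close>

lemma eta_surj:
  fixes \<psi> :: "'n::{finite,linorder} koszul \<Rightarrow> real"
  assumes \<psi>: "\<psi> \<in> gr (d + int CARD('n))"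
  shows "\<exists>a\<in>gr d. eta_K a = \<psi>"
proof -
  have nonhom: "\<psi> f = 0" if "\<not> homogeneous f" for f using \<psi> that unfolding gr_fun_def by blast
  have gr: "\<psi> f \<in> gr (e + (d + int CARD('n)))" if "f \<in> gr e" for f e using \<psi> that unfolding gr_fun_def by blast
  have scale: "\<psi> (r *\<^sub>R f) = r *\<^sub>R \<psi> f" if "f \<in> gr e" for f e r using \<psi> that unfolding gr_fun_def by blast
  have add: "\<psi> (f + g) = \<psi> f + \<psi> g" if "f \<in> gr e" "g \<in> gr e" for f g e using \<psi> that unfolding gr_fun_def by blast
  define a where "a = Ext (\<lambda>S. (-1) ^ inversions S (- S) * \<psi> (kmono (- S) 1))"
  have km: "kmono S r = r *\<^sub>R kmono S 1" for S :: "'n set" and r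
    by (rule ext_eqI) (simp add: kmono_def)
  have sq: "(- 1) ^ m * ((- 1) ^ m * x * y) = x * (y :: real)" for m x y
    by (cases "even m") simp_all
  have a: "a \<in> gr d"
    unfolding gr_ext_eq hpart_def mem_Collect_eq
  proof (intro allI impI)
    fix S assume "ecoeff a S \<noteq> 0"
    then have "\<psi> (kmono (- S) 1) \<noteq> 0" by (auto simp: a_def)
    moreover have "\<psi> (kmono (- S) 1) \<in> gr (- int (card (- S)) + (d + int CARD('n)))"
      by (rule gr[OF kmono_gr])
    moreover have "card (- S) + card S = CARD('n)"
      by (metis card_Un_disjoint Compl_disjoint2 finite Compl_partition2)
    ultimately show "int (card S) = - d" by (auto simp: gr_real_def split: if_splits)
  qed
  have "eta_K a f = \<psi> f" if f: "f \<in> gr e" for f e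
    using f
  proof (rule koszul_mono_induct)
    fix S :: "'n set" and r
    show "eta_K a (kmono S r) = \<psi> (kmono S r)"
      using eta_kmono[of a "- S" r] scale[OF kmono_gr, of r S 1]
      by (simp add: a_def sq flip: km)
  next
    fix f g assume fg: "f \<in> gr e" "g \<in> gr e" "eta_K a f = \<psi> f" "eta_K a g = \<psi> g"
    have "eta_K a (f + g) = eta_K a f + eta_K a g"
      using eta_gr[OF a] fg(1,2) unfolding gr_fun_def by blast
    then show "eta_K a (f + g) = \<psi> (f + g)" using fg add by simp
  qed
  then have "eta_K a f = \<psi> f" if "homogeneous f" for f
    using that unfolding homogeneous_def by blast
  moreover have "eta_K a f = \<psi> f" if "\<not> homogeneous f" for f
    using nonhom[OF that] that unfolding eta_K_def by simp
  ultimately have "eta_K a f = \<psi> f" for f by blast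
  then show ?thesis using a by blast
qed

text \<open>The sign comes from moving \<open>f\<close> past \<open>eta_K\<close>, which has degree
  \<open>n\<close>. The signs for moving \<open>f\<close> past \<open>a\<close> cancel.\<close>

lemma dual_act_eta:
  fixes a f :: "'n::{finite,linorder} koszul"
  assumes f: "homogeneous f" and a: "homogeneous a"
  shows "dual_act f (eta_K a) = ksgn (int CARD('n) * hdeg f) *\<^sub>R eta_K (f * a)"
proof (cases "a = 0")
  case True
  then show ?thesis by (simp add: dual_act_def fun_eq_iff)
next
  case False
  have "dual_act f (eta_K a) b = (ksgn (int CARD('n) * hdeg f) *\<^sub>R eta_K (f * a)) b" for b
  proof (cases "homogeneous b")
    case True
    have c: "a * f = ksgn (hdeg a * hdeg f) *\<^sub>R (f * a)"
      by (rule K.gr_commute[OF K.gr_hdeg[OF a] K.gr_hdeg[OF f]])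
    have "ecoeff (a * (f * b)) UNIV = ksgn (hdeg a * hdeg f) * ecoeff (f * a * b) UNIV"
      unfolding mult.assoc[symmetric] c by simp
    moreover have "dual_act f (eta_K a) b = ksgn (hdeg f * hdeg (eta_K a)) * eta_K a (f * b)"
      using True by (simp add: dual_act_def)
    ultimately have "dual_act f (eta_K a) b
        = (ksgn (hdeg f * (hdeg a + int CARD('n))) * ksgn (hdeg a * hdeg f)) * ecoeff (f * a * b) UNIV"
      unfolding hdeg_eta[OF a False] using True f by (simp add: eta_K_def K.homogeneous_mult)
    also have "ksgn (hdeg f * (hdeg a + int CARD('n))) * ksgn (hdeg a * hdeg f) = ksgn (int CARD('n) * hdeg f)"
      by (auto simp: ksgn_def)
    finally show ?thesis using True by (simp add: eta_K_def scaleR_fun_def)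
  qed (simp add: dual_act_def eta_K_def scaleR_fun_def)
  then show ?thesis by blast
qed

text \<open>The shift of the cohomological degree by \<open>n\<close> in the Leibniz rule is matched by the
  sign in \<open>dual_act_eta\<close>; the other conditions carry over because
  \<open>eta_K\<close> is linear and injective. Homogeneity of the values is needed for
  \<open>dual_act_eta\<close>.\<close>

lemma iota_polyder_iff:
  fixes P :: "'n::{finite,linorder} koszul list \<Rightarrow> 'n koszul"
  assumes P: "\<And>fs. homogeneous (P fs)"
  shows "iota_K P \<in> polyder dual_act (k - int CARD('n)) \<longleftrightarrow> P \<in> polyvectors k"
proof -
  have d: "int (length fs) - (k - int CARD('n)) + degs fs = (int (length fs) - k + degs fs) + int CARD('n)"
    for fs :: "'n koszul list" by simp
  have s: "ksgn (hdeg f * (m - (k - int CARD('n)) + e)) *\<^sub>R dual_act f (eta_K (P gs))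
      = eta_K (ksgn (hdeg f * (m - k + e)) *\<^sub>R (f * P gs))" if "homogeneous f" for f m e gs
    unfolding dual_act_eta[OF that P] eta_simps scaleR_scaleR
    by (rule arg_cong[where f = "\<lambda>r. r *\<^sub>R _"]) (auto simp: ksgn_def)
  have s': "ksgn (hdeg g * (m - (k - int CARD('n)) + e + h)) *\<^sub>R dual_act g (eta_K (P gs))
      = eta_K (ksgn (hdeg g * (m - k + e + h)) *\<^sub>R (g * P gs))" if "homogeneous g" for g m e h gs
    using s[OF that, of m "e + h" gs] by (simp only: add.assoc)
  have ei: "eta_K (P xs) = eta_K y \<longleftrightarrow> P xs = y" for xs y by simp
  have e0: "eta_K (P xs) = 0 \<longleftrightarrow> P xs = 0" for xs by simp
  have L: "(homogeneous f \<longrightarrow> homogeneous g \<longrightarrow>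
       (let m = int (length fs + 1 + length gs) - (k - int CARD('n)) in
        eta_K (P (fs @ (f * g) # gs)) =
          ksgn (hdeg f * (m + degs fs)) *\<^sub>R dual_act f (eta_K (P (fs @ g # gs))) +
          ksgn (hdeg g * (m + degs fs + hdeg f)) *\<^sub>R dual_act g (eta_K (P (fs @ f # gs)))))
    \<longleftrightarrow> (homogeneous f \<longrightarrow> homogeneous g \<longrightarrow>
       (let m = int (length fs + 1 + length gs) - k in
        P (fs @ (f * g) # gs) =
          ksgn (hdeg f * (m + degs fs)) *\<^sub>R (f * P (fs @ g # gs)) +
          ksgn (hdeg g * (m + degs fs + hdeg f)) *\<^sub>R (g * P (fs @ f # gs))))" for f g fs gs
  proof (cases "homogeneous f \<and> homogeneous g")
    case True
    then have f: "homogeneous f" and g: "homogeneous g" by auto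
    show ?thesis unfolding Let_def s[OF f] s'[OF g] eta_simps(2)[symmetric] ei ..
  qed auto
  show ?thesis
    unfolding polyder_def mem_Collect_eq iota_K_def comp_apply d eta_gr_iff[OF P] L e0
      eta_simps(2,4,5)[symmetric] ei ..
qed

lemma iota_image:
  "polyder (dual_act :: 'n::{finite,linorder} koszul \<Rightarrow> _) (k - int CARD('n)) = iota_K ` polyvectors k"
proof
  show "polyder (dual_act :: 'n koszul \<Rightarrow> _) (k - int CARD('n)) \<subseteq> iota_K ` polyvectors k"
  proof
    fix \<phi> :: "'n koszul list \<Rightarrow> 'n koszul \<Rightarrow> real" assume \<phi>: "\<phi> \<in> polyder dual_act (k - int CARD('n))"
    have "\<exists>a. homogeneous a \<and> eta_K a = \<phi> fs" for fs
    proof (cases "homs fs")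
      case True
      have "int (length fs) - (k - int CARD('n)) + degs fs = (int (length fs) - k + degs fs) + int CARD('n)" by simp
      then have "\<phi> fs \<in> gr ((int (length fs) - k + degs fs) + int CARD('n))" using polyder_gr[OF \<phi> True] by metis
      then show ?thesis using eta_surj K.homogeneousI by metis
    next
      case False
      then have "\<phi> fs = 0" using \<phi> unfolding polyder_def mem_Collect_eq by (elim conjE) blast
      then show ?thesis using K.homogeneous_0 by (metis eta_simps(1))
    qed
    then obtain P where P: "\<And>fs. homogeneous (P fs)" "\<And>fs. eta_K (P fs) = \<phi> fs" by metis
    have "iota_K P = \<phi>" using P(2) by (auto simp: iota_K_def)
    then show "\<phi> \<in> iota_K ` polyvectors k" using \<phi> iota_polyder_iff[of P, OF P(1)] by blast
  qed
  show "iota_K ` polyvectors k \<subseteq> polyder (dual_act :: 'n koszul \<Rightarrow> _) (k - int CARD('n))"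
  proof
    fix \<phi> :: "'n koszul list \<Rightarrow> 'n koszul \<Rightarrow> real" assume "\<phi> \<in> iota_K ` polyvectors k"
    then obtain P where P: "P \<in> polyvectors k" "\<phi> = iota_K P" by blast
    have "homogeneous (P fs)" for fs
    proof (cases "homs fs")
      case True
      then show ?thesis using polyder_gr[OF P(1)] K.homogeneousI by metis
    next
      case False
      then have "P fs = 0" using P(1) unfolding polyder_def mem_Collect_eq by (elim conjE) blast
      then show ?thesis by simp
    qed
    then show "\<phi> \<in> polyder dual_act (k - int CARD('n))" using P iota_polyder_iff by metis
  qed
qed

subsection \<open>Integration over the exterior algebra\<close>

text \<open>Integration over the odd variables at the point \<open>x = 0\<close>.\<close>

definition K_int :: "'n::{finite,linorder} forms \<Rightarrow> real"
  where "K_int a = ecoeff (const_part a) UNIV"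

lemma K_int_simps [simp]: "K_int 0 = 0" "K_int (a + b) = K_int a + K_int b" "K_int (a - b) = K_int a - K_int b"
  "K_int (- a) = - K_int a" "K_int (r *\<^sub>R a) = r * K_int a"
  by (simp_all add: K_int_def)

text \<open>No contraction contains the product of all generators, so divergences integrate to zero.\<close>

lemma K_int_bvop [simp]: "K_int (bvop a) = 0"
  by (simp add: K_int_def const_part_def bvop_def ecoeff_sum ecoeff_contract)

lemma bvop_embK [simp]: "bvop (embK f) = 0"
  by (simp add: bvop_def contract_embK)

text \<open>Integration by parts: expand the divergence of the product of \<open>a\<close> and
  \<open>f\<close>, whose integral is zero.\<close>

lemma K_int_ins: "K_int (K.ins f a) = K_int (bvop a * embK f)"
proof -
  have "K_int (bvop (a * embK f)) = K_int (bvop a * embK f) - K_int (K.ins f a)"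
    unfolding bvop_mult by (simp add: K.ins_def)
  then show ?thesis by simp
qed

lemma bvop_ins: "bvop (K.ins f a) = - K.ins f (bvop a)"
  by (simp add: K.ins_def bvop_schouten par_bvop)

lemma bvop_fold_ins: "bvop (fold K.ins fs a) = (-1) ^ length fs *\<^sub>R fold K.ins fs (bvop a)"
  by (induction fs arbitrary: a) (simp_all add: bvop_ins)

lemma fold_ins_swap:
  "a \<in> hpart k \<Longrightarrow> f \<in> gr d \<Longrightarrow> homs fs \<Longrightarrow>
    fold K.ins fs (K.ins f a) = ((-1) ^ length fs * ksgn (d * degs fs)) *\<^sub>R K.ins f (fold K.ins fs a)"
proof (induction fs arbitrary: a k)
  case (Cons g fs)
  have g: "g \<in> gr (hdeg g)" using Cons.prems by (intro K.gr_hdeg) simp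
  have "fold K.ins fs (K.ins f (K.ins g a)) = ((-1) ^ length fs * ksgn (d * degs fs)) *\<^sub>R K.ins f (fold K.ins fs (K.ins g a))"
    using Cons by (intro Cons.IH[OF K.ins_hpart[OF Cons.prems(1) g]]) auto
  then show ?case
    by (simp add: K.ins_swap[OF Cons.prems(1,2) g] ksgn_add distrib_left mult_ac)
qed simp

lemma eta_eq_K_int: "homogeneous f \<Longrightarrow> eta_K (const_part a) f = K_int (a * embK f)"
  by (simp add: eta_K_def K_int_def const_part_mult)

text \<open>The identification of \<open>V\<close> with the twisted complex; its values are integrals
  (\<open>T_K_apply\<close>).\<close>

definition T_K :: "'n::{finite,linorder} forms \<Rightarrow> 'n koszul list \<Rightarrow> 'n koszul \<Rightarrow> real"
  where "T_K a = iota_K (K.ev a)"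

lemma T_K_apply: "homs fs \<Longrightarrow> homogeneous f \<Longrightarrow> T_K a fs f = K_int (fold K.ins fs a * embK f)"
  by (simp add: T_K_def iota_K_def K.ev_def eta_eq_K_int)

lemma T_K_simps [simp]: "T_K 0 = 0" "T_K (a - b) = T_K a - T_K b"
  by (auto simp: T_K_def iota_K_def fun_eq_iff K.ev_simps)

lemma T_K_inj: "a \<in> hpart k \<Longrightarrow> b \<in> hpart k \<Longrightarrow> T_K a = T_K b \<Longrightarrow> a = b"
proof -
  assume h: "a \<in> hpart k" "b \<in> hpart k" "T_K a = T_K b"
  have "K.ev a = K.ev b"
    using h(3) by (auto simp: T_K_def iota_K_def fun_eq_iff[of "K.ev a"] dest: fun_cong)
  then show "a = b" using K.ev_eq_iff[OF h(1,2)] by simp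
qed

lemma T_K_nonhom: "\<not> homs fs \<Longrightarrow> T_K a fs = 0"
  by (simp add: T_K_def iota_K_def K.ev_nonhom)

text \<open>The additional argument is moved behind the others, and then it is removed from the insertions
  by integration by parts. Each of the other arguments contributes one sign to the first step and
  one to the passage of \<open>bvop\<close> through its insertion, so only the Koszul sign in the
  definition of the dual differential remains to be cancelled.\<close>

lemma dR_dual_T_K:
  assumes a: "a \<in> hpart k" shows "dR_dual (T_K a) = T_K (bvop a)"
proof (intro ext)
  fix fs :: "'a koszul list" and f
  show "dR_dual (T_K a) fs f = T_K (bvop a) fs f"
  proof (cases "homs fs \<and> homogeneous f")
    case True
    then have fs: "homs fs" and f: "homogeneous f" by auto
    have "T_K a (f # fs) 1 = K_int (fold K.ins fs (K.ins f a))"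
      using True K.homogeneousI[OF K.gr_1] by (subst T_K_apply) auto
    also have "\<dots> = (-1) ^ length fs * ksgn (hdeg f * degs fs) * K_int (bvop (fold K.ins fs a) * embK f)"
      by (simp add: fold_ins_swap[OF a K.gr_hdeg[OF f] fs] K_int_ins)
    also have "\<dots> = ksgn (hdeg f * degs fs) * T_K (bvop a) fs f"
      by (cases "even (length fs)") (simp_all add: bvop_fold_ins T_K_apply[OF fs f])
    finally show ?thesis using f by (simp add: dR_dual_def ksgn_def)
  next
    case False
    show ?thesis
    proof (cases "homogeneous f")
      case True
      then have "\<not> homs fs" "\<not> homs (f # fs)" using False by auto
      from this[THEN T_K_nonhom] show ?thesis by (simp add: dR_dual_def)
    next
      case False
      then show ?thesis by (simp add: dR_dual_def T_K_def iota_K_def eta_K_def)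
    qed
  qed
qed

lemma Div_K_ev:
  assumes a: "a \<in> hpart k" shows "Div_K k (K.ev a) = K.ev (bvop a)"
  unfolding Div_K_def
proof (rule the_equality)
  have b: "bvop a \<in> hpart (k - 1)" by (rule hpart_bvop[OF a])
  show "K.ev (bvop a) \<in> polyvectors (k - 1) \<and> iota_K (K.ev (bvop a)) = dR_dual (iota_K (K.ev a))"
    using K.ev_polyder[OF b] dR_dual_T_K[OF a] by (simp add: T_K_def)
  fix Q assume Q: "Q \<in> polyvectors (k - 1) \<and> iota_K Q = dR_dual (iota_K (K.ev a))"
  then have "iota_K Q = iota_K (K.ev (bvop a))" using dR_dual_T_K[OF a] by (simp add: T_K_def)
  then show "Q = K.ev (bvop a)" by (simp add: iota_K_def fun_eq_iff[of Q] fun_eq_iff[of "eta_K \<circ> Q"])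
qed

text \<open>A linear map is determined by its values on homogeneous elements because the monomials span the
  algebra.\<close>

lemma derivation_of_K_ev: "derivation_of (K.ev a) = (\<lambda>f. const_part (K.ins f a))"
  unfolding derivation_of_def
proof (rule the_equality)
  show "linear (\<lambda>f. const_part (K.ins f a)) \<and> (\<forall>f. homogeneous f \<longrightarrow> const_part (K.ins f a) = K.ev a [f])"
    by (auto intro!: linearI simp: K.ev_def)
  fix D assume D: "linear D \<and> (\<forall>f. homogeneous f \<longrightarrow> D f = K.ev a [f])"
  show "D = (\<lambda>f. const_part (K.ins f a))"
  proof
    fix f :: "'a koszul"
    have m: "D (kmono S r) = const_part (K.ins (kmono S r) a)" for S r
      using D K.homogeneousI[OF kmono_gr, of S r] by (simp add: K.ev_def)
    have l: "linear (\<lambda>f. const_part (K.ins f a))" by (auto intro!: linearI)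
    have "D (\<Sum>S\<in>UNIV. kmono S (ecoeff f S)) = const_part (K.ins (\<Sum>S\<in>UNIV. kmono S (ecoeff f S)) a)"
      using D by (simp add: linear_sum m linear_sum[OF l])
    then show "D f = const_part (K.ins f a)" by (simp only: kmono_expansion)
  qed
qed

lemma const_part_egen [simp]: "const_part (egen i) = egen i"
  using const_part_embK[of "egen i"] by simp

subsection \<open>The modular derivation and the twisted coboundary\<close>

lemma br_K_mult_right:
  assumes f: "f \<in> gr d" and a: "a \<in> gr e" and g: "g \<in> gr h"
  shows "br_K c f (a * g) = br_K c f a * g + ksgn (d * e) *\<^sub>R (a * br_K c f g)"
proof -
  let ?Y = "K.ins f (piV c)"
  have Y: "?Y \<in> hpart (2 - d - 1)" by (rule K.ins_hpart[OF piV_hpart f])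
  note hom = K.homogeneousI[OF f] K.homogeneousI[OF a] K.homogeneousI[OF g]
  have br: "br_K c f b = const_part (K.ins b ?Y)" if "homogeneous b" for b
    unfolding br_K_eq using K.br_eq[OF hom(1) that] .
  have "br_K c f g \<in> gr (d + h)" unfolding br_K_eq by (rule K.br_gr[OF f g])
  from K.gr_commute[OF this a]
  have c: "br_K c f g * a = ksgn ((d + h) * e) *\<^sub>R (a * br_K c f g)" .
  have "br_K c f (a * g) = ksgn (e * h) *\<^sub>R (br_K c f g * a) + br_K c f a * g"
    unfolding br[OF K.homogeneous_mult[OF hom(2,3)]] br[OF hom(2)] br[OF hom(3)] K.ins_prod[OF Y a g]
    by simp
  also have "ksgn (e * h) *\<^sub>R (br_K c f g * a) = ksgn (d * e) *\<^sub>R (a * br_K c f g)"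
    unfolding c scaleR_scaleR by (rule arg_cong[where f = "\<lambda>r. r *\<^sub>R _"]) (auto simp: ksgn_def)
  finally show ?thesis by simp
qed

context diagonal_quadratic
begin

sublocale SK: model_side 1 "embK :: 'n koszul \<Rightarrow> _" const_part egen "piV c"
  by unfold_locales

text \<open>The modular vector field of \<open>A\<^sup>!\<close>.\<close>

definition nuK :: "'n koszul \<Rightarrow> 'n koszul"
  where "nuK f = const_part (K.ins f modvec)"

lemma nu_pv_K_eq: "nu_pv_K c = K.ev modvec"
  by (simp add: nu_pv_K_def pi_K_eq Div_K_ev[OF piV_hpart] modvec_def)

lemma nu_K_eq: "nu_K c = nuK"
  by (simp add: nu_K_def nu_pv_K_eq derivation_of_K_ev nuK_def fun_eq_iff)

lemma nuK_simps [simp]: "nuK 0 = 0" "nuK (f + g) = nuK f + nuK g" "nuK (r *\<^sub>R f) = r *\<^sub>R nuK f"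
  by (simp_all add: nuK_def)

lemma linear_nuK: "linear nuK"
  by (rule linearI) simp_all

text \<open>The modular element is linear in \<open>x\<close>, and an insertion removes this degree.\<close>

lemma ins_modvec: "K.ins f modvec = embK (nuK f)"
proof -
  have "pdx j modvec = embK (\<Sum>k\<in>UNIV. modmat j k *\<^sub>R egen k)" for j
    by (simp add: pdx_modvec linear_sum[OF K.linear_emb])
  then have "\<exists>g. K.ins f modvec = embK g"
    unfolding K_ins pdx_par par_hpart[OF modvec_hpart]
    by (intro exI[of _ "(\<Sum>j\<in>UNIV. (\<Sum>k\<in>UNIV. modmat j k *\<^sub>R egen k) * contract j f)"])
      (simp add: linear_sum[OF K.linear_emb] embK_mult ksgn_def sum_negf)
  then show ?thesis by (auto simp: nuK_def)
qed

lemma wt_embK: "wt (embK f) = - embK (nuK f)"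
  by (simp add: wt_def K.ins_def par_hpart[OF modvec_hpart] ksgn_def flip: ins_modvec)

lemma nuK_mult: "nuK (f * g) = nuK f * g + f * nuK g"
proof -
  have "- embK (nuK (f * g)) = - (embK (nuK f) * embK g + embK f * embK (nuK g))"
    unfolding wt_embK[symmetric] embK_mult wt_mult by (simp add: wt_embK)
  then have "embK (nuK (f * g)) = embK (nuK f * g + f * nuK g)"
    unfolding neg_equal_iff_equal by (simp add: embK_mult)
  then show ?thesis unfolding K.emb_eq_iff .
qed

lemma nuK_gr: "f \<in> gr d \<Longrightarrow> nuK f \<in> gr d"
  using K.pr_gr[OF K.ins_hpart[OF modvec_hpart, of f d]] by (simp add: nuK_def)

lemma nuK_homogeneous: "homogeneous f \<Longrightarrow> homogeneous (nuK f)"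
  using nuK_gr unfolding homogeneous_def by blast

lemma nuK_hdeg: "homogeneous f \<Longrightarrow> nuK f = 0 \<or> hdeg (nuK f) = hdeg f"
  using K.hdeg_eq[OF nuK_gr[OF K.gr_hdeg]] by blast

lemma nuK_egen: "nuK (egen i) = (\<Sum>j\<in>UNIV. modmat i j *\<^sub>R egen j)"
  by (simp add: nuK_def K_ins_egen pdx_par par_hpart[OF modvec_hpart] ksgn_def pdx_modvec const_part_sum)

text \<open>This is integration by parts for a Hamiltonian vector field, whose divergence is given by the
  modular vector field.\<close>

lemma integral_br_K:
  assumes f: "homogeneous f" and b: "homogeneous b"
  shows "ecoeff (br_K c f b) UNIV = ecoeff (nuK f * b) UNIV"
proof -
  have "ecoeff (br_K c f b) UNIV = K_int (K.ins b (K.ins f \<pi>))"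
    unfolding br_K_eq K.br_eq[OF f b] K_int_def ..
  also have "\<dots> = K_int (embK (nuK f) * embK b)"
    by (simp add: K_int_ins bvop_ins flip: ins_modvec) (simp add: modvec_def)
  finally show ?thesis by (simp add: K_int_def const_part_mult)
qed

text \<open>The Poisson action on the dual is, up to sign, integration against a bracket. By the Leibniz
  rule and \<open>integral_br_K\<close> the bracket can be moved to the other factor, at the cost
  of a term with the modular vector field. This is the term by which the twisted differential
  differs from the untwisted one.\<close>

lemma dual_br_eta:
  assumes f: "homogeneous f" and a: "homogeneous a"
  shows "dual_br (br_K c) f (eta_K a) = ksgn (int CARD('n) * hdeg f) *\<^sub>R eta_K (br_K c f a - nuK f * a)"
proof (cases "a = 0")
  case True
  have "br_K c f 0 = 0" unfolding br_K_eq K.br_eq[OF f K.homogeneous_0] by simp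
  then show ?thesis using True by (simp add: dual_br_def fun_eq_iff)
next
  case False
  have "dual_br (br_K c) f (eta_K a) g = (ksgn (int CARD('n) * hdeg f) *\<^sub>R eta_K (br_K c f a - nuK f * a)) g" for g
  proof (cases "homogeneous g")
    case True
    note gr = K.gr_hdeg[OF f] K.gr_hdeg[OF a] K.gr_hdeg[OF True]
    have h: "homogeneous (br_K c f g)" unfolding br_K_eq using K.br_gr[OF gr(1,3)] by (rule K.homogeneousI)
    have "ecoeff (nuK f * (a * g)) UNIV
        = ecoeff (br_K c f a * g) UNIV + ksgn (hdeg f * hdeg a) * ecoeff (a * br_K c f g) UNIV"
      unfolding integral_br_K[OF f K.homogeneous_mult[OF a True], symmetric] br_K_mult_right[OF gr] by simp
    then have "ksgn (hdeg f * hdeg a) * ecoeff (a * br_K c f g) UNIV = - ecoeff ((br_K c f a - nuK f * a) * g) UNIV"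
      by (simp add: left_diff_distrib mult.assoc)
    then have "ecoeff (a * br_K c f g) UNIV = - (ksgn (hdeg f * hdeg a) * ecoeff ((br_K c f a - nuK f * a) * g) UNIV)"
      by (auto simp: ksgn_def split: if_splits)
    then have "dual_br (br_K c) f (eta_K a) g
        = (ksgn (hdeg f * (hdeg a + int CARD('n))) * ksgn (hdeg f * hdeg a)) * ecoeff ((br_K c f a - nuK f * a) * g) UNIV"
      using True h unfolding dual_br_def hdeg_eta[OF a False] by (simp add: eta_K_def)
    also have "ksgn (hdeg f * (hdeg a + int CARD('n))) * ksgn (hdeg f * hdeg a) = ksgn (int CARD('n) * hdeg f)"
      by (auto simp: ksgn_def)
    finally show ?thesis using True by (simp add: eta_K_def scaleR_fun_def)
  qed (simp add: dual_br_def eta_K_def scaleR_fun_def)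
  then show ?thesis by blast
qed

lemma nu_pv_K_not_single:
  assumes "length fs \<noteq> 1" shows "K.ev modvec fs = 0"
proof (cases fs)
  case Nil
  have "const_part modvec = 0"
    by (simp add: modvec_eq const_part_sum lookup_var_mult[of _ 1, simplified] del: K.emb_simps A.emb_simps)
  then show ?thesis using Nil by (simp add: K.ev_Nil)
next
  case (Cons f gs)
  then obtain g hs where gs: "gs = g # hs" using assms by (cases gs) auto
  show ?thesis
  proof (cases "homs fs")
    case True
    have "K.ins g (K.ins f modvec) = 0" unfolding ins_modvec by (simp add: K_ins pdx_par)
    then show ?thesis using True by (simp add: Cons gs K.ev_Cons)
  qed (rule K.ev_nonhom)
qed

text \<open>The modular vector field takes exactly one argument, and so the sum over all shuffles reduces to
  a sum over the argument that it receives.\<close>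

lemma wedge_nu_eta:
  assumes fs: "homs fs" and P: "\<And>fs. homogeneous (P fs)"
  shows "wedge dual_act 1 (k - int CARD('n)) (nu_pv_K c) (iota_K P) fs
    = (\<Sum>i<length fs. ksgn (int i + hdeg (fs ! i) * (int (length fs) - 1 - k + degs (take i fs)))
         *\<^sub>R eta_K (nuK (fs ! i) * P (nths fs (- {i}))))"
proof -
  define F where "F I = (let q = int (length fs) - int (card I) in
       ksgn ((\<Sum>b\<in>I. \<Sum>a\<in>{..<b} - I. 1 + hdeg (fs ! a) * hdeg (fs ! b))
             + (\<Sum>a\<in>I. (q - (k - int CARD('n))) * hdeg (fs ! a))
             + q * (int (card I) - 1))
       *\<^sub>R dual_act (K.ev modvec (nths fs I)) (iota_K P (nths fs (- I))))" for I
  have "wedge dual_act 1 (k - int CARD('n)) (nu_pv_K c) (iota_K P) fs = sum F (Pow {..<length fs})"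
    unfolding wedge_def nu_pv_K_eq F_def using fs by simp
  also have "\<dots> = sum F ((\<lambda>i. {i}) ` {..<length fs})"
  proof (rule sum.mono_neutral_right)
    show "\<forall>I\<in>Pow {..<length fs} - (\<lambda>i. {i}) ` {..<length fs}. F I = 0"
    proof
      fix I assume I: "I \<in> Pow {..<length fs} - (\<lambda>i. {i}) ` {..<length fs}"
      have "card I \<noteq> 1" using I by (auto simp: card_1_singleton_iff)
      moreover have "{i. i < length fs \<and> i \<in> I} = I" using I by auto
      ultimately have "length (nths fs I) \<noteq> 1" by (simp add: length_nths)
      then have "K.ev modvec (nths fs I) = 0" by (rule nu_pv_K_not_single)
      moreover have "dual_act 0 \<psi> = 0" if "\<psi> 0 = 0" for \<psi> :: "'n koszul \<Rightarrow> real"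
        using that by (auto simp: dual_act_def fun_eq_iff)
      ultimately show "F I = 0" by (simp add: F_def Let_def iota_K_def eta_K_def)
    qed
  qed auto
  also have "\<dots> = (\<Sum>i<length fs. F {i})" by (subst sum.reindex) auto
  also have "\<dots> = (\<Sum>i<length fs. ksgn (int i + hdeg (fs ! i) * (int (length fs) - 1 - k + degs (take i fs)))
         *\<^sub>R eta_K (nuK (fs ! i) * P (nths fs (- {i}))))"
  proof (rule sum.cong[OF refl])
    fix i assume "i \<in> {..<length fs}"
    then have i: "i < length fs" by simp
    then have fi: "homogeneous (fs ! i)" using fs by simp
    have "{..<i} - {i} = {..<i}" by auto
    moreover have "degs (take i fs) = (\<Sum>a<i. hdeg (fs ! a))"
      using i by (simp add: sum_list_sum_nth lessThan_atLeast0)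
    ultimately have S: "(\<Sum>b\<in>{i}. \<Sum>a\<in>{..<b} - {i}. 1 + hdeg (fs ! a) * hdeg (fs ! b)) = int i + hdeg (fs ! i) * degs (take i fs)"
      by (simp add: sum.distrib sum_distrib_left mult.commute)
    have "nths fs {i} = [fs ! i]"
      by (rule nths_singleton[OF i])
    then have e: "K.ev modvec (nths fs {i}) = nuK (fs ! i)"
      using fi by (simp add: K.ev_def nuK_def)
    have "F {i} = ksgn (int i + hdeg (fs ! i) * degs (take i fs) + (int (length fs) - 1 - (k - int CARD('n))) * hdeg (fs ! i))
        *\<^sub>R ksgn (int CARD('n) * hdeg (nuK (fs ! i))) *\<^sub>R eta_K (nuK (fs ! i) * P (nths fs (- {i})))"
      unfolding F_def Let_def S e by (simp add: iota_K_def dual_act_eta[OF nuK_homogeneous[OF fi] P])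
    also have "\<dots> = ksgn (int i + hdeg (fs ! i) * (int (length fs) - 1 - k + degs (take i fs)))
        *\<^sub>R eta_K (nuK (fs ! i) * P (nths fs (- {i})))"
    proof (cases "nuK (fs ! i) = 0")
      case False
      then have "hdeg (nuK (fs ! i)) = hdeg (fs ! i)" using nuK_hdeg[OF fi] by blast
      then show ?thesis unfolding scaleR_scaleR
        by (intro arg_cong[where f = "\<lambda>r. r *\<^sub>R _"]) (auto simp: ksgn_def)
    qed simp
    finally show "F {i} = \<dots>" .
  qed
  finally show ?thesis .
qed

text \<open>The terms with the modular vector field from \<open>dual_br_eta\<close> cancel against those
  from \<open>wedge_nu_eta\<close>.\<close>

lemma twisted_coboundary_T_K:
  assumes a: "a \<in> hpart k"
  shows "twisted_coboundary c (k - int CARD('n)) (T_K a) = T_K (- schouten \<pi> a)"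
proof
  fix fs :: "'n koszul list"
  have P: "homogeneous (K.ev a fs)" for fs :: "'n koszul list"
    using K.homogeneousI[OF K.ev_gr[OF a]] K.ev_nonhom[of fs a] K.homogeneous_0 by metis
  have "T_K (- schouten \<pi> a) = iota_K (K.ev (K.dl c a))"
    by (simp add: T_K_def K.dl_def)
  also have "\<dots> = iota_K (coboundary (br_K c) (br_K c) k (K.ev a))"
    unfolding br_K_eq K.coboundary_ev[OF a] ..
  finally have T: "T_K (- schouten \<pi> a) fs = eta_K (coboundary (br_K c) (br_K c) k (K.ev a) fs)"
    by (simp add: iota_K_def)
  show "twisted_coboundary c (k - int CARD('n)) (T_K a) fs = T_K (- schouten \<pi> a) fs"
  proof (cases "homs fs")
    case True
    define s where "s i = ksgn (int i + hdeg (fs ! i) * (int (length fs) - 1 - k + degs (take i fs)))" for i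
    define x where "x i = K.ev a (nths fs (- {i}))" for i
    have "ksgn (int i + hdeg (fs ! i) * (int (length fs) - 1 - (k - int CARD('n)) + degs (take i fs)))
        *\<^sub>R dual_br (br_K c) (fs ! i) (eta_K (x i)) = s i *\<^sub>R eta_K (br_K c (fs ! i) (x i)) - s i *\<^sub>R eta_K (nuK (fs ! i) * x i)"
      if i: "i < length fs" for i
    proof -
      have fi: "homogeneous (fs ! i)" using i True by simp
      have "ksgn (int i + hdeg (fs ! i) * (int (length fs) - 1 - (k - int CARD('n)) + degs (take i fs)))
          * ksgn (int CARD('n) * hdeg (fs ! i)) = s i"
        by (auto simp: s_def ksgn_def)
      then show ?thesis
        unfolding x_def dual_br_eta[OF fi P] scaleR_scaleR by (simp add: scaleR_diff_right)
    qed
    note summand = this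
    define Z where "Z = (\<Sum>j<length fs. \<Sum>i<j.
       ksgn (int (i + j) + hdeg (fs ! i) * degs (take i fs)
             + hdeg (fs ! j) * (degs (take j fs) + hdeg (fs ! i)))
       *\<^sub>R eta_K (K.ev a (br_K c (fs ! i) (fs ! j) # nths fs (- {i, j}))))"
    have "coboundary (br_K c) (dual_br (br_K c)) (k - int CARD('n)) (T_K a) fs
      = (\<Sum>i<length fs. s i *\<^sub>R eta_K (br_K c (fs ! i) (x i)) - s i *\<^sub>R eta_K (nuK (fs ! i) * x i)) + Z"
      unfolding coboundary_def if_not_P[OF not_not[THEN iffD2, OF True]] T_K_def iota_K_def comp_apply Z_def
      by (intro arg_cong2[where f = plus] sum.cong refl) (simp add: summand flip: x_def)
    moreover have "wedge dual_act 1 (k - int CARD('n)) (nu_pv_K c) (T_K a) fs = (\<Sum>i<length fs. s i *\<^sub>R eta_K (nuK (fs ! i) * x i))"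
      unfolding T_K_def wedge_nu_eta[OF True P] s_def x_def ..
    moreover have "T_K (- schouten \<pi> a) fs = (\<Sum>i<length fs. s i *\<^sub>R eta_K (br_K c (fs ! i) (x i))) + Z"
      unfolding T unfolding coboundary_def if_not_P[OF not_not[THEN iffD2, OF True]] Z_def s_def x_def
      by (simp only: eta_simps eta_sum)
    moreover have "twisted_coboundary c (k - int CARD('n)) (T_K a) fs
      = coboundary (br_K c) (dual_br (br_K c)) (k - int CARD('n)) (T_K a) fs
        + wedge dual_act 1 (k - int CARD('n)) (nu_pv_K c) (T_K a) fs"
      by (simp only: twisted_coboundary_def plus_fun_apply)
    moreover have "u - v + z + v = u + z" for u v z :: "'n koszul \<Rightarrow> real" by simp
    ultimately show ?thesis by (simp only: sum_subtractf)
  next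
    case False
    then show ?thesis
      unfolding T by (simp add: twisted_coboundary_def coboundary_nonhom wedge_def)
  qed
qed

subsection \<open>Functionals of weight zero\<close>

text \<open>The modular element has divergence zero, and it vanishes at \<open>x = 0\<close>.\<close>

lemma K_int_wt [simp]: "K_int (wt a) = 0"
proof -
  have "const_part modvec = 0"
    using nu_pv_K_not_single[of "[]"] by (simp add: K.ev_Nil)
  then have "K_int (modvec * b) = 0" for b by (simp add: K_int_def const_part_mult)
  moreover have "bvop (modvec * a) = wt a - modvec * bvop a"
    by (simp add: bvop_mult wt_def par_hpart[OF modvec_hpart] ksgn_def)
  ultimately show ?thesis using K_int_bvop[of "modvec * a"] by simp
qed

text \<open>The derivation \<open>wt\<close> acts on \<open>A\<^sup>!\<close> by minus the modular vector
  field (\<open>wt_embK\<close>), which is why the second term appears with a plus sign.\<close>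

lemma ins_wt:
  assumes a: "a \<in> hpart k" shows "K.ins f (wt a) = wt (K.ins f a) + K.ins (nuK f) a"
proof -
  have "schouten (wt a) (embK f) = wt (schouten a (embK f)) + schouten a (embK (nuK f))"
    using schouten_jacobi[OF modvec_hpart a, of "embK f"] wt_embK[of f]
    by (simp add: wt_def ksgn_def)
  then show ?thesis
    by (simp add: K.ins_eq[OF a] K.ins_eq[OF wt_hpart[OF a]] linear_scale[OF linear_wt] scaleR_add_right)
qed

lemma fold_ins_wt:
  "a \<in> hpart k \<Longrightarrow> list_all2 (\<lambda>f l. homogeneous f \<and> nuK f = l *\<^sub>R f) fs ls \<Longrightarrow>
    fold K.ins fs (wt a) = wt (fold K.ins fs a) + sum_list ls *\<^sub>R fold K.ins fs a"
proof (induction fs arbitrary: a k ls)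
  case (Cons f fs)
  then obtain l ms where ls: "ls = l # ms" and f: "homogeneous f" "nuK f = l *\<^sub>R f"
    and ms: "list_all2 (\<lambda>f l. homogeneous f \<and> nuK f = l *\<^sub>R f) fs ms"
    by (auto simp: list_all2_Cons1)
  have "fold K.ins fs (wt (K.ins f a)) = wt (fold K.ins fs (K.ins f a)) + sum_list ms *\<^sub>R fold K.ins fs (K.ins f a)"
    by (rule Cons.IH[OF K.ins_hpart[OF Cons.prems(1) K.gr_hdeg[OF f(1)]] ms])
  then show ?case by (simp add: ins_wt[OF Cons.prems(1)] f(2) ls scaleR_add_left)
qed simp

text \<open>The functional belonging to \<open>wt a\<close> evaluates the one belonging to \<open>a\<close>
  on the Lie derivative of a differential form. The integral of a Lie derivative is zero, so the
  weights of all arguments add up.\<close>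

lemma T_K_wt:
  assumes a: "a \<in> hpart k" and e: "list_all2 (\<lambda>f l. homogeneous f \<and> nuK f = l *\<^sub>R f) (f0 # fs) ls"
  shows "T_K (wt a) fs f0 = sum_list ls * T_K a fs f0"
proof -
  obtain l ms where ls: "ls = l # ms" and f: "homogeneous f0" "nuK f0 = l *\<^sub>R f0"
    and ms: "list_all2 (\<lambda>f l. homogeneous f \<and> nuK f = l *\<^sub>R f) fs ms"
    using e by (auto simp: list_all2_Cons1)
  have fs: "homs fs" using ms by (induction fs ms) auto
  let ?Y = "fold K.ins fs a"
  have "wt (?Y * embK f0) = wt ?Y * embK f0 - l *\<^sub>R (?Y * embK f0)"
    by (simp add: wt_mult wt_embK f(2))
  then have "K_int (wt ?Y * embK f0) = l * K_int (?Y * embK f0)"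
    using K_int_wt[of "?Y * embK f0"] by simp
  then show ?thesis
    by (simp add: T_K_apply[OF fs f(1)] fold_ins_wt[OF a ms] ls distrib_right)
qed

abbreviation eigK :: "'n koszul set"
  where "eigK \<equiv> {v. homogeneous v \<and> (\<exists>l. nuK v = l *\<^sub>R v)}"

text \<open>The rows of the spectral projections are the coefficients of eigenvectors.\<close>

lemma egen_eigK_span: "egen i \<in> span eigK"
proof -
  obtain F E where F: "finite F" and one: "\<And>i j. (\<Sum>l\<in>F. E l i j) = (if i = j then 1 else 0 :: real)"
    and eig: "\<And>l i j. l \<in> F \<Longrightarrow> (\<Sum>k\<in>UNIV. E l i k * modmat k j) = l * E l i j"
    by (rule spectral_projections) (rule that)
  define u where "u l = (\<Sum>k\<in>UNIV. E l i k *\<^sub>R egen k :: 'n koszul)" for l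
  have "nuK (u l) = l *\<^sub>R u l" if "l \<in> F" for l
  proof -
    \<comment> \<open>The matrix acts on the generators from the right, as in the relation for the projections.\<close>
    have "nuK (u l) = (\<Sum>k\<in>UNIV. \<Sum>j\<in>UNIV. (E l i k * modmat k j) *\<^sub>R egen j)"
      by (simp add: u_def linear_sum[OF linear_nuK] nuK_egen scaleR_sum_right)
    also have "\<dots> = (\<Sum>j\<in>UNIV. (\<Sum>k\<in>UNIV. E l i k * modmat k j) *\<^sub>R egen j)"
      by (subst sum.swap) (simp add: scaleR_sum_left)
    finally show ?thesis by (simp add: eig[OF that] u_def scaleR_sum_right)
  qed
  moreover have "u l \<in> gr (- 1)" for l
    unfolding u_def gr_ext_eq by (intro hpart_sum hpart_scaleR) simp
  ultimately have "u l \<in> span eigK" if "l \<in> F" for l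
    using that K.homogeneousI by (intro span_base) blast
  then have "(\<Sum>l\<in>F. u l) \<in> span eigK" by (rule span_sum)
  also have "(\<Sum>l\<in>F. u l) = (\<Sum>k\<in>UNIV. if i = k then egen k else 0)"
    unfolding u_def by (subst sum.swap) (simp add: one if_distrib[of "\<lambda>r. r *\<^sub>R _"] flip: scaleR_sum_left cong: if_cong)
  finally show ?thesis by simp
qed

lemma eigK_span: "f \<in> span eigK"
proof -
  have S: "x * y \<in> span eigK" if xy: "x \<in> eigK" "y \<in> eigK" for x y
  proof -
    obtain l m where "nuK x = l *\<^sub>R x" "nuK y = m *\<^sub>R y" using xy by blast
    then have "nuK (x * y) = (l + m) *\<^sub>R (x * y)" by (simp add: nuK_mult scaleR_add_left)
    then show ?thesis using xy K.homogeneous_mult by (intro span_base) blast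
  qed
  have "nuK 1 = 0" using nuK_mult[of 1 1] by simp
  then have "1 \<in> eigK" using K.homogeneousI[OF K.gr_1] by (auto intro!: exI[of _ 0])
  then have "r *\<^sub>R 1 \<in> span eigK" for r by (intro span_scale span_base)
  moreover have "econst r = r *\<^sub>R (1 :: 'n koszul)" for r
    by (rule ext_eqI) (simp add: econst_def one_ext_def)
  ultimately have E: "econst r \<in> span eigK" for r by simp
  show ?thesis
  proof (rule ext_induct)
    show "egen i * g \<in> span eigK" if g: "g \<in> span eigK" for i g
      by (rule span_mult_closed[OF S egen_eigK_span g])
  qed (rule E, rule span_add)
qed

theorem diagonalizable_nu_K: "diagonalizable (nu_K c)"
  unfolding nu_K_eq
proof (rule diagonalizableI[OF linear_nuK])
  fix x :: "'n koszul"
  have "eigK \<subseteq> {v. \<exists>l. nuK v = l *\<^sub>R v}" by blast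
  then show "x \<in> span {v. \<exists>l. nuK v = l *\<^sub>R v}" using span_mono eigK_span by blast
qed

lemma linear_0_on_eigK:
  assumes "linear L" "\<And>v. v \<in> eigK \<Longrightarrow> L v = 0" shows "L f = 0"
  using eigK_span[of f] linear_eq_0_on_span[OF assms] by blast

text \<open>This removes the restriction to eigenvectors from one argument after the other.\<close>

lemma const_part_fold_ins_eq_0:
  "(\<And>gs. set gs \<subseteq> eigK \<Longrightarrow> const_part (fold K.ins gs b) = 0) \<Longrightarrow> const_part (fold K.ins fs b) = 0"
proof (induction fs arbitrary: b)
  case Nil
  show ?case by (rule Nil) simp
next
  case (Cons f fs)
  have "const_part (fold K.ins gs (K.ins f b)) = 0" if gs: "set gs \<subseteq> eigK" for gs
  proof (rule linear_0_on_eigK[of "\<lambda>f. const_part (fold K.ins gs (K.ins f b))"])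
    show "linear (\<lambda>f. const_part (fold K.ins gs (K.ins f b)))" by (rule linearI) simp_all
    fix v assume v: "v \<in> eigK"
    show "const_part (fold K.ins gs (K.ins v b)) = 0"
      using Cons.prems[of "v # gs"] v gs by simp
  qed
  then show ?case using Cons.IH[of "K.ins f b"] by simp
qed

lemma T_K_eq_0:
  assumes b: "b \<in> hpart k" and z: "\<And>fs f0. set fs \<subseteq> eigK \<Longrightarrow> f0 \<in> eigK \<Longrightarrow> T_K b fs f0 = 0"
  shows "b = 0"
proof -
  have "const_part (fold K.ins gs b) = 0" if gs: "set gs \<subseteq> eigK" for gs
  proof -
    let ?X = "const_part (fold K.ins gs b)"
    have h: "homs gs" using gs by blast
    have "ecoeff (?X * f) UNIV = 0" for f
    proof (rule linear_0_on_eigK[of "\<lambda>f. ecoeff (?X * f) UNIV"])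
      show "linear (\<lambda>f. ecoeff (?X * f) UNIV)" by (rule linearI) (simp_all add: distrib_left)
      fix v assume v: "v \<in> eigK"
      show "ecoeff (?X * v) UNIV = 0"
        using z[OF gs v] v h by (simp add: T_K_apply K_int_def const_part_mult)
    qed
    then have "eta_K ?X = 0" by (simp add: eta_K_def fun_eq_iff)
    then show ?thesis by simp
  qed
  then have "const_part (fold K.ins fs b) = 0" for fs by (rule const_part_fold_ins_eq_0)
  then have "K.ev b = 0" by (simp add: K.ev_def fun_eq_iff)
  then show ?thesis by (rule K.ev_inj[OF b])
qed

text \<open>By \<open>T_K_wt\<close> the functional of \<open>a\<close> vanishes on all products of
  eigenvectors of nonzero weight exactly if the functional of \<open>wt a\<close> vanishes on all
  products of eigenvectors. As these span, the latter means that \<open>wt a\<close> is zero.\<close>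

lemma T_K_weight_zero_iff:
  assumes a: "a \<in> hpart k" shows "T_K a \<in> weight_zero_dual (nu_K c) \<longleftrightarrow> wt a = 0"
proof
  assume w: "wt a = 0"
  show "T_K a \<in> weight_zero_dual (nu_K c)"
    unfolding weight_zero_dual_def nu_K_eq mem_Collect_eq
  proof (intro allI impI)
    fix f0 fs ls
    assume "list_all2 (\<lambda>f l. homogeneous f \<and> nuK f = l *\<^sub>R f) (f0 # fs) ls \<and> sum_list ls \<noteq> 0"
    then show "T_K a fs f0 = 0" using T_K_wt[OF a, of f0 fs ls] w by simp
  qed
next
  assume T: "T_K a \<in> weight_zero_dual (nu_K c)"
  show "wt a = 0"
  proof (rule T_K_eq_0[OF wt_hpart[OF a]])
    fix fs f0 assume fs: "set fs \<subseteq> eigK" and f0: "f0 \<in> eigK"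
    have "\<exists>ls. list_all2 (\<lambda>f l. homogeneous f \<and> nuK f = l *\<^sub>R f) gs ls" if "set gs \<subseteq> eigK" for gs
      using that by (induction gs) (auto simp: list_all2_Cons1)
    moreover have "set (f0 # fs) \<subseteq> eigK" using fs f0 by simp
    ultimately obtain ls where ls: "list_all2 (\<lambda>f l. homogeneous f \<and> nuK f = l *\<^sub>R f) (f0 # fs) ls" by blast
    show "T_K (wt a) fs f0 = 0"
    proof (cases "sum_list ls = 0")
      case False
      then have "T_K a fs f0 = 0"
        using T ls unfolding weight_zero_dual_def nu_K_eq by blast
      then show ?thesis by (simp add: T_K_wt[OF a ls])
    qed (simp add: T_K_wt[OF a ls])
  qed
qed

text \<open>The map \<open>T_K\<close> satisfies the hypotheses of \<open>cls_transport\<close>.\<close>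

theorem HP_K_presents: "presents SK.cls (HP_K c)"
proof -
  let ?n = "int CARD('n)"
  have pd: "polyder dual_act (k - ?n) = (T_K :: 'n forms \<Rightarrow> _) ` hpart k" for k
    unfolding iota_image K.polyvectors_eq image_image T_K_def ..
  have W: "{\<phi> \<in> polyder dual_act (k - ?n) \<inter> weight_zero_dual (nu_K c). twisted_coboundary c (k - ?n) \<phi> = 0}
      = (T_K :: 'n forms \<Rightarrow> _) ` cocyc0 k" for k
  proof -
    have "T_K a \<in> weight_zero_dual (nu_K c) \<and> twisted_coboundary c (k - ?n) (T_K a) = 0 \<longleftrightarrow> a \<in> cocyc0 k"
      if a: "a \<in> hpart k" for a
    proof -
      have h: "- schouten \<pi> a \<in> hpart (k + 1)"
        using hpart_schouten[OF piV_hpart a] by (intro hpart_minus) (simp add: algebra_simps)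
      have "T_K (- schouten \<pi> a) = 0 \<longleftrightarrow> schouten \<pi> a = 0"
        using T_K_inj[OF h, of 0] by auto
      then show ?thesis
        unfolding T_K_weight_zero_iff[OF a] twisted_coboundary_T_K[OF a] cocyc0_def cocyc_def using a by auto
    qed
    then show ?thesis unfolding pd by (auto simp: cocyc0_def cocyc_def)
  qed
  have B: "twisted_coboundary c (k - ?n - 1) ` polyder dual_act (k - ?n - 1) = (T_K :: 'n forms \<Rightarrow> _) ` cobound k" for k
  proof -
    have k: "k - ?n - 1 = (k - 1) - ?n" by simp
    have "twisted_coboundary c ((k - 1) - ?n) ` T_K ` hpart (k - 1) = (\<lambda>a. T_K (- schouten \<pi> a)) ` hpart (k - 1)"
      unfolding image_image by (rule image_cong[OF refl twisted_coboundary_T_K])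
    also have "\<dots> = T_K ` (\<lambda>a. - a) ` cobound k" by (simp add: cobound_def image_image)
    also have "(\<lambda>a. - a) ` cobound k = cobound k"
    proof
      show "cobound k \<subseteq> (\<lambda>a. - a) ` cobound k"
      proof
        fix a assume "a \<in> cobound k"
        then show "a \<in> (\<lambda>a. - a) ` cobound k" using cobound_minus by (intro image_eqI[of _ _ "- a"]) auto
      qed
    qed (use cobound_minus in blast)
    finally show ?thesis unfolding k pd .
  qed
  have br: "bracket_of (K.ev \<pi>) = br_K c" by (rule br_K_eq[symmetric])
  have "Delta_K c k (SK.cls k a) = SK.cls (k - 1) (bvop a)" if "a \<in> cocyc0 k" for k a
    unfolding Delta_K_def Let_def W B unfolding br[symmetric]
    by (rule SK.cls_transport[where T = T_K, OF T_K_def[symmetric] T_K_simps(2) T_K_inj refl refl dR_dual_T_K that])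
  then have "presents SK.cls (HP (bracket_of (K.ev \<pi>)) (Delta_K c))" by (rule SK.HP_presents)
  then show ?thesis by (simp only: HP_K_def br)
qed

end

theorem lemma6p6:
  fixes c :: "'n::{finite,linorder} \<Rightarrow> 'n \<Rightarrow> 'n \<Rightarrow> 'n \<Rightarrow> real"
  assumes "poisson_bracket (br_A c)"
    and "diagonalizable (nu_A c)"
  shows "diagonalizable (nu_K c) \<and> bv_isomorphic (HP_A c) (HP_K c)"
proof -
  interpret diagonal_quadratic c
    by unfold_locales (rule assms)+
  show ?thesis
    using diagonalizable_nu_K presents_bv_isomorphic[OF HP_A_presents HP_K_presents] by blast
qed

end
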